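(* Let $\mathscr B$ be a mixed quasi-norm space on $\mathbf R^{2d}$. Then $$\bigcup M(\omega,\mathscr B)=\Upsilon(\mathbf R^d),$$ where the union is taken over all rotation invariant $\omega\in\mathscr P_Q^0(\mathbf R^{2d})$. Furthermore, if $0<\gamma<2$, $0<\varepsilon<\min(\gamma,2-\gamma)$ and $\omega(x,\xi)=Ce^{c(|x|^\gamma+|\xi|^\gamma)}$ for some constants $C>0$ and $c\in\mathbf R$ which are independent of $x,\xi\in\mathbf R^d$, then the following is true: (1) if $c>0$, then $\mathcal S_{1/(\gamma+\varepsilon)}(\mathbf R^d)\subseteq M(\omega,\mathscr B)\subseteq\mathcal S_{1/(\gamma-\varepsilon)}(\mathbf R^d)$; (2) if $c<0$, then $\mathcal S_{1/(\gamma-\varepsilon)}'(\mathbf R^d)\subseteq M(\omega,\mathscr B)\subseteq\mathcal S_{1/(\gamma+\varepsilon)}'(\mathbf R^d)$.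
   Context: Weights. A weight on $\mathbf R^n$ is a positive function $\omega\in L^\infty_{loc}(\mathbf R^n)$ bounded below by a positive constant on each compact set. $\mathscr P_Q^0(\mathbf R^n)$ is the set of weights $\omega$ such that (i) there are $c,C>0$ with $C^{-1}\omega(x)^2\le\omega(x+y)\omega(x-y)\le C\omega(x)^2$ whenever $|x|\ge 2c$ and $|y|\le c/|x|$; (ii) for every $c>0$ there is $C>0$ with $C^{-1}e^{-c|x|^2}\le\omega(x)\le Ce^{c|x|^2}$ for all $x$. Mixed quasi-norm spaces. A mixed quasi-norm space on $\mathbf R^n$ is $\mathscr B=L^p(V)$, where $V=(V_1,\dots,V_m)$ are vector subspaces with $V_1\oplus\cdots\oplus V_m=\mathbf R^n$ and $p=(p_1,\dots,p_m)\in(0,\infty]^m$; $\|f\|_{\mathscr B}$ is obtained by writing $f=f(x_1,\dots,x_m)$, $x_j\in V_j$, and taking successively the $L^{p_1}(V_1)$ quasi-norm in $x_1$, ..., and finally the $L^{p_m}(V_m)$ quasi-norm in $x_m$. Gelfand-Shilov spaces. For $s\ge1/2$, $\mathcal S_s(\mathbf R^d)=\bigcup_{h>0}\mathcal S_{s,h}(\mathbf R^d)$ (inductive limit), where $\mathcal S_{s,h}$ is the Banach space of $f\in C^\infty(\mathbf R^d)$ with $\sup_{\alpha,\beta,x}|x^\beta\partial^\alpha f(x)|/(h^{|\alpha|+|\beta|}(\alpha!\beta!)^s)<\infty$; $\mathcal S_s'(\mathbf R^d)$ is its dual, regarded as a subspace of $\mathcal S_{1/2}'(\mathbf R^d)$.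 Let $\phi(x)=\pi^{-d/4}e^{-|x|^2/2}$ and, for $f\in\mathcal S'_{1/2}(\mathbf R^d)$, $V_\phi f(x,\xi)=(2\pi)^{-d/2}\langle f,\phi(\cdot-x)e^{-i\langle\cdot,\xi\rangle}\rangle$. $M(\omega,\mathscr B)$ is the set of $f\in\mathcal S'_{1/2}(\mathbf R^d)$ with $\|V_\phi f\cdot\omega\|_{\mathscr B}<\infty$. $\Upsilon(\mathbf R^d)$ is the set of all $f\in\mathcal S'_{1/2}(\mathbf R^d)$ such that for every $\varepsilon>0$ there is $C_\varepsilon>0$ with $|V_\phi f(x,\xi)|\le C_\varepsilon e^{\varepsilon(|x|^2+|\xi|^2)}$ for all $x,\xi\in\mathbf R^d$. *)

theory Defs
  imports "HOL-Analysis.Analysis" "HOL-Probability.Essential_Supremum"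
begin

section \<open>Weights\<close>

definition weight :: "('a::euclidean_space \<Rightarrow> real) \<Rightarrow> bool" where
  "weight \<omega> \<longleftrightarrow> (\<forall>x. 0 < \<omega> x) \<and> \<omega> \<in> borel_measurable lebesgue \<and>
     (\<forall>K. compact K \<longrightarrow> (\<exists>C. AE x in lebesgue. x \<in> K \<longrightarrow> \<omega> x \<le> C)) \<and>
     (\<forall>K. compact K \<longrightarrow> (\<exists>c>0. \<forall>x\<in>K. c \<le> \<omega> x))"

definition PQ0 :: "('a::euclidean_space \<Rightarrow> real) set" where
  "PQ0 = {\<omega>. weight \<omega> \<and>
     (\<exists>c>0. \<exists>C>0. \<forall>x y. 2 * c \<le> norm x \<and> norm y \<le> c / norm x \<longrightarrow>
        inverse C * (\<omega> x)\<^sup>2 \<le> \<omega> (x + y) * \<omega> (x - y) \<and> \<omega> (x + y) * \<omega> (x - y) \<le> C * (\<omega> x)\<^sup>2) \<and>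
     (\<forall>c>0. \<exists>C>0. \<forall>x.
        inverse C * exp (- c * (norm x)\<^sup>2) \<le> \<omega> x \<and> \<omega> x \<le> C * exp (c * (norm x)\<^sup>2))}"

text \<open>In dimension at least two, invariance under the special orthogonal group and invariance
  under the full orthogonal group are the same condition.\<close>

definition rotation_invariant :: "('a::euclidean_space \<Rightarrow> real) \<Rightarrow> bool" where
  "rotation_invariant \<omega> \<longleftrightarrow> (\<forall>T. orthogonal_transformation T \<longrightarrow> (\<forall>x. \<omega> (T x) = \<omega> x))"


section \<open>Mixed quasi-norm spaces\<close>

definition orthonormal_basis_of :: "'a::euclidean_space set \<Rightarrow> 'a set \<Rightarrow> bool" where
  "orthonormal_basis_of V E \<longleftrightarrow>
     pairwise orthogonal E \<and> (\<forall>b\<in>E. norm b = 1) \<and> span E = V"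

text \<open>Lebesgue measure on a subspace \<open>V\<close>, as a complete measure on the ambient space
  concentrated on \<open>V\<close>. The construction copies that of \<^const>\<open>lborel\<close>, with an orthonormal basis
  of \<open>V\<close> in place of the standard basis; it does not depend on the choice of that basis.
  Completion matters because weights are only assumed to be Lebesgue measurable.\<close>

definition lebesgue_subspace :: "'a::euclidean_space set \<Rightarrow> 'a measure" where
  "lebesgue_subspace V =
     (let E = (SOME E. orthonormal_basis_of V E) in
      completion (distr (\<Pi>\<^sub>M b\<in>E. (lborel :: real measure)) borel (\<lambda>c. \<Sum>b\<in>E. c b *\<^sub>R b)))"

text \<open>Powers with a positive exponent.\<close>

definition ennreal_rpow :: "ennreal \<Rightarrow> real \<Rightarrow> ennreal" where
  "ennreal_rpow t r = (if t = \<infinity> then \<infinity> else ennreal (enn2real t powr r))"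

definition Lp_qnorm :: "'a measure \<Rightarrow> ennreal \<Rightarrow> ('a \<Rightarrow> ennreal) \<Rightarrow> ennreal" where
  "Lp_qnorm M p g =
     (if p = \<infinity> then esssup M g
      else ennreal_rpow (\<integral>\<^sup>+ x. ennreal_rpow (g x) (enn2real p) \<partial>M) (1 / enn2real p))"

text \<open>A list \<open>[(V\<^sub>1, p\<^sub>1), \<dots>, (V\<^sub>m, p\<^sub>m)]\<close> encodes \<open>L\<^sup>p(V)\<close>. The second condition says that the whole
  space is the direct sum of the \<open>V\<^sub>j\<close>.\<close>

type_synonym 'a mixed_space = "('a set \<times> ennreal) list"

definition mixed_quasi_norm_space :: "'a::euclidean_space mixed_space \<Rightarrow> bool" where
  "mixed_quasi_norm_space B \<longleftrightarrow>
     (\<forall>(V, p)\<in>set B. subspace V \<and> 0 < p) \<and>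
     (\<forall>x. \<exists>!xs. list_all2 (\<lambda>v (V, p). v \<in> V) xs B \<and> sum_list xs = x)"

text \<open>The quasi-norm of a function with values in \<open>[0, \<infinity>]\<close>. In the recursive call, \<open>y\<close> stands for
  \<open>x\<^sub>2 + \<dots> + x\<^sub>m\<close>, and the variable of the innermost (first) quasi-norm is \<open>x\<^sub>1\<close>.\<close>

fun mixed_qnorm :: "'a::euclidean_space mixed_space \<Rightarrow> ('a \<Rightarrow> ennreal) \<Rightarrow> ennreal" where
  "mixed_qnorm [] f = f 0"
| "mixed_qnorm ((V, p) # B) f =
     mixed_qnorm B (\<lambda>y. Lp_qnorm (lebesgue_subspace V) p (\<lambda>x. f (x + y)))"


section \<open>Gelfand-Shilov spaces\<close>

definition partial_deriv ::
    "'d::finite \<Rightarrow> (real^'d \<Rightarrow> complex) \<Rightarrow> real^'d \<Rightarrow> complex" where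
  "partial_deriv i f x = frechet_derivative f (at x) (axis i 1)"

definition iter_partial ::
    "'d::finite list \<Rightarrow> (real^'d \<Rightarrow> complex) \<Rightarrow> real^'d \<Rightarrow> complex" where
  "iter_partial L f = foldr partial_deriv L f"

definition C_infinity :: "(real^'d::finite \<Rightarrow> complex) set" where
  "C_infinity = {f. \<forall>L. iter_partial L f differentiable_on UNIV}"

text \<open>The derivative with multi-index \<open>\<alpha>\<close>: differentiate \<open>\<alpha> i\<close> times in each direction \<open>i\<close>.
  The order of differentiation is irrelevant for functions in \<open>C_infinity\<close>.\<close>

definition multi_deriv ::
    "('d::finite \<Rightarrow> nat) \<Rightarrow> (real^'d \<Rightarrow> complex) \<Rightarrow> real^'d \<Rightarrow> complex" where
  "multi_deriv \<alpha> f = iter_partial (SOME L. \<forall>i. count_list L i = \<alpha> i) f"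

definition multi_power :: "real^'d::finite \<Rightarrow> ('d \<Rightarrow> nat) \<Rightarrow> real" where
  "multi_power x \<beta> = (\<Prod>i\<in>UNIV. (x $ i) ^ \<beta> i)"

definition multi_abs :: "('d::finite \<Rightarrow> nat) \<Rightarrow> nat" where
  "multi_abs \<alpha> = (\<Sum>i\<in>UNIV. \<alpha> i)"

definition multi_fact :: "('d::finite \<Rightarrow> nat) \<Rightarrow> real" where
  "multi_fact \<alpha> = (\<Prod>i\<in>UNIV. fact (\<alpha> i))"

definition GS_norm :: "real \<Rightarrow> real \<Rightarrow> (real^'d::finite \<Rightarrow> complex) \<Rightarrow> ennreal" where
  "GS_norm s h f =
     (SUP \<alpha>. SUP \<beta>. SUP x.
        ennreal (norm (complex_of_real (multi_power x \<beta>) * multi_deriv \<alpha> f x) /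
          (h ^ (multi_abs \<alpha> + multi_abs \<beta>) * (multi_fact \<alpha> * multi_fact \<beta>) powr s)))"

definition GS_step :: "real \<Rightarrow> real \<Rightarrow> (real^'d::finite \<Rightarrow> complex) set" where
  "GS_step s h = {f \<in> C_infinity. GS_norm s h f < \<infinity>}"

definition GS :: "real \<Rightarrow> (real^'d::finite \<Rightarrow> complex) set" where
  "GS s = (\<Union>h\<in>{0<..}. GS_step s h)"

text \<open>The locally convex inductive limit topology: a base of neighbourhoods of \<open>0\<close> consists of the
  absolutely convex sets whose intersection with each step is a neighbourhood of \<open>0\<close> there.\<close>

definition absolutely_convex :: "('x \<Rightarrow> complex) set \<Rightarrow> bool" where
  "absolutely_convex U \<longleftrightarrow>
     (\<forall>f\<in>U. \<forall>g\<in>U. \<forall>a b :: complex. norm a + norm b \<le> 1 \<longrightarrow> (\<lambda>x. a * f x + b * g x) \<in> U)"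

definition GS_nhd0 :: "real \<Rightarrow> (real^'d::finite \<Rightarrow> complex) set \<Rightarrow> bool" where
  "GS_nhd0 s U \<longleftrightarrow> U \<subseteq> GS s \<and> absolutely_convex U \<and>
     (\<forall>h>0. \<exists>r>0. {f \<in> GS_step s h. GS_norm s h f < ennreal r} \<subseteq> U)"

definition GS_open :: "real \<Rightarrow> (real^'d::finite \<Rightarrow> complex) set \<Rightarrow> bool" where
  "GS_open s W \<longleftrightarrow> W \<subseteq> GS s \<and>
     (\<forall>f\<in>W. \<exists>U. GS_nhd0 s U \<and> (\<forall>g\<in>U. (\<lambda>x. f x + g x) \<in> W))"

definition GS_topology :: "real \<Rightarrow> (real^'d::finite \<Rightarrow> complex) topology" where
  "GS_topology s = topology (GS_open s)"

lemma GS_nhd0_Int: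
  fixes U V :: "(real^'d::finite \<Rightarrow> complex) set"
  assumes "GS_nhd0 s U" "GS_nhd0 s V"
  shows "GS_nhd0 s (U \<inter> V)"
  unfolding GS_nhd0_def
proof (intro conjI allI impI)
  show "U \<inter> V \<subseteq> GS s" using assms unfolding GS_nhd0_def by blast
  show "absolutely_convex (U \<inter> V)"
    using assms unfolding GS_nhd0_def absolutely_convex_def by simp
  fix h :: real assume h: "0 < h"
  from assms(1) h obtain r where r: "0 < r" "{f \<in> GS_step s h. GS_norm s h f < ennreal r} \<subseteq> U"
    unfolding GS_nhd0_def by blast
  from assms(2) h obtain q where q: "0 < q" "{f \<in> GS_step s h. GS_norm s h f < ennreal q} \<subseteq> V"
    unfolding GS_nhd0_def by blast
  show "\<exists>r>0. {f \<in> GS_step s h. GS_norm s h f < ennreal r} \<subseteq> U \<inter> V"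
  proof (intro exI[of _ "min r q"] conjI subsetI)
    show "0 < min r q" using r(1) q(1) by simp
    fix f :: "real^'d \<Rightarrow> complex"
    assume f: "f \<in> {f \<in> GS_step s h. GS_norm s h f < ennreal (min r q)}"
    have "ennreal (min r q) \<le> ennreal r" "ennreal (min r q) \<le> ennreal q"
      by (simp_all add: ennreal_leI)
    with f have "f \<in> {f \<in> GS_step s h. GS_norm s h f < ennreal r}"
      and "f \<in> {f \<in> GS_step s h. GS_norm s h f < ennreal q}"
      by (auto intro: less_le_trans)
    then show "f \<in> U \<inter> V" using r(2) q(2) by (simp add: subset_iff)
  qed
qed

lemma istopology_GS_open: "istopology (GS_open s)"
  unfolding istopology_def
proof (intro conjI allI impI)
  fix S T :: "(real^'d \<Rightarrow> complex) set"
  assume S: "GS_open s S" and T: "GS_open s T"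
  show "GS_open s (S \<inter> T)"
    unfolding GS_open_def
  proof (intro conjI ballI)
    show "S \<inter> T \<subseteq> GS s" using S unfolding GS_open_def by blast
    fix f assume "f \<in> S \<inter> T"
    then have f: "f \<in> S" "f \<in> T" by simp_all
    from S f(1) obtain U where U: "GS_nhd0 s U" "\<forall>g\<in>U. (\<lambda>x. f x + g x) \<in> S"
      unfolding GS_open_def by blast
    from T f(2) obtain V where V: "GS_nhd0 s V" "\<forall>g\<in>V. (\<lambda>x. f x + g x) \<in> T"
      unfolding GS_open_def by blast
    show "\<exists>U. GS_nhd0 s U \<and> (\<forall>g\<in>U. (\<lambda>x. f x + g x) \<in> S \<inter> T)"
      using GS_nhd0_Int[OF U(1) V(1)] U(2) V(2) by (intro exI[of _ "U \<inter> V"]) simp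
  qed
next
  fix K :: "(real^'d \<Rightarrow> complex) set set"
  assume K: "\<forall>S\<in>K. GS_open s S"
  show "GS_open s (\<Union>K)"
    unfolding GS_open_def
  proof (intro conjI ballI)
    show "\<Union>K \<subseteq> GS s" using K unfolding GS_open_def by blast
    fix f assume "f \<in> \<Union>K"
    then obtain S where S: "S \<in> K" "f \<in> S" by blast
    from K S(1) have "GS_open s S" by simp
    with S(2) obtain U where "GS_nhd0 s U" "\<forall>g\<in>U. (\<lambda>x. f x + g x) \<in> S"
      unfolding GS_open_def by blast
    with S(1) show "\<exists>U. GS_nhd0 s U \<and> (\<forall>g\<in>U. (\<lambda>x. f x + g x) \<in> \<Union>K)"
      by (intro exI[of _ U]) auto
  qed
qed

lemma openin_GS_topology: "openin (GS_topology s) W \<longleftrightarrow> GS_open s W"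
  unfolding GS_topology_def by (simp add: topology_inverse'[OF istopology_GS_open])

text \<open>Functionals on \<open>GS s\<close> are represented by extensional functions, so that equality in the dual is
  equality in HOL.\<close>

definition GS_dual :: "real \<Rightarrow> ((real^'d::finite \<Rightarrow> complex) \<Rightarrow> complex) set" where
  "GS_dual s = {u \<in> extensional (GS s).
     (\<forall>f\<in>GS s. \<forall>g\<in>GS s. \<forall>a b. u (\<lambda>x. a * f x + b * g x) = a * u f + b * u g) \<and>
     continuous_map (GS_topology s) euclidean u}"

text \<open>The spaces \<open>S\<^sub>s\<close> and \<open>S\<^sub>s'\<close> for \<open>s \<ge> 1/2\<close>, regarded as subspaces of \<open>S\<^sub>1\<^sub>/\<^sub>2'\<close>: functions act by
  the bilinear pairing, functionals by restriction.\<close>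

definition GS_distr :: "(real^'d::finite \<Rightarrow> complex) \<Rightarrow> (real^'d \<Rightarrow> complex) \<Rightarrow> complex" where
  "GS_distr f = (\<lambda>\<psi>\<in>GS (1/2). LINT x|lborel. f x * \<psi> x)"

definition GS_sub :: "real \<Rightarrow> ((real^'d::finite \<Rightarrow> complex) \<Rightarrow> complex) set" where
  "GS_sub s = GS_distr ` GS s"

definition GS_dual_sub :: "real \<Rightarrow> ((real^'d::finite \<Rightarrow> complex) \<Rightarrow> complex) set" where
  "GS_dual_sub s = (\<lambda>u. restrict u (GS (1/2))) ` GS_dual s"


section \<open>Short-time Fourier transform and modulation spaces\<close>

definition gauss_window :: "real^'d::finite \<Rightarrow> real" where
  "gauss_window x = pi powr (- real CARD('d) / 4) * exp (- (norm x)\<^sup>2 / 2)"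

definition STFT ::
    "((real^'d::finite \<Rightarrow> complex) \<Rightarrow> complex) \<Rightarrow> (real^'d) \<times> (real^'d) \<Rightarrow> complex" where
  "STFT u = (\<lambda>(x, \<xi>). complex_of_real ((2 * pi) powr (- real CARD('d) / 2)) *
     u (\<lambda>y. complex_of_real (gauss_window (y - x)) * exp (- \<i> * complex_of_real (y \<bullet> \<xi>))))"

definition modulation_space ::
    "((real^'d::finite) \<times> (real^'d) \<Rightarrow> real) \<Rightarrow> ((real^'d) \<times> (real^'d)) mixed_space \<Rightarrow>
     ((real^'d \<Rightarrow> complex) \<Rightarrow> complex) set" where
  "modulation_space \<omega> B =
     {u \<in> GS_dual (1/2). mixed_qnorm B (\<lambda>z. ennreal (norm (STFT u z * complex_of_real (\<omega> z)))) < \<infinity>}"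

definition Upsilon :: "((real^'d::finite \<Rightarrow> complex) \<Rightarrow> complex) set" where
  "Upsilon = {u \<in> GS_dual (1/2). \<forall>\<epsilon>>0. \<exists>C>0. \<forall>x \<xi>.
     norm (STFT u (x, \<xi>)) \<le> C * exp (\<epsilon> * ((norm x)\<^sup>2 + (norm \<xi>)\<^sup>2))}"

end

theory Submission
  imports Defs "HOL-Complex_Analysis.Complex_Analysis" "HOL-Probability.Probability"
begin

text \<open>Every \<open>u\<close> in the dual of \<open>S\<^bsub>1/2\<^esub>\<close> satisfies \<open>|V u (z)| \<le> C\<^sub>\<epsilon> exp (\<epsilon> |z|\<^sup>2)\<close> for all \<open>\<epsilon> > 0\<close>, because
  the time-frequency shifts of the Gaussian have seminorms of this size. Hence \<open>\<Upsilon>\<close> is the whole dual, and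
  each such \<open>u\<close> lies in the modulation space of a radial weight \<open>exp (- \<kappa> (|z|\<^sup>2) - |z|)\<close>, with \<open>\<kappa>\<close> an infimum of
  affine functions.

  For the exponential weights, \<open>V u\<close> is a Gaussian factor times an entire function. This gives a local
  estimate that recovers pointwise bounds for \<open>V u\<close> from the mixed quasi-norm, also for exponents
  below \<open>1\<close>; conversely, integrable pointwise decay bounds the quasi-norm. So membership in the modulation
  space is decay or growth of \<open>|V u|\<close>, up to changing the constant in the exponent. The functions in
  \<open>S\<^sub>s\<close> have time-frequency coefficients decaying like \<open>exp (- r (|x|\<^bsup>1/s\<^esup> + |\<xi>|\<^bsup>1/s\<^esup>))\<close>, by repeated
  integration by parts, and the reconstruction formula
  \<open>u f = (2\<pi>)\<^bsup>-d\<^esup> \<integral> V f (x, -\<xi>) u (\<phi>\<^bsub>x,\<xi>\<^esub>)\<close> (unnormalized \<open>V\<close>) turns decay of \<open>V u\<close> into a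
  representing function in a Gelfand-Shilov space and growth of \<open>V u\<close> into a continuous extension to one.\<close>

section \<open>Seminorms and duals of Gelfand-Shilov spaces\<close>

text \<open>The order of quantifiers shapes the proof. Atoms have seminorm at most
  \<open>C * exp (\<delta> * ...)\<close> for every \<delta>, but in a step \<open>h\<close> that
  depends on \<delta>. This is harmless on the dual side, since a continuous functional is bounded
  on every step. On the function side the rate of decay cannot be chosen: it is dictated by the step
  that contains the function. A weight with exponent \<gamma> and an arbitrary constant
  \<open>c\<close> is therefore absorbed only by a strictly larger exponent, and this is what
  \<epsilon> pays for. Passing from a quasi-norm to pointwise values changes rates but not
  exponents, so it costs nothing more. A functional is known only through seminorm bounds. Hence
  every limit taken under it, be it a derivative, a modulus of continuity or an integral, is carried
  out inside one fixed seminorm, and holomorphy is used only along complex lines. The index 1/2 is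
  the border case: Hermite polynomials contribute about the square root of \<open>fact k\<close>,
  and the coefficients of test functions still have Gaussian decay, enough to expand an arbitrary
  functional.\<close>

lemma iter_partial_simps [simp]:
  "iter_partial [] f = f" "iter_partial (i # L) f = partial_deriv i (iter_partial L f)"
  by (simp_all add: iter_partial_def)

lemma C_infinity_differentiable:
  "f \<in> C_infinity \<Longrightarrow> iter_partial L f differentiable (at x)"
  by (auto simp: C_infinity_def differentiable_on_def)

text \<open>The coordinate form in which derivatives are handled: it survives products and
  integrals, and \<open>partial_deriv_eqI\<close> reads the partial derivatives off it.\<close>

lemma has_derivative_partial_deriv:
  fixes f :: "real^'d::finite \<Rightarrow> complex"
  assumes "f differentiable (at x)"
  shows "(f has_derivative (\<lambda>v. \<Sum>i\<in>UNIV. v $ i *\<^sub>R partial_deriv i f x)) (at x)"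
proof -
  let ?D = "frechet_derivative f (at x)"
  have D: "(f has_derivative ?D) (at x)" using assms by (simp add: frechet_derivative_works)
  then have lin: "linear ?D" by (rule has_derivative_linear)
  have "?D v = (\<Sum>i\<in>UNIV. v $ i *\<^sub>R partial_deriv i f x)" for v
  proof -
    have "?D v = ?D (\<Sum>i\<in>UNIV. v $ i *\<^sub>R axis i 1)"
      by (subst basis_expansion[of v, unfolded scalar_mult_eq_scaleR, symmetric]) simp
    also have "\<dots> = (\<Sum>i\<in>UNIV. v $ i *\<^sub>R partial_deriv i f x)"
      by (simp add: linear_sum[OF lin] linear_scale[OF lin] partial_deriv_def)
    finally show ?thesis .
  qed
  then have "?D = (\<lambda>v. \<Sum>i\<in>UNIV. v $ i *\<^sub>R partial_deriv i f x)" by (simp add: fun_eq_iff)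
  with D show ?thesis by simp
qed

lemma partial_deriv_eqI:
  fixes f :: "real^'d::finite \<Rightarrow> complex"
  assumes "(f has_derivative (\<lambda>v. \<Sum>i\<in>UNIV. v $ i *\<^sub>R f' i)) (at x)"
  shows "partial_deriv i f x = f' i"
proof -
  have "frechet_derivative f (at x) = (\<lambda>v. \<Sum>i\<in>UNIV. v $ i *\<^sub>R f' i)"
    using frechet_derivative_at[OF assms] by simp
  then show ?thesis
    by (simp add: partial_deriv_def axis_def if_distrib[of "\<lambda>a. a *\<^sub>R _"] cong: if_cong)
qed

lemma iter_partial_lincomb:
  assumes "f \<in> C_infinity" "g \<in> C_infinity"
  shows "iter_partial L (\<lambda>x. a * f x + b * g x) = (\<lambda>x. a * iter_partial L f x + b * iter_partial L g x)"
proof (induction L)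
  case (Cons i L)
  show ?case
  proof (rule ext)
    fix x
    have "((\<lambda>x. a * iter_partial L f x + b * iter_partial L g x) has_derivative
      (\<lambda>v. \<Sum>j\<in>UNIV. v $ j *\<^sub>R (a * partial_deriv j (iter_partial L f) x + b * partial_deriv j (iter_partial L g) x))) (at x)"
      by (rule has_derivative_eq_rhs, (rule derivative_intros
        has_derivative_partial_deriv[OF C_infinity_differentiable[OF assms(1), of L]]
        has_derivative_partial_deriv[OF C_infinity_differentiable[OF assms(2), of L]])+)
        (simp add: fun_eq_iff sum.distrib sum_distrib_left scaleR_add_right)
    from partial_deriv_eqI[OF this]
    show "iter_partial (i # L) (\<lambda>x. a * f x + b * g x) x =
      a * iter_partial (i # L) f x + b * iter_partial (i # L) g x"
      by (simp add: Cons.IH)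
  qed
qed simp

lemma C_infinity_lincomb:
  assumes "f \<in> C_infinity" "g \<in> C_infinity"
  shows "(\<lambda>x. a * f x + b * g x) \<in> C_infinity"
  using assms unfolding C_infinity_def
  by (auto simp: iter_partial_lincomb[OF assms] intro!: derivative_intros)

lemma multi_deriv_lincomb:
  assumes "f \<in> C_infinity" "g \<in> C_infinity"
  shows "multi_deriv \<alpha> (\<lambda>x. a * f x + b * g x) x = a * multi_deriv \<alpha> f x + b * multi_deriv \<alpha> g x"
  by (simp add: multi_deriv_def iter_partial_lincomb[OF assms])

lemma multi_fact_ge_1: "1 \<le> multi_fact \<alpha>"
  unfolding multi_fact_def by (intro prod_ge_1) (simp add: fact_ge_1)

text \<open>The factor that \<^const>\<open>GS_norm\<close> divides by; \<open>gs_bound s h M f\<close> below says that the seminorm of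
  \<open>f\<close> is at most \<open>M\<close>, which keeps \<open>ennreal\<close> out of the estimates.\<close>

definition gs_weight :: "real \<Rightarrow> real \<Rightarrow> ('d::finite \<Rightarrow> nat) \<Rightarrow> ('d \<Rightarrow> nat) \<Rightarrow> real" where
  "gs_weight s h \<alpha> \<beta> = h ^ (multi_abs \<alpha> + multi_abs \<beta>) * (multi_fact \<alpha> * multi_fact \<beta>) powr s"

lemma gs_weight_pos: "0 < h \<Longrightarrow> 0 < gs_weight s h \<alpha> \<beta>"
  using multi_fact_ge_1[of \<alpha>] multi_fact_ge_1[of \<beta>] by (auto simp: gs_weight_def)

text \<open>Factorials are at least 1, so a larger \<open>s\<close> gives a larger weight; this is
  behind all inclusions between spaces of different index.\<close>

lemma gs_weight_mono:
  assumes "0 < h" "h \<le> h'" "s \<le> s'"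
  shows "gs_weight s h \<alpha> \<beta> \<le> gs_weight s' h' \<alpha> \<beta>"
proof -
  have "1 * 1 \<le> multi_fact \<alpha> * multi_fact \<beta>"
    by (intro mult_mono) (use multi_fact_ge_1[of \<alpha>] multi_fact_ge_1[of \<beta>] in auto)
  then show ?thesis unfolding gs_weight_def using assms
    by (intro mult_mono power_mono powr_mono) auto
qed

definition gs_bound :: "real \<Rightarrow> real \<Rightarrow> real \<Rightarrow> (real^'d::finite \<Rightarrow> complex) \<Rightarrow> bool" where
  "gs_bound s h M f \<longleftrightarrow> f \<in> C_infinity \<and>
     (\<forall>\<alpha> \<beta> x. \<bar>multi_power x \<beta>\<bar> * norm (multi_deriv \<alpha> f x) \<le> M * gs_weight s h \<alpha> \<beta>)"

lemma gs_boundD: "gs_bound s h M f \<Longrightarrow> \<bar>multi_power x \<beta>\<bar> * norm (multi_deriv \<alpha> f x) \<le> M * gs_weight s h \<alpha> \<beta>"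
  by (auto simp: gs_bound_def)

lemma gs_bound_C_infinity: "gs_bound s h M f \<Longrightarrow> f \<in> C_infinity"
  by (auto simp: gs_bound_def)

lemma GS_norm_le_iff:
  assumes "0 < h" "0 \<le> M" "f \<in> C_infinity"
  shows "GS_norm s h f \<le> ennreal M \<longleftrightarrow> gs_bound s h M f"
proof -
  have "ennreal (norm (complex_of_real (multi_power x \<beta>) * multi_deriv \<alpha> f x) /
          (h ^ (multi_abs \<alpha> + multi_abs \<beta>) * (multi_fact \<alpha> * multi_fact \<beta>) powr s)) \<le> ennreal M \<longleftrightarrow>
       \<bar>multi_power x \<beta>\<bar> * norm (multi_deriv \<alpha> f x) \<le> M * gs_weight s h \<alpha> \<beta>" for \<alpha> \<beta> x
    using gs_weight_pos[OF assms(1), of s \<alpha> \<beta>] assms(2)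
    unfolding gs_weight_def[symmetric] by (simp add: ennreal_le_iff norm_mult divide_le_eq)
  then show ?thesis
    using assms(3) by (simp add: GS_norm_def SUP_le_iff gs_bound_def)
qed

lemma GS_step_iff:
  assumes "0 < h"
  shows "f \<in> GS_step s h \<longleftrightarrow> (\<exists>M\<ge>0. gs_bound s h M f)"
proof
  assume f: "f \<in> GS_step s h"
  then have "GS_norm s h f = ennreal (enn2real (GS_norm s h f))" by (simp add: GS_step_def)
  with f show "\<exists>M\<ge>0. gs_bound s h M f"
    using GS_norm_le_iff[OF assms, of "enn2real (GS_norm s h f)" f s]
    by (auto simp: GS_step_def intro!: exI[of _ "enn2real (GS_norm s h f)"])
next
  assume "\<exists>M\<ge>0. gs_bound s h M f"
  then obtain M where M: "0 \<le> M" "gs_bound s h M f" by blast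
  then show "f \<in> GS_step s h"
    using GS_norm_le_iff[OF assms M(1) gs_bound_C_infinity[OF M(2)], of s]
    by (auto simp: GS_step_def gs_bound_C_infinity less_top[symmetric] top_unique)
qed

lemma gs_bound_in_GS: "0 < h \<Longrightarrow> 0 \<le> M \<Longrightarrow> gs_bound s h M f \<Longrightarrow> f \<in> GS s"
  using GS_step_iff[of h f s] by (auto simp: GS_def)

lemma GS_E:
  assumes "f \<in> GS s"
  obtains h M where "0 < h" "0 \<le> M" "gs_bound s h M f"
  using assms by (auto simp: GS_def GS_step_iff)

lemma gs_bound_mono:
  assumes "gs_bound s h M f" "0 < h" "h \<le> h'" "s \<le> s'" "0 \<le> M" "M \<le> M'"
  shows "gs_bound s' h' M' f"
  unfolding gs_bound_def
proof (intro conjI allI)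
  fix \<alpha> \<beta> x
  have "\<bar>multi_power x \<beta>\<bar> * norm (multi_deriv \<alpha> f x) \<le> M * gs_weight s h \<alpha> \<beta>"
    using assms(1) by (rule gs_boundD)
  also have "\<dots> \<le> M' * gs_weight s' h' \<alpha> \<beta>"
    using assms gs_weight_pos[of h s \<alpha> \<beta>] by (intro mult_mono gs_weight_mono) auto
  finally show "\<bar>multi_power x \<beta>\<bar> * norm (multi_deriv \<alpha> f x) \<le> M' * gs_weight s' h' \<alpha> \<beta>" .
qed (use assms in \<open>auto simp: gs_bound_def\<close>)

lemma gs_bound_lincomb:
  assumes "gs_bound s h M f" "gs_bound s h N g"
  shows "gs_bound s h (norm a * M + norm b * N) (\<lambda>x. a * f x + b * g x)"
  unfolding gs_bound_def
proof (intro conjI allI)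
  have fg: "f \<in> C_infinity" "g \<in> C_infinity" using assms by (auto simp: gs_bound_def)
  then show "(\<lambda>x. a * f x + b * g x) \<in> C_infinity" by (rule C_infinity_lincomb)
  fix \<alpha> \<beta> x
  have "\<bar>multi_power x \<beta>\<bar> * norm (multi_deriv \<alpha> (\<lambda>x. a * f x + b * g x) x) \<le>
    \<bar>multi_power x \<beta>\<bar> * (norm a * norm (multi_deriv \<alpha> f x) + norm b * norm (multi_deriv \<alpha> g x))"
    unfolding multi_deriv_lincomb[OF fg]
    by (intro mult_left_mono order.trans[OF norm_triangle_ineq]) (auto simp: norm_mult)
  also have "\<dots> = norm a * (\<bar>multi_power x \<beta>\<bar> * norm (multi_deriv \<alpha> f x)) + norm b * (\<bar>multi_power x \<beta>\<bar> * norm (multi_deriv \<alpha> g x))"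
    by (simp add: algebra_simps)
  also have "\<dots> \<le> norm a * (M * gs_weight s h \<alpha> \<beta>) + norm b * (N * gs_weight s h \<alpha> \<beta>)"
    by (intro add_mono mult_left_mono gs_boundD assms) auto
  finally show "\<bar>multi_power x \<beta>\<bar> * norm (multi_deriv \<alpha> (\<lambda>x. a * f x + b * g x) x) \<le> (norm a * M + norm b * N) * gs_weight s h \<alpha> \<beta>"
    by (simp add: algebra_simps)
qed

lemma gs_bound_scale:
  assumes "gs_bound s h M f"
  shows "gs_bound s h (norm a * M) (\<lambda>x. a * f x)"
  using gs_bound_lincomb[OF assms assms, of a 0] by simp

lemma GS_lincomb:
  assumes "f \<in> GS s" "g \<in> GS s"
  shows "(\<lambda>x. a * f x + b * g x) \<in> GS s"
proof -
  obtain h M where f: "0 < h" "0 \<le> M" "gs_bound s h M f" using assms(1) by (rule GS_E)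
  obtain k N where g: "0 < k" "0 \<le> N" "gs_bound s k N g" using assms(2) by (rule GS_E)
  have "gs_bound s (max h k) M f" "gs_bound s (max h k) N g"
    using f g gs_bound_mono[OF f(3,1), of "max h k" s M] gs_bound_mono[OF g(3,1), of "max h k" s N] by auto
  from gs_bound_lincomb[OF this] show ?thesis
    using f g by (intro gs_bound_in_GS[of "max h k" "norm a * M + norm b * N"]) auto
qed

lemma GS_mono: "s \<le> s' \<Longrightarrow> GS s \<subseteq> GS s'"
proof
  fix f :: "real^'a \<Rightarrow> complex" assume "s \<le> s'" "f \<in> GS s"
  then obtain h M where f: "0 < h" "0 \<le> M" "gs_bound s h M f" by (auto elim: GS_E)
  show "f \<in> GS s'"
    using gs_bound_in_GS[OF f(1,2) gs_bound_mono[OF f(3,1) order_refl \<open>s \<le> s'\<close> f(2) order_refl]] .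
qed

lemma zero_in_GS: "(\<lambda>x. 0) \<in> GS s"
proof -
  have it: "iter_partial L (\<lambda>x. 0) = (\<lambda>x::real^'d. 0::complex)" for L
  proof (induction L)
    case (Cons i L)
    show ?case unfolding iter_partial_simps Cons.IH
      by (rule ext) (simp add: partial_deriv_def frechet_derivative_const)
  qed simp
  have "gs_bound s 1 0 (\<lambda>x::real^'d. 0)"
    by (auto simp: gs_bound_def C_infinity_def it multi_deriv_def)
  then show ?thesis by (intro gs_bound_in_GS[of 1]) auto
qed

lemma topspace_GS_topology: "topspace (GS_topology s) = (GS s :: (real^'d::finite \<Rightarrow> complex) set)"
proof -
  have "GS_open s (GS s :: (real^'d \<Rightarrow> complex) set)"
    unfolding GS_open_def
  proof (intro conjI ballI exI)
    fix f :: "real^'d \<Rightarrow> complex" assume f: "f \<in> GS s"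
    show "GS_nhd0 s (GS s :: (real^'d \<Rightarrow> complex) set)"
      unfolding GS_nhd0_def absolutely_convex_def
    proof (intro conjI ballI allI impI exI)
      fix f g :: "real^'d \<Rightarrow> complex" and a b :: complex assume "f \<in> GS s" "g \<in> GS s"
      then show "(\<lambda>x. a * f x + b * g x) \<in> GS s" by (rule GS_lincomb)
    next
      fix h :: real assume "0 < h"
      then show "{f \<in> GS_step s h. GS_norm s h f < ennreal 1} \<subseteq> GS s" by (auto simp: GS_def)
    qed auto
    fix g :: "real^'d \<Rightarrow> complex" assume "g \<in> GS s"
    with f GS_lincomb[of f s g 1 1] show "(\<lambda>x. f x + g x) \<in> GS s" by simp
  qed simp
  then show ?thesis
    by (auto simp: topspace_def openin_GS_topology GS_open_def)
qed

lemma GS_dual_linear: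
  "u \<in> GS_dual s \<Longrightarrow> f \<in> GS s \<Longrightarrow> g \<in> GS s \<Longrightarrow> u (\<lambda>x. a * f x + b * g x) = a * u f + b * u g"
  by (auto simp: GS_dual_def)

lemma GS_dual_scale:
  "u \<in> GS_dual s \<Longrightarrow> f \<in> GS s \<Longrightarrow> u (\<lambda>x. a * f x) = a * u f"
  using GS_dual_linear[of u s f f a 0] by simp

lemma GS_dual_sum:
  assumes "u \<in> GS_dual s" "finite I" "I \<noteq> {}" "\<And>i. i \<in> I \<Longrightarrow> f i \<in> GS s"
  shows "(\<lambda>x. \<Sum>i\<in>I. a i * f i x) \<in> GS s \<and> u (\<lambda>x. \<Sum>i\<in>I. a i * f i x) = (\<Sum>i\<in>I. a i * u (f i))"
  using assms(2-)
proof (induction I rule: finite_ne_induct)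
  case (singleton i)
  then show ?case using GS_dual_scale[OF assms(1), of "f i" "a i"] GS_lincomb[of "f i" s "f i" "a i" 0] by simp
next
  case (insert i I)
  then show ?case
    using GS_dual_linear[OF assms(1), of "f i" "\<lambda>x. \<Sum>i\<in>I. a i * f i x" "a i" 1]
    GS_lincomb[of "f i" s "\<lambda>x. \<Sum>i\<in>I. a i * f i x" "a i" 1] by simp
qed

text \<open>With the converse \<open>GS_dualI\<close> this translates continuity for the limit
  topology into estimates. The preimage of the unit disc contains a small seminorm ball of each
  step, and homogeneity turns that into a linear bound.\<close>

lemma GS_dual_bounded:
  fixes u :: "(real^'d::finite \<Rightarrow> complex) \<Rightarrow> complex"
  assumes u: "u \<in> GS_dual s" and h: "0 < h"
  obtains K where "0 < K" "\<And>M f. 0 \<le> M \<Longrightarrow> gs_bound s h M f \<Longrightarrow> norm (u f) \<le> K * M"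
proof -
  have cont: "continuous_map (GS_topology s) euclidean u" using u by (simp add: GS_dual_def)
  have u0: "u (\<lambda>x. 0) = 0" using GS_dual_scale[OF u zero_in_GS, of 0] by simp
  let ?W = "{f \<in> GS s. u f \<in> ball 0 1}"
  have "GS_open s ?W"
    using openin_continuous_map_preimage[OF cont, of "ball 0 1"]
    by (simp add: openin_GS_topology topspace_GS_topology)
  moreover have "(\<lambda>x. 0) \<in> ?W" using zero_in_GS u0 by simp
  ultimately obtain U where U: "GS_nhd0 s U" "\<forall>g\<in>U. (\<lambda>x. 0 + g x) \<in> ?W"
    unfolding GS_open_def by blast
  from U(1) h obtain r where r: "r > 0" "{f \<in> GS_step s h. GS_norm s h f < ennreal r} \<subseteq> U"
    unfolding GS_nhd0_def by blast
  have small: "norm (u f) < 1" if "gs_bound s h (r / 2) f" for f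
  proof -
    have "GS_norm s h f \<le> ennreal (r/2)"
      using that r h by (subst GS_norm_le_iff) (auto simp: gs_bound_def)
    also have "\<dots> < ennreal r" using r by (simp add: ennreal_less_iff)
    finally have "GS_norm s h f < ennreal r" .
    moreover have "f \<in> GS_step s h" using that r h by (auto simp: GS_step_iff intro!: exI[of _ "r/2"])
    ultimately have "f \<in> ?W" using U(2) r(2) by auto
    then show ?thesis by simp
  qed
  have "norm (u f) \<le> (2 / r) * M" if M: "0 \<le> M" and f: "gs_bound s h M f" for M f
  proof (rule field_le_epsilon)
    fix e :: real assume e: "0 < e"
    \<comment> \<open>\<open>M\<close> may be 0, so \<open>f\<close> is rescaled with a slightly
      larger bound, whose excess costs exactly \<open>e\<close> in the end.\<close>
    define M' where "M' = M + e * r / 2"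
    have M': "M' > 0" "M \<le> M'" using M e r by (auto simp: M'_def intro: add_nonneg_pos)
    have "gs_bound s h M' f" using gs_bound_mono[OF f h, of h s M'] M M' by simp
    from gs_bound_scale[OF this, of "complex_of_real (r / (2 * M'))"]
    have "gs_bound s h (r/2) (\<lambda>x. complex_of_real (r / (2 * M')) * f x)"
      using M' r by (simp add: norm_divide norm_mult)
    from small[OF this] have "norm (complex_of_real (r / (2 * M')) * u f) < 1"
      using GS_dual_scale[OF u gs_bound_in_GS[OF h M f], of "complex_of_real (r / (2 * M'))"] by simp
    then have "norm (u f) < (2 / r) * M'"
      using M' r by (simp add: norm_mult norm_divide field_simps)
    then show "norm (u f) \<le> (2 / r) * M + e" using r by (simp add: M'_def field_simps)
  qed
  with r that[of "2/r"] show ?thesis by simp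
qed

text \<open>The preimage of a disc is absolutely convex, so continuity for the inductive limit topology reduces
  to boundedness on each step.\<close>

lemma GS_dualI:
  fixes u :: "(real^'d::finite \<Rightarrow> complex) \<Rightarrow> complex"
  assumes "u \<in> extensional (GS s)"
    and lin: "\<And>f g a b. f \<in> GS s \<Longrightarrow> g \<in> GS s \<Longrightarrow> u (\<lambda>x. a * f x + b * g x) = a * u f + b * u g"
    and bd: "\<And>h. 0 < h \<Longrightarrow> \<exists>K. \<forall>M f. 0 \<le> M \<longrightarrow> gs_bound s h M f \<longrightarrow> norm (u f) \<le> K * M"
  shows "u \<in> GS_dual s"
proof -
  have nhd: "GS_nhd0 s {f \<in> GS s. norm (u f) < e}" (is "GS_nhd0 s ?U") if e: "0 < e" for e :: real
    unfolding GS_nhd0_def absolutely_convex_def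
  proof (intro conjI allI impI ballI)
    fix f g :: "real^'d \<Rightarrow> complex" and a b :: complex assume f: "f \<in> ?U" and g: "g \<in> ?U" and ab: "norm a + norm b \<le> 1"
    let ?m = "max (norm (u f)) (norm (u g))"
    have "norm (a * u f + b * u g) \<le> norm a * norm (u f) + norm b * norm (u g)"
      by (rule order.trans[OF norm_triangle_ineq]) (simp add: norm_mult)
    also have "\<dots> \<le> norm a * ?m + norm b * ?m" by (intro add_mono mult_left_mono) auto
    also have "\<dots> = (norm a + norm b) * ?m" by (simp add: algebra_simps)
    also have "\<dots> \<le> 1 * ?m" using ab by (intro mult_right_mono) (auto simp: le_max_iff_disj)
    also have "\<dots> < e" using f g by auto
    finally show "(\<lambda>x. a * f x + b * g x) \<in> ?U" using f g by (auto simp: lin intro: GS_lincomb)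
  next
    fix h :: real assume h: "0 < h"
    from bd[OF h] obtain K where K: "\<And>M f. 0 \<le> M \<Longrightarrow> gs_bound s h M f \<Longrightarrow> norm (u f) \<le> K * M" by blast
    \<comment> \<open>\<open>K\<close> may be negative or 0, hence the denominator with
      \<open>\<bar>K\<bar> + 1\<close>.\<close>
    define r where "r = e / (2 * (\<bar>K\<bar> + 1))"
    have K1: "0 < \<bar>K\<bar> + 1" by simp
    have r: "0 < r" using e K1 unfolding r_def by (intro divide_pos_pos mult_pos_pos) simp_all
    show "\<exists>r>0. {f \<in> GS_step s h. GS_norm s h f < ennreal r} \<subseteq> ?U"
    proof (rule exI[of _ r], rule conjI[OF r], rule subsetI)
      fix f :: "real^'d \<Rightarrow> complex" assume f: "f \<in> {f \<in> GS_step s h. GS_norm s h f < ennreal r}"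
      then have b: "gs_bound s h r f"
        using GS_norm_le_iff[OF h, of r f s] r by (auto simp: GS_step_def less_imp_le)
      have "norm (u f) \<le> K * r" using r b by (intro K) auto
      also have "\<dots> \<le> (\<bar>K\<bar> + 1) * r" using r by (intro mult_right_mono) auto
      also have "\<dots> = e / 2" using K1 by (simp add: r_def field_simps)
      also have "\<dots> < e" using e by simp
      finally show "f \<in> ?U" using gs_bound_in_GS[OF h _ b] r by auto
    qed
  qed auto
  have "continuous_map (GS_topology s) euclidean u"
    unfolding continuous_map_def
  proof (intro conjI allI impI)
    fix S :: "complex set" assume "openin euclidean S"
    then have S: "open S" by simp
    have "GS_open s {f \<in> GS s. u f \<in> S}"
      unfolding GS_open_def
    proof (intro conjI ballI)
      fix f :: "real^'d \<Rightarrow> complex" assume "f \<in> {f \<in> GS s. u f \<in> S}"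
      then have f: "f \<in> GS s" "u f \<in> S" by auto
      with S obtain e where e: "e > 0" "ball (u f) e \<subseteq> S" by (auto simp: open_contains_ball)
      show "\<exists>U. GS_nhd0 s U \<and> (\<forall>g\<in>U. (\<lambda>x. f x + g x) \<in> {f \<in> GS s. u f \<in> S})"
      proof (intro exI conjI ballI)
        show "GS_nhd0 s {f \<in> GS s. norm (u f) < e}" using e by (intro nhd)
        fix g assume g: "g \<in> {f \<in> GS s. norm (u f) < e}"
        have "(\<lambda>x. f x + g x) \<in> GS s" using f g GS_lincomb[of f s g 1 1] by auto
        moreover have "u (\<lambda>x. f x + g x) = u f + u g" using lin[of f g 1 1] f g by auto
        moreover have "u f + u g \<in> S" using e(2) g by (auto simp: dist_norm subset_iff)
        ultimately show "(\<lambda>x. f x + g x) \<in> {f \<in> GS s. u f \<in> S}" by auto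
      qed
    qed auto
    then show "openin (GS_topology s) {x \<in> topspace (GS_topology s). u x \<in> S}"
      by (simp add: openin_GS_topology topspace_GS_topology)
  qed auto
  with assms(1) lin show ?thesis by (simp add: GS_dual_def)
qed

text \<open>At equal \<open>h\<close> the seminorm of the larger index is the smaller one, so
  boundedness on the steps of \<open>GS s\<close> is inherited by the restriction.\<close>

lemma GS_dual_sub_mono:
  fixes u :: "(real^'d::finite \<Rightarrow> complex) \<Rightarrow> complex"
  assumes "u \<in> GS_dual s" "1/2 \<le> s"
  shows "restrict u (GS (1/2)) \<in> GS_dual (1/2)"
proof (rule GS_dualI)
  show "restrict u (GS (1/2)) \<in> extensional (GS (1/2))" by simp
next
  have sub: "f \<in> GS s" if "f \<in> GS (1/2)" for f :: "real^'d \<Rightarrow> complex"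
    using that GS_mono[OF assms(2)] by blast
  fix f g :: "real^'d \<Rightarrow> complex" and a b :: complex assume fg: "f \<in> GS (1/2)" "g \<in> GS (1/2)"
  show "restrict u (GS (1/2)) (\<lambda>x. a * f x + b * g x) = a * restrict u (GS (1/2)) f + b * restrict u (GS (1/2)) g"
    using fg GS_lincomb[OF fg] GS_dual_linear[OF assms(1) sub sub, of f g] by simp
next
  fix h :: real assume h: "0 < h"
  obtain K where K: "0 < K" "\<And>M f. 0 \<le> M \<Longrightarrow> gs_bound s h M f \<Longrightarrow> norm (u f) \<le> K * M"
    using GS_dual_bounded[OF assms(1) h] by blast
  show "\<exists>K. \<forall>M f. 0 \<le> M \<longrightarrow> gs_bound (1/2) h M f \<longrightarrow> norm (restrict u (GS (1/2)) f) \<le> K * M"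
  proof (intro exI allI impI)
    fix M and f :: "real^'d \<Rightarrow> complex" assume *: "0 \<le> M" "gs_bound (1/2) h M f"
    then have "gs_bound s h M f" "f \<in> GS (1/2)"
      using gs_bound_mono[OF *(2) h order_refl assms(2) *(1) order_refl] gs_bound_in_GS[OF h *] by auto
    then show "norm (restrict u (GS (1/2)) f) \<le> K * M" using K * by simp
  qed
qed

section \<open>Factorial bounds and exponential decay\<close>

lemma power_le_fact_exp:
  fixes x :: real
  assumes "0 \<le> x" shows "x ^ n \<le> fact n * exp x"
proof -
  have "x ^ n /\<^sub>R fact n \<le> (\<Sum>k. x ^ k /\<^sub>R fact k)"
    using summable_exp_generic[of x] assms
    by (intro order.trans[OF _ sum_le_suminf[of _ "{n}"]]) auto
  then show ?thesis by (simp add: exp_def divide_simps mult.commute)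
qed

text \<open>The \<open>s\<close>-th power of \<open>x ^ n \<le> fact n * exp x\<close> at
  \<open>x = (\<delta> / s) * t powr (1 / s)\<close>. The rate \<delta> is free; its price is the
  geometric factor \<open>H ^ n\<close>, which only changes the step.\<close>

lemma power_le_powr_fact_exp:
  fixes \<delta> s :: real
  assumes "0 < \<delta>" "0 < s"
  shows "\<exists>H\<ge>1. \<forall>(t::real) n. 0 \<le> t \<longrightarrow> t ^ n \<le> H ^ n * fact n powr s * exp (\<delta> * t powr (1 / s))"
proof -
  define H where "H = max 1 ((s / \<delta>) powr s)"
  have H: "1 \<le> H" by (simp add: H_def)
  have "t ^ n \<le> H ^ n * fact n powr s * exp (\<delta> * t powr (1 / s))" if t: "0 \<le> t" for t :: real and n
  proof -
  define x where "x = (\<delta> / s) * t powr (1 / s)"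
  have x: "0 \<le> x" using assms by (simp add: x_def)
  have "(x ^ n) powr s \<le> (fact n * exp x) powr s"
    using x assms by (intro powr_mono2 power_le_fact_exp) auto
  also have "\<dots> = fact n powr s * exp (\<delta> * t powr (1/s))"
    using assms by (simp add: powr_mult exp_powr_real x_def)
  finally have 1: "(x ^ n) powr s \<le> fact n powr s * exp (\<delta> * t powr (1/s))" .
  \<comment> \<open>Powers are rewritten with \<open>powr\<close>, which needs a positive base; the
    case \<open>t = 0\<close>, \<open>n > 0\<close> is set apart, both sides being 0.\<close>
  have 2: "t ^ n = ((s / \<delta>) powr s) ^ n * (x ^ n) powr s"
  proof (cases "t = 0 \<and> n = 0 \<or> t \<noteq> 0")
    case True
    have "x powr s = (\<delta> / s) powr s * t"
      unfolding x_def using assms t by (subst powr_mult) (auto simp: powr_powr)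
    then have "(s / \<delta>) powr s * x powr s = t"
      using assms by (simp add: powr_divide)
    then have "t ^ n = (((s / \<delta>) powr s) * x powr s) ^ n" by simp
    also have "\<dots> = ((s / \<delta>) powr s) ^ n * (x ^ n) powr s"
      using True assms t by (auto simp: power_mult_distrib powr_realpow[symmetric] powr_powr mult.commute x_def)
    finally show ?thesis .
  qed (use assms in \<open>auto simp: x_def power_0_left\<close>)
  have "t ^ n \<le> ((s / \<delta>) powr s) ^ n * (fact n powr s * exp (\<delta> * t powr (1/s)))"
    unfolding 2 using 1 by (rule mult_left_mono) simp
  also have "\<dots> \<le> H ^ n * (fact n powr s * exp (\<delta> * t powr (1/s)))"
    by (intro mult_right_mono power_mono) (auto simp: H_def)
  finally show ?thesis by (simp add: mult.assoc)
  qed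
  with H show ?thesis by blast
qed

text \<open>Taking powers with exponent \<open>1 / s\<close> turns the hypotheses into bounds on
  single terms of an exponential series. Halving the argument makes these terms geometric with sum
  2, whence the constant \<open>2 powr s\<close>.\<close>

lemma exp_decay_of_power_bounds:
  fixes a t K H s :: real
  assumes "0 \<le> a" "0 \<le> t" "0 \<le> K" "0 < H" "0 < s"
    and bd: "\<And>n. t ^ n * a \<le> K * H ^ n * fact n powr s"
  shows "a \<le> 2 powr s * K * exp (- (s / 2 / H powr (1 / s)) * t powr (1 / s))"
proof (cases "K = 0 \<or> a = 0")
  case True
  then have "a = 0" using bd[of 0] assms by auto
  then show ?thesis using assms by simp
next
  case False
  then have K: "0 < K" and a: "0 < a" using assms by auto
  define y where "y = (t / H) powr (1/s)"
  define b where "b = (a / K) powr (1/s)"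
  have b: "0 < b" using a K by (simp add: b_def)
  have trm: "b * ((y/2) ^ n /\<^sub>R fact n) \<le> (1/2) ^ n" for n
  proof (cases "t = 0")
    case True
    have "b \<le> 1 powr (1/s)" unfolding b_def using bd[of 0] K a assms by (intro powr_mono2) auto
    with True show ?thesis by (cases n) (auto simp: y_def)
  next
    case False
    then have "t > 0" using assms by simp
    have "(t / H) ^ n * (a / K) \<le> fact n powr s"
      using bd[of n] K assms by (simp add: power_divide field_simps)
    then have "((t / H) ^ n * (a / K)) powr (1/s) \<le> (fact n powr s) powr (1/s)"
      using assms K by (intro powr_mono2) auto
    moreover have "((t / H) ^ n * (a / K)) powr (1/s) = y ^ n * b"
    proof -
      have "((t / H) ^ n) powr (1/s) = y ^ n"
        using assms \<open>t > 0\<close> by (simp add: y_def powr_realpow[symmetric] powr_powr mult.commute)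
      then show ?thesis unfolding b_def using assms K a \<open>t > 0\<close> by (subst powr_mult) auto
    qed
    moreover have "(fact n powr s) powr (1/s) = (fact n :: real)"
      using assms by (simp add: powr_powr)
    ultimately have "y ^ n * b \<le> fact n" by simp
    then have "b * (y ^ n / fact n) \<le> 1" by (simp add: field_simps)
    then have "b * (y ^ n / fact n) * (1/2)^n \<le> 1 * (1/2)^n" by (intro mult_right_mono) auto
    then show ?thesis by (simp add: power_divide divide_simps mult_ac)
  qed
  have sm: "summable (\<lambda>n. b * ((y/2) ^ n /\<^sub>R fact n))"
    using summable_exp_generic[of "y/2"] by (rule summable_mult)
  have "b * exp (y/2) = (\<Sum>n. b * ((y/2) ^ n /\<^sub>R fact n))"
    unfolding exp_def using summable_exp_generic[of "y/2"] by (rule suminf_mult[symmetric])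
  also have "\<dots> \<le> (\<Sum>n. (1/2) ^ n)"
    by (intro suminf_le trm sm summable_geometric) auto
  also have "\<dots> = 2" by (simp add: suminf_geometric)
  finally have "(b * exp (y/2)) powr s \<le> 2 powr s"
    using b assms by (intro powr_mono2) auto
  moreover have "(b * exp (y/2)) powr s = (a / K) * exp (s * y / 2)"
    using b a K assms by (simp add: powr_mult b_def powr_powr exp_powr_real mult_ac)
  ultimately have "(a / K) * exp (s * y / 2) \<le> 2 powr s" by simp
  then have "a * exp (s * y / 2) \<le> 2 powr s * K" using K by (simp add: field_simps)
  then have "a \<le> 2 powr s * K * exp (- (s * y / 2))"
    by (simp add: exp_minus field_simps)
  also have "s * y / 2 = (s / 2 / H powr (1 / s)) * t powr (1 / s)"
    using assms by (simp add: y_def powr_divide)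
  finally show ?thesis by simp
qed

section \<open>Hermite polynomials and Gaussian waves\<close>

text \<open>Probabilists' Hermite polynomials on \<open>\<complex>\<close>: \<open>hermite k (w - y)\<close> is the polynomial factor of the
  \<open>k\<close>-th derivative in \<open>y\<close> of \<open>exp (w y - y\<^sup>2 / 2)\<close>.\<close>

fun hermite :: "nat \<Rightarrow> complex \<Rightarrow> complex" where
  "hermite 0 v = 1"
| "hermite (Suc 0) v = v"
| "hermite (Suc (Suc k)) v = v * hermite (Suc k) v - of_nat (Suc k) * hermite k v"

lemma hermite_has_derivative:
  "(hermite k has_field_derivative of_nat k * hermite (k - 1) v) (at v)"
proof (induction k rule: hermite.induct[of "\<lambda>k _. (hermite k has_field_derivative of_nat k * hermite (k - 1) v) (at v)" _ v])
  case 1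
  have "hermite 0 = (\<lambda>v. 1)" by auto
  then show ?case by simp
next
  case 2
  have "hermite (Suc 0) = (\<lambda>v. v)" by auto
  then show ?case by simp
next
  case (3 k)
  have "hermite (Suc (Suc k)) = (\<lambda>v. v * hermite (Suc k) v - of_nat (Suc k) * hermite k v)" by auto
  moreover have "((\<lambda>v. v * hermite (Suc k) v - of_nat (Suc k) * hermite k v) has_field_derivative
     of_nat (Suc (Suc k)) * hermite (Suc k) v) (at v)"
    by (rule derivative_eq_intros 3 refl)+ (cases k; simp add: algebra_simps)
  ultimately show ?case by simp
qed

lemma hermite_holomorphic [holomorphic_intros]:
  "f holomorphic_on A \<Longrightarrow> (\<lambda>z. hermite k (f z)) holomorphic_on A"
proof -
  have "hermite k holomorphic_on UNIV"
    unfolding holomorphic_on_def field_differentiable_def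
    using hermite_has_derivative has_field_derivative_at_within by blast
  moreover assume "f holomorphic_on A"
  ultimately show ?thesis
    using holomorphic_on_compose_gen[of f A "hermite k" UNIV] by (simp add: o_def)
qed

text \<open>In the recurrence the coefficient \<open>Suc k\<close> comes with a drop of the index by
  two, so one degree costs only a square root. The bound grows like
  \<open>fact k powr (1/2)\<close>, the origin of the restriction
  \<open>1/2 \<le> s\<close>.\<close>

lemma norm_hermite_le: "norm (hermite k v) \<le> (norm v + sqrt (real k)) ^ k"
proof (induction k rule: hermite.induct[of "\<lambda>k _. norm (hermite k v) \<le> (norm v + sqrt (real k)) ^ k" _ v])
  case (3 k)
  \<comment> \<open>\<open>a\<close> belongs to the largest index \<open>k + 2\<close>, so that
    \<open>a * a\<close> dominates the coefficient \<open>k + 1\<close> of the recurrence.\<close>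
  define r a where "r = norm v" and "a = sqrt (real (k + 2))"
  have ra: "0 \<le> r" "0 \<le> a" "a * a = real (k + 2)" by (auto simp: r_def a_def)
  have 1: "norm (hermite (Suc k) v) \<le> (r + a) ^ Suc k"
    unfolding r_def a_def by (rule order.trans[OF 3(1)], intro power_mono add_left_mono real_sqrt_le_mono) auto
  have 2: "norm (hermite k v) \<le> (r + a) ^ k"
    unfolding r_def a_def by (rule order.trans[OF 3(2)], intro power_mono add_left_mono real_sqrt_le_mono) auto
  have "norm (hermite (Suc (Suc k)) v) \<le> r * norm (hermite (Suc k) v) + real (Suc k) * norm (hermite k v)"
    unfolding hermite.simps
    by (rule order.trans[OF norm_triangle_ineq4]) (simp add: norm_mult r_def del: of_nat_Suc)
  also have "\<dots> \<le> r * (r + a) ^ Suc k + real (k + 2) * (r + a) ^ k"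
    using 1 2 ra by (intro add_mono mult_mono) auto
  also have "\<dots> = (r * (r + a) + a * a) * (r + a) ^ k" unfolding ra(3) by (simp add: algebra_simps)
  also have "\<dots> \<le> ((r + a) * (r + a)) * (r + a) ^ k"
    using ra by (intro mult_right_mono) (auto simp: algebra_simps)
  also have "\<dots> = (r + a) ^ Suc (Suc k)" by (simp add: mult.assoc)
  finally show ?case by (simp add: r_def a_def add.commute)
qed auto

definition hermite_wave :: "nat \<Rightarrow> complex \<Rightarrow> real \<Rightarrow> complex" where
  "hermite_wave k w y = hermite k (w - of_real y) * exp (w * of_real y - of_real (y\<^sup>2 / 2))"

lemma hermite_wave_derivative:
  "(hermite_wave k w has_vector_derivative hermite_wave (Suc k) w y) (at y)"
proof -
  define f where "f = (\<lambda>z. hermite k (w - z) * exp (w * z - z\<^sup>2 / 2))"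
  have Suc_k: "hermite (Suc k) v = v * hermite k v - of_nat k * hermite (k - 1) v" for v
    by (cases k) auto
  have hd: "((\<lambda>z. hermite k (w - z)) has_field_derivative - (of_nat k * hermite (k - 1) (w - z))) (at z)" for z
  proof -
    have "((\<lambda>z. w - z) has_field_derivative -1) (at z)" by (auto intro!: derivative_eq_intros)
    from DERIV_chain2[OF hermite_has_derivative[of k "w - z"] this] show ?thesis by simp
  qed
  have "(f has_field_derivative hermite (Suc k) (w - z) * exp (w * z - z\<^sup>2 / 2)) (at z)" for z
  proof -
    have "((\<lambda>z. exp (w * z - z\<^sup>2 / 2)) has_field_derivative exp (w * z - z\<^sup>2 / 2) * (w - z)) (at z)"
      by (auto intro!: derivative_eq_intros)
    from DERIV_mult[OF hd this] show ?thesis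
      unfolding f_def Suc_k by (simp add: algebra_simps)
  qed
  then have "((\<lambda>y. f (of_real y)) has_vector_derivative
       hermite (Suc k) (w - of_real y) * exp (w * of_real y - (of_real y)\<^sup>2 / 2)) (at y)"
    by (rule has_vector_derivative_real_field)
  then show ?thesis by (simp add: f_def hermite_wave_def[abs_def])
qed

lemma norm_exp_wave: "norm (exp (Complex x b * of_real y - of_real (y\<^sup>2 / 2))) = exp (x\<^sup>2/2) * exp (- ((y - x)\<^sup>2 / 2))"
proof -
  have "norm (exp (Complex x b * of_real y - of_real (y\<^sup>2 / 2))) = exp (x * y - y\<^sup>2/2)"
    by (simp add: norm_exp_eq_Re)
  also have "x * y - y\<^sup>2/2 = x\<^sup>2/2 + - ((y - x)\<^sup>2 / 2)" by (simp add: power2_eq_square field_simps)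
  finally show ?thesis by (simp only: exp_add)
qed

lemma power_add_le:
  fixes a b :: real assumes "0 \<le> a" "0 \<le> b"
  shows "(a + b) ^ n \<le> 2 ^ n * (a ^ n + b ^ n)"
proof -
  have "(a + b) ^ n \<le> (2 * max a b) ^ n" using assms by (intro power_mono) auto
  also have "\<dots> = 2 ^ n * (max a b) ^ n" by (simp add: power_mult_distrib)
  also have "\<dots> \<le> 2 ^ n * (a ^ n + b ^ n)" using assms by (auto simp: max_def)
  finally show ?thesis .
qed

text \<open>\<open>k ^ k\<close> is at most \<open>fact k * exp k\<close>, so the square root in the
  Hermite bound fits below \<open>fact k powr s\<close> once \<open>1/2 \<le> s\<close>.\<close>

lemma sqrt_power_self_le:
  assumes "1/2 \<le> s" shows "sqrt (real k) ^ k \<le> exp 1 ^ k * fact k powr s"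
proof -
  have "sqrt (real k) ^ k = sqrt (real k ^ k)" by (simp add: real_sqrt_power)
  also have "\<dots> \<le> sqrt (fact k * exp (real k))" by (intro real_sqrt_le_mono power_le_fact_exp) auto
  also have "\<dots> = fact k powr (1/2) * exp (real k / 2)"
  proof -
    have "sqrt (exp (real k)) = exp (real k / 2)"
      by (rule real_sqrt_unique) (auto simp: exp_double[symmetric])
    then show ?thesis by (simp add: real_sqrt_mult powr_half_sqrt)
  qed
  also have "\<dots> \<le> fact k powr s * exp (real k)"
    using assms by (intro mult_mono powr_mono) (auto simp: fact_ge_1)
  finally show ?thesis by (simp add: exp_of_nat_mult[symmetric] mult.commute)
qed

text \<open>Both \<open>y\<close> and the argument of the Hermite polynomial lie within
  \<open>\<bar>y - x\<bar>\<close> of a quantity depending on the phase point alone. Powers of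
  \<open>\<bar>y - x\<bar>\<close> are absorbed by the Gaussian factor, powers of
  \<open>\<bar>x\<bar>\<close> and \<open>\<bar>\<xi>\<bar>\<close> by the exponential of rate
  \<delta>.\<close>

lemma hermite_wave_bound:
  assumes s: "1/2 \<le> s" and d: "0 < \<delta>"
  obtains H where "1 \<le> H" "\<And>x \<xi> y n k. \<bar>y\<bar> ^ n * norm (hermite_wave k (Complex x (- \<xi>)) y) \<le>
     8 * H ^ (n + k) * (fact n * fact k) powr s *
      exp (x\<^sup>2/2 + \<delta> * (\<bar>x\<bar> powr (1/s) + \<bar>\<xi>\<bar> powr (1/s)))"
proof -
  have s0: "0 < s" using s by simp
  \<comment> \<open>The rate 1/8 leaves room: \<open>exp (a\<^sup>2 / 8)\<close> is paid once for
    \<open>y\<close> and once for the Hermite polynomial, against the Gaussian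
    \<open>exp (- (a\<^sup>2 / 2))\<close>.\<close>
  obtain H1 :: real where H1: "1 \<le> H1" "\<And>(t::real) n. 0 \<le> t \<Longrightarrow> t ^ n \<le> H1 ^ n * fact n powr (1/2) * exp (1/8 * t powr (1 / (1/2)))"
    using power_le_powr_fact_exp[of "1/8" "1/2"] by (metis (no_types, lifting) half_gt_zero zero_less_divide_1_iff zero_less_numeral zero_less_one)
  obtain H2 :: real where H2: "1 \<le> H2" "\<And>(t::real) n. 0 \<le> t \<Longrightarrow> t ^ n \<le> H2 ^ n * fact n powr s * exp (\<delta> * t powr (1 / s))"
    using power_le_powr_fact_exp[OF d s0] by blast
  define G where "G = max (max H1 H2) (exp 1)"
  have G: "1 \<le> G" "H1 \<le> G" "H2 \<le> G" "exp 1 \<le> G" using H1 by (auto simp: G_def)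
  have B1: "t ^ n \<le> G ^ n * fact n powr s * exp (t\<^sup>2 / 8)" if "0 \<le> t" for t n
  proof -
    have "t ^ n \<le> H1 ^ n * fact n powr (1/2) * exp (1/8 * t powr (1 / (1/2)))" using H1 that by blast
    also have "\<dots> \<le> G ^ n * fact n powr s * exp (1/8 * t powr (1 / (1/2)))"
      using G H1 s by (intro mult_right_mono mult_mono power_mono powr_mono) (auto simp: fact_ge_1)
    finally show ?thesis using that by simp
  qed
  have B2: "t ^ n \<le> G ^ n * fact n powr s * exp (\<delta> * t powr (1 / s))" if "0 \<le> t" for t n
  proof -
    have "t ^ n \<le> H2 ^ n * fact n powr s * exp (\<delta> * t powr (1 / s))" using H2 that by blast
    also have "\<dots> \<le> G ^ n * fact n powr s * exp (\<delta> * t powr (1 / s))"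
      using G H2 by (intro mult_right_mono power_mono) auto
    finally show ?thesis .
  qed
  have B3: "sqrt (real k) ^ k \<le> G ^ k * fact k powr s" for k
  proof -
    have "sqrt (real k) ^ k \<le> exp 1 ^ k * fact k powr s" by (rule sqrt_power_self_le[OF s])
    also have "\<dots> \<le> G ^ k * fact k powr s" using G by (intro mult_right_mono power_mono) auto
    finally show ?thesis .
  qed
  show ?thesis
  proof
    show "1 \<le> 4 * G" using G by simp
    fix x \<xi> y :: real and n k :: nat
    define a b c where "a = \<bar>y - x\<bar>" and "b = \<bar>\<xi>\<bar>" and "c = \<bar>x\<bar>"
    define E X where "E = exp (\<delta> * b powr (1/s))" and "X = exp (\<delta> * c powr (1/s))"
    define A where "A = exp (a\<^sup>2 / 8)"
    have nn: "0 \<le> a" "0 \<le> b" "0 \<le> c" by (auto simp: a_def b_def c_def)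
    have E: "1 \<le> E" "1 \<le> X" "1 \<le> A" using d by (auto simp: E_def X_def A_def)
    have "norm (Complex x (-\<xi>) - of_real y) \<le> a + b"
    proof -
      have "Complex x (-\<xi>) - of_real y = Complex (x - y) (- \<xi>)" by (simp add: complex_eq_iff)
      then show ?thesis
        using sqrt_sum_squares_le_sum_abs[of "x - y" "-\<xi>"]
        by (simp add: complex_norm a_def b_def abs_minus_commute)
    qed
    then have "norm (hermite k (Complex x (-\<xi>) - of_real y)) \<le> ((a + b) + sqrt (real k)) ^ k"
      by (intro order.trans[OF norm_hermite_le] power_mono) auto
    also have "\<dots> \<le> 2 ^ k * ((a + b) ^ k + sqrt (real k) ^ k)" using nn by (intro power_add_le) auto
    also have "\<dots> \<le> 2 ^ k * (2 ^ k * (a ^ k + b ^ k) + 2 ^ k * sqrt (real k) ^ k)"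
    proof -
      have "1 * sqrt (real k) ^ k \<le> 2 ^ k * sqrt (real k) ^ k" by (intro mult_right_mono) auto
      then show ?thesis using power_add_le[OF nn(1,2), of k] by (intro mult_left_mono add_mono) auto
    qed
    also have "\<dots> = 4 ^ k * (a ^ k + b ^ k + sqrt (real k) ^ k)"
    proof -
      have "(4::real) ^ k = 2 ^ k * 2 ^ k" by (simp flip: power_mult_distrib)
      then show ?thesis by (simp add: algebra_simps)
    qed
    also have "\<dots> \<le> 4 ^ k * (3 * (G ^ k * fact k powr s * A * E))"
    proof (intro mult_left_mono)
      have AE: "1 \<le> A * E" using mult_mono[of 1 A 1 E] E by simp
      have P: "0 \<le> G ^ k * fact k powr s" using G by simp
      have "a ^ k \<le> G ^ k * fact k powr s * A * 1" using B1[OF nn(1), of k] by (simp add: A_def)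
      also have "\<dots> \<le> G ^ k * fact k powr s * A * E" using E P by (intro mult_left_mono) (auto intro: mult_nonneg_nonneg)
      finally have a: "a ^ k \<le> G ^ k * fact k powr s * A * E" .
      have "b ^ k \<le> G ^ k * fact k powr s * 1 * E" using B2[OF nn(2), of k] by (simp add: E_def)
      also have "\<dots> \<le> G ^ k * fact k powr s * A * E" using E P by (intro mult_right_mono mult_left_mono) auto
      finally have b: "b ^ k \<le> G ^ k * fact k powr s * A * E" .
      have "sqrt (real k) ^ k \<le> G ^ k * fact k powr s * 1" using B3 by simp
      also have "\<dots> \<le> G ^ k * fact k powr s * (A * E)" using AE P by (intro mult_left_mono) auto
      finally show "a ^ k + b ^ k + sqrt (real k) ^ k \<le> 3 * (G ^ k * fact k powr s * A * E)"
        using a b by (simp add: mult.assoc)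
    qed simp
    also have "\<dots> = 3 * ((4 * G) ^ k * fact k powr s * A * E)" by (simp add: power_mult_distrib)
    finally have K: "norm (hermite k (Complex x (-\<xi>) - of_real y)) \<le> 3 * ((4 * G) ^ k * fact k powr s * A * E)" .
    have "\<bar>y\<bar> ^ n \<le> (c + a) ^ n" by (intro power_mono) (auto simp: c_def a_def)
    also have "\<dots> \<le> 2 ^ n * (c ^ n + a ^ n)" using nn by (intro power_add_le)
    also have "\<dots> \<le> 4 ^ n * (2 * (G ^ n * fact n powr s * A * X))"
    proof (intro mult_mono power_mono)
      have P: "0 \<le> G ^ n * fact n powr s" using G by simp
      have "a ^ n \<le> G ^ n * fact n powr s * A * 1" using B1[OF nn(1), of n] by (simp add: A_def)
      also have "\<dots> \<le> G ^ n * fact n powr s * A * X" using E P by (intro mult_left_mono) (auto intro: mult_nonneg_nonneg)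
      finally have a: "a ^ n \<le> G ^ n * fact n powr s * A * X" .
      have "c ^ n \<le> G ^ n * fact n powr s * 1 * X" using B2[OF nn(3), of n] by (simp add: X_def)
      also have "\<dots> \<le> G ^ n * fact n powr s * A * X" using E P by (intro mult_right_mono mult_left_mono) auto
      finally show "c ^ n + a ^ n \<le> 2 * (G ^ n * fact n powr s * A * X)" using a by simp
    qed (use nn in auto)
    also have "\<dots> = 2 * ((4 * G) ^ n * fact n powr s * A * X)" by (simp add: power_mult_distrib)
    finally have N: "\<bar>y\<bar> ^ n \<le> 2 * ((4 * G) ^ n * fact n powr s * A * X)" .
    have "A * A * exp (- ((y - x)\<^sup>2 / 2)) \<le> 1"
    proof -
      have "A * A * exp (- ((y - x)\<^sup>2 / 2)) = exp (- ((y - x)\<^sup>2 / 4))"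
        by (simp add: A_def a_def flip: exp_add)
      then show ?thesis by simp
    qed
    note AA = this
    have "\<bar>y\<bar> ^ n * norm (hermite_wave k (Complex x (- \<xi>)) y) =
        \<bar>y\<bar> ^ n * norm (hermite k (Complex x (-\<xi>) - of_real y)) * (exp (x\<^sup>2/2) * exp (- ((y - x)\<^sup>2 / 2)))"
      by (simp only: hermite_wave_def norm_mult norm_exp_wave mult.assoc)
    also have "\<dots> \<le> (2 * ((4 * G) ^ n * fact n powr s * A * X)) * (3 * ((4 * G) ^ k * fact k powr s * A * E)) *
        (exp (x\<^sup>2/2) * exp (- ((y - x)\<^sup>2 / 2)))"
      using G E by (intro mult_right_mono mult_mono N K) (auto intro!: mult_nonneg_nonneg)
    also have "\<dots> = 6 * (4*G) ^ (n + k) * (fact n * fact k) powr s * (exp (x\<^sup>2/2) * X * E) * (A * A * exp (- ((y - x)\<^sup>2 / 2)))"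
      by (simp add: power_add powr_mult mult_ac)
    also have "\<dots> \<le> 6 * (4*G) ^ (n + k) * (fact n * fact k) powr s * (exp (x\<^sup>2/2) * X * E) * 1"
      using AA G E by (intro mult_left_mono) (auto intro!: mult_nonneg_nonneg)
    also have "\<dots> \<le> 8 * (4*G) ^ (n + k) * (fact n * fact k) powr s * (exp (x\<^sup>2/2) * X * E) * 1"
      using G E by (intro mult_right_mono) (auto intro!: mult_nonneg_nonneg)
    also have "exp (x\<^sup>2/2) * X * E = exp (x\<^sup>2/2 + \<delta> * (\<bar>x\<bar> powr (1/s) + \<bar>\<xi>\<bar> powr (1/s)))"
      by (simp add: X_def E_def c_def b_def exp_add algebra_simps)
    finally show "\<bar>y\<bar> ^ n * norm (hermite_wave k (Complex x (- \<xi>)) y) \<le>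
     8 * (4*G) ^ (n + k) * (fact n * fact k) powr s *
      exp (x\<^sup>2/2 + \<delta> * (\<bar>x\<bar> powr (1/s) + \<bar>\<xi>\<bar> powr (1/s)))" by simp
  qed
qed

section \<open>Tensor products of one-dimensional waves\<close>

definition tensor_wave :: "('d::finite \<Rightarrow> nat) \<Rightarrow> ('d \<Rightarrow> complex) \<Rightarrow> real^'d \<Rightarrow> complex" where
  "tensor_wave \<alpha> w y = (\<Prod>j\<in>UNIV. hermite_wave (\<alpha> j) (w j) (y $ j))"

lemma tensor_wave_has_derivative:
  "(tensor_wave \<alpha> w has_derivative (\<lambda>v. \<Sum>i\<in>UNIV. v $ i *\<^sub>R tensor_wave (\<alpha>(i := Suc (\<alpha> i))) w y)) (at y)"
proof -
  have 1: "((\<lambda>y. hermite_wave (\<alpha> j) (w j) (y $ j)) has_derivative (\<lambda>v. v $ j *\<^sub>R hermite_wave (Suc (\<alpha> j)) (w j) (y $ j))) (at y)" for j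
  proof -
    have "((\<lambda>y. y $ j) has_derivative (\<lambda>v. v $ j)) (at y)"
      by (rule bounded_linear_imp_has_derivative[OF bounded_linear_vec_nth])
    from has_derivative_compose[OF this hermite_wave_derivative[unfolded has_vector_derivative_def, of "\<alpha> j" "w j" "y $ j"]]
    show ?thesis .
  qed
  have "((\<lambda>y. \<Prod>j\<in>UNIV. hermite_wave (\<alpha> j) (w j) (y $ j)) has_derivative
     (\<lambda>v. \<Sum>i\<in>UNIV. v $ i *\<^sub>R hermite_wave (Suc (\<alpha> i)) (w i) (y $ i) * (\<Prod>j\<in>UNIV - {i}. hermite_wave (\<alpha> j) (w j) (y $ j)))) (at y)"
    by (rule has_derivative_prod) (rule 1)
  moreover have "tensor_wave (\<alpha>(i := Suc (\<alpha> i))) w y =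
     hermite_wave (Suc (\<alpha> i)) (w i) (y $ i) * (\<Prod>j\<in>UNIV - {i}. hermite_wave (\<alpha> j) (w j) (y $ j))" for i
    unfolding tensor_wave_def by (subst prod.remove[of _ i]) (auto intro!: prod.cong)
  ultimately show ?thesis unfolding tensor_wave_def[of \<alpha> w, abs_def] by simp
qed

text \<open>The result depends on \<open>L\<close> only through its letter counts, so for waves the
  list chosen in \<open>multi_deriv\<close> does not matter.\<close>

lemma iter_partial_tensor_wave: "iter_partial L (tensor_wave (\<lambda>_. 0) w) = tensor_wave (count_list L) w"
proof (induction L)
  case (Cons i L)
  have "(count_list L)(i := Suc (count_list L i)) = count_list (i # L)" by auto
  with partial_deriv_eqI[OF tensor_wave_has_derivative[of "count_list L" w], of i] show ?case
    by (simp add: Cons.IH fun_eq_iff fun_upd_def cong: if_cong)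
qed (simp add: fun_eq_iff)

lemma tensor_wave_C_infinity: "tensor_wave (\<lambda>_. 0) w \<in> C_infinity"
proof -
  have "tensor_wave \<alpha> w differentiable (at y)" for \<alpha> y
    using tensor_wave_has_derivative by (rule differentiableI)
  then show ?thesis
    by (simp add: C_infinity_def iter_partial_tensor_wave differentiable_on_def)
qed

lemma count_list_replicate_if: "count_list (replicate n j) i = (if i = j then n else 0)"
  by (induction n) auto

text \<open>Guarantees that the choice in \<open>multi_deriv\<close> really picks a list with the
  prescribed counts.\<close>

lemma ex_list_counts: "\<exists>L. \<forall>i::'d::finite. count_list L i = \<alpha> i"
proof -
  obtain xs :: "'d list" where xs: "set xs = UNIV" "distinct xs" using finite_distinct_list[OF finite] by metis
  have "count_list (concat (map (\<lambda>j. replicate (\<alpha> j) j) ys)) i = (if i \<in> set ys then \<alpha> i else 0)" if "distinct ys" for i ys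
    using that by (induction ys) (auto simp: count_list_append count_list_replicate_if)
  with xs show ?thesis by (intro exI[of _ "concat (map (\<lambda>j. replicate (\<alpha> j) j) xs)"]) auto
qed

lemma count_list_SOME: "count_list (SOME L. \<forall>i::'d::finite. count_list L i = \<alpha> i) = \<alpha>"
  using someI_ex[OF ex_list_counts[of \<alpha>]] by auto

lemma multi_deriv_tensor_wave: "multi_deriv \<alpha> (tensor_wave (\<lambda>_. 0) w) = tensor_wave \<alpha> w"
  by (simp add: multi_deriv_def iter_partial_tensor_wave count_list_SOME)

text \<open>The complex point \<open>w = x - \<i>\<xi>\<close>: the wave \<open>exp (w y - y\<^sup>2 / 2)\<close> is, up to a
  factor depending only on \<open>|x|\<close>, the Gaussian centred at \<open>x\<close> with frequency \<open>\<xi>\<close>, and it depends holomorphically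
  on \<open>w\<close>.\<close>

definition phase_point :: "real^'d::finite \<Rightarrow> real^'d \<Rightarrow> 'd \<Rightarrow> complex" where
  "phase_point x \<xi> j = Complex (x $ j) (- \<xi> $ j)"

lemma norm_vec_power2: "(norm (x::real^'d::finite))\<^sup>2 = (\<Sum>j\<in>UNIV. (x $ j)\<^sup>2)"
  by (simp add: norm_vec_def L2_set_def sum_nonneg)

lemma tensor_wave_gs_bound:
  fixes s \<delta> :: real
  assumes s: "1/2 \<le> s" and d: "0 < \<delta>"
  obtains H C where "1 \<le> H" "0 < C" "\<And>(x::real^'d::finite) \<xi>. gs_bound s H
    (C * exp ((norm x)\<^sup>2/2 + \<delta> * (norm x powr (1/s) + norm \<xi> powr (1/s)))) (tensor_wave (\<lambda>_. 0) (phase_point x \<xi>))"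
proof -
  define n where "n = real CARD('d)"
  have n: "0 < n" by (simp add: n_def)
  have s0: "0 < s" using s by simp
  \<comment> \<open>Each coordinate gets the share \<open>\<delta> / n\<close>, because all
    \<open>n\<close> coordinates are afterwards bounded by the full norm.\<close>
  obtain H where H: "1 \<le> H" "\<And>x \<xi> y m k. \<bar>y\<bar> ^ m * norm (hermite_wave k (Complex x (- \<xi>)) y) \<le>
     8 * H ^ (m + k) * (fact m * fact k) powr s *
      exp (x\<^sup>2/2 + \<delta> / n * (\<bar>x\<bar> powr (1/s) + \<bar>\<xi>\<bar> powr (1/s)))"
    using hermite_wave_bound[OF s, of "\<delta> / n"] d n by auto
  show ?thesis
  proof
    show "1 \<le> H" by fact
    show "0 < (8::real) ^ CARD('d)" by simp
    fix x \<xi> :: "real^'d"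
    let ?E = "exp ((norm x)\<^sup>2/2 + \<delta> * (norm x powr (1/s) + norm \<xi> powr (1/s)))"
    show "gs_bound s H (8 ^ CARD('d) * ?E) (tensor_wave (\<lambda>_. 0) (phase_point x \<xi>))"
      unfolding gs_bound_def multi_deriv_tensor_wave
    proof (intro conjI allI tensor_wave_C_infinity)
      fix \<alpha> \<beta> :: "'d \<Rightarrow> nat" and y :: "real^'d"
      have "\<bar>multi_power y \<beta>\<bar> * norm (tensor_wave \<alpha> (phase_point x \<xi>) y) =
         (\<Prod>j\<in>UNIV. \<bar>y $ j\<bar> ^ \<beta> j * norm (hermite_wave (\<alpha> j) (phase_point x \<xi> j) (y $ j)))"
        by (simp add: multi_power_def tensor_wave_def abs_prod power_abs prod_norm prod.distrib)
      also have "\<dots> \<le> (\<Prod>j\<in>UNIV. 8 * H ^ (\<beta> j + \<alpha> j) * (fact (\<beta> j) * fact (\<alpha> j)) powr s *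
          exp ((x $ j)\<^sup>2/2 + \<delta> / n * (\<bar>x $ j\<bar> powr (1/s) + \<bar>\<xi> $ j\<bar> powr (1/s))))"
        unfolding phase_point_def by (intro prod_mono conjI H(2)) auto
      also have "\<dots> = 8 ^ CARD('d) * H ^ (multi_abs \<alpha> + multi_abs \<beta>) * (multi_fact \<alpha> * multi_fact \<beta>) powr s *
          exp (\<Sum>j\<in>UNIV. (x $ j)\<^sup>2/2 + \<delta> / n * (\<bar>x $ j\<bar> powr (1/s) + \<bar>\<xi> $ j\<bar> powr (1/s)))"
        unfolding exp_sum[OF finite]
        by (simp add: prod.distrib multi_abs_def multi_fact_def power_sum[symmetric] sum.distrib
              prod_powr_distrib[symmetric] add.commute mult.commute)
      also have "\<dots> \<le> 8 ^ CARD('d) * H ^ (multi_abs \<alpha> + multi_abs \<beta>) * (multi_fact \<alpha> * multi_fact \<beta>) powr s * ?E"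
      proof (intro mult_left_mono)
        have "(\<Sum>j\<in>UNIV. (x $ j)\<^sup>2/2 + \<delta> / n * (\<bar>x $ j\<bar> powr (1/s) + \<bar>\<xi> $ j\<bar> powr (1/s))) \<le>
           (\<Sum>j\<in>(UNIV::'d set). (x $ j)\<^sup>2/2 + \<delta> / n * (norm x powr (1/s) + norm \<xi> powr (1/s)))"
          using d n s0 by (intro sum_mono add_left_mono mult_left_mono add_mono powr_mono2 component_le_norm_cart) auto
        also have "\<dots> = (norm x)\<^sup>2/2 + \<delta> * (norm x powr (1/s) + norm \<xi> powr (1/s))"
          using n by (simp add: sum.distrib norm_vec_power2 sum_divide_distrib[symmetric] n_def)
        finally show "exp (\<Sum>j\<in>UNIV. (x $ j)\<^sup>2/2 + \<delta> / n * (\<bar>x $ j\<bar> powr (1/s) + \<bar>\<xi> $ j\<bar> powr (1/s))) \<le> ?E" by simp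
      qed (use H in auto)
      finally show "\<bar>multi_power y \<beta>\<bar> * norm (tensor_wave \<alpha> (phase_point x \<xi>) y) \<le> 8 ^ CARD('d) * ?E * gs_weight s H \<alpha> \<beta>"
        by (simp add: gs_weight_def mult_ac)
    qed
  qed
qed

section \<open>Holomorphy of the short-time Fourier transform\<close>

text \<open>Cauchy's inequality on discs of radius \<open>\<rho> / 2\<close> about the points of the
  half disc bounds the first two derivatives; the mean value inequality and Taylor's formula do the
  rest. The factor 8 is \<open>fact 2 / (1/2) ^ 2\<close>.\<close>

lemma entire_difference_bound:
  assumes hol: "f holomorphic_on UNIV" and \<rho>: "0 < \<rho>"
    and M: "\<And>z. norm (z - c) \<le> \<rho> \<Longrightarrow> norm (f z) \<le> M" and t: "norm (t - c) \<le> \<rho> / 2"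
  shows "norm (f t - f c) \<le> 2 * M / \<rho> * norm (t - c)"
    and "norm (f t - f c - (t - c) * deriv f c) \<le> 8 * M / \<rho>\<^sup>2 * (norm (t - c))\<^sup>2"
proof -
  have M0: "0 \<le> M" using M[of c] \<rho> order.trans[OF norm_ge_zero] by fastforce
  have hd: "((deriv ^^ i) f has_field_derivative (deriv ^^ Suc i) f z) (at z within S)" for i z S
    using holomorphic_derivI[OF holomorphic_higher_deriv[OF hol open_UNIV, of i] open_UNIV, of z]
    by (simp add: has_field_derivative_at_within)
  have B: "norm ((deriv ^^ i) f z) \<le> fact i * M / (\<rho> / 2) ^ i" if "z \<in> cball c (\<rho>/2)" for i z
  proof (rule Cauchy_inequality)
    show "f holomorphic_on ball z (\<rho>/2)" using hol by (rule holomorphic_on_subset) simp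
    show "continuous_on (cball z (\<rho>/2)) f"
      using holomorphic_on_imp_continuous_on[OF hol] by (rule continuous_on_subset) simp
    fix x assume "norm (z - x) = \<rho>/2"
    then have "norm (x - c) \<le> \<rho>" using that norm_triangle_ineq[of "x - z" "z - c"]
      by (simp add: dist_norm norm_minus_commute)
    then show "norm (f x) \<le> M" by (rule M)
  qed (use \<rho> in simp)
  have t': "t \<in> cball c (\<rho>/2)" "c \<in> cball c (\<rho>/2)" using t \<rho> by (auto simp: dist_norm norm_minus_commute)
  have "norm (f t - f c) \<le> (2 * M / \<rho>) * norm (t - c)"
    by (rule field_differentiable_bound[of "cball c (\<rho>/2)" f "deriv f"])
       (use hd[of 0] B[of _ 1] t' in \<open>auto simp: mult.commute\<close>)
  then show "norm (f t - f c) \<le> 2 * M / \<rho> * norm (t - c)" .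
  have "norm ((deriv ^^ 0) f t - (\<Sum>i\<le>1. (deriv ^^ i) f c * (t - c) ^ i / fact i)) \<le>
      (8 * M / \<rho>\<^sup>2) * norm (t - c) ^ Suc 1 / fact 1"
    by (rule complex_Taylor[of "cball c (\<rho>/2)"])
       (use hd B[of _ 2] t' in \<open>auto simp: power_divide numeral_2_eq_2\<close>)
  then show "norm (f t - f c - (t - c) * deriv f c) \<le> 8 * M / \<rho>\<^sup>2 * (norm (t - c))\<^sup>2"
    by (simp add: algebra_simps power2_eq_square)
qed

abbreviation gauss_wave :: "('d::finite \<Rightarrow> complex) \<Rightarrow> real^'d \<Rightarrow> complex" where
  "gauss_wave w \<equiv> tensor_wave (\<lambda>_. 0) w"

lemma tensor_wave_line_holomorphic:
  "(\<lambda>t. tensor_wave \<alpha> (\<lambda>j. w j + t * v j) y) holomorphic_on UNIV"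
  unfolding tensor_wave_def hermite_wave_def by (intro holomorphic_intros)

text \<open>Cauchy estimates along complex lines, applied pointwise in \<open>y\<close> to each derivative, bound
  increments and differences of difference quotients in one seminorm. The difference quotients are thus
  Cauchy, and remain so after applying a continuous functional; completeness of the spaces is not needed.\<close>

lemma gauss_wave_line_bounds:
  fixes w v :: "'d::finite \<Rightarrow> complex"
  assumes M: "\<And>t. norm t \<le> 2 \<Longrightarrow> gs_bound s h M (gauss_wave (\<lambda>j. w j + t * v j))"
  shows "norm t \<le> 1 \<Longrightarrow> gs_bound s h (M * norm t) (\<lambda>y. gauss_wave (\<lambda>j. w j + t * v j) y - gauss_wave w y)"
    and "t \<noteq> 0 \<Longrightarrow> t' \<noteq> 0 \<Longrightarrow> norm t \<le> 1 \<Longrightarrow> norm t' \<le> 1 \<Longrightarrow>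
      gs_bound s h (2 * M * (norm t + norm t')) (\<lambda>y. inverse t * (gauss_wave (\<lambda>j. w j + t * v j) y - gauss_wave w y) +
         (- inverse t') * (gauss_wave (\<lambda>j. w j + t' * v j) y - gauss_wave w y))"
proof -
  let ?W = "\<lambda>t. gauss_wave (\<lambda>j. w j + t * v j)"
  have CW: "gauss_wave u \<in> C_infinity" for u :: "'d \<Rightarrow> complex" by (rule tensor_wave_C_infinity)
  have CD: "(\<lambda>y. ?W t y - gauss_wave w y) \<in> C_infinity" for t
    using C_infinity_lincomb[OF CW[of "\<lambda>j. w j + t * v j"] CW[of w], of 1 "-1"] by simp
  have mdD: "multi_deriv \<alpha> (\<lambda>y. ?W t y - gauss_wave w y) y = tensor_wave \<alpha> (\<lambda>j. w j + t * v j) y - tensor_wave \<alpha> w y" for t \<alpha> y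
    using multi_deriv_lincomb[OF CW[of "\<lambda>j. w j + t * v j"] CW[of w], of \<alpha> 1 "-1"] by (simp add: multi_deriv_tensor_wave)
  \<comment> \<open>One term of the seminorm at fixed \<open>y\<close>, as an entire function of
    \<open>t\<close>. The weight enters only as a constant factor, so the estimates are uniform in
    \<alpha>, \<beta> and \<open>y\<close>.\<close>
  define e where "e = (\<lambda>\<alpha> \<beta> y t. complex_of_real (multi_power y \<beta>) * tensor_wave \<alpha> (\<lambda>j. w j + t * v j) y)"
  have e_hol: "e \<alpha> \<beta> y holomorphic_on UNIV" for \<alpha> \<beta> y
    unfolding e_def by (intro holomorphic_intros tensor_wave_line_holomorphic)
  have e_bd: "norm (e \<alpha> \<beta> y t) \<le> M * gs_weight s h \<alpha> \<beta>" if "norm (t - 0) \<le> 2" for \<alpha> \<beta> y t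
    using gs_boundD[OF M, of t y \<beta> \<alpha>] that by (simp add: e_def norm_mult multi_deriv_tensor_wave)
  have e0: "e \<alpha> \<beta> y 0 = complex_of_real (multi_power y \<beta>) * tensor_wave \<alpha> w y" for \<alpha> \<beta> y by (simp add: e_def)
  {
    assume t: "norm t \<le> 1"
    show "gs_bound s h (M * norm t) (\<lambda>y. ?W t y - gauss_wave w y)"
      unfolding gs_bound_def mdD
    proof (intro conjI allI CD)
      fix \<alpha> \<beta> y
      have "\<bar>multi_power y \<beta>\<bar> * norm (tensor_wave \<alpha> (\<lambda>j. w j + t * v j) y - tensor_wave \<alpha> w y) = norm (e \<alpha> \<beta> y t - e \<alpha> \<beta> y 0)"
        by (simp add: e_def norm_mult flip: right_diff_distrib)
      also have "\<dots> \<le> 2 * (M * gs_weight s h \<alpha> \<beta>) / 2 * norm (t - 0)"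
        by (rule entire_difference_bound(1)[OF e_hol _ e_bd]) (use t in auto)
      finally show "\<bar>multi_power y \<beta>\<bar> * norm (tensor_wave \<alpha> (\<lambda>j. w j + t * v j) y - tensor_wave \<alpha> w y) \<le> M * norm t * gs_weight s h \<alpha> \<beta>"
        by (simp add: mult_ac)
    qed
  }
  {
    assume t: "t \<noteq> 0" "t' \<noteq> 0" "norm t \<le> 1" "norm t' \<le> 1"
    show "gs_bound s h (2 * M * (norm t + norm t')) (\<lambda>y. inverse t * (?W t y - gauss_wave w y) + (- inverse t') * (?W t' y - gauss_wave w y))"
      unfolding gs_bound_def multi_deriv_lincomb[OF CD CD] mdD
    proof (intro conjI allI C_infinity_lincomb CD)
      fix \<alpha> \<beta> y
      \<comment> \<open>Both quotients are compared with the scalar derivative at 0, which cancels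
        in their difference.\<close>
      define D where "D = deriv (e \<alpha> \<beta> y) 0"
      have q: "norm (inverse \<tau> * (e \<alpha> \<beta> y \<tau> - e \<alpha> \<beta> y 0) - D) \<le> 2 * (M * gs_weight s h \<alpha> \<beta>) * norm \<tau>"
        if "\<tau> \<noteq> 0" "norm \<tau> \<le> 1" for \<tau>
      proof -
        have "norm (e \<alpha> \<beta> y \<tau> - e \<alpha> \<beta> y 0 - (\<tau> - 0) * D) \<le> 8 * (M * gs_weight s h \<alpha> \<beta>) / 2\<^sup>2 * (norm (\<tau> - 0))\<^sup>2"
          unfolding D_def by (rule entire_difference_bound(2)[OF e_hol _ e_bd]) (use that in auto)
        moreover have "inverse \<tau> * (e \<alpha> \<beta> y \<tau> - e \<alpha> \<beta> y 0) - D = inverse \<tau> * (e \<alpha> \<beta> y \<tau> - e \<alpha> \<beta> y 0 - \<tau> * D)"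
          using that by (simp add: field_simps)
        ultimately have "norm (inverse \<tau> * (e \<alpha> \<beta> y \<tau> - e \<alpha> \<beta> y 0) - D) \<le> inverse (norm \<tau>) * (2 * (M * gs_weight s h \<alpha> \<beta>) * (norm \<tau>)\<^sup>2)"
          by (simp add: norm_mult norm_inverse mult_left_mono)
        also have "inverse (norm \<tau>) * (2 * (M * gs_weight s h \<alpha> \<beta>) * (norm \<tau>)\<^sup>2) = 2 * (M * gs_weight s h \<alpha> \<beta>) * norm \<tau>"
          using that by (simp add: power2_eq_square field_simps)
        finally show ?thesis .
      qed
      have "\<bar>multi_power y \<beta>\<bar> * norm (inverse t * (tensor_wave \<alpha> (\<lambda>j. w j + t * v j) y - tensor_wave \<alpha> w y) +
             (- inverse t') * (tensor_wave \<alpha> (\<lambda>j. w j + t' * v j) y - tensor_wave \<alpha> w y)) =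
          norm (complex_of_real (multi_power y \<beta>) * (inverse t * (tensor_wave \<alpha> (\<lambda>j. w j + t * v j) y - tensor_wave \<alpha> w y) +
             (- inverse t') * (tensor_wave \<alpha> (\<lambda>j. w j + t' * v j) y - tensor_wave \<alpha> w y)))"
        by (simp add: norm_mult)
      also have "\<dots> = norm ((inverse t * (e \<alpha> \<beta> y t - e \<alpha> \<beta> y 0) - D) - (inverse t' * (e \<alpha> \<beta> y t' - e \<alpha> \<beta> y 0) - D))"
        unfolding e_def by (rule arg_cong[where f=norm]) (simp add: algebra_simps)
      also have "\<dots> \<le> 2 * (M * gs_weight s h \<alpha> \<beta>) * norm t + 2 * (M * gs_weight s h \<alpha> \<beta>) * norm t'"
        using q[OF t(1,3)] q[OF t(2,4)] by (intro order.trans[OF norm_triangle_ineq4]) simp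
      finally show "\<bar>multi_power y \<beta>\<bar> * norm (inverse t * (tensor_wave \<alpha> (\<lambda>j. w j + t * v j) y - tensor_wave \<alpha> w y) +
             (- inverse t') * (tensor_wave \<alpha> (\<lambda>j. w j + t' * v j) y - tensor_wave \<alpha> w y)) \<le> 2 * M * (norm t + norm t') * gs_weight s h \<alpha> \<beta>"
        by (simp add: algebra_simps)
    qed
  }
qed

lemma phase_point_surj: "w = phase_point (\<chi> j. Re (w j)) (\<chi> j. - Im (w j))"
  by (simp add: phase_point_def fun_eq_iff)

lemma norm_phase_le:
  fixes w :: "'d::finite \<Rightarrow> complex"
  assumes "\<And>j. norm (w j) \<le> R"
  shows "norm (\<chi> j. Re (w j)) \<le> real CARD('d) * R" "norm (\<chi> j. - Im (w j)) \<le> real CARD('d) * R"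
proof -
  have "norm (\<chi> j. Re (w j)) \<le> (\<Sum>j\<in>UNIV. \<bar>Re (w j)\<bar>)"
    using norm_le_l1_cart[of "\<chi> j. Re (w j)"] by simp
  also have "\<dots> \<le> (\<Sum>j\<in>(UNIV::'d set). R)"
    using assms abs_Re_le_cmod order.trans by (intro sum_mono) blast
  finally show "norm (\<chi> j. Re (w j)) \<le> real CARD('d) * R" by simp
  have "norm (\<chi> j. - Im (w j)) \<le> (\<Sum>j\<in>UNIV. \<bar>Im (w j)\<bar>)"
    using norm_le_l1_cart[of "\<chi> j. - Im (w j)"] by simp
  also have "\<dots> \<le> (\<Sum>j\<in>(UNIV::'d set). R)"
    using assms abs_Im_le_cmod order.trans by (intro sum_mono) blast
  finally show "norm (\<chi> j. - Im (w j)) \<le> real CARD('d) * R" by simp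
qed

text \<open>\<open>H\<close> is fixed before the radius: all waves lie in one step, and a functional
  is controlled on them by the single constant of that step.\<close>

lemma gauss_wave_locally_bounded:
  assumes s: "1/2 \<le> s"
  obtains H where "1 \<le> H" "\<And>R. \<exists>M>0. \<forall>w :: 'd::finite \<Rightarrow> complex. (\<forall>j. norm (w j) \<le> R) \<longrightarrow> gs_bound s H M (gauss_wave w)"
proof -
  have s0: "0 < s" using s by simp
  obtain H C where H: "1 \<le> H" "0 < C" "\<And>(x::real^'d) \<xi>. gs_bound s H
    (C * exp ((norm x)\<^sup>2/2 + 1 * (norm x powr (1/s) + norm \<xi> powr (1/s)))) (gauss_wave (phase_point x \<xi>))"
    using tensor_wave_gs_bound[OF s zero_less_one, where 'd='d] by metis
  have "\<exists>M>0. \<forall>w :: 'd \<Rightarrow> complex. (\<forall>j. norm (w j) \<le> R) \<longrightarrow> gs_bound s H M (gauss_wave w)" for R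
  proof (intro exI conjI allI impI)
    let ?n = "real CARD('d) * R"
    show "0 < C * exp (?n\<^sup>2/2 + 1 * (?n powr (1/s) + ?n powr (1/s)))" using H by simp
    fix w :: "'d \<Rightarrow> complex" assume "\<forall>j. norm (w j) \<le> R"
    then have n: "norm (\<chi> j. Re (w j)) \<le> ?n" "norm (\<chi> j. - Im (w j)) \<le> ?n" by (auto intro!: norm_phase_le)
    have p: "norm (\<chi> j. Re (w j)) powr (1/s) + norm (\<chi> j. - Im (w j)) powr (1/s) \<le> 2 * ?n powr (1/s)"
      using powr_mono2[OF _ _ n(1), of "1/s"] powr_mono2[OF _ _ n(2), of "1/s"] s0 by simp
    show "gs_bound s H (C * exp (?n\<^sup>2/2 + 1 * (?n powr (1/s) + ?n powr (1/s)))) (gauss_wave w)"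
      by (subst phase_point_surj, rule gs_bound_mono[OF H(3)])
         (use H n s0 p in \<open>auto intro!: mult_left_mono add_mono[of "_ / 2"] divide_right_mono power_mono\<close>)
  qed
  with H(1) that show ?thesis by blast
qed

lemma GS_gauss_wave: "1/2 \<le> s \<Longrightarrow> gauss_wave (w::'d::finite \<Rightarrow> complex) \<in> GS s"
proof -
  assume s: "1/2 \<le> s"
  obtain H where H: "1 \<le> H" "\<And>R. \<exists>M>0. \<forall>w :: 'd \<Rightarrow> complex. (\<forall>j. norm (w j) \<le> R) \<longrightarrow> gs_bound s H M (gauss_wave w)"
    using gauss_wave_locally_bounded[OF s, where 'd='d] by blast
  have "\<forall>j. norm (w j) \<le> (\<Sum>j\<in>UNIV. norm (w j))" by (auto intro: member_le_sum)
  with H(2)[of "\<Sum>j\<in>UNIV. norm (w j)"] obtain M where "M > 0" "gs_bound s H M (gauss_wave w)" by blast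
  with H(1) show ?thesis by (intro gs_bound_in_GS[of H M]) auto
qed

text \<open>Differentiability at 0 for every base point \<open>w\<close> is enough, since moving
  along the line only changes the base point.\<close>

lemma GS_dual_gauss_wave_holomorphic:
  fixes u :: "(real^'d::finite \<Rightarrow> complex) \<Rightarrow> complex"
  assumes u: "u \<in> GS_dual (1/2)"
  shows "(\<lambda>t. u (gauss_wave (\<lambda>j. w j + t * v j))) holomorphic_on UNIV"
proof -
  obtain H where H: "1 \<le> H" "\<And>R. \<exists>M>0. \<forall>w :: 'd \<Rightarrow> complex. (\<forall>j. norm (w j) \<le> R) \<longrightarrow> gs_bound (1/2) H M (gauss_wave w)"
    using gauss_wave_locally_bounded[of "1/2", where 'd='d] by auto
  obtain K where K: "0 < K" "\<And>M f. 0 \<le> M \<Longrightarrow> gs_bound (1/2) H M f \<Longrightarrow> norm (u f) \<le> K * M"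
    using GS_dual_bounded[OF u, of H] H(1) by (metis less_le_trans zero_less_one)
  have GS: "gauss_wave w \<in> GS (1/2)" for w :: "'d \<Rightarrow> complex" by (rule GS_gauss_wave) simp
  have base: "\<exists>L. ((\<lambda>t. u (gauss_wave (\<lambda>j. w j + t * v j))) has_field_derivative L) (at 0)" for w :: "'d \<Rightarrow> complex"
  proof -
    define F where "F = (\<lambda>t. u (gauss_wave (\<lambda>j. w j + t * v j)))"
    define q where "q t = inverse t * (F t - F 0)" for t
    \<comment> \<open>Bounds every coordinate of \<open>w j + t * v j\<close> for
      \<open>norm t \<le> 2\<close>, the disc on which the Cauchy estimates are based.\<close>
    define R where "R = (\<Sum>j\<in>UNIV. norm (w j) + 2 * norm (v j))"
    obtain M where M: "M > 0" "\<And>w :: 'd \<Rightarrow> complex. (\<forall>j. norm (w j) \<le> R) \<Longrightarrow> gs_bound (1/2) H M (gauss_wave w)"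
      using H(2)[of R] by blast
    have bd: "gs_bound (1/2) H M (gauss_wave (\<lambda>j. w j + t * v j))" if "norm t \<le> 2" for t
    proof (rule M(2), rule allI)
      fix j
      have "norm (w j + t * v j) \<le> norm (w j) + 2 * norm (v j)"
        using that by (intro order.trans[OF norm_triangle_ineq] add_left_mono) (auto simp: norm_mult intro: mult_right_mono)
      also have "\<dots> \<le> R" unfolding R_def by (rule member_le_sum) auto
      finally show "norm (w j + t * v j) \<le> R" .
    qed
    have GSd: "(\<lambda>y. gauss_wave (\<lambda>j. w j + t * v j) y - gauss_wave w y) \<in> GS (1/2)" for t
      using GS_lincomb[OF GS[of "\<lambda>j. w j + t * v j"] GS[of w], of 1 "-1"] by simp
    have ud: "u (\<lambda>y. gauss_wave (\<lambda>j. w j + t * v j) y - gauss_wave w y) = F t - F 0" for t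
      using GS_dual_linear[OF u GS[of "\<lambda>j. w j + t * v j"] GS[of w], of 1 "-1"] by (simp add: F_def)
    have qd: "norm (q t - q t') \<le> 2 * K * M * (norm t + norm t')" if "t \<noteq> 0" "t' \<noteq> 0" "norm t \<le> 1" "norm t' \<le> 1" for t t'
    proof -
      let ?f = "\<lambda>y. inverse t * (gauss_wave (\<lambda>j. w j + t * v j) y - gauss_wave w y) +
         (- inverse t') * (gauss_wave (\<lambda>j. w j + t' * v j) y - gauss_wave w y)"
      have "u ?f = q t - q t'" by (subst GS_dual_linear[OF u GSd GSd]) (simp add: ud q_def)
      moreover have "norm (u ?f) \<le> K * (2 * M * (norm t + norm t'))"
        by (rule K(2)[OF _ gauss_wave_line_bounds(2)[OF bd that]]) (use M in auto)
      ultimately show ?thesis by (simp add: mult_ac)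
    qed
    \<comment> \<open>One null sequence produces the candidate for the derivative; \<open>qd\<close>
      then compares arbitrary \<open>t\<close> with this sequence.\<close>
    define \<tau> :: "nat \<Rightarrow> complex" where "\<tau> n = of_real (inverse (real (Suc n)))" for n
    have \<tau>: "\<tau> n \<noteq> 0" "norm (\<tau> n) \<le> 1" "norm (\<tau> n) = inverse (real (Suc n))" for n
      unfolding \<tau>_def norm_of_real by (simp_all add: inverse_le_1_iff del: of_nat_Suc)
    have \<tau>0: "(\<lambda>n. norm (\<tau> n)) \<longlonglongrightarrow> 0" unfolding \<tau>(3) by (rule LIMSEQ_inverse_real_of_nat)
    have "Cauchy (\<lambda>n. q (\<tau> n))"
    proof (rule metric_CauchyI)
      fix e :: real assume e: "0 < e"
      have "eventually (\<lambda>n. norm (\<tau> n) < e / (4 * K * M)) sequentially"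
        using \<tau>0 e K M by (intro order_tendstoD(2)[OF \<tau>0]) auto
      then obtain N where N: "\<And>n. n \<ge> N \<Longrightarrow> norm (\<tau> n) < e / (4 * K * M)" by (auto simp: eventually_sequentially)
      show "\<exists>N. \<forall>m\<ge>N. \<forall>n\<ge>N. dist (q (\<tau> m)) (q (\<tau> n)) < e"
      proof (intro exI allI impI)
        fix m n assume mn: "N \<le> m" "N \<le> n"
        have "dist (q (\<tau> m)) (q (\<tau> n)) \<le> 2 * K * M * (norm (\<tau> m) + norm (\<tau> n))"
          unfolding dist_norm by (rule qd) (use \<tau> in auto)
        also have "\<dots> < 2 * K * M * (e / (4 * K * M) + e / (4 * K * M))"
          using N[OF mn(1)] N[OF mn(2)] K M by (intro mult_strict_left_mono add_strict_mono) auto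
        also have "\<dots> = e" using K M by simp
        finally show "dist (q (\<tau> m)) (q (\<tau> n)) < e" .
      qed
    qed
    then obtain L where L: "(\<lambda>n. q (\<tau> n)) \<longlonglongrightarrow> L" using Cauchy_convergent convergent_def by blast
    have qL: "norm (q t - L) \<le> 2 * K * M * norm t" if "t \<noteq> 0" "norm t \<le> 1" for t
    proof (rule tendsto_le[OF sequentially_bot])
      show "(\<lambda>n. norm (q t - q (\<tau> n))) \<longlonglongrightarrow> norm (q t - L)" by (intro tendsto_intros L)
      have "(\<lambda>n. 2 * K * M * (norm t + norm (\<tau> n))) \<longlonglongrightarrow> 2 * K * M * (norm t + 0)" by (intro tendsto_intros \<tau>0)
      then show "(\<lambda>n. 2 * K * M * (norm t + norm (\<tau> n))) \<longlonglongrightarrow> 2 * K * M * norm t" by simp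
      show "\<forall>\<^sub>F n in sequentially. norm (q t - q (\<tau> n)) \<le> 2 * K * M * (norm t + norm (\<tau> n))"
        using that \<tau> by (intro always_eventually allI qd) auto
    qed
    have "(q \<longlongrightarrow> L) (at 0)"
    proof (rule Lim_null_comparison[THEN LIM_zero_cancel])
      show "\<forall>\<^sub>F t in at 0. norm (q t - L) \<le> 2 * K * M * norm t"
        unfolding eventually_at by (rule exI[of _ 1]) (auto simp: dist_norm intro!: qL)
      have "((\<lambda>t::complex. 2 * K * M * norm t) \<longlongrightarrow> 2 * K * M * norm (0::complex)) (at 0)" by (intro tendsto_intros)
      then show "((\<lambda>t::complex. 2 * K * M * norm t) \<longlongrightarrow> 0) (at 0)" by simp
    qed
    then have "(F has_field_derivative L) (at 0)"
      unfolding has_field_derivative_iff q_def[abs_def] by (simp add: divide_inverse mult.commute)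
    then show ?thesis unfolding F_def by blast
  qed
  show ?thesis
    unfolding holomorphic_on_def
  proof
    fix t0 :: complex
    obtain L where L: "((\<lambda>t. u (gauss_wave (\<lambda>j. (w j + t0 * v j) + t * v j))) has_field_derivative L) (at 0)"
      using base[of "\<lambda>j. w j + t0 * v j"] by blast
    have "((\<lambda>t. u (gauss_wave (\<lambda>j. w j + t * v j))) has_field_derivative L) (at (0 + t0))"
      by (subst DERIV_shift) (use L in \<open>simp add: algebra_simps\<close>)
    then show "(\<lambda>t. u (gauss_wave (\<lambda>j. w j + t * v j))) field_differentiable at t0 within UNIV"
      by (auto simp: field_differentiable_def)
  qed
qed

section \<open>Time-frequency shifts of the Gaussian\<close>

definition tf_shift :: "real^'d::finite \<Rightarrow> real^'d \<Rightarrow> real^'d \<Rightarrow> complex" where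
  "tf_shift x \<xi> = (\<lambda>y. complex_of_real (gauss_window (y - x)) * exp (- \<i> * complex_of_real (y \<bullet> \<xi>)))"

lemma STFT_eq: "STFT u (x, \<xi>) = complex_of_real ((2 * pi) powr (- real CARD('d) / 2)) * u (tf_shift x (\<xi> :: real^'d::finite))"
  by (simp add: STFT_def tf_shift_def)

text \<open>Completing the square isolates \<open>exp (- (norm x)\<^sup>2 / 2)\<close>, the only
  factor that does not depend holomorphically on the phase point.\<close>

lemma tf_shift_eq:
  fixes x \<xi> :: "real^'d::finite"
  shows "tf_shift x \<xi> = (\<lambda>y. complex_of_real (pi powr (- real CARD('d) / 4) * exp (- (norm x)\<^sup>2 / 2)) * gauss_wave (phase_point x \<xi>) y)"
proof
  fix y :: "real^'d"
  have "gauss_wave (phase_point x \<xi>) y = exp (\<Sum>j\<in>UNIV. Complex (x $ j) (- \<xi> $ j) * of_real (y $ j) - of_real ((y $ j)\<^sup>2 / 2))"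
    by (simp add: tensor_wave_def hermite_wave_def phase_point_def exp_sum)
  also have "(\<Sum>j\<in>UNIV. Complex (x $ j) (- \<xi> $ j) * of_real (y $ j) - of_real ((y $ j)\<^sup>2 / 2)) =
      of_real (x \<bullet> y - (norm y)\<^sup>2 / 2) - \<i> * of_real (y \<bullet> \<xi>)"
    by (simp add: complex_eq_iff inner_vec_def norm_vec_power2 sum_subtractf sum_divide_distrib mult.commute sum_negf)
  finally have 1: "gauss_wave (phase_point x \<xi>) y = of_real (exp (x \<bullet> y - (norm y)\<^sup>2 / 2)) * exp (- \<i> * of_real (y \<bullet> \<xi>))"
    using exp_add[of "complex_of_real (x \<bullet> y - (norm y)\<^sup>2 / 2)" "- (\<i> * of_real (y \<bullet> \<xi>))"]
    by (simp only: exp_of_real diff_conv_add_uminus mult_minus_left)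
  have 2: "- (norm (y - x))\<^sup>2 / 2 = - (norm x)\<^sup>2 / 2 + (x \<bullet> y - (norm y)\<^sup>2 / 2)"
    by (simp add: power2_norm_eq_inner inner_diff_left inner_diff_right inner_commute field_simps)
  show "tf_shift x \<xi> y = complex_of_real (pi powr (- real CARD('d) / 4) * exp (- (norm x)\<^sup>2 / 2)) * gauss_wave (phase_point x \<xi>) y"
    unfolding tf_shift_def gauss_window_def 1 2 exp_add by simp
qed

text \<open>The Gaussian prefactor cancels the growth \<open>exp ((norm x)\<^sup>2 / 2)\<close> of
  the waves exactly, and only the freely chosen rate \<delta> remains.\<close>

lemma tf_shift_gs_bound:
  fixes s \<delta> :: real
  assumes s: "1/2 \<le> s" and d: "0 < \<delta>"
  obtains H C where "1 \<le> H" "0 < C" "\<And>(x::real^'d::finite) \<xi>. gs_bound s H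
    (C * exp (\<delta> * (norm x powr (1/s) + norm \<xi> powr (1/s)))) (tf_shift x \<xi>)"
proof -
  obtain H C where H: "1 \<le> H" "0 < C" "\<And>(x::real^'d) \<xi>. gs_bound s H
    (C * exp ((norm x)\<^sup>2/2 + \<delta> * (norm x powr (1/s) + norm \<xi> powr (1/s)))) (gauss_wave (phase_point x \<xi>))"
    using tensor_wave_gs_bound[OF s d, where 'd='d] by metis
  let ?c = "pi powr (- real CARD('d) / 4)"
  show ?thesis
  proof (rule that[OF H(1)])
    show "0 < ?c * C" using H by simp
    fix x \<xi> :: "real^'d"
    have "norm (complex_of_real (?c * exp (- (norm x)\<^sup>2 / 2))) * (C * exp ((norm x)\<^sup>2/2 + \<delta> * (norm x powr (1/s) + norm \<xi> powr (1/s)))) =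
       ?c * C * exp (\<delta> * (norm x powr (1/s) + norm \<xi> powr (1/s)))"
    proof -
      have "exp (- (norm x)\<^sup>2 / 2) * exp ((norm x)\<^sup>2/2 + E) = exp E" for E :: real by (simp flip: exp_add)
      then show ?thesis by (simp only: norm_of_real) (simp add: abs_mult mult_ac)
    qed
    note eq = this
    show "gs_bound s H (?c * C * exp (\<delta> * (norm x powr (1/s) + norm \<xi> powr (1/s)))) (tf_shift x \<xi>)"
      unfolding tf_shift_eq eq[symmetric] by (rule gs_bound_scale[OF H(3)])
  qed
qed

lemma GS_tf_shift: "1/2 \<le> s \<Longrightarrow> tf_shift x \<xi> \<in> GS s"
  unfolding tf_shift_eq using GS_lincomb[OF GS_gauss_wave GS_gauss_wave, of s _ _ 0] by simp

lemma linear_le_quadratic: "0 < \<delta> \<Longrightarrow> k * t \<le> k\<^sup>2 / (4 * \<delta>) + \<delta> * t\<^sup>2" for t :: real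
proof -
  assume d: "0 < \<delta>"
  have "0 \<le> (k - 2 * \<delta> * t)\<^sup>2 / (4 * \<delta>)" using d by simp
  also have "\<dots> = k\<^sup>2 / (4 * \<delta>) + \<delta> * t\<^sup>2 - k * t" using d by (simp add: power2_diff field_simps power2_eq_square)
  finally show ?thesis by simp
qed

text \<open>On the complex line through \<open>z\<close> and \<open>z'\<close> the function \<open>u (gauss_wave w)\<close> is entire. Multiplying it
  by an exponential of a linear function (the factor in \<open>G\<close> below) gives a function whose modulus differs from
  \<open>|V u|\<close> only by a factor in \<open>[1, 2]\<close> near \<open>z\<close>, and the Cauchy estimate applies.\<close>

lemma STFT_local_estimate:
  fixes u :: "(real^'d::finite \<Rightarrow> complex) \<Rightarrow> complex"
  assumes u: "u \<in> GS_dual (1/2)" and \<rho>: "0 < \<rho>" "\<rho> \<le> 1"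
    and M: "\<And>p. dist p z \<le> \<rho> \<Longrightarrow> norm (STFT u p) \<le> M" and z': "dist z' z \<le> \<rho> / 2"
  shows "norm (STFT u z) - 4 * M / \<rho> * dist z' z \<le> 2 * norm (STFT u z')"
proof (cases "z' = z")
  case True then show ?thesis by simp
next
  case False
  define r where "r = dist z' z"
  have r: "0 < r" "r \<le> \<rho>/2" using False z' by (auto simp: r_def)
  obtain x \<xi> x' \<xi>' where z: "z = (x, \<xi>)" "z' = (x', \<xi>')" by (metis surj_pair)
  define w v where "w = phase_point x \<xi>" and "v = phase_point (x' - x) (\<xi>' - \<xi>)"
  define xt where "xt t = x + (\<chi> j. Re (t * v j))" for t
  define \<xi>t where "\<xi>t t = \<xi> + (\<chi> j. - Im (t * v j))" for t
  have pt: "(\<lambda>j. w j + t * v j) = phase_point (xt t) (\<xi>t t)" for t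
    by (simp add: w_def phase_point_def xt_def \<xi>t_def fun_eq_iff complex_eq_iff)
  have z1: "(xt 1, \<xi>t 1) = z'" by (simp add: z xt_def \<xi>t_def v_def phase_point_def vec_eq_iff)
  have z0: "(xt 0, \<xi>t 0) = z" by (simp add: z xt_def \<xi>t_def vec_eq_iff)
  have nv: "(\<Sum>j\<in>UNIV. (norm (v j))\<^sup>2) = r\<^sup>2"
    by (simp add: r_def z dist_norm norm_Pair norm_vec_power2 v_def phase_point_def cmod_power2 sum.distrib add_nonneg_nonneg sum_nonneg
         power2_commute)
  have dt: "dist (xt t, \<xi>t t) z = norm t * r" for t
  proof -
    have "(dist (xt t, \<xi>t t) z)\<^sup>2 = (\<Sum>j\<in>UNIV. (norm (t * v j))\<^sup>2)"
      by (simp only: z dist_norm norm_Pair norm_vec_power2 xt_def \<xi>t_def cmod_power2 sum.distrib fst_diff snd_diff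
           diff_Pair add_diff_cancel_left' vec_lambda_beta power2_minus real_sqrt_pow2[OF add_nonneg_nonneg[OF sum_nonneg sum_nonneg], OF zero_le_power2 zero_le_power2])
    also have "\<dots> = (norm t * r)\<^sup>2"
      by (simp add: norm_mult power_mult_distrib sum_distrib_left[symmetric] nv)
    finally show ?thesis using r by (simp add: power2_eq_iff_nonneg)
  qed
  define c where "c = (2 * pi) powr (- real CARD('d) / 2) * pi powr (- real CARD('d) / 4)"
  have c: "0 < c" by (simp add: c_def)
  define F where "F t = u (gauss_wave (\<lambda>j. w j + t * v j))" for t
  define G where "G t = of_real (c * exp (- (norm x)\<^sup>2 / 2)) * exp (- (\<Sum>j\<in>UNIV. of_real (x $ j) * (t * v j))) * F t" for t
  have G_hol: "G holomorphic_on UNIV"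
    unfolding G_def[abs_def] F_def by (intro holomorphic_intros GS_dual_gauss_wave_holomorphic u)
  have S: "norm (STFT u (xt t, \<xi>t t)) = c * exp (- (norm (xt t))\<^sup>2 / 2) * norm (F t)" for t
    unfolding STFT_eq tf_shift_eq F_def pt
    by (subst GS_dual_scale[OF u GS_gauss_wave]) (simp_all add: norm_mult c_def)
  \<comment> \<open>The correcting factor misses the true Gaussian by
    \<open>exp ((norm (xt t - x))\<^sup>2 / 2)\<close>, at most \<open>exp (1/2)\<close> within
    distance 1; hence the condition \<open>\<rho> \<le> 1\<close> and the factors 2 below.\<close>
  have nG: "norm (G t) = norm (STFT u (xt t, \<xi>t t)) * exp ((norm (xt t - x))\<^sup>2 / 2)" for t
  proof -
    have Re: "Re (- (\<Sum>j\<in>UNIV. of_real (x $ j) * (t * v j))) = - (x \<bullet> (xt t - x))"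
      by (simp add: inner_vec_def xt_def)
    have "norm (G t) = c * exp (- (norm x)\<^sup>2 / 2 - (x \<bullet> (xt t - x))) * norm (F t)"
    proof -
      have "norm (complex_of_real (c * exp (- (norm x)\<^sup>2 / 2))) = c * exp (- (norm x)\<^sup>2 / 2)"
        using c by (simp only: norm_of_real) (simp add: abs_mult)
      moreover have "exp (- (norm x)\<^sup>2 / 2) * exp (- (x \<bullet> (xt t - x))) = exp (- (norm x)\<^sup>2 / 2 - (x \<bullet> (xt t - x)))"
        by (simp add: exp_add[symmetric] del: inner_diff_right)
      ultimately show ?thesis unfolding G_def norm_mult norm_exp_eq_Re Re by (simp only: mult.assoc)
    qed
    also have "- (norm x)\<^sup>2 / 2 - (x \<bullet> (xt t - x)) = - (norm (xt t))\<^sup>2 / 2 + (norm (xt t - x))\<^sup>2 / 2"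
      by (simp add: power2_norm_eq_inner inner_diff_left inner_diff_right inner_commute field_simps)
    finally show ?thesis unfolding S exp_add by (simp add: mult_ac)
  qed
  \<comment> \<open>The ball of radius \<rho> around \<open>z\<close> has radius \<open>T\<close> in
    the parameter \<open>t\<close>. The point \<open>z'\<close> is \<open>t = 1\<close> and lies in
    the half disc, since \<open>2 \<le> T\<close>.\<close>
  define T where "T = \<rho> / r"
  have T: "2 \<le> T" using r \<rho> by (simp add: T_def field_simps)
  have M0: "0 \<le> M" using order.trans[OF norm_ge_zero M[of z]] \<rho> by simp
  have e2: "exp (1/2) \<le> (2::real)" using exp_bound_half[of "1/2::real"] by simp
  have nx: "norm (xt t - x) \<le> norm t * r" for t
    using dt[of t] norm_fst_le[of "xt t - x" "\<xi>t t - \<xi>"] by (simp add: z dist_norm)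
  have Gb: "norm (G t) \<le> 2 * M" if "norm (t - 0) \<le> T" for t
  proof -
    have tr: "norm t * r \<le> \<rho>" using that r by (simp add: T_def field_simps)
    have "exp ((norm (xt t - x))\<^sup>2 / 2) \<le> exp (1/2)"
      using nx[of t] tr \<rho> by (simp add: power_le_one)
    then have "exp ((norm (xt t - x))\<^sup>2 / 2) \<le> 2" using e2 by (rule order.trans)
    then show ?thesis unfolding nG using M[of "(xt t, \<xi>t t)"] dt[of t] tr e2 M0
      by (subst mult.commute) (auto intro!: mult_mono)
  qed
  have "norm (G 1 - G 0) \<le> 2 * (2 * M) / T * norm (1 - 0 :: complex)"
    by (rule entire_difference_bound(1)[OF G_hol _ Gb]) (use T in auto)
  then have "norm (G 1 - G 0) \<le> 4 * M / \<rho> * r" by (simp add: T_def)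
  moreover have "norm (G 0) = norm (STFT u z)" unfolding nG z0 by (simp add: xt_def vec_eq_iff flip: zero_vec_def)
  moreover have "norm (G 1) \<le> 2 * norm (STFT u z')"
  proof -
    have "norm (xt 1 - x) \<le> 1" using nx[of 1] r \<rho> by simp
    then have "exp ((norm (xt 1 - x))\<^sup>2 / 2) \<le> exp (1/2)" by (simp add: power_le_one)
    then have "exp ((norm (xt 1 - x))\<^sup>2 / 2) \<le> 2" using e2 by (rule order.trans)
    then have "norm (STFT u z') * exp ((norm (xt 1 - x))\<^sup>2 / 2) \<le> norm (STFT u z') * 2"
      by (intro mult_left_mono) auto
    then show ?thesis unfolding nG z1 by simp
  qed
  moreover have "norm (G 0) \<le> norm (G 1) + norm (G 1 - G 0)" by (metis norm_minus_commute norm_triangle_sub add.commute)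
  ultimately show ?thesis by (simp add: r_def)
qed

lemma abs_one_minus_exp_le: "\<bar>1 - exp a\<bar> \<le> \<bar>a\<bar> * exp \<bar>a\<bar>" for a :: real
proof (cases "0 \<le> a")
  case True
  have "1 + (- a) \<le> exp (- a)" by (rule exp_ge_add_one_self)
  then have "(1 - a) * exp a \<le> exp (- a) * exp a" by (intro mult_right_mono) auto
  also have "\<dots> = 1" by (simp flip: exp_add)
  finally show ?thesis using True by (simp add: algebra_simps)
next
  case False
  have "1 - exp a \<le> - a" using exp_ge_add_one_self[of a] by linarith
  also have "\<dots> = \<bar>a\<bar> * 1" using False by simp
  also have "\<dots> \<le> \<bar>a\<bar> * exp \<bar>a\<bar>" by (intro mult_left_mono) auto
  finally show ?thesis using False by simp
qed

lemma gs_bound_zero: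
  fixes f :: "real^'d::finite \<Rightarrow> complex"
  shows "gs_bound s h M f \<Longrightarrow> gs_bound s h 0 (\<lambda>x::real^'d. 0)"
  using gs_bound_scale[of s h M f 0] by simp

text \<open>An arbitrary functional will be applied to such differences, so they must be small in a
  single seminorm, with growth of arbitrarily small Gaussian rate. Close points are joined by a
  complex line of waves, to which the Cauchy estimate applies; for distant points the triangle
  inequality is enough.\<close>

lemma tf_shift_lipschitz:
  fixes \<delta> :: real
  assumes d: "0 < \<delta>"
  obtains H C where "1 \<le> H" "0 < C" "\<And>(x::real^'d::finite) \<xi> x' \<xi>'. gs_bound (1/2) H
    (C * exp (\<delta> * ((norm x)\<^sup>2 + (norm \<xi>)\<^sup>2 + (norm x')\<^sup>2 + (norm \<xi>')\<^sup>2)) * (norm (x' - x) + norm (\<xi>' - \<xi>)))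
    (\<lambda>y. tf_shift x' \<xi>' y - tf_shift x \<xi> y)"
proof -
  \<comment> \<open>The largest rate spent below is \<open>3 * e\<close>.\<close>
  define e where "e = \<delta> / 3"
  have e: "0 < e" using d by (simp add: e_def)
  define k where "k = pi powr (- real CARD('d) / 4)"
  have k: "0 < k" by (simp add: k_def)
  obtain H C0 where "1 \<le> H" "0 < C0" "\<And>(x::real^'d) \<xi>. gs_bound (1/2) H
    (C0 * exp ((norm x)\<^sup>2/2 + e * (norm x powr (1/(1/2)) + norm \<xi> powr (1/(1/2))))) (gauss_wave (phase_point x \<xi>))"
    using tensor_wave_gs_bound[of "1/2" e, where 'd='d] e by auto
  then have H: "1 \<le> H" and C0: "0 < C0" and W: "\<And>(x::real^'d) \<xi>. gs_bound (1/2) H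
    (C0 * exp ((norm x)\<^sup>2/2 + e * ((norm x)\<^sup>2 + (norm \<xi>)\<^sup>2))) (gauss_wave (phase_point x \<xi>))"
    by (simp_all)
  have P: "gs_bound (1/2) H (k * C0 * exp (e * ((norm x)\<^sup>2 + (norm \<xi>)\<^sup>2))) (tf_shift x \<xi>)" for x \<xi> :: "real^'d"
  proof -
    have "exp (- (norm x)\<^sup>2 / 2) * exp ((norm x)\<^sup>2/2 + E) = exp E" for E :: real by (simp flip: exp_add)
    then have eq: "norm (complex_of_real (k * exp (- (norm x)\<^sup>2 / 2))) * (C0 * exp ((norm x)\<^sup>2/2 + e * ((norm x)\<^sup>2 + (norm \<xi>)\<^sup>2))) =
       k * C0 * exp (e * ((norm x)\<^sup>2 + (norm \<xi>)\<^sup>2))"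
      using k by (simp only: norm_of_real) (simp add: abs_mult mult_ac)
    show ?thesis unfolding tf_shift_eq k_def[symmetric] eq[symmetric] by (rule gs_bound_scale[OF W])
  qed
  \<comment> \<open>Bounds the displacement of position and of frequency along the line: each
    coordinate of \<open>t * v j\<close> has modulus at most 2.\<close>
  define m where "m = 2 * real CARD('d)"
  define c1 where "c1 = m\<^sup>2 / (4 * e) + m\<^sup>2 / 2 + 4 * e * m\<^sup>2"
  define C where "C = 2 * k * C0 + k * C0 * exp c1 + k * C0 * exp (2 / e)"
  have Cpos: "0 < C" unfolding C_def using k C0 by (intro add_pos_pos) auto
  have main: "gs_bound (1/2) H (C * exp (\<delta> * ((norm x)\<^sup>2 + (norm \<xi>)\<^sup>2 + (norm x')\<^sup>2 + (norm \<xi>')\<^sup>2)) * (norm (x' - x) + norm (\<xi>' - \<xi>)))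
    (\<lambda>y. tf_shift x' \<xi>' y - tf_shift x \<xi> y)" for x \<xi> x' \<xi>' :: "real^'d"
  proof -
    define r where "r = norm (x' - x) + norm (\<xi>' - \<xi>)"
    define Q Q' where "Q = (norm x)\<^sup>2 + (norm \<xi>)\<^sup>2" and "Q' = (norm x')\<^sup>2 + (norm \<xi>')\<^sup>2"
    have Q: "0 \<le> Q" "0 \<le> Q'" by (auto simp: Q_def Q'_def)
    have r0: "0 \<le> r" by (simp add: r_def)
    have d3: "\<delta> = 3 * e" by (simp add: e_def)
    let ?f = "\<lambda>y. tf_shift x' \<xi>' y - tf_shift x \<xi> y"
    have "\<exists>M\<ge>0. M \<le> C * exp (3 * e * (Q + Q')) * r \<and> gs_bound (1/2) H M ?f"
    proof -
      consider "1 \<le> r" | "r = 0" | "0 < r" "r < 1" using r0 by linarith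
      then show ?thesis
      proof cases
        case 1
        let ?M = "k * C0 * exp (e * Q') + k * C0 * exp (e * Q)"
        have "gs_bound (1/2) H ?M ?f"
          using gs_bound_lincomb[OF P[of x' \<xi>'] P[of x \<xi>], of 1 "-1"] by (simp add: Q_def Q'_def)
        moreover have "?M \<le> C * exp (3 * e * (Q + Q')) * r"
        proof -
          have "exp (e * Q') \<le> exp (3 * e * (Q + Q'))" "exp (e * Q) \<le> exp (3 * e * (Q + Q'))"
            using e Q by (auto simp: algebra_simps intro: add_nonneg_nonneg mult_nonneg_nonneg)
          then have "?M \<le> k * C0 * exp (3 * e * (Q + Q')) + k * C0 * exp (3 * e * (Q + Q'))"
            using k C0 by (intro add_mono mult_left_mono) auto
          also have "\<dots> = (2 * k * C0) * exp (3 * e * (Q + Q')) * 1" by simp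
          also have "\<dots> \<le> C * exp (3 * e * (Q + Q')) * r"
            using 1 k C0 Cpos by (intro mult_mono) (auto simp: C_def)
          finally show ?thesis .
        qed
        ultimately show ?thesis using k C0 by (intro exI[of _ ?M]) auto
      next
        case 2
        then have "x' = x" "\<xi>' = \<xi>" unfolding r_def by (simp_all add: add_nonneg_eq_0_iff)
        then show ?thesis using gs_bound_zero[OF P[of x \<xi>]] 2 by (intro exI[of _ 0]) auto
      next
        case 3
        \<comment> \<open>After division by \<open>r\<close> the direction is bounded by 1 in each
          coordinate and \<open>t = r\<close> reaches the second point. The factor
          \<open>norm t\<close> of the Cauchy estimate is then the Lipschitz factor.\<close>
        define w v where "w = phase_point x \<xi>" and "v = (\<lambda>j. phase_point (x' - x) (\<xi>' - \<xi>) j / of_real r)"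
        have w': "(\<lambda>j. w j + of_real r * v j) = phase_point x' \<xi>'"
          using 3 by (simp add: w_def v_def phase_point_def fun_eq_iff complex_eq_iff)
        have v: "norm (v j) \<le> 1" for j
        proof -
          have "norm (phase_point (x' - x) (\<xi>' - \<xi>) j) \<le> \<bar>(x' - x) $ j\<bar> + \<bar>(\<xi>' - \<xi>) $ j\<bar>"
            using cmod_le[of "phase_point (x' - x) (\<xi>' - \<xi>) j"] by (simp add: phase_point_def)
          also have "\<dots> \<le> r" unfolding r_def by (intro add_mono component_le_norm_cart)
          finally show ?thesis using 3 by (simp add: v_def norm_divide)
        qed
        define M where "M = C0 * exp ((norm x)\<^sup>2 / 2 + 3 * e * Q + c1)"
        have "gs_bound (1/2) H M (gauss_wave (\<lambda>j. w j + t * v j))" if t: "norm t \<le> 2" for t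
        proof -
          define a b where "a = (\<chi> j. Re (t * v j))" and "b = (\<chi> j. - Im (t * v j))"
          have pt: "(\<lambda>j. w j + t * v j) = phase_point (x + a) (\<xi> + b)"
            by (simp add: w_def phase_point_def a_def b_def fun_eq_iff complex_eq_iff)
          have "norm (t * v j) \<le> 2" for j unfolding norm_mult using mult_mono[OF t v[of j]] by simp
          then have ab: "norm a \<le> m" "norm b \<le> m" using norm_phase_le[of "\<lambda>j. t * v j" 2]
            unfolding a_def b_def m_def by (simp_all add: mult.commute)
          have sq: "(norm (p + q))\<^sup>2 \<le> 2 * (norm p)\<^sup>2 + 2 * m\<^sup>2" if "norm q \<le> m" for p q :: "real^'d"
          proof -
            have "(norm (p + q))\<^sup>2 \<le> (norm p + m)\<^sup>2"
              using that by (intro power_mono order.trans[OF norm_triangle_ineq]) auto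
            also have "\<dots> \<le> 2 * (norm p)\<^sup>2 + 2 * m\<^sup>2"
              using sum_squares_bound[of "norm p" m] by (simp add: power2_sum)
            finally show ?thesis .
          qed
          have "(norm (x + a))\<^sup>2 \<le> (norm x + m)\<^sup>2"
            using ab by (intro power_mono order.trans[OF norm_triangle_ineq]) auto
          then have "(norm (x + a))\<^sup>2 / 2 \<le> (norm x)\<^sup>2 / 2 + m * norm x + m\<^sup>2 / 2"
            by (simp add: power2_sum field_simps)
          also have "m * norm x \<le> m\<^sup>2 / (4 * e) + e * (norm x)\<^sup>2" using e by (rule linear_le_quadratic)
          finally have 1: "(norm (x + a))\<^sup>2 / 2 \<le> (norm x)\<^sup>2 / 2 + (m\<^sup>2 / (4 * e) + e * (norm x)\<^sup>2) + m\<^sup>2 / 2" by simp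
          have "(norm (x + a))\<^sup>2 + (norm (\<xi> + b))\<^sup>2 \<le> 2 * Q + 4 * m\<^sup>2"
            using sq[OF ab(1), of x] sq[OF ab(2), of \<xi>] by (simp add: Q_def)
          then have 2: "e * ((norm (x + a))\<^sup>2 + (norm (\<xi> + b))\<^sup>2) \<le> e * (2 * Q + 4 * m\<^sup>2)"
            using e by (intro mult_left_mono) auto
          have 3: "e * (norm x)\<^sup>2 \<le> e * Q" using e by (simp add: Q_def)
          have "(norm (x + a))\<^sup>2 / 2 + e * ((norm (x + a))\<^sup>2 + (norm (\<xi> + b))\<^sup>2) \<le> (norm x)\<^sup>2 / 2 + 3 * e * Q + c1"
            using 1 2 3 by (simp add: c1_def algebra_simps)
          then show ?thesis unfolding pt M_def
            using C0 H by (intro gs_bound_mono[OF W]) auto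
        qed
        from gauss_wave_line_bounds(1)[OF this, of "of_real r"] 3
        have "gs_bound (1/2) H (M * r) (\<lambda>y. gauss_wave (phase_point x' \<xi>') y - gauss_wave w y)"
          unfolding w' by simp
        \<comment> \<open>The difference of atoms splits into a difference of waves, both with the
          Gaussian factor of \<open>x\<close>, and a multiple of the second atom that accounts for
          the change of this factor.\<close>
        note D1 = gs_bound_lincomb[OF this P[of x' \<xi>'], of "of_real (k * exp (- (norm x)\<^sup>2 / 2))" "of_real (1 - exp (((norm x')\<^sup>2 - (norm x)\<^sup>2) / 2))"]
        have f: "(\<lambda>y. of_real (k * exp (- (norm x)\<^sup>2 / 2)) * (gauss_wave (phase_point x' \<xi>') y - gauss_wave w y) +
            of_real (1 - exp (((norm x')\<^sup>2 - (norm x)\<^sup>2) / 2)) * tf_shift x' \<xi>' y) = ?f"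
        proof
          fix y
          have "exp (((norm x')\<^sup>2 - (norm x)\<^sup>2) / 2) * (k * exp (- (norm x')\<^sup>2 / 2)) = k * exp (- (norm x)\<^sup>2 / 2)"
            by (simp add: mult.commute mult.assoc flip: exp_add) (simp add: field_simps flip: exp_add)
          then have "complex_of_real (exp (((norm x')\<^sup>2 - (norm x)\<^sup>2) / 2)) * complex_of_real (k * exp (- (norm x')\<^sup>2 / 2)) = complex_of_real (k * exp (- (norm x)\<^sup>2 / 2))"
            by (simp only: of_real_mult[symmetric])
          then have "of_real (exp (((norm x')\<^sup>2 - (norm x)\<^sup>2) / 2)) * tf_shift x' \<xi>' y = of_real (k * exp (- (norm x)\<^sup>2 / 2)) * gauss_wave (phase_point x' \<xi>') y"
            unfolding tf_shift_eq k_def[symmetric] by (metis mult.assoc)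
          moreover have "tf_shift x \<xi> y = of_real (k * exp (- (norm x)\<^sup>2 / 2)) * gauss_wave w y"
            unfolding tf_shift_eq k_def[symmetric] w_def ..
          ultimately show "of_real (k * exp (- (norm x)\<^sup>2 / 2)) * (gauss_wave (phase_point x' \<xi>') y - gauss_wave w y) +
            of_real (1 - exp (((norm x')\<^sup>2 - (norm x)\<^sup>2) / 2)) * tf_shift x' \<xi>' y = ?f y"
            by (simp only: of_real_diff of_real_1) (simp add: algebra_simps)
        qed
        let ?M = "norm (complex_of_real (k * exp (- (norm x)\<^sup>2 / 2))) * (M * r) +
           norm (complex_of_real (1 - exp (((norm x')\<^sup>2 - (norm x)\<^sup>2) / 2))) * (k * C0 * exp (e * Q'))"
        have "norm (complex_of_real (k * exp (- (norm x)\<^sup>2 / 2))) * (M * r) = k * C0 * exp c1 * exp (3 * e * Q) * r"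
        proof -
          have "exp (- (norm x)\<^sup>2 / 2) * exp ((norm x)\<^sup>2 / 2 + 3 * e * Q + c1) = exp c1 * exp (3 * e * Q)"
            by (simp flip: exp_add)
          then show ?thesis using k by (simp only: norm_of_real M_def) (simp add: abs_mult mult_ac)
        qed
        also have "\<dots> \<le> k * C0 * exp c1 * exp (3 * e * (Q + Q')) * r"
          using k C0 r0 e Q by (intro mult_right_mono mult_left_mono) auto
        finally have M1: "norm (complex_of_real (k * exp (- (norm x)\<^sup>2 / 2))) * (M * r) \<le> k * C0 * exp c1 * exp (3 * e * (Q + Q')) * r" .
        define \<sigma> where "\<sigma> = norm x + norm x'"
        define a where "a = ((norm x')\<^sup>2 - (norm x)\<^sup>2) / 2"
        have "\<bar>norm x' - norm x\<bar> \<le> r" using norm_triangle_ineq3[of x' x] by (simp add: r_def add_increasing2)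
        then have "\<bar>norm x' - norm x\<bar> * \<sigma> \<le> r * \<sigma>" by (intro mult_right_mono) (auto simp: \<sigma>_def)
        moreover have "\<bar>a\<bar> = \<bar>norm x' - norm x\<bar> * \<sigma> / 2"
          unfolding a_def \<sigma>_def by (simp add: power2_eq_square square_diff_square_factored abs_mult mult.commute add.commute)
        ultimately have a1: "\<bar>a\<bar> \<le> r * \<sigma>" using mult_nonneg_nonneg[OF abs_ge_zero[of "norm x' - norm x"], of \<sigma>] by (simp add: \<sigma>_def)
        have s0: "0 \<le> \<sigma>" by (simp add: \<sigma>_def)
        have "r * \<sigma> \<le> 1 * \<sigma>" using 3 s0 by (intro mult_right_mono) auto
        then have a2: "\<bar>a\<bar> \<le> \<sigma>" using a1 by simp
        have "\<bar>1 - exp a\<bar> \<le> \<bar>a\<bar> * exp \<bar>a\<bar>" by (rule abs_one_minus_exp_le)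
        also have "\<dots> \<le> (r * \<sigma>) * exp \<sigma>" using a1 a2 r0 s0 by (intro mult_mono) auto
        also have "\<dots> \<le> (r * exp \<sigma>) * exp \<sigma>"
        proof -
          have "\<sigma> \<le> exp \<sigma>" using exp_ge_add_one_self[of \<sigma>] by linarith
          then show ?thesis using r0 by (intro mult_right_mono mult_left_mono) auto
        qed
        also have "\<dots> = r * exp (2 * \<sigma>)" by (simp add: mult_exp_exp mult.assoc)
        also have "\<dots> \<le> r * exp (2 / e + e * (Q + Q'))"
        proof -
          have "2 * norm x \<le> 1 / e + e * (norm x)\<^sup>2" "2 * norm x' \<le> 1 / e + e * (norm x')\<^sup>2"
            using linear_le_quadratic[OF e, of 2 "norm x"] linear_le_quadratic[OF e, of 2 "norm x'"] by auto
          moreover have "e * (norm x)\<^sup>2 + e * (norm x')\<^sup>2 \<le> e * (Q + Q')"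
            using e by (auto simp: Q_def Q'_def simp flip: distrib_left)
          ultimately have "2 * \<sigma> \<le> 2 / e + e * (Q + Q')" by (simp add: \<sigma>_def)
          then show ?thesis using r0 by (intro mult_left_mono) auto
        qed
        finally have ea: "\<bar>1 - exp a\<bar> \<le> r * exp (2 / e + e * (Q + Q'))" .
        have "norm (complex_of_real (1 - exp a)) * (k * C0 * exp (e * Q')) \<le> (r * exp (2 / e + e * (Q + Q'))) * (k * C0 * exp (e * (Q + Q')))"
          unfolding norm_of_real using k C0 r0 e Q by (intro mult_mono ea mult_left_mono) auto
        also have "\<dots> = k * C0 * exp (2 / e) * exp (2 * e * (Q + Q')) * r"
          by (simp add: exp_add[symmetric] mult_ac)
        also have "\<dots> \<le> k * C0 * exp (2 / e) * exp (3 * e * (Q + Q')) * r"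
          using k C0 r0 e Q by (intro mult_right_mono mult_left_mono) auto
        finally have M2: "norm (complex_of_real (1 - exp a)) * (k * C0 * exp (e * Q')) \<le> k * C0 * exp (2 / e) * exp (3 * e * (Q + Q')) * r" .
        have "?M \<le> (k * C0 * exp c1 + k * C0 * exp (2 / e)) * (exp (3 * e * (Q + Q')) * r)"
          using M1 M2 unfolding a_def by (simp add: distrib_right mult.assoc)
        also have "\<dots> \<le> C * (exp (3 * e * (Q + Q')) * r)"
          using k C0 r0 by (intro mult_right_mono) (auto simp: C_def)
        finally have "?M \<le> C * exp (3 * e * (Q + Q')) * r" by (simp add: mult.assoc)
        moreover have "0 \<le> ?M" using k C0 r0 unfolding M_def by (intro add_nonneg_nonneg mult_nonneg_nonneg) auto
        moreover have "gs_bound (1/2) H ?M ?f" using D1 unfolding f by (simp add: Q'_def)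
        ultimately show ?thesis by blast
      qed
    qed
    then obtain M where "0 \<le> M" "M \<le> C * exp (3 * e * (Q + Q')) * r" "gs_bound (1/2) H M ?f" by blast
    then have "gs_bound (1/2) H (C * exp (3 * e * (Q + Q')) * r) ?f"
      using H gs_bound_mono[of "1/2" H M ?f H "1/2" "C * exp (3 * e * (Q + Q')) * r"] by auto
    then show ?thesis by (simp add: Q_def Q'_def r_def d3 add.assoc)
  qed
  show ?thesis by (rule that[OF H Cpos main])
qed

lemma GS_dual_tf_shift_bound:
  fixes u :: "(real^'d::finite \<Rightarrow> complex) \<Rightarrow> complex"
  assumes u: "u \<in> GS_dual s" and s: "1/2 \<le> s" and e: "0 < \<epsilon>"
  obtains C where "0 < C" "\<And>x \<xi>. norm (u (tf_shift x \<xi>)) \<le> C * exp (\<epsilon> * (norm x powr (1/s) + norm \<xi> powr (1/s)))"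
proof -
  obtain H C where H: "1 \<le> H" "0 < C" "\<And>(x::real^'d) \<xi>. gs_bound s H
    (C * exp (\<epsilon> * (norm x powr (1/s) + norm \<xi> powr (1/s)))) (tf_shift x \<xi>)"
    by (rule tf_shift_gs_bound[OF s e, where 'd='d]) (rule that)
  obtain K where K: "0 < K" "\<And>M f. 0 \<le> M \<Longrightarrow> gs_bound s H M f \<Longrightarrow> norm (u f) \<le> K * M"
    using GS_dual_bounded[OF u, of H] H(1) by (metis less_le_trans zero_less_one)
  show ?thesis
  proof (rule that)
    show "0 < K * C" using K H by simp
    fix x \<xi> :: "real^'d"
    show "norm (u (tf_shift x \<xi>)) \<le> K * C * exp (\<epsilon> * (norm x powr (1/s) + norm \<xi> powr (1/s)))"
      using K(2)[OF _ H(3), of x \<xi>] H(2) by (simp add: mult.assoc)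
  qed
qed

lemma Upsilon_eq_GS_dual: "(Upsilon :: ((real^'d::finite \<Rightarrow> complex) \<Rightarrow> complex) set) = GS_dual (1/2)"
proof
  show "Upsilon \<subseteq> GS_dual (1/2)" by (auto simp: Upsilon_def)
  show "GS_dual (1/2) \<subseteq> (Upsilon :: ((real^'d \<Rightarrow> complex) \<Rightarrow> complex) set)"
  proof
    fix u :: "(real^'d \<Rightarrow> complex) \<Rightarrow> complex" assume u: "u \<in> GS_dual (1/2)"
    have "\<exists>C>0. \<forall>x \<xi>. norm (STFT u (x, \<xi>)) \<le> C * exp (\<epsilon> * ((norm x)\<^sup>2 + (norm \<xi>)\<^sup>2))" if e: "0 < \<epsilon>" for \<epsilon> :: real
    proof -
      let ?c = "(2 * pi) powr (- real CARD('d) / 2)"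
      obtain C where C: "0 < C" "\<And>x \<xi>. norm (u (tf_shift x \<xi>)) \<le> C * exp (\<epsilon> * (norm x powr (1/(1/2)) + norm \<xi> powr (1/(1/2))))"
        by (rule GS_dual_tf_shift_bound[OF u order_refl e]) (rule that)
      have "norm (STFT u (x, \<xi>)) \<le> (?c * C) * exp (\<epsilon> * ((norm x)\<^sup>2 + (norm \<xi>)\<^sup>2))" for x \<xi>
        using mult_left_mono[OF C(2)[of x \<xi>], of ?c] unfolding STFT_eq norm_mult norm_of_real
        by (simp add: mult.assoc)
      with C(1) show ?thesis by (intro exI[of _ "?c * C"]) auto
    qed
    with u show "u \<in> Upsilon" by (simp add: Upsilon_def)
  qed
qed

lemma continuous_on_GS_dual_tf_shift:
  fixes u :: "(real^'d::finite \<Rightarrow> complex) \<Rightarrow> complex"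
  assumes u: "u \<in> GS_dual (1/2)"
  shows "continuous_on UNIV (\<lambda>z. u (tf_shift (fst z) (snd z)))"
proof -
  obtain H C where H: "1 \<le> H" "0 < C" "\<And>(x::real^'d) \<xi> x' \<xi>'. gs_bound (1/2) H
    (C * exp (1 * ((norm x)\<^sup>2 + (norm \<xi>)\<^sup>2 + (norm x')\<^sup>2 + (norm \<xi>')\<^sup>2)) * (norm (x' - x) + norm (\<xi>' - \<xi>)))
    (\<lambda>y. tf_shift x' \<xi>' y - tf_shift x \<xi> y)"
    by (rule tf_shift_lipschitz[OF zero_less_one, where 'd='d]) (rule that)
  obtain K where K: "0 < K" "\<And>M f. 0 \<le> M \<Longrightarrow> gs_bound (1/2) H M f \<Longrightarrow> norm (u f) \<le> K * M"
    using GS_dual_bounded[OF u, of H] H(1) by (metis less_le_trans zero_less_one)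
  have GS: "tf_shift x \<xi> \<in> GS (1/2)" for x \<xi> :: "real^'d" by (rule GS_tf_shift) simp
  have "((\<lambda>z. u (tf_shift (fst z) (snd z))) \<longlongrightarrow> u (tf_shift (fst z0) (snd z0))) (at z0)" for z0 :: "(real^'d) \<times> (real^'d)"
  proof (rule Lim_null_comparison[THEN LIM_zero_cancel])
    let ?g = "\<lambda>z. K * (C * exp (1 * ((norm (fst z0))\<^sup>2 + (norm (snd z0))\<^sup>2 + (norm (fst z))\<^sup>2 + (norm (snd z))\<^sup>2)) * (norm (fst z - fst z0) + norm (snd z - snd z0)))"
    have "norm (u (tf_shift (fst z) (snd z)) - u (tf_shift (fst z0) (snd z0))) \<le> ?g z" for z
    proof -
      have "u (\<lambda>y. 1 * tf_shift (fst z) (snd z) y + (-1) * tf_shift (fst z0) (snd z0) y) = u (tf_shift (fst z) (snd z)) - u (tf_shift (fst z0) (snd z0))"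
        by (subst GS_dual_linear[OF u GS GS]) simp
      with K(2)[OF _ H(3), of "fst z0" "snd z0" "fst z" "snd z"] H(2) show ?thesis by simp
    qed
    then show "\<forall>\<^sub>F z in at z0. norm (u (tf_shift (fst z) (snd z)) - u (tf_shift (fst z0) (snd z0))) \<le> ?g z"
      by (intro always_eventually allI)
    have "(?g \<longlongrightarrow> ?g z0) (at z0)" by (intro tendsto_intros)
    then show "(?g \<longlongrightarrow> 0) (at z0)" by simp
  qed
  then show ?thesis by (simp add: continuous_on_def)
qed

section \<open>Bounds for mixed quasi-norms\<close>

lemma lebesgue_subspace_basis:
  fixes V :: "'a::euclidean_space set"
  assumes "subspace V"
  obtains E where "finite E" "\<And>b b'. b \<in> E \<Longrightarrow> b' \<in> E \<Longrightarrow> b \<bullet> b' = (if b = b' then 1 else 0)" "span E = V"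
    "lebesgue_subspace V = completion (distr (\<Pi>\<^sub>M b\<in>E. (lborel :: real measure)) borel (\<lambda>c. \<Sum>b\<in>E. c b *\<^sub>R b))"
proof -
  have "\<exists>E. orthonormal_basis_of V E"
    using orthonormal_basis_subspace[OF assms] unfolding orthonormal_basis_of_def by metis
  define E where "E = (SOME E. orthonormal_basis_of V E)"
  have E: "orthonormal_basis_of V E" unfolding E_def using \<open>\<exists>E. _\<close> by (rule someI_ex)
  then have po: "pairwise orthogonal E" and n1: "\<forall>b\<in>E. norm b = 1" and sp: "span E = V"
    by (auto simp: orthonormal_basis_of_def)
  have "0 \<notin> E" using n1 by auto
  then have "finite E" using po pairwise_orthogonal_independent independent_imp_finite by blast
  moreover have "b \<bullet> b' = (if b = b' then 1 else 0)" if "b \<in> E" "b' \<in> E" for b b'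
    using that po n1 by (auto simp: pairwise_def orthogonal_def norm_eq_1)
  moreover have "lebesgue_subspace V = completion (distr (\<Pi>\<^sub>M b\<in>E. (lborel :: real measure)) borel (\<lambda>c. \<Sum>b\<in>E. c b *\<^sub>R b))"
    by (simp add: lebesgue_subspace_def E_def Let_def)
  ultimately show ?thesis using sp that by blast
qed

lemma measurable_basis_sum [measurable]:
  fixes E :: "'a::euclidean_space set"
  shows "(\<lambda>c. \<Sum>b\<in>E. c b *\<^sub>R b) \<in> borel_measurable (\<Pi>\<^sub>M b\<in>E. (lborel :: real measure))"
  by (intro borel_measurable_sum borel_measurable_scaleR) auto

lemma borel_measurable_lebesgue_subspace:
  "f \<in> borel_measurable borel \<Longrightarrow> f \<in> borel_measurable (lebesgue_subspace V)"
  unfolding lebesgue_subspace_def Let_def by (intro measurable_completion) simp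

lemma AE_lebesgue_subspace:
  assumes "subspace V" shows "AE x in lebesgue_subspace V. x \<in> V"
proof -
  obtain E where E: "finite E" "\<And>b b'. b \<in> E \<Longrightarrow> b' \<in> E \<Longrightarrow> b \<bullet> b' = (if b = b' then 1 else 0)" "span E = V"
    and L: "lebesgue_subspace V = completion (distr (\<Pi>\<^sub>M b\<in>E. (lborel :: real measure)) borel (\<lambda>c. \<Sum>b\<in>E. c b *\<^sub>R b))"
    by (rule lebesgue_subspace_basis[OF assms]) (rule that)
  have "V \<in> sets borel" using closed_subspace[OF assms] by simp
  have "AE x in distr (\<Pi>\<^sub>M b\<in>E. (lborel :: real measure)) borel (\<lambda>c. \<Sum>b\<in>E. c b *\<^sub>R b). x \<in> V"
  proof (subst AE_distr_iff)
    show "{x \<in> space borel. x \<in> V} \<in> sets borel" using \<open>V \<in> sets borel\<close> by simp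
    show "AE x in \<Pi>\<^sub>M b\<in>E. (lborel :: real measure). (\<Sum>b\<in>E. x b *\<^sub>R b) \<in> V"
      unfolding E(3)[symmetric] by (intro AE_I2 span_sum span_scale span_base)
  qed simp
  then show ?thesis unfolding L by (rule AE_completion)
qed

text \<open>A cube in orthonormal coordinates fits into the ball, and its measure is a product of
  lengths; this makes the bound uniform in the centre.\<close>

lemma lebesgue_subspace_ball_lower:
  fixes V :: "'a::euclidean_space set"
  assumes V: "subspace V"
  obtains c n where "0 < c" "\<And>w \<rho>. w \<in> V \<Longrightarrow> 0 < \<rho> \<Longrightarrow> ennreal (c * \<rho> ^ n) \<le> emeasure (lebesgue_subspace V) (ball w \<rho> \<inter> V)"
proof -
  obtain E where E: "finite E" "\<And>b b'. b \<in> E \<Longrightarrow> b' \<in> E \<Longrightarrow> b \<bullet> b' = (if b = b' then 1 else 0)" "span E = V"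
    and L: "lebesgue_subspace V = completion (distr (\<Pi>\<^sub>M b\<in>E. (lborel :: real measure)) borel (\<lambda>c. \<Sum>b\<in>E. c b *\<^sub>R b))"
    by (rule lebesgue_subspace_basis[OF V]) (rule that)
  interpret product_sigma_finite "\<lambda>b::'a. lborel :: real measure" ..
  let ?P = "\<Pi>\<^sub>M b\<in>E. (lborel :: real measure)"
  have nE: "norm b = 1" if "b \<in> E" for b using E(2)[OF that that] by (simp add: norm_eq_1)
  define k where "k = card E"
  show ?thesis
  proof (rule that)
    show "0 < (2 / (real k + 1)) ^ k" by simp
    fix w :: 'a and \<rho> :: real assume w: "w \<in> V" and \<rho>: "0 < \<rho>"
    obtain m where m: "w = (\<Sum>b\<in>E. m b *\<^sub>R b)"
      using w unfolding E(3)[symmetric] span_finite[OF E(1)] by blast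
    \<comment> \<open>Dividing by \<open>k + 1\<close> instead of \<open>k\<close> gives a strict
      inequality and includes the trivial subspace.\<close>
    define r where "r = \<rho> / (real k + 1)"
    have r: "0 < r" using \<rho> by (simp add: r_def)
    have ball_V: "ball w \<rho> \<inter> V \<in> sets borel" using closed_subspace[OF V] by simp
    have sub: "Pi\<^sub>E E (\<lambda>b. {m b - r<..<m b + r}) \<subseteq> (\<lambda>c. \<Sum>b\<in>E. c b *\<^sub>R b) -` (ball w \<rho> \<inter> V) \<inter> space ?P"
    proof
      fix c assume c: "c \<in> Pi\<^sub>E E (\<lambda>b. {m b - r<..<m b + r})"
      have "norm ((\<Sum>b\<in>E. c b *\<^sub>R b) - w) = norm (\<Sum>b\<in>E. (c b - m b) *\<^sub>R b)"
        by (simp add: m scaleR_diff_left sum_subtractf)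
      also have "\<dots> \<le> (\<Sum>b\<in>E. \<bar>c b - m b\<bar>)" by (rule order.trans[OF norm_sum]) (simp add: nE)
      also have "\<dots> \<le> (\<Sum>b\<in>E. r)" using c by (intro sum_mono) (auto simp: PiE_iff abs_le_iff dest!: bspec)
      also have "\<dots> < \<rho>" using \<rho> by (simp add: k_def[symmetric] r_def field_simps)
      finally have "(\<Sum>b\<in>E. c b *\<^sub>R b) \<in> ball w \<rho>" by (simp add: dist_norm norm_minus_commute)
      moreover have "(\<Sum>b\<in>E. c b *\<^sub>R b) \<in> V" unfolding E(3)[symmetric] by (intro span_sum span_scale span_base)
      moreover have "c \<in> space ?P" using c by (auto simp: space_PiM PiE_iff)
      ultimately show "c \<in> (\<lambda>c. \<Sum>b\<in>E. c b *\<^sub>R b) -` (ball w \<rho> \<inter> V) \<inter> space ?P" by simp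
    qed
    have "ennreal ((2 / (real k + 1)) ^ k * \<rho> ^ k) = ennreal ((2 * r) ^ k)"
      by (simp add: r_def power_divide power_mult_distrib)
    also have "\<dots> = (\<Prod>b\<in>E. emeasure lborel {m b - r<..<m b + r})"
      using r by (simp add: k_def ennreal_power)
    also have "\<dots> = emeasure ?P (Pi\<^sub>E E (\<lambda>b. {m b - r<..<m b + r}))"
      by (rule emeasure_PiM[symmetric]) (use E in auto)
    also have "\<dots> \<le> emeasure ?P ((\<lambda>c. \<Sum>b\<in>E. c b *\<^sub>R b) -` (ball w \<rho> \<inter> V) \<inter> space ?P)"
      by (rule emeasure_mono[OF sub]) (rule measurable_sets[OF measurable_basis_sum ball_V])
    also have "\<dots> = emeasure (lebesgue_subspace V) (ball w \<rho> \<inter> V)"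
      unfolding L using ball_V by (simp add: emeasure_distr)
    finally show "ennreal ((2 / (real k + 1)) ^ k * \<rho> ^ k) \<le> emeasure (lebesgue_subspace V) (ball w \<rho> \<inter> V)" .
  qed
qed

lemma ennreal_rpow_ennreal: "0 \<le> t \<Longrightarrow> ennreal_rpow (ennreal t) r = ennreal (t powr r)"
  by (simp add: ennreal_rpow_def)

lemma ennreal_rpow_mono: "x \<le> y \<Longrightarrow> 0 \<le> r \<Longrightarrow> ennreal_rpow x r \<le> ennreal_rpow y r"
  by (auto simp: ennreal_rpow_def top_unique less_top intro!: ennreal_leI powr_mono2 enn2real_mono)

text \<open>Transfers strict superlevel sets through powers, the form in which lower semicontinuity
  is checked.\<close>

lemma less_ennreal_rpow_iff:
  assumes "0 < r"
  shows "t < ennreal_rpow x r \<longleftrightarrow> t \<noteq> \<infinity> \<and> ennreal_rpow t (1 / r) < x"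
proof -
  have inv: "ennreal_rpow (ennreal_rpow z (1 / r)) r = z" "ennreal_rpow (ennreal_rpow z r) (1 / r) = z" for z
    using assms by (cases z; simp add: ennreal_rpow_def powr_powr)+
  show ?thesis
    using ennreal_rpow_mono[of "ennreal_rpow x r" t "1 / r"] ennreal_rpow_mono[of x "ennreal_rpow t (1/r)" r] inv assms
    by (metis infinity_ennreal_def linorder_not_le less_imp_le order_less_irrefl top_greatest zero_le_divide_1_iff)
qed

section \<open>Lower bounds for mixed quasi-norms\<close>

lemma esssup_subspace_lower:
  assumes V: "subspace V" and w: "w \<in> V" and \<rho>: "0 < \<rho>"
    and g: "\<And>x. x \<in> V \<Longrightarrow> dist x w < \<rho> \<Longrightarrow> t \<le> g x"
  shows "t \<le> esssup (lebesgue_subspace V) (g :: 'a::euclidean_space \<Rightarrow> ennreal)"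
proof (rule ccontr)
  assume "\<not> t \<le> esssup (lebesgue_subspace V) g"
  then have less: "esssup (lebesgue_subspace V) g < t" by simp
  have "AE x in lebesgue_subspace V. x \<notin> ball w \<rho> \<inter> V"
    using esssup_AE[of g "lebesgue_subspace V"]
  proof eventually_elim
    case (elim x)
    show ?case
    proof
      assume "x \<in> ball w \<rho> \<inter> V"
      then have "t \<le> g x" using g by (auto simp: dist_commute)
      with elim less show False by simp
    qed
  qed
  moreover have "ball w \<rho> \<inter> V \<in> sets (lebesgue_subspace V)"
    unfolding lebesgue_subspace_def Let_def using closed_subspace[OF V] by (intro sets_completionI_sets) simp
  ultimately have "emeasure (lebesgue_subspace V) (ball w \<rho> \<inter> V) = 0"
    by (intro null_setsD1) (simp only: AE_iff_null_sets)
  moreover obtain c n where "0 < c" "\<And>w \<rho>. w \<in> V \<Longrightarrow> 0 < \<rho> \<Longrightarrow> ennreal (c * \<rho> ^ n) \<le> emeasure (lebesgue_subspace V) (ball w \<rho> \<inter> V)"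
    using lebesgue_subspace_ball_lower[OF V] by blast
  ultimately have "ennreal (c * \<rho> ^ n) \<le> 0" "0 < c * \<rho> ^ n" using w \<rho> by (metis, simp)
  then show False by (simp add: ennreal_eq_0_iff)
qed

text \<open>Stated for arbitrary \<open>g\<close>, which will itself be a partial quasi-norm of an
  arbitrary function. The constants depend on \<open>V\<close> and \<open>p\<close> alone, so the
  bound can be iterated.\<close>

lemma Lp_qnorm_subspace_lower:
  fixes V :: "'a::euclidean_space set"
  assumes V: "subspace V" and p: "0 < p"
  shows "\<exists>c>0. \<exists>N\<ge>0. \<forall>g t w \<rho>. 0 \<le> t \<and> w \<in> V \<and> 0 < \<rho> \<and> \<rho> \<le> 1 \<and> (\<forall>x\<in>V. dist x w < \<rho> \<longrightarrow> ennreal t \<le> g x)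
    \<longrightarrow> ennreal (c * t * \<rho> powr N) \<le> Lp_qnorm (lebesgue_subspace V) p g"
proof (cases "p = \<infinity>")
  case True
  show ?thesis
    by (rule exI[of _ 1], rule conjI[OF zero_less_one], rule exI[of _ 0])
       (use esssup_subspace_lower[OF V] True in \<open>auto simp: Lp_qnorm_def\<close>)
next
  case False
  define r where "r = enn2real p"
  have r: "0 < r" using p False by (simp add: r_def enn2real_positive_iff less_top)
  obtain c n where c: "0 < c" "\<And>w \<rho>. w \<in> V \<Longrightarrow> 0 < \<rho> \<Longrightarrow> ennreal (c * \<rho> ^ n) \<le> emeasure (lebesgue_subspace V) (ball w \<rho> \<inter> V)"
    using lebesgue_subspace_ball_lower[OF V] by blast
  show ?thesis
  proof (intro exI conjI allI impI)
    show "0 < c powr (1 / r)" using c by simp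
    show "0 \<le> real n / r" using r by simp
    fix g :: "'a \<Rightarrow> ennreal" and t :: real and w :: 'a and \<rho> :: real
    assume "0 \<le> t \<and> w \<in> V \<and> 0 < \<rho> \<and> \<rho> \<le> 1 \<and> (\<forall>x\<in>V. dist x w < \<rho> \<longrightarrow> ennreal t \<le> g x)"
    then have a: "0 \<le> t" "w \<in> V" "0 < \<rho>" and g: "\<And>x. x \<in> V \<Longrightarrow> dist x w < \<rho> \<Longrightarrow> ennreal t \<le> g x" by auto
    have ms: "ball w \<rho> \<inter> V \<in> sets (lebesgue_subspace V)"
      unfolding lebesgue_subspace_def Let_def using closed_subspace[OF V] by (intro sets_completionI_sets) simp
    have "ennreal (t powr r * (c * \<rho> ^ n)) = ennreal (t powr r) * ennreal (c * \<rho> ^ n)"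
      using c a by (simp add: ennreal_mult)
    also have "\<dots> \<le> ennreal (t powr r) * emeasure (lebesgue_subspace V) (ball w \<rho> \<inter> V)"
      using c a by (intro mult_left_mono) auto
    also have "\<dots> = (\<integral>\<^sup>+ x. ennreal (t powr r) * indicator (ball w \<rho> \<inter> V) x \<partial>lebesgue_subspace V)"
      using ms by (rule nn_integral_cmult_indicator[symmetric])
    also have "\<dots> \<le> (\<integral>\<^sup>+ x. ennreal_rpow (g x) r \<partial>lebesgue_subspace V)"
    proof (intro nn_integral_mono)
      fix x :: 'a
      show "ennreal (t powr r) * indicator (ball w \<rho> \<inter> V) x \<le> ennreal_rpow (g x) r"
        using ennreal_rpow_mono[OF g[of x], of r] a r
        by (auto simp: indicator_def ennreal_rpow_ennreal dist_commute)
    qed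
    finally have "ennreal_rpow (ennreal (t powr r * (c * \<rho> ^ n))) (1 / r) \<le> Lp_qnorm (lebesgue_subspace V) p g"
      using r False unfolding Lp_qnorm_def r_def[symmetric] by (simp add: ennreal_rpow_mono)
    also have "ennreal_rpow (ennreal (t powr r * (c * \<rho> ^ n))) (1 / r) = ennreal ((t powr r * (c * \<rho> ^ n)) powr (1 / r))"
      using a c by (intro ennreal_rpow_ennreal) auto
    also have "(t powr r * (c * \<rho> ^ n)) powr (1 / r) = c powr (1 / r) * t * \<rho> powr (real n / r)"
      using a c r by (simp add: powr_mult powr_powr powr_realpow[symmetric])
    finally show "ennreal (c powr (1 / r) * t * \<rho> powr (real n / r)) \<le> Lp_qnorm (lebesgue_subspace V) p g" .
  qed
qed

text \<open>The hypothesis speaks of lists of components because the tails of \<open>B\<close> met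
  in the induction no longer span the space. Each component varies in its own small ball, and the
  exponents of \<rho> add up.\<close>

lemma mixed_qnorm_lower_aux:
  fixes B :: "'a::euclidean_space mixed_space"
  assumes "\<forall>(V, p)\<in>set B. subspace V \<and> 0 < p"
  shows "\<exists>c>0. \<exists>N\<ge>0. \<forall>f t ws \<rho>. 0 \<le> t \<and> 0 < \<rho> \<and> \<rho> \<le> 1 \<and> list_all2 (\<lambda>v (V, p). v \<in> V) ws B \<and>
     (\<forall>xs. list_all2 (\<lambda>v (V, p). v \<in> V) xs B \<and> list_all2 (\<lambda>x w. dist x w < \<rho>) xs ws \<longrightarrow> ennreal t \<le> f (sum_list xs))
     \<longrightarrow> ennreal (c * t * \<rho> powr N) \<le> mixed_qnorm B f"
  using assms
proof (induction B)
  case Nil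
  show ?case by (rule exI[of _ 1], rule conjI[OF zero_less_one], rule exI[of _ 0]) auto
next
  case (Cons Vp B)
  obtain V p where Vp: "Vp = (V, p)" by (cases Vp)
  with Cons.prems have V: "subspace V" "0 < p" by auto
  from Cons.IH Cons.prems obtain c1 N1 where c1: "c1 > 0" "N1 \<ge> 0" and IH: "\<And>f t ws \<rho>. 0 \<le> t \<and> 0 < \<rho> \<and> \<rho> \<le> 1 \<and> list_all2 (\<lambda>v (V, p). v \<in> V) ws B \<and>
     (\<forall>xs. list_all2 (\<lambda>v (V, p). v \<in> V) xs B \<and> list_all2 (\<lambda>x w. dist x w < \<rho>) xs ws \<longrightarrow> ennreal t \<le> f (sum_list xs))
     \<Longrightarrow> ennreal (c1 * t * \<rho> powr N1) \<le> mixed_qnorm B f"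
    by (auto simp: Vp)
  obtain c2 N2 where c2: "c2 > 0" "N2 \<ge> 0" and LP: "\<And>g t w \<rho>. 0 \<le> t \<and> w \<in> V \<and> 0 < \<rho> \<and> \<rho> \<le> 1 \<and> (\<forall>x\<in>V. dist x w < \<rho> \<longrightarrow> ennreal t \<le> g x)
    \<Longrightarrow> ennreal (c2 * t * \<rho> powr N2) \<le> Lp_qnorm (lebesgue_subspace V) p g"
    using Lp_qnorm_subspace_lower[OF V] by blast
  show ?case
  proof (rule exI[of _ "c1 * c2"], rule conjI, use c1 c2 in simp, rule exI[of _ "N1 + N2"], rule conjI, use c1 c2 in simp, intro allI impI)
    fix f :: "'a \<Rightarrow> ennreal" and t :: real and ws :: "'a list" and \<rho> :: real
    assume *: "0 \<le> t \<and> 0 < \<rho> \<and> \<rho> \<le> 1 \<and> list_all2 (\<lambda>v (V, p). v \<in> V) ws (Vp # B) \<and>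
     (\<forall>xs. list_all2 (\<lambda>v (V, p). v \<in> V) xs (Vp # B) \<and> list_all2 (\<lambda>x w. dist x w < \<rho>) xs ws \<longrightarrow> ennreal t \<le> f (sum_list xs))"
    then obtain w ws' where ws: "ws = w # ws'" and w: "w \<in> V" and ws': "list_all2 (\<lambda>v (V, p). v \<in> V) ws' B"
      by (cases ws) (auto simp: Vp)
    have "ennreal (c1 * (c2 * t * \<rho> powr N2) * \<rho> powr N1) \<le> mixed_qnorm B (\<lambda>y. Lp_qnorm (lebesgue_subspace V) p (\<lambda>x. f (x + y)))"
    proof (rule IH, intro conjI allI impI)
      fix xs assume xs: "list_all2 (\<lambda>v (V, p). v \<in> V) xs B \<and> list_all2 (\<lambda>x w. dist x w < \<rho>) xs ws'"
      show "ennreal (c2 * t * \<rho> powr N2) \<le> Lp_qnorm (lebesgue_subspace V) p (\<lambda>x. f (x + sum_list xs))"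
      proof (rule LP, intro conjI ballI impI)
        fix x assume "x \<in> V" "dist x w < \<rho>"
        then show "ennreal t \<le> f (x + sum_list xs)" using * xs by (auto simp: ws Vp dest!: spec[of _ "x # xs"])
      qed (use * w in auto)
    qed (use * ws' c2 in auto)
    moreover have "c1 * (c2 * t * \<rho> powr N2) * \<rho> powr N1 = c1 * c2 * t * \<rho> powr (N1 + N2)"
      by (simp add: powr_add)
    ultimately show "ennreal (c1 * c2 * t * \<rho> powr (N1 + N2)) \<le> mixed_qnorm (Vp # B) f" by (simp add: Vp)
  qed
qed

lemma dist_sum_list_le:
  "list_all2 (\<lambda>x w. dist x w < \<rho>) xs ws \<Longrightarrow> dist (sum_list xs) (sum_list ws) \<le> real (length ws) * (\<rho>::real)"
  for xs :: "'a::real_normed_vector list"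
proof (induction xs ws rule: list_all2_induct)
  case (Cons x xs w ws)
  have "dist (x + sum_list xs) (w + sum_list ws) \<le> dist x w + dist (sum_list xs) (sum_list ws)"
    by (rule dist_triangle_add)
  with Cons show ?case by (simp add: algebra_simps)
qed simp

lemma mixed_qnorm_lower:
  fixes B :: "'a::euclidean_space mixed_space"
  assumes B: "mixed_quasi_norm_space B"
  obtains c N where "0 < c" "0 \<le> N" "\<And>f t z \<rho>. 0 \<le> t \<Longrightarrow> 0 < \<rho> \<Longrightarrow> \<rho> \<le> 1 \<Longrightarrow> (\<And>x. dist x z < \<rho> \<Longrightarrow> ennreal t \<le> f x) \<Longrightarrow>
     ennreal (c * t * \<rho> powr N) \<le> mixed_qnorm B f"
proof -
  obtain c N where c: "c > 0" "N \<ge> 0" and L: "\<And>f t ws \<rho>. 0 \<le> t \<and> 0 < \<rho> \<and> \<rho> \<le> 1 \<and> list_all2 (\<lambda>v (V, p). v \<in> V) ws B \<and>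
     (\<forall>xs. list_all2 (\<lambda>v (V, p). v \<in> V) xs B \<and> list_all2 (\<lambda>x w. dist x w < \<rho>) xs ws \<longrightarrow> ennreal t \<le> f (sum_list xs))
     \<Longrightarrow> ennreal (c * t * \<rho> powr N) \<le> mixed_qnorm B f"
    using mixed_qnorm_lower_aux[of B] B unfolding mixed_quasi_norm_space_def by blast
  \<comment> \<open>The sum of the components moves by at most \<open>length B\<close> times the
    radius of one component; the additional 1 makes this less than \<rho>.\<close>
  define m where "m = real (length B) + 1"
  have m: "1 \<le> m" by (simp add: m_def)
  show ?thesis
  proof (rule that)
    show "0 < c * (1 / m) powr N" using c m by simp
    show "0 \<le> N" by fact
    fix f :: "'a \<Rightarrow> ennreal" and t \<rho> :: real and z :: 'a
    assume a: "0 \<le> t" "0 < \<rho>" "\<rho> \<le> 1" and f: "\<And>x. dist x z < \<rho> \<Longrightarrow> ennreal t \<le> f x"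
    obtain ws where ws: "list_all2 (\<lambda>v (V, p). v \<in> V) ws B" "sum_list ws = z"
      using B unfolding mixed_quasi_norm_space_def by blast
    have len: "length ws = length B" using ws(1) by (rule list_all2_lengthD)
    have "ennreal (c * t * (\<rho> / m) powr N) \<le> mixed_qnorm B f"
    proof (rule L, intro conjI allI impI)
      show "0 \<le> t" "list_all2 (\<lambda>v (V, p). v \<in> V) ws B" by fact+
      show "0 < \<rho> / m" using a m by simp
      show "\<rho> / m \<le> 1" using a m by (simp add: divide_le_eq)
      fix xs assume "list_all2 (\<lambda>v (V, p). v \<in> V) xs B \<and> list_all2 (\<lambda>x w. dist x w < \<rho> / m) xs ws"
      then have "dist (sum_list xs) z \<le> real (length ws) * (\<rho> / m)"
        using dist_sum_list_le[of "\<rho> / m" xs ws] ws(2) by simp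
      also have "\<dots> < \<rho>" using a m by (simp add: len m_def field_simps)
      finally show "ennreal t \<le> f (sum_list xs)" by (rule f)
    qed
    moreover have "(\<rho> / m) powr N = (1 / m) powr N * \<rho> powr N" using a m by (simp add: powr_divide)
    ultimately show "ennreal (c * (1 / m) powr N * t * \<rho> powr N) \<le> mixed_qnorm B f" by (simp add: mult_ac)
  qed
qed

text \<open>Lower semicontinuity, unlike continuity, passes to partial quasi-norms, and so settles the
  measurability of the successive integrands.\<close>

definition lower_semicont :: "('a::topological_space \<Rightarrow> ennreal) \<Rightarrow> bool" where
  "lower_semicont f \<longleftrightarrow> (\<forall>t. open {x. t < f x})"

lemma lower_semicont_borel: "lower_semicont f \<Longrightarrow> f \<in> borel_measurable borel"
  by (rule borel_measurableI_greater) (auto simp: lower_semicont_def)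

lemma lower_semicont_continuous: "continuous_on UNIV f \<Longrightarrow> lower_semicont f"
  unfolding lower_semicont_def by (intro allI open_Collect_less continuous_intros)

lemma lower_semicont_translate:
  assumes "lower_semicont f" shows "lower_semicont (\<lambda>x::'a::real_normed_vector. f (x + y))"
  unfolding lower_semicont_def
proof
  fix t
  have "open {x. t < f x}" using assms by (simp add: lower_semicont_def)
  then have "open ((\<lambda>x. x + y) -` {x. t < f x})" by (rule open_vimage) (intro continuous_intros)
  then show "open {x. t < f (x + y)}" by (simp add: vimage_def)
qed

lemma lower_semicont_rpow:
  assumes "lower_semicont f" "0 < r" shows "lower_semicont (\<lambda>x. ennreal_rpow (f x) r)"
  unfolding lower_semicont_def
proof
  fix t show "open {x. t < ennreal_rpow (f x) r}"
    using assms by (cases "t = \<infinity>") (auto simp: lower_semicont_def less_ennreal_rpow_iff)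
qed

lemma lower_semicont_seq_le_liminf:
  assumes f: "lower_semicont f" and X: "X \<longlonglongrightarrow> x"
  shows "f x \<le> liminf (\<lambda>n. f (X n))"
  unfolding le_Liminf_iff
proof (intro allI impI)
  fix t assume "t < f x"
  then show "\<forall>\<^sub>F n in sequentially. t < f (X n)"
    using topological_tendstoD[OF X, of "{x. t < f x}"] f by (auto simp: lower_semicont_def)
qed

text \<open>Fatou's lemma along a convergent sequence of parameters shows that the sublevel sets are
  closed.\<close>

lemma lower_semicont_nn_integral:
  fixes f :: "'a::euclidean_space \<Rightarrow> ennreal"
  assumes f: "lower_semicont f"
  shows "lower_semicont (\<lambda>y. \<integral>\<^sup>+ x. f (x + y) \<partial>lebesgue_subspace V)"
  unfolding lower_semicont_def
proof
  fix t
  let ?I = "\<lambda>y. \<integral>\<^sup>+ x. f (x + y) \<partial>lebesgue_subspace V"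
  have "closed {y. ?I y \<le> t}"
  proof (subst closed_sequential_limits, intro allI impI, elim conjE)
    fix X y assume le: "\<forall>n. X n \<in> {y. ?I y \<le> t}" and X: "X \<longlonglongrightarrow> y"
    have "?I y \<le> (\<integral>\<^sup>+ x. liminf (\<lambda>n. f (x + X n)) \<partial>lebesgue_subspace V)"
      by (intro nn_integral_mono lower_semicont_seq_le_liminf[OF f] tendsto_intros X)
    also have "\<dots> \<le> liminf (\<lambda>n. ?I (X n))"
      by (intro nn_integral_liminf borel_measurable_lebesgue_subspace lower_semicont_borel lower_semicont_translate f)
    also have "\<dots> \<le> liminf (\<lambda>n. t)" using le by (intro Liminf_mono always_eventually) auto
    also have "\<dots> = t" by (simp add: Liminf_const)
    finally show "y \<in> {y. ?I y \<le> t}" by simp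
  qed
  moreover have "{y. t < ?I y} = - {y. ?I y \<le> t}" by auto
  ultimately show "open {y. t < ?I y}" by (simp add: open_closed)
qed

text \<open>For \<open>p = \<infinity>\<close>: if the essential supremum exceeds \<open>t\<close>,
  then \<open>f\<close> exceeds \<open>t\<close> at some point, hence near it, and a whole ball in
  \<open>V\<close> survives a small translation.\<close>

lemma lower_semicont_Lp_qnorm:
  fixes f :: "'a::euclidean_space \<Rightarrow> ennreal"
  assumes V: "subspace V" and p: "0 < p" and f: "lower_semicont f"
  shows "lower_semicont (\<lambda>y. Lp_qnorm (lebesgue_subspace V) p (\<lambda>x. f (x + y)))"
proof (cases "p = \<infinity>")
  case False
  then have r: "0 < enn2real p" using p by (simp add: enn2real_positive_iff less_top)
  have "lower_semicont (\<lambda>y. ennreal_rpow (\<integral>\<^sup>+ x. ennreal_rpow (f (x + y)) (enn2real p) \<partial>lebesgue_subspace V) (1 / enn2real p))"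
    using lower_semicont_nn_integral[OF lower_semicont_rpow[OF f r], of V] r
    by (intro lower_semicont_rpow) auto
  then show ?thesis using False by (simp add: Lp_qnorm_def)
next
  case True
  show ?thesis
    unfolding lower_semicont_def open_dist
  proof (intro allI ballI)
    fix t y assume "y \<in> {y. t < Lp_qnorm (lebesgue_subspace V) p (\<lambda>x. f (x + y))}"
    then have t: "t < Lp_qnorm (lebesgue_subspace V) p (\<lambda>x. f (x + y))" by simp
    have "\<exists>x\<in>V. t < f (x + y)"
    proof (rule ccontr)
      assume "\<not> (\<exists>x\<in>V. t < f (x + y))"
      then have le: "f (x + y) \<le> t" if "x \<in> V" for x using that by (auto simp: not_less)
      have "AE x in lebesgue_subspace V. f (x + y) \<le> t"
        using AE_lebesgue_subspace[OF V] by eventually_elim (rule le)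
      then have "esssup (lebesgue_subspace V) (\<lambda>x. f (x + y)) \<le> t"
        by (rule esssup_I[rotated]) (intro borel_measurable_lebesgue_subspace lower_semicont_borel lower_semicont_translate f)
      with t True show False by (simp add: Lp_qnorm_def)
    qed
    then obtain x where x: "x \<in> V" "t < f (x + y)" by blast
    \<comment> \<open>A level strictly above \<open>t\<close> keeps the inequality strict after
      passing to the essential supremum.\<close>
    then obtain t' where t': "t < t'" "t' < f (x + y)" using dense by blast
    have "open {z. t' < f z}" using f by (simp add: lower_semicont_def)
    with t'(2) obtain e where e: "0 < e" "\<And>z. dist z (x + y) < e \<Longrightarrow> t' < f z"
      unfolding open_dist by blast
    show "\<exists>e>0. \<forall>y'. dist y' y < e \<longrightarrow> y' \<in> {x. t < Lp_qnorm (lebesgue_subspace V) p (\<lambda>xa. f (xa + x))}"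
    proof (intro exI conjI allI impI)
      show "0 < e / 2" using e by simp
      fix y' assume y': "dist y' y < e / 2"
      have "t' \<le> esssup (lebesgue_subspace V) (\<lambda>x. f (x + y'))"
      proof (rule esssup_subspace_lower[OF V x(1)])
        show "0 < e / 2" using e by simp
        fix x' assume "dist x' x < e / 2"
        then have "dist (x' + y') (x + y) < e" using y' dist_triangle_add[of x' y' x y] by simp
        then show "t' \<le> f (x' + y')" using e(2) by (simp add: less_imp_le)
      qed
      with t'(1) True show "y' \<in> {x. t < Lp_qnorm (lebesgue_subspace V) p (\<lambda>xa. f (xa + x))}"
        by (simp add: Lp_qnorm_def)
    qed
  qed
qed

section \<open>Upper bounds for mixed quasi-norms\<close>

lemma nn_integral_inverse_1_plus_square_finite: "(\<integral>\<^sup>+ x. ennreal (inverse (1 + x\<^sup>2)) \<partial>(lborel :: real measure)) < \<infinity>"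
proof -
  have "integrable lborel (\<lambda>x::real. inverse (1 + x\<^sup>2))"
    using integrable_inverse_1_plus_square by (simp add: set_integrable_def einterval_def)
  then have "(\<integral>\<^sup>+ x. ennreal (norm (inverse (1 + x\<^sup>2))) \<partial>(lborel :: real measure)) < \<infinity>"
    by (simp add: integrable_iff_bounded)
  moreover have "norm (inverse (1 + x\<^sup>2)) = inverse (1 + x\<^sup>2)" for x :: real
    by (simp add: add_nonneg_nonneg)
  ultimately show ?thesis by simp
qed

text \<open>Every coordinate is bounded by the norm, so two powers of \<open>1 + norm x\<close> per
  coordinate dominate the product of the factors \<open>1 + (c b)\<^sup>2\<close>, whose inverses
  are integrable.\<close>

lemma nn_integral_subspace_decay:
  fixes V :: "'a::euclidean_space set"
  assumes V: "subspace V"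
  obtains n where "(\<integral>\<^sup>+ x. ennreal ((1 + norm x) powr (- real n)) \<partial>lebesgue_subspace V) < \<infinity>"
proof -
  obtain E where E: "finite E" "\<And>b b'. b \<in> E \<Longrightarrow> b' \<in> E \<Longrightarrow> b \<bullet> b' = (if b = b' then 1 else 0)" "span E = V"
    and L: "lebesgue_subspace V = completion (distr (\<Pi>\<^sub>M b\<in>E. (lborel :: real measure)) borel (\<lambda>c. \<Sum>b\<in>E. c b *\<^sub>R b))"
    by (rule lebesgue_subspace_basis[OF V]) (rule that)
  interpret product_sigma_finite "\<lambda>b::'a. lborel :: real measure" ..
  let ?P = "\<Pi>\<^sub>M b\<in>E. (lborel :: real measure)"
  let ?n = "2 * card E"
  have nE: "norm b = 1" if "b \<in> E" for b using E(2)[OF that that] by (simp add: norm_eq_1)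
  have le: "(1 + norm (\<Sum>b\<in>E. c b *\<^sub>R b)) powr (- real ?n) \<le> (\<Prod>b\<in>E. inverse (1 + (c b)\<^sup>2))" for c
  proof -
    let ?x = "\<Sum>b\<in>E. c b *\<^sub>R b"
    have cb: "1 + (c b)\<^sup>2 \<le> (1 + norm ?x)\<^sup>2" if b: "b \<in> E" for b
    proof -
      have "?x \<bullet> b = (\<Sum>b'\<in>E. c b' * (if b' = b then 1 else 0))"
        unfolding inner_sum_left using E(2) b by (intro sum.cong) auto
      also have "\<dots> = c b" using b E(1) by (simp add: if_distrib cong: if_cong)
      finally have "\<bar>c b\<bar> \<le> norm ?x" using Cauchy_Schwarz_ineq2[of ?x b] nE[OF b] by simp
      then have "\<bar>c b\<bar>\<^sup>2 \<le> (norm ?x)\<^sup>2" by (intro power_mono) auto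
      then show ?thesis by (simp add: power2_sum add_increasing2)
    qed
    have "(1 + norm ?x) powr (- real ?n) = (\<Prod>b\<in>E. inverse ((1 + norm ?x)\<^sup>2))"
    proof -
      have pos: "0 < 1 + norm ?x" by (simp add: add_pos_nonneg)
      show ?thesis unfolding powr_minus powr_realpow[OF pos] by (simp add: power_mult power_inverse)
    qed
    also have "\<dots> \<le> (\<Prod>b\<in>E. inverse (1 + (c b)\<^sup>2))"
      using cb by (intro prod_mono conjI le_imp_inverse_le) (auto simp: add_pos_nonneg)
    finally show ?thesis .
  qed
  have "(\<integral>\<^sup>+ x. ennreal ((1 + norm x) powr (- real ?n)) \<partial>lebesgue_subspace V) =
      (\<integral>\<^sup>+ c. ennreal ((1 + norm (\<Sum>b\<in>E. c b *\<^sub>R b)) powr (- real ?n)) \<partial>?P)"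
    unfolding L nn_integral_completion by (subst nn_integral_distr) auto
  also have "\<dots> \<le> (\<integral>\<^sup>+ c. (\<Prod>b\<in>E. ennreal (inverse (1 + (c b)\<^sup>2))) \<partial>?P)"
  proof (intro nn_integral_mono)
    fix c :: "'a \<Rightarrow> real"
    have "(\<Prod>b\<in>E. ennreal (inverse (1 + (c b)\<^sup>2))) = ennreal (\<Prod>b\<in>E. inverse (1 + (c b)\<^sup>2))"
      by (rule prod_ennreal) simp
    then show "ennreal ((1 + norm (\<Sum>b\<in>E. c b *\<^sub>R b)) powr (- real ?n)) \<le> (\<Prod>b\<in>E. ennreal (inverse (1 + (c b)\<^sup>2)))"
      using ennreal_leI[OF le[of c]] by (simp only:)
  qed
  also have "\<dots> = (\<Prod>b\<in>E. (\<integral>\<^sup>+ x. ennreal (inverse (1 + x\<^sup>2)) \<partial>(lborel :: real measure)))"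
    by (rule product_nn_integral_prod[OF E(1)]) auto
  also have "\<dots> < \<infinity>" using nn_integral_inverse_1_plus_square_finite by (simp add: power_less_top_ennreal)
  finally show ?thesis by (rule that)
qed

lemma Lp_qnorm_subspace_upper:
  fixes V :: "'a::euclidean_space set"
  assumes V: "subspace V" and p: "0 < p"
  shows "\<exists>M\<ge>0. \<exists>C\<ge>0. \<forall>g K. 0 \<le> K \<and> g \<in> borel_measurable (lebesgue_subspace V) \<and> (\<forall>x\<in>V. g x \<le> ennreal (K * (1 + norm x) powr - M)) \<longrightarrow>
    Lp_qnorm (lebesgue_subspace V) p g \<le> ennreal (C * K)"
proof (cases "p = \<infinity>")
  case True
  show ?thesis
  proof (rule exI[of _ 0], rule conjI[OF order_refl], rule exI[of _ 1], rule conjI[OF zero_le_one], intro allI impI)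
    fix g :: "'a \<Rightarrow> ennreal" and K :: real
    assume *: "0 \<le> K \<and> g \<in> borel_measurable (lebesgue_subspace V) \<and> (\<forall>x\<in>V. g x \<le> ennreal (K * (1 + norm x) powr - 0))"
    have "AE x in lebesgue_subspace V. g x \<le> ennreal K"
      using AE_lebesgue_subspace[OF V]
    proof eventually_elim
      case (elim x)
      then have "g x \<le> ennreal (K * (1 + norm x) powr - 0)" using * by blast
      moreover have "(1 + norm x) powr - 0 = 1" by (simp add: add_nonneg_eq_0_iff)
      ultimately show ?case by simp
    qed
    with * True show "Lp_qnorm (lebesgue_subspace V) p g \<le> ennreal (1 * K)" by (auto simp: Lp_qnorm_def)
  qed
next
  case False
  define r where "r = enn2real p"
  have r: "0 < r" using p False by (simp add: r_def enn2real_positive_iff less_top)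
  obtain n where n: "(\<integral>\<^sup>+ x. ennreal ((1 + norm x) powr (- real n)) \<partial>lebesgue_subspace V) < \<infinity>"
    using nn_integral_subspace_decay[OF V] .
  then obtain A where A: "0 \<le> A" "(\<integral>\<^sup>+ x. ennreal ((1 + norm x) powr (- real n)) \<partial>lebesgue_subspace V) = ennreal A"
    by (cases "\<integral>\<^sup>+ x. ennreal ((1 + norm x) powr (- real n)) \<partial>lebesgue_subspace V") auto
  show ?thesis
  proof (rule exI[of _ "real n / r"], rule conjI, use r in simp, rule exI[of _ "A powr (1/r)"], rule conjI, simp, intro allI impI)
    fix g :: "'a \<Rightarrow> ennreal" and K :: real
    assume *: "0 \<le> K \<and> g \<in> borel_measurable (lebesgue_subspace V) \<and> (\<forall>x\<in>V. g x \<le> ennreal (K * (1 + norm x) powr - (real n / r)))"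
    have "(\<integral>\<^sup>+ x. ennreal_rpow (g x) r \<partial>lebesgue_subspace V) \<le> (\<integral>\<^sup>+ x. ennreal (K powr r) * ennreal ((1 + norm x) powr (- real n)) \<partial>lebesgue_subspace V)"
    proof (rule nn_integral_mono_AE)
      show "AE x in lebesgue_subspace V. ennreal_rpow (g x) r \<le> ennreal (K powr r) * ennreal ((1 + norm x) powr (- real n))"
        using AE_lebesgue_subspace[OF V]
      proof eventually_elim
        case (elim x)
        with * have "g x \<le> ennreal (K * (1 + norm x) powr - (real n / r))" by blast
        from ennreal_rpow_mono[OF this, of r] r
        have "ennreal_rpow (g x) r \<le> ennreal ((K * (1 + norm x) powr - (real n / r)) powr r)"
          using * by (simp add: ennreal_rpow_ennreal)
        also have "(K * (1 + norm x) powr - (real n / r)) powr r = K powr r * (1 + norm x) powr (- real n)"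
          using * r by (simp add: powr_mult powr_powr)
        finally show ?case by (simp add: ennreal_mult)
      qed
    qed
    also have "\<dots> = ennreal (K powr r * A)"
      using A by (subst nn_integral_cmult)
        (auto simp: ennreal_mult intro!: borel_measurable_lebesgue_subspace)
    finally have "Lp_qnorm (lebesgue_subspace V) p g \<le> ennreal_rpow (ennreal (K powr r * A)) (1 / r)"
      using False r unfolding Lp_qnorm_def r_def[symmetric] by (simp add: ennreal_rpow_mono)
    also have "\<dots> = ennreal (A powr (1/r) * K)"
      using * A r by (simp add: ennreal_rpow_ennreal powr_mult powr_powr mult.commute)
    finally show "Lp_qnorm (lebesgue_subspace V) p g \<le> ennreal (A powr (1/r) * K)" .
  qed
qed

lemma prod_list_powr_antimono:
  "M \<le> M' \<Longrightarrow> (\<Prod>x\<leftarrow>xs. (1 + norm x) powr - M') \<le> (\<Prod>x\<leftarrow>xs. (1 + norm x) powr - M)"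
proof (induction xs)
  case (Cons x xs)
  then show ?case
    by (auto intro!: mult_mono powr_mono prod_list_nonneg)
qed simp

text \<open>Decay is assumed in each component separately, so that one component can be integrated
  out while the others keep theirs. Lower semicontinuity supplies measurability at every
  stage.\<close>

lemma mixed_qnorm_upper_aux:
  fixes B :: "'a::euclidean_space mixed_space"
  assumes "\<forall>(V, p)\<in>set B. subspace V \<and> 0 < p"
  shows "\<exists>M\<ge>0. \<exists>C\<ge>0. \<forall>f K. lower_semicont f \<and> 0 \<le> K \<and>
     (\<forall>xs. list_all2 (\<lambda>v (V, p). v \<in> V) xs B \<longrightarrow> f (sum_list xs) \<le> ennreal (K * (\<Prod>x\<leftarrow>xs. (1 + norm x) powr - M)))
     \<longrightarrow> mixed_qnorm B f \<le> ennreal (C * K)"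
  using assms
proof (induction B)
  case Nil
  show ?case by (rule exI[of _ 0], rule conjI[OF order_refl], rule exI[of _ 1]) auto
next
  case (Cons Vp B)
  obtain V p where Vp: "Vp = (V, p)" by (cases Vp)
  with Cons.prems have V: "subspace V" "0 < p" by auto
  from Cons.prems have Bp: "\<forall>(V, p)\<in>set B. subspace V \<and> 0 < p" by simp
  from Cons.IH[OF Bp] obtain M1 C1 where M1: "0 \<le> M1" "0 \<le> C1" and IH: "\<And>f K. lower_semicont f \<and> 0 \<le> K \<and>
     (\<forall>xs. list_all2 (\<lambda>v (V, p). v \<in> V) xs B \<longrightarrow> f (sum_list xs) \<le> ennreal (K * (\<Prod>x\<leftarrow>xs. (1 + norm x) powr - M1)))
     \<Longrightarrow> mixed_qnorm B f \<le> ennreal (C1 * K)" by blast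
  obtain M2 C2 where M2: "0 \<le> M2" "0 \<le> C2" and LP: "\<And>g K. 0 \<le> K \<and> g \<in> borel_measurable (lebesgue_subspace V) \<and> (\<forall>x\<in>V. g x \<le> ennreal (K * (1 + norm x) powr - M2)) \<Longrightarrow>
    Lp_qnorm (lebesgue_subspace V) p g \<le> ennreal (C2 * K)"
    using Lp_qnorm_subspace_upper[OF V] by blast
  define M where "M = max M1 M2"
  have M: "M1 \<le> M" "M2 \<le> M" "0 \<le> M" using M1 by (auto simp: M_def)
  show ?case
  proof (rule exI[of _ M], rule conjI[OF M(3)], rule exI[of _ "C1 * C2"], rule conjI, use M1 M2 in simp, intro allI impI)
    fix f :: "'a \<Rightarrow> ennreal" and K :: real
    assume *: "lower_semicont f \<and> 0 \<le> K \<and>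
     (\<forall>xs. list_all2 (\<lambda>v (V, p). v \<in> V) xs (Vp # B) \<longrightarrow> f (sum_list xs) \<le> ennreal (K * (\<Prod>x\<leftarrow>xs. (1 + norm x) powr - M)))"
    have "mixed_qnorm B (\<lambda>y. Lp_qnorm (lebesgue_subspace V) p (\<lambda>x. f (x + y))) \<le> ennreal (C1 * (C2 * K))"
    proof (rule IH, intro conjI allI impI)
      show "lower_semicont (\<lambda>y. Lp_qnorm (lebesgue_subspace V) p (\<lambda>x. f (x + y)))"
        using * V by (intro lower_semicont_Lp_qnorm) auto
      show "0 \<le> C2 * K" using * M2 by simp
      fix xs assume xs: "list_all2 (\<lambda>v (V, p). v \<in> V) xs B"
      let ?Q = "\<Prod>x\<leftarrow>xs. (1 + norm x) powr - M1"
      have Q: "0 \<le> ?Q" by (intro prod_list_nonneg) auto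
      have "Lp_qnorm (lebesgue_subspace V) p (\<lambda>x. f (x + sum_list xs)) \<le> ennreal (C2 * (K * ?Q))"
      proof (rule LP, intro conjI ballI)
        show "0 \<le> K * ?Q" using * Q by simp
        show "(\<lambda>x. f (x + sum_list xs)) \<in> borel_measurable (lebesgue_subspace V)"
          using * by (intro borel_measurable_lebesgue_subspace lower_semicont_borel lower_semicont_translate) auto
        fix x assume x: "x \<in> V"
        have "f (x + sum_list xs) \<le> ennreal (K * ((1 + norm x) powr - M * (\<Prod>x\<leftarrow>xs. (1 + norm x) powr - M)))"
          using * x xs by (auto simp: Vp dest!: spec[of _ "x # xs"])
        also have "\<dots> \<le> ennreal (K * ((1 + norm x) powr - M2 * ?Q))"
          using * M by (intro ennreal_leI mult_left_mono mult_mono prod_list_powr_antimono powr_mono) (auto intro!: prod_list_nonneg)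
        finally show "f (x + sum_list xs) \<le> ennreal (K * ?Q * (1 + norm x) powr - M2)" by (simp add: mult_ac)
      qed
      then show "Lp_qnorm (lebesgue_subspace V) p (\<lambda>x. f (x + sum_list xs)) \<le> ennreal (C2 * K * ?Q)" by (simp add: mult_ac)
    qed
    then show "mixed_qnorm (Vp # B) f \<le> ennreal (C1 * C2 * K)" by (simp add: Vp mult_ac)
  qed
qed

text \<open>By uniqueness of the decomposition the component maps are linear, hence bounded in
  finite dimension.\<close>

lemma mixed_space_component_bound:
  fixes B :: "'a::euclidean_space mixed_space"
  assumes B: "mixed_quasi_norm_space B"
  obtains A where "0 \<le> A" "\<And>xs x. list_all2 (\<lambda>v (V, p). v \<in> V) xs B \<Longrightarrow> x \<in> set xs \<Longrightarrow> norm x \<le> A * norm (sum_list xs)"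
proof -
  let ?D = "\<lambda>xs. list_all2 (\<lambda>v (V, p). v \<in> V) xs B"
  have ex1: "\<exists>!xs. ?D xs \<and> sum_list xs = x" for x using B by (simp add: mixed_quasi_norm_space_def)
  define X where "X x = (THE xs. ?D xs \<and> sum_list xs = x)" for x
  have X: "?D (X x)" "sum_list (X x) = x" for x using theI'[OF ex1[of x]] by (auto simp: X_def)
  have uniq: "X (sum_list xs) = xs" if "?D xs" for xs
    unfolding X_def using that ex1 by (intro the1_equality) auto
  have sub: "subspace V" if "(V, p) \<in> set B" for V p using B that by (auto simp: mixed_quasi_norm_space_def)
  have len: "length (X x) = length B" for x using X(1) by (rule list_all2_lengthD)
  have nthV: "X x ! i \<in> fst (B ! i)" if "i < length B" for x i
    using X(1)[of x] that by (auto simp: list_all2_conv_all_nth case_prod_unfold)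
  have subi: "subspace (fst (B ! i))" if "i < length B" for i
    using sub[of "fst (B ! i)" "snd (B ! i)"] that by simp
  have sl: "sum_list (map2 (\<lambda>x y. a *\<^sub>R x + b *\<^sub>R y) xs ys) = a *\<^sub>R sum_list xs + b *\<^sub>R sum_list ys"
    if "length xs = length ys" for a b and xs ys :: "'a list"
    using that by (induction xs ys rule: list_induct2) (auto simp: algebra_simps)
  have lin: "X (a *\<^sub>R x + b *\<^sub>R y) = map2 (\<lambda>x y. a *\<^sub>R x + b *\<^sub>R y) (X x) (X y)" for a b x y
  proof -
    have "?D (map2 (\<lambda>x y. a *\<^sub>R x + b *\<^sub>R y) (X x) (X y))"
      using nthV subi by (auto simp: list_all2_conv_all_nth len case_prod_unfold intro!: subspace_add subspace_scale)
    from uniq[OF this] show ?thesis by (simp add: sl len X(2))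
  qed
  have "\<exists>K\<ge>0. \<forall>x. norm (X x ! i) \<le> K * norm x" if i: "i < length B" for i
  proof -
    have "linear (\<lambda>x. X x ! i)"
    proof (rule linearI)
      show "X (x + y) ! i = X x ! i + X y ! i" for x y using lin[of 1 x 1 y] i by (simp add: len)
      show "X (c *\<^sub>R x) ! i = c *\<^sub>R (X x ! i)" for c x using lin[of c x 0 x] i by (simp add: len)
    qed
    then obtain K where "K > 0" "\<And>x. norm (X x ! i) \<le> K * norm x" using linear_bounded_pos by blast
    then show ?thesis by (intro exI[of _ K]) auto
  qed
  then obtain K where K: "\<And>i. i < length B \<Longrightarrow> 0 \<le> K i \<and> (\<forall>x. norm (X x ! i) \<le> K i * norm x)" by metis
  show ?thesis
  proof (rule that)
    show "0 \<le> (\<Sum>i<length B. K i)" using K by (intro sum_nonneg) auto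
    fix xs x assume xs: "?D xs" "x \<in> set xs"
    then obtain i where i: "i < length B" "x = xs ! i" using list_all2_lengthD[OF xs(1)] by (auto simp: in_set_conv_nth)
    have "norm x \<le> K i * norm (sum_list xs)" using K[OF i(1)] i uniq[OF xs(1)] by metis
    also have "\<dots> \<le> (\<Sum>i<length B. K i) * norm (sum_list xs)"
      using i K by (intro mult_right_mono member_le_sum) auto
    finally show "norm x \<le> (\<Sum>i<length B. K i) * norm (sum_list xs)" .
  qed
qed

lemma prod_list_decay_lower:
  assumes "\<And>x. x \<in> set xs \<Longrightarrow> 1 + norm x \<le> R" "0 < R" "0 \<le> M"
  shows "R powr (- M * real (length xs)) \<le> (\<Prod>x\<leftarrow>xs. (1 + norm x) powr - M)"
  using assms
proof (induction xs)
  case (Cons x xs)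
  have "R powr - M \<le> (1 + norm x) powr - M"
    using Cons.prems by (intro powr_mono2') (auto simp: add_pos_nonneg)
  moreover have "R powr (- M * real (length xs)) \<le> (\<Prod>x\<leftarrow>xs. (1 + norm x) powr - M)"
    using Cons.prems by (intro Cons.IH) auto
  ultimately have "R powr - M * R powr (- M * real (length xs)) \<le> (1 + norm x) powr - M * (\<Prod>x\<leftarrow>xs. (1 + norm x) powr - M)"
    by (intro mult_mono) auto
  then show ?case by (simp add: powr_add[symmetric] algebra_simps)
qed simp

text \<open>Each component is bounded by a multiple of \<open>norm z\<close>, so decay in
  \<open>norm z\<close> of order \<open>M\<close> times the number of components yields decay of
  order \<open>M\<close> in every component.\<close>

lemma mixed_qnorm_finite:
  fixes B :: "'a::euclidean_space mixed_space"
  assumes B: "mixed_quasi_norm_space B"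
  obtains N where "\<And>f K. lower_semicont f \<Longrightarrow> (\<And>z. f z \<le> ennreal (K * (1 + norm z) powr - N)) \<Longrightarrow> mixed_qnorm B f < \<infinity>"
proof -
  obtain M C where M: "0 \<le> M" "0 \<le> C" and U: "\<And>f K. lower_semicont f \<and> 0 \<le> K \<and>
     (\<forall>xs. list_all2 (\<lambda>v (V, p). v \<in> V) xs B \<longrightarrow> f (sum_list xs) \<le> ennreal (K * (\<Prod>x\<leftarrow>xs. (1 + norm x) powr - M)))
     \<Longrightarrow> mixed_qnorm B f \<le> ennreal (C * K)"
    using mixed_qnorm_upper_aux[of B] B unfolding mixed_quasi_norm_space_def by blast
  obtain A where A: "0 \<le> A" "\<And>xs x. list_all2 (\<lambda>v (V, p). v \<in> V) xs B \<Longrightarrow> x \<in> set xs \<Longrightarrow> norm x \<le> A * norm (sum_list xs)"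
    by (rule mixed_space_component_bound[OF B]) (rule that)
  define N where "N = M * real (length B)"
  show ?thesis
  proof (rule that)
    fix f :: "'a \<Rightarrow> ennreal" and K :: real
    assume f: "lower_semicont f" and bd: "\<And>z. f z \<le> ennreal (K * (1 + norm z) powr - N)"
    \<comment> \<open>\<open>K\<close> may be negative, in which case the bound counts as 0 in
      \<open>ennreal\<close>.\<close>
    define K' where "K' = max K 0 * (1 + A) powr N"
    have "mixed_qnorm B f \<le> ennreal (C * K')"
    proof (rule U, intro conjI allI impI f)
      show "0 \<le> K'" by (simp add: K'_def)
      fix xs assume xs: "list_all2 (\<lambda>v (V, p). v \<in> V) xs B"
      let ?z = "sum_list xs"
      have len: "length xs = length B" using xs by (rule list_all2_lengthD)
      have "((1 + A) * (1 + norm ?z)) powr (- M * real (length xs)) \<le> (\<Prod>x\<leftarrow>xs. (1 + norm x) powr - M)"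
      proof (rule prod_list_decay_lower)
        fix x assume "x \<in> set xs"
        with A(2)[OF xs] have "norm x \<le> A * norm ?z" by blast
        then show "1 + norm x \<le> (1 + A) * (1 + norm ?z)" using A(1) by (simp add: algebra_simps add_increasing)
      qed (use A M in \<open>auto simp: add_pos_nonneg\<close>)
      then have 1: "(1 + norm ?z) powr - N \<le> (1 + A) powr N * (\<Prod>x\<leftarrow>xs. (1 + norm x) powr - M)"
      proof -
        have pos: "0 < 1 + A" "0 < 1 + norm ?z" using A(1) by (auto simp: add_pos_nonneg)
        then have "(1 + A) powr - N * (1 + norm ?z) powr - N = ((1 + A) * (1 + norm ?z)) powr (- M * real (length xs))"
          by (subst powr_mult) (auto simp: N_def len)
        also have "\<dots> \<le> (\<Prod>x\<leftarrow>xs. (1 + norm x) powr - M)" by fact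
        finally have "(1 + A) powr N * ((1 + A) powr - N * (1 + norm ?z) powr - N) \<le> (1 + A) powr N * (\<Prod>x\<leftarrow>xs. (1 + norm x) powr - M)"
          by (rule mult_left_mono) simp
        moreover have "(1 + A) powr N * ((1 + A) powr - N * (1 + norm ?z) powr - N) = (1 + norm ?z) powr - N"
          using pos by (simp add: powr_add[symmetric] mult.assoc[symmetric])
        ultimately show ?thesis by simp
      qed
      have "f ?z \<le> ennreal (K * (1 + norm ?z) powr - N)" by (rule bd)
      also have "\<dots> \<le> ennreal (max K 0 * ((1 + A) powr N * (\<Prod>x\<leftarrow>xs. (1 + norm x) powr - M)))"
        by (intro ennreal_leI mult_mono 1) auto
      finally show "f ?z \<le> ennreal (K' * (\<Prod>x\<leftarrow>xs. (1 + norm x) powr - M))" by (simp add: K'_def mult.assoc)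
    qed
    then show "mixed_qnorm B f < \<infinity>" by (simp add: order.strict_trans1)
  qed
qed

section \<open>Modulation spaces and the union over all weights\<close>

lemma continuous_on_STFT: "u \<in> GS_dual (1/2) \<Longrightarrow> continuous_on UNIV (STFT u)"
proof -
  assume u: "u \<in> GS_dual (1/2)"
  have "STFT u = (\<lambda>z. complex_of_real ((2 * pi) powr (- real CARD('a) / 2)) * u (tf_shift (fst z) (snd z)))"
    by (rule ext) (metis STFT_eq prod.collapse)
  then show ?thesis by (simp only:) (intro continuous_intros continuous_on_GS_dual_tf_shift u)
qed

text \<open>For exponents below \<open>1\<close> there is no Hoelder inequality. Instead, choose a point maximizing \<open>|V u|\<close>
  times a power of the distance to the boundary of the unit ball; around it \<open>STFT_local_estimate\<close> keeps \<open>|V u|\<close> large on a ball of controlled radius.\<close>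

lemma STFT_le_mixed_qnorm:
  fixes B :: "((real^'d::finite) \<times> (real^'d)) mixed_space"
  assumes B: "mixed_quasi_norm_space B"
  obtains c where "0 < c" "\<And>u \<omega> z m. u \<in> GS_dual (1/2) \<Longrightarrow> 0 \<le> m \<Longrightarrow> (\<And>p. dist p z \<le> 1 \<Longrightarrow> m \<le> \<omega> p) \<Longrightarrow>
    ennreal (c * m * norm (STFT u z)) \<le> mixed_qnorm B (\<lambda>p. ennreal (norm (STFT u p * complex_of_real (\<omega> p))))"
proof -
  obtain c N where c: "0 < c" "0 \<le> N" and lower: "\<And>f t z \<rho>. 0 \<le> t \<Longrightarrow> 0 < \<rho> \<Longrightarrow> \<rho> \<le> 1 \<Longrightarrow> (\<And>x. dist x z < \<rho> \<Longrightarrow> ennreal t \<le> f x) \<Longrightarrow>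
     ennreal (c * t * \<rho> powr N) \<le> mixed_qnorm B f"
    using mixed_qnorm_lower[OF B] by blast
  \<comment> \<open>The exponent \<open>n\<close> is a natural number not below \<open>N\<close>.
    Being positive, it makes \<open>A\<close> vanish on the boundary sphere, which puts the maximum
    inside the ball.\<close>
  obtain n0 :: nat where "N \<le> real n0" using real_arch_simple by blast
  define n where "n = Suc n0"
  have n: "N \<le> real n" "0 < n" using \<open>N \<le> real n0\<close> by (auto simp: n_def)
  \<comment> \<open>Chosen so that the local estimate, applied at distance
    \<open>\<kappa> * \<rho>\<close> with the bound \<open>2 ^ n * S w\<close>, loses
    \<open>S w / 2\<close>.\<close>
  define \<kappa> where "\<kappa> = 1 / (8 * 2 ^ n :: real)"
  have \<kappa>: "0 < \<kappa>" "\<kappa> \<le> 1/2" by (auto simp: \<kappa>_def divide_simps) (use one_le_power[of "2::real" n] in linarith)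
  show ?thesis
  proof (rule that)
    show "0 < c * \<kappa> ^ n / (4 * 2 ^ n)" using c \<kappa> by simp
    fix u :: "(real^'d \<Rightarrow> complex) \<Rightarrow> complex" and \<omega> :: "(real^'d) \<times> (real^'d) \<Rightarrow> real" and z :: "(real^'d) \<times> (real^'d)" and m :: real
    assume u: "u \<in> GS_dual (1/2)" and m: "0 \<le> m" and \<omega>: "\<And>p. dist p z \<le> 1 \<Longrightarrow> m \<le> \<omega> p"
    define S where "S p = norm (STFT u p)" for p
    show "ennreal (c * \<kappa> ^ n / (4 * 2 ^ n) * m * norm (STFT u z)) \<le> mixed_qnorm B (\<lambda>p. ennreal (norm (STFT u p * complex_of_real (\<omega> p))))"
    proof (cases "S z = 0")
      case False
      then have Sz: "0 < S z" by (simp add: S_def)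
      define A where "A p = S p * (1 - dist p z) ^ n" for p
      have "continuous_on (cball z 1) A"
        unfolding A_def S_def
        by (intro continuous_intros continuous_on_subset[OF continuous_on_STFT[OF u]]) auto
      then obtain w where w: "w \<in> cball z 1" "\<And>p. p \<in> cball z 1 \<Longrightarrow> A p \<le> A w"
        using continuous_attains_sup[of "cball z 1" A] by auto
      have "A z = S z" by (simp add: A_def)
      then have Aw: "S z \<le> A w" using w(2)[of z] by simp
      have dw: "dist w z < 1"
      proof (rule ccontr)
        assume "\<not> dist w z < 1"
        then have "A w = 0" using w(1) n(2) by (simp add: A_def dist_commute)
        with Aw Sz show False by simp
      qed
      \<comment> \<open>Half the distance to the boundary: on this ball \<open>1 - dist p z\<close>
        is still at least \<rho>, so maximality of \<open>A w\<close> bounds \<open>S\<close> by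
        \<open>2 ^ n * S w\<close>.\<close>
      define \<rho> where "\<rho> = (1 - dist w z) / 2"
      have \<rho>: "0 < \<rho>" "\<rho> \<le> 1" using dw zero_le_dist[of w z] by (simp_all add: \<rho>_def del: zero_le_dist)
      have in1: "dist p z \<le> 1 - \<rho>" if "dist p w \<le> \<rho>" for p
        using dist_triangle[of p z w] that unfolding \<rho>_def by (simp add: field_simps)
      have "2 * \<rho> = 1 - dist w z" by (simp add: \<rho>_def)
      then have Aw2: "A w = S w * (2 * \<rho>) ^ n" by (simp only: A_def)
      have bd: "norm (STFT u p) \<le> 2 ^ n * S w" if "dist p w \<le> \<rho>" for p
      proof -
        have "S p * \<rho> ^ n \<le> A p" unfolding A_def
          using in1[OF that] \<rho> by (intro mult_left_mono power_mono) (auto simp: S_def)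
        also have "\<dots> \<le> A w" using in1[OF that] \<rho> by (intro w(2)) (auto simp: dist_commute)
        also have "\<dots> = (2 ^ n * S w) * \<rho> ^ n" by (simp add: Aw2 power_mult_distrib)
        finally show ?thesis using \<rho> by (simp add: S_def)
      qed
      have low: "S w / 4 \<le> S p" if p: "dist p w < \<kappa> * \<rho>" for p
      proof -
        have "\<kappa> * \<rho> \<le> 1/2 * \<rho>" using \<kappa> \<rho> by (intro mult_right_mono) auto
        then have "dist p w \<le> \<rho> / 2" using p by simp
        then have 1: "S w - 4 * (2 ^ n * S w) / \<rho> * dist p w \<le> 2 * S p"
          unfolding S_def using STFT_local_estimate[OF u \<rho> bd] by (simp add: S_def)
        have "4 * (2 ^ n * S w) / \<rho> * dist p w \<le> 4 * (2 ^ n * S w) / \<rho> * (\<kappa> * \<rho>)"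
          using p \<rho> by (intro mult_left_mono) (auto simp: S_def)
        also have "\<dots> = S w / 2" using \<rho> by (simp add: \<kappa>_def)
        finally show ?thesis using 1 by simp
      qed
      have "ennreal (c * (S w / 4 * m) * (\<kappa> * \<rho>) powr N) \<le> mixed_qnorm B (\<lambda>p. ennreal (norm (STFT u p * complex_of_real (\<omega> p))))"
      proof (rule lower)
        show "0 \<le> S w / 4 * m" using m by (simp add: S_def)
        show "0 < \<kappa> * \<rho>" using \<kappa> \<rho> by simp
        show "\<kappa> * \<rho> \<le> 1" using \<kappa> \<rho> mult_mono[of \<kappa> 1 \<rho> 1] by simp
        fix p assume p: "dist p w < \<kappa> * \<rho>"
        have "\<kappa> * \<rho> \<le> 1 * \<rho>" using \<kappa> \<rho> by (intro mult_right_mono) auto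
        then have "dist p w \<le> \<rho>" using p by linarith
        then have "dist p z \<le> 1" using in1[of p] \<rho> by linarith
        then have "m \<le> \<omega> p" by (rule \<omega>)
        then have "S w / 4 * m \<le> S p * \<omega> p" using low[OF p] m by (intro mult_mono) (auto simp: S_def)
        also have "\<dots> \<le> norm (STFT u p * complex_of_real (\<omega> p))"
          by (simp add: norm_mult S_def mult_left_mono)
        finally show "ennreal (S w / 4 * m) \<le> ennreal (norm (STFT u p * complex_of_real (\<omega> p)))" by (rule ennreal_leI)
      qed
      \<comment> \<open>The power of \<rho> lost on the small ball is compensated by the one
        contained in \<open>A w\<close>; with \<open>S z \<le> A w\<close> the constant becomes
        independent of \<rho>.\<close>
      moreover have "c * \<kappa> ^ n / (4 * 2 ^ n) * m * S z \<le> c * (S w / 4 * m) * (\<kappa> * \<rho>) powr N"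
      proof -
        have "(\<kappa> * \<rho>) ^ n = (\<kappa> * \<rho>) powr real n" using \<kappa> \<rho> by (simp add: powr_realpow)
        also have "\<dots> \<le> (\<kappa> * \<rho>) powr N"
          using \<kappa> \<rho> n mult_mono[of \<kappa> 1 \<rho> 1] by (intro powr_mono') auto
        finally have 1: "(\<kappa> * \<rho>) ^ n \<le> (\<kappa> * \<rho>) powr N" .
        have "c * \<kappa> ^ n / (4 * 2 ^ n) * m * S z \<le> c * \<kappa> ^ n / (4 * 2 ^ n) * m * A w"
          using Aw c \<kappa> m by (intro mult_left_mono) auto
        also have "\<dots> = c * (S w / 4 * m) * (\<kappa> * \<rho>) ^ n"
          by (simp add: Aw2 power_mult_distrib)
        also have "\<dots> \<le> c * (S w / 4 * m) * (\<kappa> * \<rho>) powr N"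
          using 1 c m by (intro mult_left_mono) (auto simp: S_def)
        finally show ?thesis .
      qed
      ultimately show ?thesis unfolding S_def using ennreal_leI order.trans by blast
    qed (simp add: S_def)
  qed
qed

lemma exp_powr_decay:
  fixes r q N :: real
  assumes "0 < r" "0 < q"
  obtains K where "0 < K" "\<And>t. 0 \<le> t \<Longrightarrow> exp (- r * t powr q) \<le> K * (1 + t) powr - N"
proof -
  obtain H :: real where H: "1 \<le> H" "\<And>(t::real) n. 0 \<le> t \<Longrightarrow> t ^ n \<le> H ^ n * fact n powr (1/q) * exp (r * t powr (1 / (1/q)))"
    using power_le_powr_fact_exp[of r "1/q"] assms by fastforce
  obtain n :: nat where n: "N \<le> real n" using real_arch_simple by blast
  define K where "K = 2 ^ n * (1 + H ^ n * fact n powr (1/q))"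
  show ?thesis
  proof (rule that)
    show "0 < K" using H by (auto simp: K_def intro!: mult_pos_pos add_pos_nonneg)
    fix t :: real assume t: "0 \<le> t"
    have "(1 + t) powr N \<le> (1 + t) powr real n" using n t by (intro powr_mono) auto
    also have "\<dots> = (1 + t) ^ n" using t by (simp add: powr_realpow)
    also have "\<dots> \<le> 2 ^ n * (1 ^ n + t ^ n)" using t by (intro power_add_le) auto
    also have "\<dots> \<le> 2 ^ n * (exp (r * t powr q) + H ^ n * fact n powr (1/q) * exp (r * t powr q))"
      using H(2)[OF t, of n] assms by (intro mult_left_mono add_mono) auto
    also have "\<dots> = K * exp (r * t powr q)" by (simp add: K_def algebra_simps)
    finally have "(1 + t) powr N \<le> K * exp (r * t powr q)" .
    then show "exp (- r * t powr q) \<le> K * (1 + t) powr - N"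
      using t by (simp add: powr_minus exp_minus field_simps)
  qed
qed

lemma powr_add_le:
  fixes a b q :: real
  assumes "0 \<le> a" "0 \<le> b" "0 \<le> q"
  shows "(a + b) powr q \<le> 2 powr q * (a powr q + b powr q)"
proof -
  have "(a + b) powr q \<le> (2 * max a b) powr q" using assms by (intro powr_mono2) auto
  also have "\<dots> = 2 powr q * (max a b) powr q" using assms by (intro powr_mult)
  also have "\<dots> \<le> 2 powr q * (a powr q + b powr q)" by (intro mult_left_mono) (auto simp: max_def)
  finally show ?thesis .
qed

lemma norm_pair_le: "norm z \<le> norm (fst z) + norm (snd z)"
  by (metis norm_Pair_le prod.collapse)

lemma exp_phase_decay:
  fixes r q N :: real
  assumes r: "0 < r" and q: "0 < q"
  obtains K where "0 < K" "\<And>z :: 'a::real_normed_vector \<times> 'b::real_normed_vector. exp (- r * (norm (fst z) powr q + norm (snd z) powr q)) \<le> K * (1 + norm z) powr - N"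
proof -
  define r' where "r' = r / 2 powr q"
  have r': "0 < r'" using r by (simp add: r'_def)
  obtain K where K: "0 < K" "\<And>t. 0 \<le> t \<Longrightarrow> exp (- r' * t powr q) \<le> K * (1 + t) powr - N"
    by (rule exp_powr_decay[OF r' q, of N]) (rule that)
  show ?thesis
  proof (rule that[OF K(1)])
    fix z :: "'a \<times> 'b"
    have "norm z powr q \<le> (norm (fst z) + norm (snd z)) powr q"
      using q by (intro powr_mono2 norm_pair_le) auto
    also have "\<dots> \<le> 2 powr q * (norm (fst z) powr q + norm (snd z) powr q)"
      using q by (intro powr_add_le) auto
    finally have "r' * norm z powr q \<le> r' * (2 powr q * (norm (fst z) powr q + norm (snd z) powr q))"
      using r' by (intro mult_left_mono) auto
    also have "\<dots> = r * (norm (fst z) powr q + norm (snd z) powr q)" by (simp add: r'_def)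
    finally have "exp (- r * (norm (fst z) powr q + norm (snd z) powr q)) \<le> exp (- r' * norm z powr q)" by simp
    also have "\<dots> \<le> K * (1 + norm z) powr - N" by (rule K(2)) simp
    finally show "exp (- r * (norm (fst z) powr q + norm (snd z) powr q)) \<le> K * (1 + norm z) powr - N" .
  qed
qed

text \<open>Decay faster than every power serves all mixed quasi-norms at once, each of which asks
  for some finite order.\<close>

lemma modulation_spaceI:
  fixes B :: "((real^'d::finite) \<times> (real^'d)) mixed_space"
  assumes B: "mixed_quasi_norm_space B" and u: "u \<in> GS_dual (1/2)" and \<omega>: "continuous_on UNIV \<omega>"
    and bd: "\<And>N. \<exists>K. \<forall>z. norm (STFT u z) * \<bar>\<omega> z\<bar> \<le> K * (1 + norm z) powr - N"
  shows "u \<in> modulation_space \<omega> B"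
proof -
  obtain N where N: "\<And>f K. lower_semicont f \<Longrightarrow> (\<And>z. f z \<le> ennreal (K * (1 + norm z) powr - N)) \<Longrightarrow> mixed_qnorm B f < \<infinity>"
    using mixed_qnorm_finite[OF B] by blast
  obtain K where K: "\<And>z. norm (STFT u z) * \<bar>\<omega> z\<bar> \<le> K * (1 + norm z) powr - N" using bd by blast
  have "mixed_qnorm B (\<lambda>z. ennreal (norm (STFT u z * complex_of_real (\<omega> z)))) < \<infinity>"
  proof (rule N[where K = K])
    show "lower_semicont (\<lambda>z. ennreal (norm (STFT u z * complex_of_real (\<omega> z))))"
      by (intro lower_semicont_continuous continuous_on_ennreal continuous_intros continuous_on_STFT u \<omega>)
    show "ennreal (norm (STFT u z * complex_of_real (\<omega> z))) \<le> ennreal (K * (1 + norm z) powr - N)" for z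
      using K[of z] by (intro ennreal_leI) (simp add: norm_mult)
  qed
  with u show ?thesis by (simp add: modulation_space_def)
qed

text \<open>The infimum of affine functions with slopes \<open>1 / (n + 1)\<close> is sublinear, which is what makes
  \<open>exp (- \<kappa> (|z|\<^sup>2) - |z|)\<close> an admissible weight absorbing all the bounds defining \<^const>\<open>Upsilon\<close>.\<close>

lemma infimum_of_lines:
  fixes a :: "nat \<Rightarrow> real"
  assumes a: "\<And>n. 0 \<le> a n"
  defines "\<kappa> \<equiv> \<lambda>t. INF n. a n + t / (real n + 1)"
  shows "\<kappa> t \<le> a n + t / (real n + 1)" "0 \<le> t \<Longrightarrow> 0 \<le> \<kappa> t" "\<bar>\<kappa> t - \<kappa> t'\<bar> \<le> \<bar>t - t'\<bar>"
    "(\<And>n. b \<le> a n + t / (real n + 1)) \<Longrightarrow> b \<le> \<kappa> t"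
proof -
  have shrink: "\<bar>t / (real n + 1)\<bar> \<le> \<bar>t\<bar>" for t n
    using divide_left_mono[of 1 "real n + 1" "\<bar>t\<bar>"] by (simp add: abs_divide)
  have bdd: "bdd_below (range (\<lambda>n. a n + t / (real n + 1)))" for t
  proof (rule bdd_belowI2[where m = "- \<bar>t\<bar>"])
    fix n
    have "\<bar>t / (real n + 1)\<bar> \<le> \<bar>t\<bar>" by (rule shrink)
    then show "- \<bar>t\<bar> \<le> a n + t / (real n + 1)" using a[of n] by linarith
  qed
  show 1: "\<kappa> t \<le> a n + t / (real n + 1)" for t n unfolding \<kappa>_def by (rule cINF_lower[OF bdd]) simp
  show 2: "b \<le> \<kappa> t" if "\<And>n. b \<le> a n + t / (real n + 1)" for b t
    unfolding \<kappa>_def by (rule cINF_greatest) (use that in auto)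
  show "0 \<le> t \<Longrightarrow> 0 \<le> \<kappa> t" by (rule 2) (use a in \<open>auto intro!: add_nonneg_nonneg\<close>)
  have 3: "\<kappa> t - \<bar>t - t'\<bar> \<le> \<kappa> t'" for t t'
  proof (rule 2)
    fix n
    have "\<bar>(t - t') / (real n + 1)\<bar> \<le> \<bar>t - t'\<bar>" by (rule shrink)
    then show "\<kappa> t - \<bar>t - t'\<bar> \<le> a n + t' / (real n + 1)" using 1[of t n] by (simp add: diff_divide_distrib)
  qed
  show "\<bar>\<kappa> t - \<kappa> t'\<bar> \<le> \<bar>t - t'\<bar>" using 3[of t t'] 3[of t' t] by (simp add: abs_le_iff abs_minus_commute)
qed

text \<open>For \<open>norm y \<le> 1 / norm x\<close> the squared norms of \<open>x + y\<close> and
  \<open>x - y\<close> differ from that of \<open>x\<close> by at most 3. A Lipschitz function of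
  the squared norm therefore has exactly the regularity that \<open>PQ0\<close> demands.\<close>

lemma radial_weight_PQ0:
  fixes \<kappa> :: "real \<Rightarrow> real"
  assumes nonneg: "\<And>t. 0 \<le> t \<Longrightarrow> 0 \<le> \<kappa> t" and lip: "\<And>t t'. \<bar>\<kappa> t - \<kappa> t'\<bar> \<le> \<bar>t - t'\<bar>"
    and small: "\<And>e. 0 < e \<Longrightarrow> \<exists>A. \<forall>t\<ge>0. \<kappa> t \<le> A + e * t"
  defines "\<omega> \<equiv> \<lambda>z :: 'a::euclidean_space. exp (- \<kappa> ((norm z)\<^sup>2) - norm z)"
  shows "\<omega> \<in> PQ0" "rotation_invariant \<omega>" "continuous_on UNIV \<omega>"
proof -
  have "continuous_on UNIV \<kappa>"
    unfolding continuous_on_iff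
  proof (intro ballI allI impI)
    fix t e :: real assume "0 < e"
    then show "\<exists>d>0. \<forall>x'\<in>UNIV. dist x' t < d \<longrightarrow> dist (\<kappa> x') (\<kappa> t) < e"
      using lip by (intro exI[of _ e]) (auto simp: dist_real_def intro: order.strict_trans1)
  qed
  then have "continuous_on UNIV (\<lambda>z::'a. \<kappa> ((norm z)\<^sup>2))"
    by (rule continuous_on_compose2) (auto intro!: continuous_intros)
  then show cont: "continuous_on UNIV \<omega>" unfolding \<omega>_def by (intro continuous_intros)
  show "rotation_invariant \<omega>"
    by (auto simp: rotation_invariant_def \<omega>_def orthogonal_transformation_norm)
  have le1: "\<omega> z \<le> 1" for z using nonneg[of "(norm z)\<^sup>2"] norm_ge_zero[of z]
    unfolding \<omega>_def by (simp del: norm_ge_zero)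
  have "weight \<omega>"
    unfolding weight_def
  proof (intro conjI allI impI)
    show "0 < \<omega> x" for x by (simp add: \<omega>_def)
    show "\<omega> \<in> borel_measurable lebesgue"
      by (intro measurable_completion) (simp add: borel_measurable_continuous_onI[OF cont])
    show "\<exists>C. AE x in lebesgue. x \<in> K \<longrightarrow> \<omega> x \<le> C" for K using le1 by auto
    fix K :: "'a set" assume K: "compact K"
    show "\<exists>c>0. \<forall>x\<in>K. c \<le> \<omega> x"
    proof (cases "K = {}")
      case True then show ?thesis by (auto intro: exI[of _ 1])
    next
      case False
      obtain x where "x \<in> K" "\<And>y. y \<in> K \<Longrightarrow> \<omega> x \<le> \<omega> y"
        using continuous_attains_inf[OF K False continuous_on_subset[OF cont]] by auto
      then show ?thesis by (intro exI[of _ "\<omega> x"]) (auto simp: \<omega>_def)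
    qed
  qed
  \<comment> \<open>The constant \<open>exp 8\<close> arises because each of the two factors changes
    the exponent by at most 3 + 1.\<close>
  moreover have "\<exists>c>0. \<exists>C>0. \<forall>x y. 2 * c \<le> norm x \<and> norm y \<le> c / norm x \<longrightarrow>
        inverse C * (\<omega> x)\<^sup>2 \<le> \<omega> (x + y) * \<omega> (x - y) \<and> \<omega> (x + y) * \<omega> (x - y) \<le> C * (\<omega> x)\<^sup>2"
  proof (rule exI[of _ 1], rule conjI[OF zero_less_one], rule exI[of _ "exp 8"], rule conjI, simp, intro allI impI)
    fix x y :: 'a assume xy: "2 * 1 \<le> norm x \<and> norm y \<le> 1 / norm x"
    define L where "L z = \<kappa> ((norm z)\<^sup>2) + norm z" for z :: 'a
    have \<omega>L: "\<omega> z = exp (- L z)" for z by (simp add: \<omega>_def L_def)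
    have y: "norm x * norm y \<le> 1" "norm y \<le> 1"
    proof -
      have "0 < norm x" using xy by linarith
      then show "norm x * norm y \<le> 1" using xy by (simp add: pos_le_divide_eq mult.commute)
      have "1 / norm x \<le> 1" using xy by (simp add: divide_le_eq)
      then show "norm y \<le> 1" using xy by linarith
    qed
    have close: "\<bar>L (x + v) - L x\<bar> \<le> 4" if v: "norm v = norm y" for v
    proof -
      have "(norm (x + v))\<^sup>2 - (norm x)\<^sup>2 = 2 * (x \<bullet> v) + (norm v)\<^sup>2"
        by (simp add: power2_norm_eq_inner inner_add_left inner_add_right inner_commute)
      moreover have "\<bar>x \<bullet> v\<bar> \<le> 1" using Cauchy_Schwarz_ineq2[of x v] y v by simp
      moreover have "(norm v)\<^sup>2 \<le> 1" using v y by (simp add: power_le_one)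
      moreover have "0 \<le> (norm v)\<^sup>2" by simp
      ultimately have "\<bar>(norm (x + v))\<^sup>2 - (norm x)\<^sup>2\<bar> \<le> 3" by linarith
      then have "\<bar>\<kappa> ((norm (x + v))\<^sup>2) - \<kappa> ((norm x)\<^sup>2)\<bar> \<le> 3"
        using lip[of "(norm (x + v))\<^sup>2" "(norm x)\<^sup>2"] by linarith
      moreover have "\<bar>norm (x + v) - norm x\<bar> \<le> 1"
        using norm_triangle_ineq3[of "x + v" x] v y by simp
      ultimately show ?thesis unfolding L_def by linarith
    qed
    have "\<bar>L (x + y) - L x\<bar> \<le> 4" "\<bar>L (x - y) - L x\<bar> \<le> 4" using close[of y] close[of "- y"] by auto
    then have "- 8 - 2 * L x \<le> - L (x + y) - L (x - y)" "- L (x + y) - L (x - y) \<le> 8 - 2 * L x" by linarith+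
    moreover have "\<omega> (x + y) * \<omega> (x - y) = exp (- L (x + y) - L (x - y))" by (simp add: \<omega>L flip: exp_add)
    moreover have "inverse (exp 8) * (\<omega> x)\<^sup>2 = exp (- 8 - 2 * L x)" "exp 8 * (\<omega> x)\<^sup>2 = exp (8 - 2 * L x)"
      by (simp_all add: \<omega>L exp_minus[symmetric] power2_eq_square mult_exp_exp)
    ultimately show "inverse (exp 8) * (\<omega> x)\<^sup>2 \<le> \<omega> (x + y) * \<omega> (x - y) \<and> \<omega> (x + y) * \<omega> (x - y) \<le> exp 8 * (\<omega> x)\<^sup>2" by simp
  qed
  moreover have "\<exists>C>0. \<forall>x. inverse C * exp (- c * (norm x)\<^sup>2) \<le> \<omega> x \<and> \<omega> x \<le> C * exp (c * (norm x)\<^sup>2)" if c: "0 < c" for c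
  proof -
    \<comment> \<open>Half of \<open>c\<close> pays for \<kappa>, the other half for the linear term
      \<open>norm x\<close>.\<close>
    obtain A where A: "\<And>t. 0 \<le> t \<Longrightarrow> \<kappa> t \<le> A + c/2 * t" using small[of "c/2"] c by auto
    define D where "D = max A 0 + 1 / (2 * c)"
    have D: "0 \<le> D" "A + 1 / (2 * c) \<le> D" using c by (auto simp: D_def)
    show ?thesis
    proof (intro exI[of _ "exp D"] conjI allI)
      fix x :: 'a
      have "1 * norm x \<le> 1\<^sup>2 / (4 * (c/2)) + c/2 * (norm x)\<^sup>2" using c by (intro linear_le_quadratic) auto
      then have "\<kappa> ((norm x)\<^sup>2) + norm x \<le> D + c * (norm x)\<^sup>2"
        using A[of "(norm x)\<^sup>2"] D(2) by simp
      then show "inverse (exp D) * exp (- c * (norm x)\<^sup>2) \<le> \<omega> x"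
        by (simp add: \<omega>_def exp_minus[symmetric] mult_exp_exp)
      have "\<omega> x \<le> 1 * 1" using le1 by simp
      also have "\<dots> \<le> exp D * exp (c * (norm x)\<^sup>2)" using D c by (intro mult_mono) auto
      finally show "\<omega> x \<le> exp D * exp (c * (norm x)\<^sup>2)" .
    qed simp
  qed
  ultimately show "\<omega> \<in> PQ0" by (simp add: PQ0_def)
qed

lemma union_modulation_spaces:
  fixes B :: "((real^'d::finite) \<times> (real^'d)) mixed_space"
  assumes B: "mixed_quasi_norm_space B"
  shows "(\<Union>\<omega>\<in>{\<omega> \<in> PQ0. rotation_invariant \<omega>}. modulation_space \<omega> B) = Upsilon"
proof
  show "(\<Union>\<omega>\<in>{\<omega> \<in> PQ0. rotation_invariant \<omega>}. modulation_space \<omega> B) \<subseteq> Upsilon"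
    by (auto simp: Upsilon_eq_GS_dual modulation_space_def)
  show "Upsilon \<subseteq> (\<Union>\<omega>\<in>{\<omega> \<in> PQ0. rotation_invariant \<omega>}. modulation_space \<omega> B)"
  proof
    fix u :: "(real^'d \<Rightarrow> complex) \<Rightarrow> complex" assume "u \<in> Upsilon"
    then have u: "u \<in> GS_dual (1/2)" and bd: "\<And>\<epsilon>. 0 < \<epsilon> \<Longrightarrow> \<exists>C>0. \<forall>x \<xi>. norm (STFT u (x, \<xi>)) \<le> C * exp (\<epsilon> * ((norm x)\<^sup>2 + (norm \<xi>)\<^sup>2))"
      by (auto simp: Upsilon_def)
    \<comment> \<open>The countably many rates \<open>1 / (n + 1)\<close> suffice, and enlarging the
      constants makes every \<open>a n\<close> nonnegative.\<close>
    have "\<exists>a\<ge>0. \<forall>z. norm (STFT u z) \<le> exp (a + (norm z)\<^sup>2 / (real n + 1))" for n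
    proof -
      obtain C where C: "C > 0" "\<And>x \<xi>. norm (STFT u (x, \<xi>)) \<le> C * exp (1 / (real n + 1) * ((norm x)\<^sup>2 + (norm \<xi>)\<^sup>2))"
        using bd[of "1 / (real n + 1)"] by auto
      show ?thesis
      proof (intro exI[of _ "max 0 (ln C)"] conjI allI)
        fix z :: "(real^'d) \<times> (real^'d)"
        have "norm (STFT u z) \<le> exp (ln C) * exp ((norm z)\<^sup>2 / (real n + 1))"
          using C(2)[of "fst z" "snd z"] C(1) by (simp add: norm_prod_def)
        also have "\<dots> \<le> exp (max 0 (ln C)) * exp ((norm z)\<^sup>2 / (real n + 1))" by (intro mult_right_mono) auto
        finally show "norm (STFT u z) \<le> exp (max 0 (ln C) + (norm z)\<^sup>2 / (real n + 1))" by (simp add: exp_add)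
      qed simp
    qed
    then obtain a where a: "\<And>n. 0 \<le> a n" and ab: "\<And>n z. norm (STFT u z) \<le> exp (a n + (norm z)\<^sup>2 / (real n + 1))"
      by metis
    define \<kappa> where "\<kappa> t = (INF n. a n + t / (real n + 1))" for t
    note \<kappa> = infimum_of_lines[of a, OF a, folded \<kappa>_def]
    define \<omega> where "\<omega> = (\<lambda>z :: (real^'d) \<times> (real^'d). exp (- \<kappa> ((norm z)\<^sup>2) - norm z))"
    have small: "\<exists>A. \<forall>t\<ge>0. \<kappa> t \<le> A + e * t" if e: "0 < e" for e
    proof -
      obtain n where n: "inverse (real (Suc n)) < e" using reals_Archimedean[OF e] by blast
      have "\<kappa> t \<le> a n + e * t" if "0 \<le> t" for t
      proof -
        have "inverse (real (Suc n)) * t \<le> e * t" using n that by (intro mult_right_mono) auto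
        then show ?thesis using \<kappa>(1)[of t n] by (simp add: divide_inverse mult.commute add.commute)
      qed
      then show ?thesis by blast
    qed
    have w: "\<omega> \<in> PQ0" "rotation_invariant \<omega>" "continuous_on UNIV \<omega>"
      unfolding \<omega>_def using radial_weight_PQ0[of \<kappa>, OF \<kappa>(2) \<kappa>(3) small] by auto
    \<comment> \<open>The infimum over all bounds is again a bound for \<open>|V u|\<close>; the
      extra factor \<open>exp (- norm z)\<close> in the weight then makes the quasi-norm
      finite.\<close>
    have S: "norm (STFT u z) * \<bar>\<omega> z\<bar> \<le> exp (- norm z)" for z
    proof -
      have "norm (STFT u z) \<le> exp (\<kappa> ((norm z)\<^sup>2))"
      proof (cases "STFT u z = 0")
        case False
        have "ln (norm (STFT u z)) \<le> \<kappa> ((norm z)\<^sup>2)"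
        proof (rule \<kappa>(4))
          show "ln (norm (STFT u z)) \<le> a n + (norm z)\<^sup>2 / (real n + 1)" for n
            using ln_le_cancel_iff[of "norm (STFT u z)" "exp (a n + (norm z)\<^sup>2 / (real n + 1))"] ab[where z=z and n=n] False by simp
        qed
        then show ?thesis using False by (metis exp_le_cancel_iff exp_ln zero_less_norm_iff)
      qed simp
      then have "norm (STFT u z) * \<bar>\<omega> z\<bar> \<le> exp (\<kappa> ((norm z)\<^sup>2)) * exp (- \<kappa> ((norm z)\<^sup>2) - norm z)"
        unfolding \<omega>_def by (intro mult_mono) auto
      also have "\<dots> = exp (- norm z)" by (simp flip: exp_add)
      finally show ?thesis .
    qed
    have "u \<in> modulation_space \<omega> B"
    proof (rule modulation_spaceI[OF B u w(3)])
      fix N :: real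
      obtain K :: real where K: "\<And>t. 0 \<le> t \<Longrightarrow> exp (- 1 * t powr 1) \<le> K * (1 + t) powr - N"
        using exp_powr_decay[of 1 1 N] by auto
      then have "norm (STFT u z) * \<bar>\<omega> z\<bar> \<le> K * (1 + norm z) powr - N" for z
        using order.trans[OF S[of z], of "K * (1 + norm z) powr - N"] K[of "norm z"] by simp
      then show "\<exists>K. \<forall>z. norm (STFT u z) * \<bar>\<omega> z\<bar> \<le> K * (1 + norm z) powr - N" by blast
    qed
    with w show "u \<in> (\<Union>\<omega>\<in>{\<omega> \<in> PQ0. rotation_invariant \<omega>}. modulation_space \<omega> B)" by blast
  qed
qed

section \<open>Fourier inversion\<close>

lemma decay_le_prod_Basis:
  fixes z :: "'a::euclidean_space"
  assumes "2 * real DIM('a) \<le> N"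
  shows "(1 + norm z) powr - N \<le> (\<Prod>b\<in>Basis. inverse (1 + (z \<bullet> b)\<^sup>2))"
proof -
  have pos: "0 < 1 + norm z" by (simp add: add_pos_nonneg)
  have zb: "1 + (z \<bullet> b)\<^sup>2 \<le> (1 + norm z)\<^sup>2" if "b \<in> Basis" for b
  proof -
    have "\<bar>z \<bullet> b\<bar>\<^sup>2 \<le> (norm z)\<^sup>2" using Basis_le_norm[OF that, of z] by (intro power_mono) auto
    then show ?thesis by (simp add: power2_sum add_increasing2)
  qed
  have "(1 + norm z) powr - N \<le> (1 + norm z) powr - real (2 * DIM('a))"
    using assms by (intro powr_mono) auto
  also have "\<dots> = (\<Prod>b\<in>(Basis :: 'a set). inverse ((1 + norm z)\<^sup>2))"
    unfolding powr_minus powr_realpow[OF pos] by (simp add: power_mult power_inverse)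
  also have "\<dots> \<le> (\<Prod>b\<in>Basis. inverse (1 + (z \<bullet> b)\<^sup>2))"
    using zb by (intro prod_mono conjI le_imp_inverse_le) (auto simp: add_pos_nonneg)
  finally show ?thesis .
qed

text \<open>Two powers per dimension allow comparison with a product of functions
  \<open>1 / (1 + x\<^sup>2)\<close>. The threshold is crude, but decay of any polynomial order is
  at hand where it is applied.\<close>

lemma integrable_lborel_decay:
  fixes f :: "'a::euclidean_space \<Rightarrow> 'b::{banach, second_countable_topology}"
  assumes "f \<in> borel_measurable borel" "\<And>z. norm (f z) \<le> K * (1 + norm z) powr - N" "2 * real DIM('a) \<le> N"
  shows "integrable lborel f"
proof -
  have K: "0 \<le> K" using order.trans[OF norm_ge_zero assms(2)[of 0]] by simp
  have "(\<integral>\<^sup>+ z. ennreal (norm (f z)) \<partial>lborel) \<le> (\<integral>\<^sup>+ z. ennreal K * (\<Prod>b\<in>(Basis :: 'a set). ennreal (inverse (1 + (z \<bullet> b)\<^sup>2))) \<partial>lborel)"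
  proof (rule nn_integral_mono)
    fix z :: 'a
    have "(\<Prod>b\<in>(Basis :: 'a set). ennreal (inverse (1 + (z \<bullet> b)\<^sup>2))) = ennreal (\<Prod>b\<in>Basis. inverse (1 + (z \<bullet> b)\<^sup>2))"
      by (rule prod_ennreal) simp
    moreover have "norm (f z) \<le> K * (\<Prod>b\<in>Basis. inverse (1 + (z \<bullet> b)\<^sup>2))"
      using decay_le_prod_Basis[OF assms(3), of z] K by (intro order.trans[OF assms(2)] mult_left_mono) auto
    ultimately show "ennreal (norm (f z)) \<le> ennreal K * (\<Prod>b\<in>Basis. ennreal (inverse (1 + (z \<bullet> b)\<^sup>2)))"
      using K by (simp only: ennreal_mult[symmetric] prod_nonneg ennreal_leI inverse_nonnegative_iff_nonnegative add_nonneg_nonneg zero_le_one zero_le_power2)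
  qed
  also have "\<dots> = ennreal K * (\<Prod>b\<in>(Basis :: 'a set). \<integral>\<^sup>+ x. ennreal (inverse (1 + x\<^sup>2)) \<partial>lborel)"
  proof (subst nn_integral_cmult)
    show "ennreal K * (\<integral>\<^sup>+ z. (\<Prod>b\<in>(Basis :: 'a set). ennreal (inverse (1 + (z \<bullet> b)\<^sup>2))) \<partial>lborel) =
        ennreal K * (\<Prod>b\<in>(Basis :: 'a set). \<integral>\<^sup>+ x. ennreal (inverse (1 + x\<^sup>2)) \<partial>lborel)"
      by (subst nn_integral_lborel_prod[where f = "\<lambda>_ x. ennreal (inverse (1 + x\<^sup>2))"]) auto
  qed measurable
  also have "\<dots> < \<infinity>"
    using nn_integral_inverse_1_plus_square_finite by (simp add: power_less_top_ennreal ennreal_mult_less_top)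
  finally show ?thesis using assms(1) by (simp add: integrable_iff_bounded)
qed

lemma integrable_pair_mult:
  fixes f :: "'a::euclidean_space \<Rightarrow> complex" and g :: "'b::euclidean_space \<Rightarrow> complex"
  assumes [measurable]: "integrable lborel f" "integrable lborel g"
  shows "integrable (lborel \<Otimes>\<^sub>M lborel) (\<lambda>(x, y). f x * g y)"
proof (rule lborel_pair.Fubini_integrable)
  have "integrable lborel (\<lambda>x. norm (f x) * (\<integral>y. norm (g y) \<partial>lborel))"
    using assms by (intro integrable_mult_left integrable_norm)
  then show "integrable lborel (\<lambda>x. \<integral>y. norm (case (x, y) of (x, y) \<Rightarrow> f x * g y) \<partial>lborel)"
    by (simp add: norm_mult)
  show "AE x in lborel. integrable lborel (\<lambda>y. case (x, y) of (x, y) \<Rightarrow> f x * g y)"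
    using assms by (auto intro: integrable_mult_right)
qed measurable

lemma lborel_integral_affine:
  fixes f :: "'a::euclidean_space \<Rightarrow> complex"
  assumes [measurable]: "f \<in> borel_measurable borel" and c: "c \<noteq> 0"
  shows "integral\<^sup>L lborel f = complex_of_real (\<bar>c\<bar> ^ DIM('a)) * (\<integral>x. f (t + c *\<^sub>R x) \<partial>lborel)"
proof -
  have "integral\<^sup>L lborel f = integral\<^sup>L (density (distr lborel borel (\<lambda>x. t + c *\<^sub>R x)) (\<lambda>_. ennreal (\<bar>c\<bar> ^ DIM('a)))) f"
    using lborel_affine[OF c, of t] by (simp add: ennreal_power)
  also have "\<dots> = complex_of_real (\<bar>c\<bar> ^ DIM('a)) * (\<integral>x. f (t + c *\<^sub>R x) \<partial>lborel)"
    by (subst integral_density) (auto simp: integral_distr scaleR_conv_of_real)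
  finally show ?thesis .
qed

lemma integrable_gauss1: "integrable lborel (\<lambda>x::real. iexp (t * x) * complex_of_real (exp (- x\<^sup>2 / 2)))"
proof -
  have "integrable lborel (\<lambda>x. exp (- x\<^sup>2 / 2) :: real)"
  proof -
    have "integrable lborel (\<lambda>x. sqrt (2 * pi) * std_normal_density x)"
      using integrable_normal_density[of 1 0] by (intro integrable_mult_right) simp
    then show ?thesis by (simp add: std_normal_density_def)
  qed
  then show ?thesis by (rule Bochner_Integration.integrable_bound) (auto simp: norm_mult)
qed

text \<open>Read off from the characteristic function of the standard normal distribution.\<close>

lemma integral_gauss1:
  "(\<integral>x. iexp (t * x) * complex_of_real (exp (- x\<^sup>2 / 2)) \<partial>(lborel :: real measure)) = complex_of_real (sqrt (2 * pi) * exp (- t\<^sup>2 / 2))"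
proof -
  have "complex_of_real (exp (- t\<^sup>2 / 2)) = char std_normal_distribution t"
    by (simp add: char_std_normal_distribution)
  also have "\<dots> = (\<integral>x. std_normal_density x *\<^sub>R iexp (t * x) \<partial>lborel)"
    unfolding char_def by (subst integral_density) auto
  also have "\<dots> = (\<integral>x. complex_of_real (1 / sqrt (2 * pi)) * (iexp (t * x) * complex_of_real (exp (- x\<^sup>2 / 2))) \<partial>lborel)"
    by (intro Bochner_Integration.integral_cong) (auto simp: std_normal_density_def scaleR_conv_of_real)
  also have "\<dots> = complex_of_real (1 / sqrt (2 * pi)) * (\<integral>x. iexp (t * x) * complex_of_real (exp (- x\<^sup>2 / 2)) \<partial>lborel)"
    by (rule Bochner_Integration.integral_mult_right_zero)
  finally have "complex_of_real (sqrt (2 * pi)) * complex_of_real (exp (- t\<^sup>2 / 2)) =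
     (complex_of_real (sqrt (2 * pi)) * complex_of_real (1 / sqrt (2 * pi))) * (\<integral>x. iexp (t * x) * complex_of_real (exp (- x\<^sup>2 / 2)) \<partial>lborel)"
    by simp
  also have "complex_of_real (sqrt (2 * pi)) * complex_of_real (1 / sqrt (2 * pi)) = 1"
    by (simp flip: of_real_mult)
  finally show ?thesis by simp
qed

lemma gauss_fourier:
  fixes \<tau> :: "'a::euclidean_space"
  shows "integrable lborel (\<lambda>\<xi>. iexp (\<tau> \<bullet> \<xi>) * complex_of_real (exp (- (norm \<xi>)\<^sup>2 / 2)))" (is ?I)
    and "(\<integral>\<xi>. iexp (\<tau> \<bullet> \<xi>) * complex_of_real (exp (- (norm \<xi>)\<^sup>2 / 2)) \<partial>lborel) =
      complex_of_real (sqrt (2 * pi) ^ DIM('a) * exp (- (norm \<tau>)\<^sup>2 / 2))" (is ?E)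
proof -
  interpret product_sigma_finite "\<lambda>b::'a. lborel :: real measure" ..
  let ?f = "\<lambda>(b::'a) x. iexp ((\<tau> \<bullet> b) * x) * complex_of_real (exp (- x\<^sup>2 / 2))"
  let ?L = "\<lambda>c. \<Sum>b\<in>Basis. c b *\<^sub>R (b::'a)"
  have eq: "iexp (\<tau> \<bullet> \<xi>) * complex_of_real (exp (- (norm \<xi>)\<^sup>2 / 2)) = (\<Prod>b\<in>Basis. ?f b (\<xi> \<bullet> b))" for \<xi> :: 'a
  proof -
    have "(norm \<xi>)\<^sup>2 = (\<Sum>b\<in>Basis. (\<xi> \<bullet> b)\<^sup>2)"
      unfolding power2_norm_eq_inner euclidean_inner[of \<xi> \<xi>] by (simp add: power2_eq_square)
    then have 1: "exp (- (norm \<xi>)\<^sup>2 / 2) = (\<Prod>b\<in>Basis. exp (- (\<xi> \<bullet> b)\<^sup>2 / 2))"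
      by (simp add: exp_sum[symmetric] sum_negf sum_divide_distrib)
    have 2: "iexp (\<tau> \<bullet> \<xi>) = (\<Prod>b\<in>Basis. iexp ((\<tau> \<bullet> b) * (\<xi> \<bullet> b)))"
      unfolding euclidean_inner[of \<tau> \<xi>] by (simp add: exp_sum[symmetric] sum_distrib_left)
    show ?thesis unfolding 1 2 by (simp add: prod.distrib)
  qed
  have eqL: "(\<Prod>b\<in>Basis. ?f b (?L c \<bullet> b)) = (\<Prod>b\<in>Basis. ?f b (c b))" for c :: "'a \<Rightarrow> real"
    by (intro prod.cong) (auto simp: inner_sum_left inner_Basis if_distrib cong: if_cong)
  have int: "integrable (\<Pi>\<^sub>M b\<in>Basis. lborel) (\<lambda>c. \<Prod>b\<in>(Basis::'a set). ?f b (c b))"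
    by (rule product_integrable_prod, simp, rule integrable_gauss1)
  have m: "(\<lambda>\<xi>::'a. \<Prod>b\<in>Basis. ?f b (\<xi> \<bullet> b)) \<in> borel_measurable borel" by measurable
  show ?I
    unfolding eq by (subst lborel_eq, subst integrable_distr_eq) (use m int in \<open>auto simp: eqL\<close>)
  have "(\<integral>\<xi>. (\<Prod>b\<in>Basis. ?f b (\<xi> \<bullet> b)) \<partial>lborel) = (\<integral>c. (\<Prod>b\<in>(Basis::'a set). ?f b (c b)) \<partial>(\<Pi>\<^sub>M b\<in>Basis. lborel))"
    by (subst lborel_eq, subst integral_distr) (use m in \<open>auto simp: eqL\<close>)
  also have "\<dots> = (\<Prod>b\<in>(Basis::'a set). \<integral>x. ?f b x \<partial>lborel)"
    by (rule product_integral_prod, simp, rule integrable_gauss1)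
  also have "\<dots> = (\<Prod>b\<in>(Basis::'a set). complex_of_real (sqrt (2 * pi) * exp (- (\<tau> \<bullet> b)\<^sup>2 / 2)))"
    by (simp only: integral_gauss1)
  also have "\<dots> = complex_of_real (sqrt (2 * pi) ^ DIM('a) * exp (\<Sum>b\<in>Basis. - (\<tau> \<bullet> b)\<^sup>2 / 2))"
    unfolding exp_sum[OF finite_Basis] by (simp add: prod.distrib)
  also have "(\<Sum>b\<in>Basis. - (\<tau> \<bullet> b)\<^sup>2 / 2) = - (norm \<tau>)\<^sup>2 / 2"
    unfolding power2_norm_eq_inner euclidean_inner[of \<tau> \<tau>] by (simp add: power2_eq_square sum_negf sum_divide_distrib)
  finally show ?E unfolding eq .
qed

lemma gauss_fourier_scaled:
  fixes v :: "'a::euclidean_space"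
  assumes \<eta>: "0 < \<eta>"
  shows "integrable lborel (\<lambda>\<xi>. iexp (v \<bullet> \<xi>) * complex_of_real (exp (- \<eta>\<^sup>2 * (norm \<xi>)\<^sup>2 / 2)))"
    and "(\<integral>\<xi>. iexp (v \<bullet> \<xi>) * complex_of_real (exp (- \<eta>\<^sup>2 * (norm \<xi>)\<^sup>2 / 2)) \<partial>lborel) =
      complex_of_real ((sqrt (2 * pi) / \<eta>) ^ DIM('a) * exp (- (norm v)\<^sup>2 / (2 * \<eta>\<^sup>2)))"
proof -
  let ?g = "\<lambda>\<xi>. iexp (v \<bullet> \<xi>) * complex_of_real (exp (- \<eta>\<^sup>2 * (norm \<xi>)\<^sup>2 / 2))"
  let ?h = "\<lambda>\<xi>. iexp ((v /\<^sub>R \<eta>) \<bullet> \<xi>) * complex_of_real (exp (- (norm \<xi>)\<^sup>2 / 2))"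
  have m: "?g \<in> borel_measurable borel" by measurable
  have gh: "?g (0 + inverse \<eta> *\<^sub>R \<xi>) = ?h \<xi>" for \<xi>
    using \<eta> by (simp add: power_mult_distrib power_inverse)
  have "integral\<^sup>L lborel ?g = complex_of_real (\<bar>inverse \<eta>\<bar> ^ DIM('a)) * (\<integral>\<xi>. ?g (0 + inverse \<eta> *\<^sub>R \<xi>) \<partial>lborel)"
    using \<eta> by (intro lborel_integral_affine[OF m]) auto
  also have "\<dots> = complex_of_real (\<bar>inverse \<eta>\<bar> ^ DIM('a)) * complex_of_real (sqrt (2 * pi) ^ DIM('a) * exp (- (norm (v /\<^sub>R \<eta>))\<^sup>2 / 2))"
    by (simp only: gh gauss_fourier(2))
  also have "\<dots> = complex_of_real ((sqrt (2 * pi) / \<eta>) ^ DIM('a) * exp (- (norm v)\<^sup>2 / (2 * \<eta>\<^sup>2)))"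
  proof -
    have "(norm (v /\<^sub>R \<eta>))\<^sup>2 / 2 = (norm v)\<^sup>2 / (2 * \<eta>\<^sup>2)" using \<eta> by (simp add: power_mult_distrib power_inverse field_simps)
    then have 1: "- (norm (v /\<^sub>R \<eta>))\<^sup>2 / 2 = - (norm v)\<^sup>2 / (2 * \<eta>\<^sup>2)"
      unfolding minus_divide_left[symmetric] by (rule arg_cong)
    have 2: "\<bar>inverse \<eta>\<bar> ^ DIM('a) * sqrt (2 * pi) ^ DIM('a) = (sqrt (2 * pi) / \<eta>) ^ DIM('a)"
      using \<eta> by (simp add: divide_inverse power_mult_distrib)
    show ?thesis unfolding 1 2[symmetric] of_real_mult by (simp only: mult.assoc)
  qed
  finally show "integral\<^sup>L lborel ?g = complex_of_real ((sqrt (2 * pi) / \<eta>) ^ DIM('a) * exp (- (norm v)\<^sup>2 / (2 * \<eta>\<^sup>2)))" .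
  show "integrable lborel ?g"
  proof (rule Bochner_Integration.integrable_bound)
    let ?k = "\<lambda>\<xi>::'a. exp (- (norm \<xi>)\<^sup>2 / 2)"
    have "integrable lborel (\<lambda>\<xi>::'a. complex_of_real (?k \<xi>))" using gauss_fourier(1)[of "0::'a"] by simp
    then have k: "integrable lborel ?k" using integrable_Re by fastforce
    have "integrable lborel (\<lambda>\<xi>::'a. ?k (0 + \<eta> *\<^sub>R \<xi>))"
    proof -
      have "integrable (density (distr lborel borel (\<lambda>x::'a. 0 + \<eta> *\<^sub>R x)) (\<lambda>_. ennreal (\<bar>\<eta>\<bar> ^ DIM('a)))) ?k"
        using k lborel_affine[of \<eta> "0::'a"] \<eta> by (simp add: ennreal_power)
      then show ?thesis using \<eta> by (subst (asm) integrable_density) (auto simp: integrable_distr_eq)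
    qed
    then show "integrable lborel (\<lambda>\<xi>::'a. exp (- \<eta>\<^sup>2 * (norm \<xi>)\<^sup>2 / 2))"
      using \<eta> by (simp add: power_mult_distrib)
  qed (auto simp: norm_mult)
qed

lemma integrable_gauss: "integrable lborel (\<lambda>\<xi>::'a::euclidean_space. exp (- (norm \<xi>)\<^sup>2 / 2))"
proof -
  have "integrable lborel (\<lambda>\<xi>::'a. complex_of_real (exp (- (norm \<xi>)\<^sup>2 / 2)))" using gauss_fourier(1)[of "0::'a"] by simp
  from integrable_Re[OF this] show ?thesis by simp
qed

text \<open>Gaussian regularization: with the factor \<open>G n\<close> inserted, Fubini turns the
  integral into a Gaussian average of \<open>h\<close> around \<open>y\<close> at scale
  \<open>\<eta> n\<close>. Dominated convergence on both sides removes the factor.\<close>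

lemma fourier_inversion:
  fixes h :: "'a::euclidean_space \<Rightarrow> complex"
  assumes cont: "continuous_on UNIV h" and bdd: "\<And>t. norm (h t) \<le> M" and int: "integrable lborel h"
  defines "F \<equiv> \<lambda>\<xi>. \<integral>t. h t * iexp (- (t \<bullet> \<xi>)) \<partial>lborel"
  assumes intF: "integrable lborel F"
  shows "(\<integral>\<xi>. F \<xi> * iexp (y \<bullet> \<xi>) \<partial>lborel) = complex_of_real ((2 * pi) ^ DIM('a)) * h y"
proof -
  have [measurable]: "h \<in> borel_measurable borel" using cont by (rule borel_measurable_continuous_onI)
  have [measurable]: "F \<in> borel_measurable borel" using intF by auto
  define \<eta> where "\<eta> n = inverse (real (Suc n))" for n
  have \<eta>: "0 < \<eta> n" for n by (simp add: \<eta>_def)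
  have \<eta>0: "\<eta> \<longlonglongrightarrow> 0" unfolding \<eta>_def by (rule LIMSEQ_inverse_real_of_nat)
  define G where "G n \<xi> = complex_of_real (exp (- (\<eta> n)\<^sup>2 * (norm \<xi>)\<^sup>2 / 2))" for n and \<xi> :: 'a
  define J where "J n = (\<integral>\<xi>. F \<xi> * iexp (y \<bullet> \<xi>) * G n \<xi> \<partial>lborel)" for n
  have lim1: "J \<longlonglongrightarrow> (\<integral>\<xi>. F \<xi> * iexp (y \<bullet> \<xi>) \<partial>lborel)"
    unfolding J_def
  proof (rule integral_dominated_convergence)
    show "integrable lborel (\<lambda>\<xi>. norm (F \<xi>))" using intF by (rule integrable_norm)
    show "AE \<xi> in lborel. (\<lambda>n. F \<xi> * iexp (y \<bullet> \<xi>) * G n \<xi>) \<longlonglongrightarrow> F \<xi> * iexp (y \<bullet> \<xi>)"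
    proof (rule AE_I2)
      fix \<xi> :: 'a
      have "(\<lambda>n. F \<xi> * iexp (y \<bullet> \<xi>) * G n \<xi>) \<longlonglongrightarrow> F \<xi> * iexp (y \<bullet> \<xi>) * complex_of_real (exp (- (0)\<^sup>2 * (norm \<xi>)\<^sup>2 / 2))"
        unfolding G_def by (intro tendsto_intros \<eta>0) auto
      then show "(\<lambda>n. F \<xi> * iexp (y \<bullet> \<xi>) * G n \<xi>) \<longlonglongrightarrow> F \<xi> * iexp (y \<bullet> \<xi>)" by simp
    qed
    show "AE \<xi> in lborel. norm (F \<xi> * iexp (y \<bullet> \<xi>) * G n \<xi>) \<le> norm (F \<xi>)" for n
      by (intro AE_I2) (auto simp: norm_mult G_def intro!: mult_left_le)
  qed (auto simp: G_def)
  have Jn: "J n = complex_of_real (sqrt (2 * pi) ^ DIM('a)) * (\<integral>\<tau>. h (y + \<eta> n *\<^sub>R \<tau>) * complex_of_real (exp (- (norm \<tau>)\<^sup>2 / 2)) \<partial>lborel)" for n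
  proof -
    have intG: "integrable lborel (\<lambda>\<xi>::'a. G n \<xi>)"
      using gauss_fourier_scaled(1)[OF \<eta>[of n], of "0::'a"] by (simp add: G_def)
    have "J n = (\<integral>\<xi>. (\<integral>t. h t * iexp (- (t \<bullet> \<xi>)) * iexp (y \<bullet> \<xi>) * G n \<xi> \<partial>lborel) \<partial>lborel)"
      unfolding J_def F_def by (simp only: Bochner_Integration.integral_mult_left_zero)
    also have "\<dots> = (\<integral>t. (\<integral>\<xi>. h t * iexp (- (t \<bullet> \<xi>)) * iexp (y \<bullet> \<xi>) * G n \<xi> \<partial>lborel) \<partial>lborel)"
    proof (rule lborel_pair.Fubini_integral)
      show "integrable (lborel \<Otimes>\<^sub>M lborel) (\<lambda>(t, \<xi>). h t * iexp (- (t \<bullet> \<xi>)) * iexp (y \<bullet> \<xi>) * G n \<xi>)"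
      proof (rule Bochner_Integration.integrable_bound)
        show "integrable (lborel \<Otimes>\<^sub>M lborel) (\<lambda>(t, \<xi>). h t * G n \<xi>)" by (rule integrable_pair_mult[OF int intG])
      qed (auto simp: norm_mult G_def)
    qed
    also have "\<dots> = (\<integral>t. h t * complex_of_real ((sqrt (2 * pi) / \<eta> n) ^ DIM('a) * exp (- (norm (y - t))\<^sup>2 / (2 * (\<eta> n)\<^sup>2))) \<partial>lborel)"
    proof (intro Bochner_Integration.integral_cong refl)
      fix t :: 'a
      have "h t * iexp (- (t \<bullet> \<xi>)) * iexp (y \<bullet> \<xi>) * G n \<xi> = h t * (iexp ((y - t) \<bullet> \<xi>) * complex_of_real (exp (- (\<eta> n)\<^sup>2 * (norm \<xi>)\<^sup>2 / 2)))" for \<xi>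
        by (simp add: G_def inner_diff_left mult_exp_exp algebra_simps)
      then show "(\<integral>\<xi>. h t * iexp (- (t \<bullet> \<xi>)) * iexp (y \<bullet> \<xi>) * G n \<xi> \<partial>lborel) =
          h t * complex_of_real ((sqrt (2 * pi) / \<eta> n) ^ DIM('a) * exp (- (norm (y - t))\<^sup>2 / (2 * (\<eta> n)\<^sup>2)))"
        by (simp only: Bochner_Integration.integral_mult_right_zero gauss_fourier_scaled(2)[OF \<eta>[of n]])
    qed
    \<comment> \<open>Substitution of \<open>y + \<eta> n *\<^sub>R \<tau>\<close> for
      \<open>t\<close>; the powers of \<open>\<eta> n\<close> cancel in the steps that
      follow.\<close>
    also have "\<dots> = complex_of_real (\<bar>\<eta> n\<bar> ^ DIM('a)) * (\<integral>\<tau>. h (y + \<eta> n *\<^sub>R \<tau>) *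
        complex_of_real ((sqrt (2 * pi) / \<eta> n) ^ DIM('a) * exp (- (norm (y - (y + \<eta> n *\<^sub>R \<tau>)))\<^sup>2 / (2 * (\<eta> n)\<^sup>2))) \<partial>lborel)"
      using \<eta>[of n] by (intro lborel_integral_affine) auto
    also have "\<dots> = complex_of_real (\<bar>\<eta> n\<bar> ^ DIM('a)) * (\<integral>\<tau>. complex_of_real ((sqrt (2 * pi) / \<eta> n) ^ DIM('a)) *
        (h (y + \<eta> n *\<^sub>R \<tau>) * complex_of_real (exp (- (norm \<tau>)\<^sup>2 / 2))) \<partial>lborel)"
      using \<eta>[of n] by (simp add: power_mult_distrib mult.left_commute)
    also have "\<dots> = complex_of_real (sqrt (2 * pi) ^ DIM('a)) * (\<integral>\<tau>. h (y + \<eta> n *\<^sub>R \<tau>) * complex_of_real (exp (- (norm \<tau>)\<^sup>2 / 2)) \<partial>lborel)"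
      using \<eta>[of n] by (simp add: power_divide)
    finally show ?thesis .
  qed
  have lim2: "(\<lambda>n. complex_of_real (sqrt (2 * pi) ^ DIM('a)) * (\<integral>\<tau>. h (y + \<eta> n *\<^sub>R \<tau>) * complex_of_real (exp (- (norm \<tau>)\<^sup>2 / 2)) \<partial>lborel))
     \<longlonglongrightarrow> complex_of_real (sqrt (2 * pi) ^ DIM('a)) * (\<integral>\<tau>. h y * complex_of_real (exp (- (norm \<tau>)\<^sup>2 / 2)) \<partial>(lborel :: 'a measure))"
  proof (intro tendsto_mult_left integral_dominated_convergence)
    show "integrable lborel (\<lambda>\<tau>::'a. M * exp (- (norm \<tau>)\<^sup>2 / 2))" by (intro integrable_mult_right integrable_gauss)
    show "AE \<tau> in lborel. (\<lambda>n. h (y + \<eta> n *\<^sub>R \<tau>) * complex_of_real (exp (- (norm \<tau>)\<^sup>2 / 2))) \<longlonglongrightarrow> h y * complex_of_real (exp (- (norm \<tau>)\<^sup>2 / 2))"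
    proof (rule AE_I2)
      fix \<tau> :: 'a
      have "(\<lambda>n. y + \<eta> n *\<^sub>R \<tau>) \<longlonglongrightarrow> y + 0 *\<^sub>R \<tau>" by (intro tendsto_intros \<eta>0)
      then have "(\<lambda>n. y + \<eta> n *\<^sub>R \<tau>) \<longlonglongrightarrow> y" by simp
      then have "(\<lambda>n. h (y + \<eta> n *\<^sub>R \<tau>)) \<longlonglongrightarrow> h y"
        using continuous_on_tendsto_compose[OF cont] by simp
      then show "(\<lambda>n. h (y + \<eta> n *\<^sub>R \<tau>) * complex_of_real (exp (- (norm \<tau>)\<^sup>2 / 2))) \<longlonglongrightarrow> h y * complex_of_real (exp (- (norm \<tau>)\<^sup>2 / 2))"
        by (rule tendsto_mult_right)
    qed
    show "AE \<tau> in lborel. norm (h (y + \<eta> n *\<^sub>R \<tau>) * complex_of_real (exp (- (norm \<tau>)\<^sup>2 / 2))) \<le> M * exp (- (norm \<tau>)\<^sup>2 / 2)" for n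
      using bdd by (intro AE_I2) (auto simp: norm_mult intro: mult_right_mono)
  qed auto
  have "(\<integral>\<xi>. F \<xi> * iexp (y \<bullet> \<xi>) \<partial>lborel) = complex_of_real (sqrt (2 * pi) ^ DIM('a)) * (\<integral>\<tau>. h y * complex_of_real (exp (- (norm \<tau>)\<^sup>2 / 2)) \<partial>(lborel :: 'a measure))"
    using lim2 unfolding Jn[symmetric] by (rule LIMSEQ_unique[OF lim1])
  also have "\<dots> = complex_of_real (sqrt (2 * pi) ^ DIM('a) * sqrt (2 * pi) ^ DIM('a)) * h y"
    using gauss_fourier(2)[of "0::'a"] by (simp add: mult_ac)
  also have "sqrt (2 * pi) ^ DIM('a) * sqrt (2 * pi) ^ DIM('a) = (sqrt (2 * pi) * sqrt (2 * pi)) ^ DIM('a)"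
    by (simp only: power_mult_distrib)
  also have "sqrt (2 * pi) * sqrt (2 * pi) = 2 * pi" by (rule real_sqrt_mult_self[THEN trans]) simp
  finally show ?thesis .
qed

text \<open>The window has norm 1 in L^2, so integrating over its centre adds no constant to the
  inversion formula.\<close>

lemma integral_gauss_window_square:
  "integrable lborel (\<lambda>t::real^'d::finite. complex_of_real (gauss_window t))"
  "(\<integral>t. complex_of_real (gauss_window (t - y)) * complex_of_real (gauss_window (t - y)) \<partial>(lborel :: (real^'d::finite) measure)) = 1"
proof -
  have "integrable lborel (\<lambda>t::real^'d. pi powr (- real CARD('d) / 4) * exp (- (norm t)\<^sup>2 / 2))"
    by (intro integrable_mult_right integrable_gauss)
  then show "integrable lborel (\<lambda>t::real^'d. complex_of_real (gauss_window t))"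
    unfolding gauss_window_def by (rule integrable_of_real)
  let ?f = "\<lambda>t::real^'d. complex_of_real (exp (- (norm t)\<^sup>2))"
  have sq: "complex_of_real (gauss_window t) * complex_of_real (gauss_window t) = complex_of_real (pi powr (- real CARD('d) / 2)) * ?f t" for t :: "real^'d"
  proof -
    let ?P = "pi powr (- real CARD('d) / 4)" and ?E = "exp (- (norm t)\<^sup>2 / 2)"
    have "gauss_window t * gauss_window t = (?P * ?P) * (?E * ?E)" by (simp add: gauss_window_def mult_ac)
    also have "?P * ?P = pi powr (- real CARD('d) / 2)" by (simp flip: powr_add)
    also have "?E * ?E = exp (- (norm t)\<^sup>2)" by (simp flip: exp_add)
    finally show ?thesis by (simp flip: of_real_mult)
  qed
  have "(\<integral>t. complex_of_real (gauss_window (t - y)) * complex_of_real (gauss_window (t - y)) \<partial>(lborel :: (real^'d) measure)) =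
      (\<integral>t. complex_of_real (pi powr (- real CARD('d) / 2)) * ?f (t - y) \<partial>lborel)"
    unfolding sq ..
  also have "\<dots> = complex_of_real (pi powr (- real CARD('d) / 2)) * (\<integral>t. ?f (t - y) \<partial>lborel)"
    by (rule Bochner_Integration.integral_mult_right_zero)
  also have "(\<integral>t. ?f (t - y) \<partial>lborel) = complex_of_real (\<bar>1 / sqrt 2\<bar> ^ DIM(real^'d)) * (\<integral>t. ?f (y + (1 / sqrt 2) *\<^sub>R t - y) \<partial>lborel)"
    by (rule lborel_integral_affine) auto
  also have "(\<integral>t. ?f (y + (1 / sqrt 2) *\<^sub>R t - y) \<partial>lborel) = (\<integral>t. complex_of_real (exp (- (norm t)\<^sup>2 / 2)) \<partial>(lborel :: (real^'d) measure))"
    by (intro Bochner_Integration.integral_cong) (auto simp: power_divide power_mult_distrib)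
  also have "\<dots> = complex_of_real (sqrt (2 * pi) ^ CARD('d))"
    using gauss_fourier(2)[of "0::real^'d"] by simp
  also have "complex_of_real (pi powr (- real CARD('d) / 2)) * (complex_of_real (\<bar>1 / sqrt 2\<bar> ^ DIM(real^'d)) * complex_of_real (sqrt (2 * pi) ^ CARD('d))) =
     complex_of_real (pi powr (- real CARD('d) / 2) * (sqrt pi ^ CARD('d)))"
    by (simp add: power_divide real_sqrt_mult power_mult_distrib)
  also have "sqrt pi ^ CARD('d) = pi powr (real CARD('d) / 2)"
    by (simp add: powr_half_sqrt[symmetric] powr_realpow[symmetric] powr_powr)
  also have "pi powr (- real CARD('d) / 2) * pi powr (real CARD('d) / 2) = 1"
    by (simp add: powr_add[symmetric])
  finally show "(\<integral>t. complex_of_real (gauss_window (t - y)) * complex_of_real (gauss_window (t - y)) \<partial>(lborel :: (real^'d) measure)) = 1" by simp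
qed

section \<open>Decay of time-frequency coefficients\<close>

text \<open>Reduces decay in the norm to powers of a single coordinate, which the seminorms with one
  nonzero index control.\<close>

lemma exists_large_component:
  fixes t :: "real^'d::finite"
  obtains j where "norm t \<le> real CARD('d) * \<bar>t $ j\<bar>"
proof -
  obtain j where j: "\<And>i. \<bar>t $ i\<bar> \<le> \<bar>t $ j\<bar>"
    using finite_imageI[OF finite, of "\<lambda>i. \<bar>t $ i\<bar>" UNIV] Max_in[of "range (\<lambda>i. \<bar>t $ i\<bar>)"] Max_ge[of "range (\<lambda>i. \<bar>t $ i\<bar>)"]
    by (metis (no_types, lifting) UNIV_not_empty image_iff image_is_empty rangeI)
  have "norm t \<le> (\<Sum>i\<in>UNIV. \<bar>t $ i\<bar>)" by (rule norm_le_l1_cart)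
  also have "\<dots> \<le> (\<Sum>i\<in>(UNIV::'d set). \<bar>t $ j\<bar>)" by (intro sum_mono j)
  finally show ?thesis using that by simp
qed

text \<open>The list with these counts is unique, so the choice in \<open>multi_deriv\<close> is
  forced.\<close>

lemma multi_deriv_single:
  "multi_deriv ((\<lambda>_. 0)(j := k)) f = iter_partial (replicate k j) f"
proof -
  have "L = replicate k j" if "\<forall>i. count_list L i = ((\<lambda>_. 0)(j := k)) i" for L
  proof -
    have "\<forall>x\<in>set L. x = j" using that by (metis count_list_0_iff fun_upd_apply)
    then have 1: "replicate (length L) j = L" by (rule replicate_length_same)
    then have "count_list L j = length L" by (metis count_list_replicate_if)
    with that 1 show ?thesis by simp
  qed
  moreover have "\<forall>i. count_list (replicate k j) i = ((\<lambda>_. 0)(j := k)) i" by (simp add: count_list_replicate_if)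
  ultimately have "(SOME L. \<forall>i. count_list L i = ((\<lambda>_. 0)(j := k)) i) = replicate k j" by (intro some_equality)
  then show ?thesis by (simp add: multi_deriv_def)
qed

lemma multi_deriv_zero: "multi_deriv (\<lambda>_. 0) f = (f :: real^'d::finite \<Rightarrow> complex)"
proof -
  have "((\<lambda>_. 0)(undefined := 0)) = (\<lambda>_ :: 'd. 0 :: nat)" by auto
  with multi_deriv_single[of undefined 0 f] show ?thesis by simp
qed

lemma multi_fact_single [simp]: "multi_fact ((\<lambda>_. 0)(j := k)) = fact k" "multi_fact (\<lambda>_. 0) = 1"
proof -
  have "(\<Prod>i\<in>UNIV. fact (((\<lambda>_. 0)(j := k)) i) :: real) = (\<Prod>i\<in>UNIV. if i = j then fact k else 1)"
    by (intro prod.cong) auto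
  then show "multi_fact ((\<lambda>_. 0)(j := k)) = fact k" by (simp add: multi_fact_def)
qed (simp add: multi_fact_def)

lemma multi_abs_single [simp]: "multi_abs ((\<lambda>_. 0)(j := k)) = k" "multi_abs (\<lambda>_. 0) = 0"
  by (simp_all add: multi_abs_def fun_upd_def)

lemma multi_power_single [simp]: "multi_power x ((\<lambda>_. 0)(j := k)) = (x $ j) ^ k" "multi_power x (\<lambda>_. 0) = 1"
proof -
  have "(\<Prod>i\<in>UNIV. (x $ i) ^ ((\<lambda>_. 0)(j := k)) i) = (\<Prod>i\<in>UNIV. if i = j then (x $ j) ^ k else 1)"
    by (intro prod.cong) auto
  then show "multi_power x ((\<lambda>_. 0)(j := k)) = (x $ j) ^ k" by (simp add: multi_power_def)
qed (simp add: multi_power_def)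

lemma gs_bound_replicate:
  assumes "gs_bound s h M f"
  shows "norm (iter_partial (replicate k j) f t) \<le> M * (h ^ k * fact k powr s)"
  using gs_boundD[OF assms, of t "\<lambda>_. 0" "(\<lambda>_. 0)(j := k)"]
  by (simp add: multi_deriv_single gs_weight_def)

text \<open>The seminorm terms without derivatives already force this decay. The rate gets worse as
  \<open>h\<close> grows, so it is dictated by the function.\<close>

lemma gs_bound_decay:
  fixes f :: "real^'d::finite \<Rightarrow> complex"
  assumes f: "gs_bound s h M f" and h: "0 < h" and s: "0 < s" and M: "0 \<le> M"
  shows "norm (f t) \<le> 2 powr s * M * exp (- (s / 2 / (real CARD('d) * h) powr (1/s)) * norm t powr (1/s))"
proof -
  obtain j where j: "norm t \<le> real CARD('d) * \<bar>t $ j\<bar>" using exists_large_component .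
  have "\<bar>t $ j\<bar> ^ n * norm (f t) \<le> M * h ^ n * fact n powr s" for n
    using gs_boundD[OF f, of t "(\<lambda>_. 0)(j := n)" "\<lambda>_. 0"] by (simp add: multi_deriv_zero gs_weight_def power_abs mult.assoc)
  then have "norm (f t) \<le> 2 powr s * M * exp (- (s / 2 / h powr (1 / s)) * \<bar>t $ j\<bar> powr (1 / s))"
    by (intro exp_decay_of_power_bounds) (use h s M in auto)
  also have "\<dots> \<le> 2 powr s * M * exp (- (s / 2 / (real CARD('d) * h) powr (1/s)) * norm t powr (1/s))"
  proof -
    have "norm t powr (1/s) \<le> (real CARD('d) * \<bar>t $ j\<bar>) powr (1/s)" using j s by (intro powr_mono2) auto
    also have "\<dots> = real CARD('d) powr (1/s) * \<bar>t $ j\<bar> powr (1/s)" by (intro powr_mult) 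
    finally have "(s / 2 / (real CARD('d) * h) powr (1/s)) * norm t powr (1/s) \<le>
       (s / 2 / (real CARD('d) * h) powr (1/s)) * (real CARD('d) powr (1/s) * \<bar>t $ j\<bar> powr (1/s))"
      using s by (intro mult_left_mono) auto
    also have "\<dots> = (s / 2 / h powr (1 / s)) * \<bar>t $ j\<bar> powr (1 / s)"
      using h by (simp add: powr_mult)
    finally show ?thesis using M by (intro mult_left_mono) auto
  qed
  finally show ?thesis .
qed

lemma gs_bound_continuous: "gs_bound s h M f \<Longrightarrow> continuous_on UNIV (iter_partial L f)"
  using C_infinity_differentiable[OF gs_bound_C_infinity]
  by (meson continuous_at_imp_continuous_on differentiable_imp_continuous_within)

section \<open>Integration by parts\<close>

lemma directional_partial_deriv:
  fixes f :: "real^'d::finite \<Rightarrow> complex"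
  assumes "f differentiable (at t)"
  shows "((\<lambda>\<tau>. f (t + \<tau> *\<^sub>R axis j 1)) has_vector_derivative partial_deriv j f t) (at 0)"
proof -
  have 1: "((\<lambda>\<tau>. t + \<tau> *\<^sub>R axis j 1) has_derivative (\<lambda>\<tau>. \<tau> *\<^sub>R axis j 1)) (at 0)"
    by (auto intro!: derivative_eq_intros)
  have 2: "(f has_derivative frechet_derivative f (at t)) (at (t + 0 *\<^sub>R axis j 1))"
    using assms by (simp add: frechet_derivative_works)
  have lin: "linear (frechet_derivative f (at t))" using 2 by (auto dest: has_derivative_linear)
  from has_derivative_compose[OF 1 2] show ?thesis
    unfolding has_vector_derivative_def partial_deriv_def by (simp add: linear_scale[OF lin])
qed

text \<open>By translation invariance the difference quotients of \<open>g\<close> have integral 0,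
  and dominated convergence carries this over to the derivative. Iterated integrals and boundary
  terms do not appear.\<close>

lemma integral_directional_deriv_zero:
  fixes g g' :: "real^'d::finite \<Rightarrow> complex"
  assumes der: "\<And>t. ((\<lambda>\<tau>. g (t + \<tau> *\<^sub>R axis j 1)) has_vector_derivative g' t) (at 0)"
    and int: "integrable lborel g" and m: "g' \<in> borel_measurable borel"
    and bd: "\<And>t. norm (g' t) \<le> K * (1 + norm t) powr - N" and N: "2 * real CARD('d) \<le> N"
  shows "(\<integral>t. g' t \<partial>lborel) = 0"
proof -
  let ?e = "axis j 1 :: real^'d"
  have K: "0 \<le> K" using order.trans[OF norm_ge_zero bd[of 0]] by simp
  have N0: "0 \<le> N" using N by (rule order.trans[rotated]) simp
  have [measurable]: "g \<in> borel_measurable borel" "g' \<in> borel_measurable borel" using int m by auto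
  have der': "((\<lambda>\<tau>. g (t + \<tau> *\<^sub>R ?e)) has_derivative (\<lambda>h. h *\<^sub>R g' (t + \<tau>0 *\<^sub>R ?e))) (at \<tau>0)" for t \<tau>0
  proof -
    have "((\<lambda>\<tau>. g (t + \<tau>0 *\<^sub>R ?e + \<tau> *\<^sub>R ?e)) has_derivative (\<lambda>h. h *\<^sub>R g' (t + \<tau>0 *\<^sub>R ?e))) (at (\<tau>0 - \<tau>0))"
      using der[of "t + \<tau>0 *\<^sub>R ?e"] by (simp add: has_vector_derivative_def)
    moreover have "((\<lambda>\<tau>. \<tau> - \<tau>0) has_derivative (\<lambda>h. h)) (at \<tau>0)" by (auto intro!: derivative_eq_intros)
    ultimately have "((\<lambda>\<tau>. g (t + \<tau>0 *\<^sub>R ?e + (\<tau> - \<tau>0) *\<^sub>R ?e)) has_derivative (\<lambda>h. h *\<^sub>R g' (t + \<tau>0 *\<^sub>R ?e))) (at \<tau>0)"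
      using has_derivative_compose by blast
    then show ?thesis by (simp add: algebra_simps)
  qed
  define \<eta> where "\<eta> n = inverse (real (Suc n))" for n
  have \<eta>: "0 < \<eta> n" "\<eta> n \<le> 1" for n by (auto simp: \<eta>_def inverse_le_1_iff)
  have \<eta>0: "\<eta> \<longlonglongrightarrow> 0" unfolding \<eta>_def by (rule LIMSEQ_inverse_real_of_nat)
  define q where "q n t = (g (t + \<eta> n *\<^sub>R ?e) - g t) /\<^sub>R \<eta> n" for n t
  have trans: "integrable lborel (\<lambda>t. g (t + v))" "(\<integral>t. g (t + v) \<partial>lborel) = (\<integral>t. g t \<partial>lborel)" for v
  proof -
    have "integrable (distr lborel borel ((+) v)) g" using int by (simp add: lborel_distr_plus)
    then show "integrable lborel (\<lambda>t. g (t + v))" by (simp add: integrable_distr_eq add.commute)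
    have "(\<integral>t. g t \<partial>lborel) = (\<integral>t. g t \<partial>distr lborel borel ((+) v))" by (simp add: lborel_distr_plus)
    then show "(\<integral>t. g (t + v) \<partial>lborel) = (\<integral>t. g t \<partial>lborel)" by (simp add: integral_distr add.commute)
  qed
  have "(\<lambda>n. \<integral>t. q n t \<partial>lborel) \<longlonglongrightarrow> (\<integral>t. g' t \<partial>lborel)"
  proof (rule integral_dominated_convergence)
    show "integrable lborel (\<lambda>t::real^'d. K * 2 powr N * (1 + norm t) powr - N)"
      by (rule integrable_lborel_decay[where K = "K * 2 powr N" and N = N]) (use N K in auto)
    show "AE t in lborel. (\<lambda>n. q n t) \<longlonglongrightarrow> g' t"
    proof (rule AE_I2)
      fix t
      have "((\<lambda>h. norm (g (t + (0 + h) *\<^sub>R ?e) - g (t + 0 *\<^sub>R ?e) - h *\<^sub>R g' t) / norm h) \<longlongrightarrow> 0) (at 0)"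
        using der[of t] unfolding has_vector_derivative_def has_derivative_at by simp
      moreover have "filterlim \<eta> (at 0) sequentially"
        unfolding filterlim_at using \<eta>0 \<eta>(1) by (simp add: less_imp_neq[symmetric])
      ultimately have "(\<lambda>n. norm (g (t + (0 + \<eta> n) *\<^sub>R ?e) - g (t + 0 *\<^sub>R ?e) - \<eta> n *\<^sub>R g' t) / norm (\<eta> n)) \<longlonglongrightarrow> 0"
        by (rule filterlim_compose)
      moreover have "norm (g (t + (0 + \<eta> n) *\<^sub>R ?e) - g (t + 0 *\<^sub>R ?e) - \<eta> n *\<^sub>R g' t) / norm (\<eta> n) = norm (q n t - g' t)" for n
      proof -
        have "q n t - g' t = (g (t + \<eta> n *\<^sub>R ?e) - g t - \<eta> n *\<^sub>R g' t) /\<^sub>R \<eta> n"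
          using \<eta>(1)[of n] by (simp add: q_def scaleR_diff_right)
        then show ?thesis using \<eta>(1)[of n] by (simp add: divide_inverse mult.commute)
      qed
      ultimately have "(\<lambda>n. norm (q n t - g' t)) \<longlonglongrightarrow> 0" by simp
      then show "(\<lambda>n. q n t) \<longlonglongrightarrow> g' t" by (rule LIM_zero_cancel[OF tendsto_norm_zero_cancel])
    qed
    show "AE t in lborel. norm (q n t) \<le> K * 2 powr N * (1 + norm t) powr - N" for n
    proof (rule AE_I2)
      fix t
      have "continuous_on {0..\<eta> n} (\<lambda>\<tau>. g (t + \<tau> *\<^sub>R ?e))"
        using der' has_derivative_continuous by (intro continuous_at_imp_continuous_on ballI) blast
      then obtain \<tau> where \<tau>: "\<tau> \<in> {0<..<\<eta> n}" "norm (g (t + \<eta> n *\<^sub>R ?e) - g (t + 0 *\<^sub>R ?e)) \<le> norm ((\<eta> n - 0) *\<^sub>R g' (t + \<tau> *\<^sub>R ?e))"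
        using mvt_general[OF \<eta>(1)[of n], of "\<lambda>\<tau>. g (t + \<tau> *\<^sub>R ?e)", OF _ der'] by blast
      then have "norm (q n t) \<le> norm (g' (t + \<tau> *\<^sub>R ?e))"
        using \<eta>[of n] by (simp add: q_def divide_simps norm_minus_commute mult.commute)
      also have "\<dots> \<le> K * (1 + norm (t + \<tau> *\<^sub>R ?e)) powr - N" by (rule bd)
      \<comment> \<open>The mean value theorem moves the point by at most 1, which costs the factor
        \<open>2 powr N\<close> in the dominating function.\<close>
      also have "\<dots> \<le> K * ((1 + norm t) / 2) powr - N"
      proof (intro mult_left_mono powr_mono2')
        have "norm t \<le> norm (t + \<tau> *\<^sub>R ?e) + norm (\<tau> *\<^sub>R ?e)" by (metis add_diff_cancel_right' norm_triangle_ineq4)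
        moreover have "norm (\<tau> *\<^sub>R ?e) \<le> 1" using \<tau> \<eta>[of n] by (simp add: norm_axis_1)
        ultimately show "(1 + norm t) / 2 \<le> 1 + norm (t + \<tau> *\<^sub>R ?e)" 
          using norm_ge_zero[of "t + \<tau> *\<^sub>R ?e"] by argo
      qed (use N0 K in \<open>auto simp: add_pos_nonneg\<close>)
      also have "\<dots> = K * 2 powr N * (1 + norm t) powr - N" by (simp add: powr_divide powr_minus field_simps)
      finally show "norm (q n t) \<le> K * 2 powr N * (1 + norm t) powr - N" .
    qed
  qed (auto simp: q_def)
  moreover have "(\<integral>t. q n t \<partial>lborel) = 0" for n
    unfolding q_def using trans int by (simp add: Bochner_Integration.integral_diff)
  ultimately show ?thesis by (simp add: LIMSEQ_const_iff)
qed

section \<open>Decay in the position variable\<close>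

lemma norm_tf_shift: "norm (tf_shift x \<xi> t) = gauss_window (t - x)"
  by (simp add: tf_shift_def norm_mult gauss_window_def abs_mult)

lemma partial_deriv_tf_shift:
  fixes x \<xi> :: "real^'d::finite"
  shows "tf_shift x \<xi> differentiable (at t)"
    "partial_deriv j (tf_shift x \<xi>) t = - (of_real (t $ j - x $ j) + \<i> * of_real (\<xi> $ j)) * tf_shift x \<xi> t"
proof -
  let ?c = "complex_of_real (pi powr (- real CARD('d) / 4) * exp (- (norm x)\<^sup>2 / 2))"
  let ?w = "phase_point x \<xi>"
  have w1: "hermite_wave (Suc 0) w y = (w - of_real y) * hermite_wave 0 w y" for w y
    by (simp add: hermite_wave_def)
  have tw: "tensor_wave ((\<lambda>_. 0)(i := Suc 0)) ?w t = (?w i - of_real (t $ i)) * gauss_wave ?w t" for i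
    unfolding tensor_wave_def
    by (subst (1 2) prod.remove[of UNIV i]) (auto simp: w1 mult.assoc intro!: prod.cong)
  have "((\<lambda>y. ?c * gauss_wave ?w y) has_derivative
     (\<lambda>v. \<Sum>i\<in>UNIV. v $ i *\<^sub>R (?c * ((?w i - of_real (t $ i)) * gauss_wave ?w t)))) (at t)"
    using has_derivative_mult_right[OF tensor_wave_has_derivative[of "\<lambda>_. 0" ?w t], of ?c]
    by (simp only: tw sum_distrib_left mult_scaleR_right)
  then have D: "(tf_shift x \<xi> has_derivative
     (\<lambda>v. \<Sum>i\<in>UNIV. v $ i *\<^sub>R (?c * ((?w i - of_real (t $ i)) * gauss_wave ?w t)))) (at t)"
    by (simp only: tf_shift_eq)
  from D show "tf_shift x \<xi> differentiable (at t)" by (rule differentiableI)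
  have wi: "?w j - of_real (t $ j) = - (of_real (t $ j - x $ j) + \<i> * of_real (\<xi> $ j))"
    by (simp add: phase_point_def complex_eq_iff)
  have "partial_deriv j (tf_shift x \<xi>) t = ?c * ((?w j - of_real (t $ j)) * gauss_wave ?w t)"
    by (rule partial_deriv_eqI[OF D])
  then show "partial_deriv j (tf_shift x \<xi>) t = - (of_real (t $ j - x $ j) + \<i> * of_real (\<xi> $ j)) * tf_shift x \<xi> t"
    unfolding wi by (simp only: tf_shift_eq[of x \<xi>] mult_ac)
qed

text \<open>The short-time Fourier transform of a function without its normalizing power of
  \<open>2 * pi\<close>; \<open>GS_distr_GS_dual\<close> relates it to functionals.\<close>

definition tf_coeff :: "(real^'d::finite \<Rightarrow> complex) \<Rightarrow> real^'d \<Rightarrow> real^'d \<Rightarrow> complex" where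
  "tf_coeff f x \<xi> = (\<integral>t. f t * tf_shift x \<xi> t \<partial>lborel)"

lemma integral_gauss_translate:
  assumes "0 < a"
  shows "integrable lborel (\<lambda>t::real^'d::finite. exp (- a * (norm (t - x))\<^sup>2))"
    "(\<integral>t. exp (- a * (norm (t - x))\<^sup>2) \<partial>(lborel :: (real^'d::finite) measure)) = (\<integral>t. exp (- a * (norm t)\<^sup>2) \<partial>(lborel :: (real^'d::finite) measure))"
proof -
  let ?f = "\<lambda>t::real^'d. exp (- a * (norm t)\<^sup>2)"
  obtain K where K: "\<And>t. 0 \<le> t \<Longrightarrow> exp (- a * t powr 2) \<le> K * (1 + t) powr - (2 * real DIM(real^'d))"
    using exp_powr_decay[OF assms, of 2 "2 * real DIM(real^'d)"] by (metis zero_less_numeral)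
  have int: "integrable lborel ?f"
    by (rule integrable_lborel_decay[where K = K and N = "2 * real DIM(real^'d)"]) (use K[of "norm _"] in auto)
  have "integrable (distr lborel borel ((+) (- x))) ?f" using int by (simp add: lborel_distr_plus)
  then show "integrable lborel (\<lambda>t::real^'d. exp (- a * (norm (t - x))\<^sup>2))" by (simp add: integrable_distr_eq add.commute)
  have "(\<integral>t. ?f t \<partial>lborel) = (\<integral>t. ?f t \<partial>distr lborel borel ((+) (- x)))" by (simp add: lborel_distr_plus)
  then show "(\<integral>t. exp (- a * (norm (t - x))\<^sup>2) \<partial>(lborel :: (real^'d) measure)) = (\<integral>t. ?f t \<partial>lborel)"
    by (simp add: integral_distr add.commute)
qed

lemma continuous_tf_shift: "continuous_on UNIV (tf_shift x \<xi>)"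
  unfolding tf_shift_def gauss_window_def by (intro continuous_intros) auto

text \<open>As \<open>norm x\<close> is at most \<open>norm t + norm (t - x)\<close>, the decay of
  \<open>f\<close> handles the first summand and the Gaussian the second, since
  \<open>1 / s \<le> 2\<close>. Half of the Gaussian exponent is kept for the integration in
  \<open>t\<close>.\<close>

lemma tf_coeff_decay_x:
  assumes s: "1/2 \<le> s" and h: "0 < h"
  obtains r C where "0 < r" "0 < C" "\<And>M (f :: real^'d::finite \<Rightarrow> complex) x \<xi>. 0 \<le> M \<Longrightarrow> gs_bound s h M f \<Longrightarrow>
    norm (tf_coeff f x \<xi>) \<le> C * M * exp (- r * norm x powr (1/s))"
proof -
  define q where "q = 1/s"
  have s0: "0 < s" using s by simp
  have q: "0 < q" "q \<le> 2" using s by (auto simp: q_def field_simps)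
  define r1 where "r1 = s / 2 / (real CARD('d) * h) powr q"
  have r1: "0 < r1" using s0 h by (simp add: r1_def)
  \<comment> \<open>The division by \<open>2 powr q\<close> compensates \<open>powr_add_le\<close>;
    the cap 1/4 is the part of the Gaussian exponent 1/2 that may be spent.\<close>
  define r where "r = min r1 (1/4) / 2 powr q"
  have r: "0 < r" "r * 2 powr q \<le> r1" "r * 2 powr q \<le> 1/4" using r1 by (auto simp: r_def)
  define k where "k = pi powr (- real CARD('d) / 4)"
  have k: "0 < k" by (simp add: k_def)
  define I where "I = (\<integral>t. exp (- (1/4) * (norm t)\<^sup>2) \<partial>(lborel :: (real^'d) measure))"
  have I: "0 \<le> I" unfolding I_def by (rule integral_nonneg_AE) simp
  show ?thesis
  proof (rule that[OF r(1)])
    show "0 < 2 powr s * k * exp (1/4) * (I + 1)" using k I by simp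
    fix M :: real and f :: "real^'d \<Rightarrow> complex" and x \<xi> :: "real^'d"
    assume M: "0 \<le> M" and f: "gs_bound s h M f"
    let ?B = "\<lambda>t. 2 powr s * M * k * exp (1/4) * exp (- r * norm x powr q) * exp (- (1/4) * (norm (t - x))\<^sup>2)"
    have bd: "norm (f t * tf_shift x \<xi> t) \<le> ?B t" for t
    proof -
      have "norm x \<le> norm t + norm (t - x)" by (metis norm_minus_commute norm_triangle_sub)
      then have "norm x powr q \<le> (norm t + norm (t - x)) powr q" using q by (intro powr_mono2) auto
      also have "\<dots> \<le> 2 powr q * (norm t powr q + norm (t - x) powr q)" using q by (intro powr_add_le) auto
      also have "\<dots> \<le> 2 powr q * (norm t powr q + (1 + (norm (t - x))\<^sup>2))"
      proof -
        have "norm (t - x) powr q \<le> 1 + (norm (t - x))\<^sup>2"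
        proof (cases "norm (t - x) \<le> 1")
          case True
          then have "norm (t - x) powr q \<le> 1 powr q" using q by (intro powr_mono2) auto
          then show ?thesis by (simp add: add_increasing2)
        next
          case False
          then have "norm (t - x) powr q \<le> norm (t - x) powr 2" using q by (intro powr_mono) auto
          then show ?thesis by simp
        qed
        then show ?thesis by (intro mult_left_mono add_left_mono) auto
      qed
      finally have "r * norm x powr q \<le> r * (2 powr q * (norm t powr q + (1 + (norm (t - x))\<^sup>2)))"
        using r by (intro mult_left_mono) auto
      also have "\<dots> = (r * 2 powr q) * norm t powr q + (r * 2 powr q) * (1 + (norm (t - x))\<^sup>2)" by (simp add: algebra_simps)
      also have "\<dots> \<le> r1 * norm t powr q + 1/4 * (1 + (norm (t - x))\<^sup>2)"
        using r by (intro add_mono mult_right_mono) auto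
      finally have e: "- r1 * norm t powr q - (norm (t - x))\<^sup>2 / 2 \<le> 1/4 - r * norm x powr q - 1/4 * (norm (t - x))\<^sup>2"
        by (simp add: algebra_simps)
      have "norm (f t * tf_shift x \<xi> t) \<le> (2 powr s * M * exp (- r1 * norm t powr q)) * (k * exp (- (norm (t - x))\<^sup>2 / 2))"
        unfolding norm_mult norm_tf_shift gauss_window_def k_def r1_def q_def
        by (intro mult_mono gs_bound_decay[OF f h s0 M]) (use M in auto)
      also have "\<dots> = 2 powr s * M * k * exp (- r1 * norm t powr q - (norm (t - x))\<^sup>2 / 2)"
      proof -
        have "exp (- r1 * norm t powr q) * exp (- (norm (t - x))\<^sup>2 / 2) = exp (- r1 * norm t powr q - (norm (t - x))\<^sup>2 / 2)"
          by (simp flip: exp_add)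
        then show ?thesis by (simp add: mult_ac)
      qed
      also have "\<dots> \<le> 2 powr s * M * k * exp (1/4 - r * norm x powr q - 1/4 * (norm (t - x))\<^sup>2)"
        using e M k by (intro mult_left_mono) auto
      also have "\<dots> = ?B t"
      proof -
        have "exp (1/4 - r * norm x powr q - 1/4 * (norm (t - x))\<^sup>2) = exp (1/4) * exp (- r * norm x powr q) * exp (- (1/4) * (norm (t - x))\<^sup>2)"
          by (simp flip: exp_add)
        then show ?thesis by (simp add: mult_ac)
      qed
      finally show ?thesis .
    qed
    have "norm (tf_coeff f x \<xi>) \<le> (\<integral>t. ?B t \<partial>lborel)"
      unfolding tf_coeff_def
    proof (rule Bochner_Integration.integral_norm_bound_integral)
      show iB: "integrable lborel ?B" by (intro integrable_mult_right integral_gauss_translate) auto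
      show "integrable lborel (\<lambda>t. f t * tf_shift x \<xi> t)"
      proof (rule Bochner_Integration.integrable_bound[OF iB])
        show "(\<lambda>t. f t * tf_shift x \<xi> t) \<in> borel_measurable lborel"
          using gs_bound_continuous[OF f, of "[]"] continuous_tf_shift[of x \<xi>]
          by (simp add: borel_measurable_continuous_onI continuous_on_mult)
        show "AE t in lborel. norm (f t * tf_shift x \<xi> t) \<le> norm (?B t)"
          unfolding real_norm_def by (intro AE_I2 order.trans[OF bd abs_ge_self])
      qed
    qed (rule bd)
    also have "\<dots> = 2 powr s * M * k * exp (1/4) * exp (- r * norm x powr q) * I"
      unfolding I_def using integral_gauss_translate(2)[of "1/4" x] by simp
    also have "\<dots> \<le> 2 powr s * M * k * exp (1/4) * exp (- r * norm x powr q) * (I + 1)"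
      using M k by (intro mult_left_mono) auto
    finally show "norm (tf_coeff f x \<xi>) \<le> 2 powr s * k * exp (1/4) * (I + 1) * M * exp (- r * norm x powr (1/s))"
      by (simp add: q_def mult_ac)
  qed
qed

text \<open>Peetre's inequality \<open>1 + norm t \<le> (1 + norm x) * (1 + norm (t - x))\<close>
  moves the centre to the origin. \<open>K\<close> may depend on \<open>x\<close>, as the bound
  serves only for domination.\<close>

lemma gauss_translate_decay:
  fixes x :: "'a::real_normed_vector"
  assumes a: "0 < a" and N: "0 \<le> N"
  obtains K where "0 < K" "\<And>t. exp (- a * (norm (t - x))\<^sup>2) \<le> K * (1 + norm t) powr - N"
proof -
  obtain K where K: "0 < K" "\<And>v. 0 \<le> v \<Longrightarrow> exp (- a * v powr 2) \<le> K * (1 + v) powr - N"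
    by (rule exp_powr_decay[OF a, of 2 N]) (simp, rule that)
  show ?thesis
  proof (rule that)
    show "0 < K * (1 + norm x) powr N" using K(1) add_pos_nonneg[OF zero_less_one norm_ge_zero[of x]] by simp
    fix t :: 'a
    have pos: "0 < 1 + norm (t - x)" "0 < 1 + norm x" "0 < 1 + norm t" by (auto simp: add_pos_nonneg)
    have "norm t \<le> norm x + norm (t - x)" by (metis add.commute norm_triangle_sub)
    moreover have "0 \<le> norm x * norm (t - x)" by simp
    ultimately have "1 + norm t \<le> (1 + norm x) * (1 + norm (t - x))" unfolding distrib_left distrib_right by linarith
    then have "((1 + norm x) * (1 + norm (t - x))) powr - N \<le> (1 + norm t) powr - N"
      using N pos by (intro powr_mono2') auto
    then have "(1 + norm x) powr N * ((1 + norm x) powr - N * (1 + norm (t - x)) powr - N) \<le> (1 + norm x) powr N * (1 + norm t) powr - N"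
      using pos by (intro mult_left_mono) (auto simp: powr_mult)
    moreover have "(1 + norm x) powr N * (1 + norm x) powr - N = 1" using pos by (simp flip: powr_add)
    ultimately have 1: "(1 + norm (t - x)) powr - N \<le> (1 + norm x) powr N * (1 + norm t) powr - N"
      by (simp add: mult.assoc[symmetric])
    have "exp (- a * (norm (t - x))\<^sup>2) \<le> K * (1 + norm (t - x)) powr - N" using K(2)[of "norm (t - x)"] by simp
    also have "\<dots> \<le> K * ((1 + norm x) powr N * (1 + norm t) powr - N)" using 1 K by (intro mult_left_mono) auto
    finally show "exp (- a * (norm (t - x))\<^sup>2) \<le> K * (1 + norm x) powr N * (1 + norm t) powr - N" by (simp add: mult.assoc)
  qed
qed

section \<open>Decay in the frequency variable\<close>

lemma fact_mult_powr_le: "0 \<le> s \<Longrightarrow> (fact k * fact m) powr s \<le> fact (k + m) powr (s::real)"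
proof -
  assume s: "0 \<le> s"
  have "(fact k * fact m :: nat) \<le> fact (k + m)" by (intro dvd_imp_le fact_fact_dvd_fact) auto
  then have "real (fact k * fact m) \<le> real (fact (k + m))" by (rule of_nat_mono)
  then have "(fact k * fact m :: real) \<le> fact (k + m)" by simp
  then show ?thesis using s by (intro powr_mono2) auto
qed

text \<open>In the recursion below, differentiating an \<open>m\<close>-th power produces the factor
  \<open>m\<close> but leaves a total order two lower than in the other terms. The two missing
  factors of the factorial, raised to \<open>s\<close>, pay for \<open>m\<close> because
  \<open>1/2 \<le> s\<close>.\<close>

lemma mult_fact_pred_powr_le:
  assumes s: "1/2 \<le> s" and m: "m \<le> l"
  shows "real m * fact (l - 1) powr s \<le> fact (l + 1) powr s"
proof (cases l)
  case 0 then show ?thesis using m by simp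
next
  case (Suc l')
  have "real m \<le> (real l * real l) powr (1/2)" using m by (simp add: powr_half_sqrt)
  also have "\<dots> \<le> (real (l + 1) * real l) powr (1/2)" by (intro powr_mono2 mult_right_mono) auto
  also have "\<dots> \<le> (real (l + 1) * real l) powr s"
    using s Suc mult_mono[of 1 "real (l+1)" 1 "real l"] by (intro powr_mono) auto
  finally have "real m * fact (l - 1) powr s \<le> (real (l + 1) * real l) powr s * fact (l - 1) powr s"
    by (intro mult_right_mono) auto
  also have "\<dots> = (real (l + 1) * real l * fact (l - 1)) powr s" by (rule powr_mult[symmetric])
  also have "real (l + 1) * real l * fact (l - 1) = fact (l + 1)" using Suc by simp
  finally show ?thesis .
qed

text \<open>For use with \<open>z = \<i>\<xi>\<^sub>j\<close> and \<open>A k m\<close> the integral of the \<open>k\<close>-th \<open>j\<close>-derivative of \<open>f\<close> times \<open>(t\<^sub>j - x\<^sub>j)\<^sup>m\<close>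
  and the modulated Gaussian; the recursion is then integration by parts.\<close>

lemma moment_recursion_bound:
  fixes A :: "nat \<Rightarrow> nat \<Rightarrow> complex"
  assumes s: "1/2 \<le> s" and G: "1 \<le> G" and M: "0 \<le> M"
    and bd: "\<And>k m. norm (A k m) \<le> M * G ^ (k + m) * (fact k * fact m) powr s"
    and rec: "\<And>k m. z * A k m = A (Suc k) m + of_nat m * A k (m - 1) - A k (Suc m)"
  shows "norm z ^ n * norm (A k m) \<le> M * 3 ^ n * G ^ (n + k + m) * fact (n + k + m) powr s"
proof (induction n arbitrary: k m)
  case 0
  have "norm (A k m) \<le> M * G ^ (k + m) * (fact k * fact m) powr s" by (rule bd)
  also have "\<dots> \<le> M * G ^ (k + m) * fact (k + m) powr s"
    using s G M by (intro mult_left_mono fact_mult_powr_le) auto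
  finally show ?case by simp
next
  case (Suc n)
  let ?l = "n + k + m"
  let ?R = "M * 3 ^ n * G ^ (?l + 1) * fact (?l + 1) powr s"
  have 1: "norm z ^ n * norm (A (Suc k) m) \<le> ?R" using Suc.IH[of "Suc k" m] by simp
  have 2: "norm z ^ n * norm (A k (Suc m)) \<le> ?R" using Suc.IH[of k "Suc m"] by simp
  have 3: "norm z ^ n * (real m * norm (A k (m - 1))) \<le> ?R"
  proof (cases m)
    case 0 then show ?thesis using M G by simp
  next
    case (Suc m')
    have "norm z ^ n * norm (A k (m - 1)) \<le> M * 3 ^ n * G ^ (?l - 1) * fact (?l - 1) powr s"
      using Suc.IH[of k "m - 1"] Suc by simp
    then have "real m * (norm z ^ n * norm (A k (m - 1))) \<le> real m * (M * 3 ^ n * G ^ (?l - 1) * fact (?l - 1) powr s)"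
      by (intro mult_left_mono) auto
    also have "\<dots> = M * 3 ^ n * G ^ (?l - 1) * (real m * fact (?l - 1) powr s)" by (simp add: mult_ac)
    also have "\<dots> \<le> M * 3 ^ n * G ^ (?l + 1) * fact (?l + 1) powr s"
      using M G s by (intro mult_mono mult_left_mono power_increasing mult_fact_pred_powr_le) auto
    finally show ?thesis by (simp add: mult_ac)
  qed
  have "norm z ^ Suc n * norm (A k m) = norm z ^ n * norm (z * A k m)" by (simp add: norm_mult)
  also have "\<dots> \<le> norm z ^ n * (norm (A (Suc k) m) + real m * norm (A k (m - 1)) + norm (A k (Suc m)))"
    unfolding rec by (intro mult_left_mono order.trans[OF norm_triangle_ineq4] add_mono order.trans[OF norm_triangle_ineq])
      (auto simp: norm_mult)
  also have "\<dots> \<le> 3 * ?R" using 1 2 3 by (simp add: algebra_simps)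
  also have "\<dots> = M * 3 ^ Suc n * G ^ (Suc n + k + m) * fact (Suc n + k + m) powr s" by simp
  finally show ?case .
qed

text \<open>All the integrals \<open>A k m\<close> carry the same Gaussian. Half of its exponent
  absorbs the powers of \<open>t - x\<close> and the other half is integrated, so the constants do
  not depend on \<open>x\<close> and \<xi>.\<close>

lemma tf_coeff_moment_bounds:
  assumes s: "1/2 \<le> s" and h: "0 < h"
  obtains G C where "1 \<le> G" "0 < C" "\<And>M (f :: real^'d::finite \<Rightarrow> complex) x \<xi> j n. 0 \<le> M \<Longrightarrow> gs_bound s h M f \<Longrightarrow>
    \<bar>\<xi> $ j\<bar> ^ n * norm (tf_coeff f x \<xi>) \<le> C * M * (3 * G) ^ n * fact n powr s"
proof -
  obtain H :: real where H: "1 \<le> H" "\<And>(v::real) m. 0 \<le> v \<Longrightarrow> v ^ m \<le> H ^ m * fact m powr (1/2) * exp (1/4 * v powr (1 / (1/2)))"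
    using power_le_powr_fact_exp[of "1/4" "1/2"] by auto
  define G where "G = max h H"
  have G: "1 \<le> G" "h \<le> G" "H \<le> G" using H by (auto simp: G_def)
  define c where "c = pi powr (- real CARD('d) / 4)"
  have c: "0 < c" by (simp add: c_def)
  define I where "I = (\<integral>t. exp (- (1/4) * (norm t)\<^sup>2) \<partial>(lborel :: (real^'d) measure))"
  have I: "0 \<le> I" unfolding I_def by (rule integral_nonneg_AE) simp
  show ?thesis
  proof (rule that[OF G(1)])
    show "0 < c * I + 1" using c I by (simp add: add_nonneg_pos)
    fix M :: real and f :: "real^'d \<Rightarrow> complex" and x \<xi> :: "real^'d" and j :: 'd and n :: nat
    assume M: "0 \<le> M" and f: "gs_bound s h M f"
    define fk where "fk k = iter_partial (replicate k j) f" for k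
    define e where "e t = complex_of_real (t $ j - x $ j)" for t
    define g where "g k m t = fk k t * e t ^ m * tf_shift x \<xi> t" for k m t
    define A where "A k m = (\<integral>t. g k m t \<partial>lborel)" for k m
    let ?E = "\<lambda>t. exp (- (1/4) * (norm (t - x))\<^sup>2)"
    have gb: "norm (g k m t) \<le> M * c * G ^ (k + m) * (fact k * fact m) powr s * ?E t" for k m t
    proof -
      have "norm (e t) \<le> norm (t - x)" using component_le_norm_cart[of "t - x" j] by (simp only: e_def norm_of_real vector_minus_component)
      then have "norm (e t) ^ m \<le> norm (t - x) ^ m" by (intro power_mono) auto
      also have "\<dots> \<le> H ^ m * fact m powr (1/2) * exp (1/4 * norm (t - x) powr (1 / (1/2)))" by (rule H(2)) simp
      also have "\<dots> \<le> G ^ m * fact m powr s * exp (1/4 * (norm (t - x))\<^sup>2)"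
        using G H s by (intro mult_mono power_mono powr_mono) (auto simp: fact_ge_1)
      finally have em: "norm (e t) ^ m \<le> G ^ m * fact m powr s * exp (1/4 * (norm (t - x))\<^sup>2)" .
      have "norm (fk k t) \<le> M * (h ^ k * fact k powr s)" unfolding fk_def by (rule gs_bound_replicate[OF f])
      also have "\<dots> \<le> M * (G ^ k * fact k powr s)" using M G h by (intro mult_left_mono mult_right_mono power_mono) auto
      finally have fk: "norm (fk k t) \<le> M * (G ^ k * fact k powr s)" .
      have "norm (g k m t) = norm (fk k t) * norm (e t) ^ m * (c * exp (- (norm (t - x))\<^sup>2 / 2))"
        by (simp add: g_def norm_mult norm_power norm_tf_shift gauss_window_def c_def)
      also have "\<dots> \<le> (M * (G ^ k * fact k powr s)) * (G ^ m * fact m powr s * exp (1/4 * (norm (t - x))\<^sup>2)) * (c * exp (- (norm (t - x))\<^sup>2 / 2))"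
        using c M G by (intro mult_right_mono mult_mono fk em) auto
      also have "\<dots> = M * c * G ^ (k + m) * (fact k * fact m) powr s * (exp (1/4 * (norm (t - x))\<^sup>2) * exp (- (norm (t - x))\<^sup>2 / 2))"
        by (simp add: power_add powr_mult mult_ac)
      also have "exp (1/4 * (norm (t - x))\<^sup>2) * exp (- (norm (t - x))\<^sup>2 / 2) = ?E t" by (simp flip: exp_add)
      finally show ?thesis .
    qed
    have cont: "continuous_on UNIV (g k m)" for k m
    proof -
      have "continuous_on UNIV (fk k)" unfolding fk_def by (rule gs_bound_continuous[OF f])
      then show ?thesis unfolding g_def e_def by (intro continuous_intros continuous_tf_shift)
    qed
    have int: "integrable lborel (g k m)" for k m
    proof (rule Bochner_Integration.integrable_bound)
      show "integrable lborel (\<lambda>t. M * c * G ^ (k + m) * (fact k * fact m) powr s * ?E t)"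
        by (intro integrable_mult_right integral_gauss_translate) simp
      show "g k m \<in> borel_measurable lborel" using cont[of k m] by (simp add: borel_measurable_continuous_onI)
      show "AE t in lborel. norm (g k m t) \<le> norm (M * c * G ^ (k + m) * (fact k * fact m) powr s * ?E t)"
        unfolding real_norm_def by (intro AE_I2 order.trans[OF gb abs_ge_self])
    qed
    have A_bd: "norm (A k m) \<le> (c * I + 1) * M * G ^ (k + m) * (fact k * fact m) powr s" for k m
    proof -
      have "norm (A k m) \<le> (\<integral>t. M * c * G ^ (k + m) * (fact k * fact m) powr s * ?E t \<partial>lborel)"
        unfolding A_def
        by (rule Bochner_Integration.integral_norm_bound_integral[OF int _ gb])
           (intro integrable_mult_right integral_gauss_translate, simp)
      also have "\<dots> = (c * I) * (M * G ^ (k + m) * (fact k * fact m) powr s)"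
        unfolding I_def using integral_gauss_translate(2)[of "1/4" x] by simp
      also have "\<dots> \<le> (c * I + 1) * (M * G ^ (k + m) * (fact k * fact m) powr s)"
        using M G by (intro mult_right_mono) auto
      finally show ?thesis by (simp add: mult.assoc)
    qed
    have rec: "(\<i> * of_real (\<xi> $ j)) * A k m = A (Suc k) m + of_nat m * A k (m - 1) - A k (Suc m)" for k m
    proof -
      \<comment> \<open>The derivative of the integrand in direction \<open>j\<close>; the vanishing
        of its integral is the recursion.\<close>
      define g' where "g' t = g (Suc k) m t + of_nat m * g k (m - 1) t - g k (Suc m) t - \<i> * of_real (\<xi> $ j) * g k m t" for t
      have der: "((\<lambda>\<tau>. g k m (t + \<tau> *\<^sub>R axis j 1)) has_vector_derivative g' t) (at 0)" for t
      proof -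
        have 1: "((\<lambda>\<tau>. fk k (t + \<tau> *\<^sub>R axis j 1)) has_vector_derivative fk (Suc k) t) (at 0)"
          using directional_partial_deriv[OF C_infinity_differentiable[OF gs_bound_C_infinity[OF f]], of "replicate k j" t j]
          by (simp add: fk_def)
        have 2: "((\<lambda>\<tau>. tf_shift x \<xi> (t + \<tau> *\<^sub>R axis j 1)) has_vector_derivative - (e t + \<i> * of_real (\<xi> $ j)) * tf_shift x \<xi> t) (at 0)"
          using directional_partial_deriv[OF partial_deriv_tf_shift(1)[of x \<xi> t], of j]
          by (simp only: partial_deriv_tf_shift(2) e_def)
        have et: "e (t + \<tau> *\<^sub>R axis j 1) = e t + of_real \<tau>" for \<tau> by (simp add: e_def axis_def)
        have "((\<lambda>\<tau>. e t + of_real \<tau>) has_vector_derivative 1) (at (0::real))"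
          by (auto intro!: derivative_eq_intros)
        moreover have "((\<lambda>z. z ^ m) has_field_derivative of_nat m * e t ^ (m - 1)) (at (e t + of_real 0))"
          by (auto intro!: derivative_eq_intros)
        ultimately have 3: "((\<lambda>\<tau>. e (t + \<tau> *\<^sub>R axis j 1) ^ m) has_vector_derivative of_nat m * e t ^ (m - 1)) (at 0)"
          unfolding et using field_vector_diff_chain_at[of "\<lambda>\<tau>. e t + of_real \<tau>" 1 0 "\<lambda>z. z ^ m"] by (simp add: o_def)
        have eS: "e (t + 0 *\<^sub>R axis j 1) = e t" by simp
        show ?thesis
          unfolding g_def
          by (rule has_vector_derivative_eq_rhs[OF has_vector_derivative_mult[OF has_vector_derivative_mult[OF 1 3] 2]])
             (simp add: g'_def g_def algebra_simps)
      qed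
      have g'm: "g' \<in> borel_measurable borel"
        unfolding g'_def using cont by (intro borel_measurable_continuous_onI continuous_intros)
      \<comment> \<open>The bounds from here on may depend on \<open>x\<close> and \<xi>, as they
        only justify that the integral vanishes.\<close>
      obtain K where K: "K > 0" "\<And>t. ?E t \<le> K * (1 + norm t) powr - (2 * real CARD('d))"
        using gauss_translate_decay[of "1/4" "2 * real CARD('d)" x] by auto
      define b where "b k m = M * c * G ^ (k + m) * (fact k * fact m) powr s" for k m
      have b0: "0 \<le> b k m" for k m using M c G by (simp add: b_def)
      define S where "S = b (Suc k) m + real m * b k (m - 1) + b k (Suc m) + \<bar>\<xi> $ j\<bar> * b k m"
      have S0: "0 \<le> S" unfolding S_def using b0 by (intro add_nonneg_nonneg mult_nonneg_nonneg) auto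
      have "norm (g' t) \<le> (S * K) * (1 + norm t) powr - (2 * real CARD('d))" for t
      proof -
        have "norm (g' t) \<le> norm (g (Suc k) m t) + real m * norm (g k (m - 1) t) + norm (g k (Suc m) t) + \<bar>\<xi> $ j\<bar> * norm (g k m t)"
          unfolding g'_def
          by (rule order.trans[OF norm_triangle_ineq4] add_mono order.trans[OF norm_triangle_ineq] | simp add: norm_mult)+
        also have "\<dots> \<le> b (Suc k) m * ?E t + real m * (b k (m - 1) * ?E t) + b k (Suc m) * ?E t + \<bar>\<xi> $ j\<bar> * (b k m * ?E t)"
          unfolding b_def by (intro add_mono mult_left_mono gb) auto
        also have "\<dots> = S * ?E t" by (simp add: S_def algebra_simps)
        also have "\<dots> \<le> S * (K * (1 + norm t) powr - (2 * real CARD('d)))" using S0 by (intro mult_left_mono K) auto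
        finally show ?thesis by (simp add: mult.assoc)
      qed
      from integral_directional_deriv_zero[OF der int g'm this order_refl] have "(\<integral>t. g' t \<partial>lborel) = 0" .
      moreover have "(\<integral>t. g' t \<partial>lborel) = A (Suc k) m + of_nat m * A k (m - 1) - A k (Suc m) - \<i> * of_real (\<xi> $ j) * A k m"
        unfolding g'_def A_def by (simp add: int Bochner_Integration.integral_diff Bochner_Integration.integral_add
            Bochner_Integration.integrable_diff Bochner_Integration.integrable_add integrable_mult_right)
      ultimately show ?thesis by simp
    qed
    have "norm (\<i> * of_real (\<xi> $ j)) ^ n * norm (A 0 0) \<le> ((c * I + 1) * M) * 3 ^ n * G ^ (n + 0 + 0) * fact (n + 0 + 0) powr s"
      by (rule moment_recursion_bound[OF s G(1) _ A_bd rec]) (use c I M in auto)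
    moreover have "A 0 0 = tf_coeff f x \<xi>" by (simp add: A_def g_def fk_def tf_coeff_def)
    ultimately show "\<bar>\<xi> $ j\<bar> ^ n * norm (tf_coeff f x \<xi>) \<le> (c * I + 1) * M * (3 * G) ^ n * fact n powr s"
      by (simp add: norm_mult power_mult_distrib mult_ac)
  qed
qed

text \<open>The bounds in \<open>x\<close> and in \<xi> are combined by multiplication: the square
  of the coefficient is at most their product, which halves the rate.\<close>

lemma tf_coeff_decay:
  assumes s: "1/2 \<le> s" and h: "0 < h"
  obtains r C where "0 < r" "0 < C" "\<And>M (f :: real^'d::finite \<Rightarrow> complex) x \<xi>. 0 \<le> M \<Longrightarrow> gs_bound s h M f \<Longrightarrow>
    norm (tf_coeff f x \<xi>) \<le> C * M * exp (- r * (norm x powr (1/s) + norm \<xi> powr (1/s)))"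
proof -
  have s0: "0 < s" using s by simp
  obtain r1 C1 where r1: "0 < r1" "0 < C1" and X: "\<And>M (f :: real^'d \<Rightarrow> complex) x \<xi>. 0 \<le> M \<Longrightarrow> gs_bound s h M f \<Longrightarrow>
    norm (tf_coeff f x \<xi>) \<le> C1 * M * exp (- r1 * norm x powr (1/s))"
    using tf_coeff_decay_x[OF s h, where 'd='d] by blast
  obtain G C2 where G: "1 \<le> G" "0 < C2" and Xi: "\<And>M (f :: real^'d \<Rightarrow> complex) x \<xi> j n. 0 \<le> M \<Longrightarrow> gs_bound s h M f \<Longrightarrow>
    \<bar>\<xi> $ j\<bar> ^ n * norm (tf_coeff f x \<xi>) \<le> C2 * M * (3 * G) ^ n * fact n powr s"
    using tf_coeff_moment_bounds[OF s h, where 'd='d] by blast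
  define r2 where "r2 = s / 2 / (real CARD('d) * (3 * G)) powr (1/s)"
  have r2: "0 < r2" using s0 G by (simp add: r2_def)
  define r where "r = min r1 r2"
  define C where "C = max C1 (2 powr s * C2)"
  have r: "0 < r" "r \<le> r1" "r \<le> r2" using r1 r2 by (auto simp: r_def)
  have C: "0 < C" "C1 \<le> C" "2 powr s * C2 \<le> C" using r1 by (auto simp: C_def)
  show ?thesis
  proof (rule that)
    show "0 < r / 2" using r by simp
    show "0 < C" by fact
    fix M :: real and f :: "real^'d \<Rightarrow> complex" and x \<xi> :: "real^'d"
    assume M: "0 \<le> M" and f: "gs_bound s h M f"
    let ?a = "norm (tf_coeff f x \<xi>)"
    obtain j where j: "norm \<xi> \<le> real CARD('d) * \<bar>\<xi> $ j\<bar>" using exists_large_component .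
    have "?a \<le> 2 powr s * (C2 * M) * exp (- (s / 2 / (3 * G) powr (1 / s)) * \<bar>\<xi> $ j\<bar> powr (1 / s))"
      by (intro exp_decay_of_power_bounds Xi[OF M f]) (use G M s0 in auto)
    also have "\<dots> \<le> 2 powr s * (C2 * M) * exp (- r2 * norm \<xi> powr (1/s))"
    proof -
      have "norm \<xi> powr (1/s) \<le> (real CARD('d) * \<bar>\<xi> $ j\<bar>) powr (1/s)" using j s0 by (intro powr_mono2) auto
      also have "\<dots> = real CARD('d) powr (1/s) * \<bar>\<xi> $ j\<bar> powr (1/s)" by (rule powr_mult)
      finally have "r2 * norm \<xi> powr (1/s) \<le> r2 * (real CARD('d) powr (1/s) * \<bar>\<xi> $ j\<bar> powr (1/s))"
        using r2 by (intro mult_left_mono) auto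
      also have "\<dots> = (s / 2 / (3 * G) powr (1 / s)) * \<bar>\<xi> $ j\<bar> powr (1 / s)"
        using G by (simp add: powr_mult r2_def)
      finally show ?thesis using M G by (intro mult_left_mono) auto
    qed
    also have "\<dots> \<le> C * M * exp (- r * norm \<xi> powr (1/s))"
    proof -
      have "2 powr s * C2 * M \<le> C * M" using C M by (intro mult_right_mono) auto
      moreover have "r * norm \<xi> powr (1/s) \<le> r2 * norm \<xi> powr (1/s)" using r by (intro mult_right_mono) auto
      ultimately show ?thesis using M G C mult_mono[of "2 powr s * C2 * M" "C * M" "exp (- r2 * norm \<xi> powr (1/s))" "exp (- r * norm \<xi> powr (1/s))"]
        by (simp add: mult.assoc)
    qed
    finally have 2: "?a \<le> C * M * exp (- r * norm \<xi> powr (1/s))" .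
    have "?a \<le> C1 * M * exp (- r1 * norm x powr (1/s))" by (rule X[OF M f])
    also have "\<dots> \<le> C * M * exp (- r * norm x powr (1/s))"
    proof -
      have "C1 * M \<le> C * M" using C M by (intro mult_right_mono) auto
      moreover have "r * norm x powr (1/s) \<le> r1 * norm x powr (1/s)" using r by (intro mult_right_mono) auto
      ultimately show ?thesis using M C by (intro mult_mono) auto
    qed
    finally have 1: "?a \<le> C * M * exp (- r * norm x powr (1/s))" .
    have "?a * ?a \<le> (C * M * exp (- r * norm x powr (1/s))) * (C * M * exp (- r * norm \<xi> powr (1/s)))"
      using C M by (intro mult_mono 1 2) auto
    also have "\<dots> = (C * M * exp (- (r / 2) * (norm x powr (1/s) + norm \<xi> powr (1/s))))\<^sup>2"
    proof -
      have "exp (- r * norm x powr (1/s)) * exp (- r * norm \<xi> powr (1/s)) = (exp (- (r / 2) * (norm x powr (1/s) + norm \<xi> powr (1/s))))\<^sup>2"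
        unfolding exp_double[symmetric] mult_exp_exp by (rule arg_cong[where f=exp]) (simp add: algebra_simps)
      then show ?thesis by (simp add: power_mult_distrib power2_eq_square mult_ac)
    qed
    finally have "?a\<^sup>2 \<le> (C * M * exp (- (r / 2) * (norm x powr (1/s) + norm \<xi> powr (1/s))))\<^sup>2" by (simp add: power2_eq_square)
    then show "?a \<le> C * M * exp (- (r / 2) * (norm x powr (1/s) + norm \<xi> powr (1/s)))"
      by (rule power2_le_imp_le) (use C M in auto)
  qed
qed

section \<open>Reconstruction from time-frequency coefficients\<close>

abbreviation tf_atom :: "(real^'d::finite) \<times> (real^'d) \<Rightarrow> real^'d \<Rightarrow> complex" where
  "tf_atom z \<equiv> tf_shift (fst z) (snd z)"

lemma norm_pair_power2: "(norm z)\<^sup>2 = (norm (fst z))\<^sup>2 + (norm (snd z))\<^sup>2"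
  by (simp add: norm_prod_def)

lemma tf_coeff_borel:
  fixes f :: "real^'d::finite \<Rightarrow> complex"
  assumes f: "continuous_on UNIV f"
  shows "(\<lambda>z. tf_coeff f (fst z) (snd z)) \<in> borel_measurable borel"
    "(\<lambda>z. tf_coeff f (fst z) (- snd z)) \<in> borel_measurable borel"
proof -
  let ?F = "\<lambda>p :: ((real^'d) \<times> (real^'d)) \<times> (real^'d). f (snd p) * tf_atom (fst p) (snd p)"
  have "continuous_on UNIV ?F"
    unfolding tf_shift_def gauss_window_def
    by (intro continuous_intros continuous_on_compose2[OF f]) auto
  then have "?F \<in> borel_measurable (borel \<Otimes>\<^sub>M borel)"
    unfolding borel_prod by (rule borel_measurable_continuous_onI)
  moreover have "sets (borel \<Otimes>\<^sub>M lborel) = sets (borel \<Otimes>\<^sub>M (borel :: (real^'d) measure))"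
    by (intro sets_pair_measure_cong) auto
  ultimately have "?F \<in> borel_measurable (borel \<Otimes>\<^sub>M lborel)" using measurable_cong_sets by blast
  then have "(\<lambda>(z, t). f t * tf_atom z t) \<in> borel_measurable (borel \<Otimes>\<^sub>M lborel)" by (simp add: case_prod_unfold)
  then show 1: "(\<lambda>z. tf_coeff f (fst z) (snd z)) \<in> borel_measurable borel"
    unfolding tf_coeff_def by (rule lborel.borel_measurable_lebesgue_integral)
  have "(\<lambda>z :: (real^'d) \<times> (real^'d). (fst z, - snd z)) \<in> borel_measurable borel"
    by (intro borel_measurable_continuous_onI continuous_intros)
  from measurable_compose[OF this 1] show "(\<lambda>z. tf_coeff f (fst z) (- snd z)) \<in> borel_measurable borel" by simp
qed

lemma iter_partial_tf_shift:
  "iter_partial L (tf_shift x \<xi>) = (\<lambda>y. complex_of_real (pi powr (- real CARD('d) / 4) * exp (- (norm x)\<^sup>2 / 2)) * tensor_wave (count_list L) (phase_point x \<xi>) y)"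
  for x \<xi> :: "real^'d::finite"
  unfolding tf_shift_eq
  using iter_partial_lincomb[OF tensor_wave_C_infinity tensor_wave_C_infinity, of L "complex_of_real (pi powr (- real CARD('d) / 4) * exp (- (norm x)\<^sup>2 / 2))" "phase_point x \<xi>" 0]
  by (simp add: iter_partial_tensor_wave)

lemma tf_shift_C_infinity: "tf_shift x \<xi> \<in> C_infinity"
  using C_infinity_lincomb[OF tensor_wave_C_infinity tensor_wave_C_infinity, of _ "phase_point x \<xi>" 0] unfolding tf_shift_eq by simp

lemma multi_deriv_count_list_tf_shift: "multi_deriv (count_list L) (tf_shift x \<xi>) = iter_partial L (tf_shift x \<xi>)"
  by (simp add: multi_deriv_def iter_partial_tf_shift count_list_SOME)

lemma continuous_iter_partial_tf_atom:
  "continuous_on UNIV (\<lambda>z. iter_partial L (tf_atom z) (y :: real^'d::finite))"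
proof -
  have h: "continuous_on UNIV (hermite k)" for k
    by (rule holomorphic_on_imp_continuous_on) (use hermite_holomorphic[of "\<lambda>z. z" UNIV k] in simp)
  have hc: "continuous_on UNIV (\<lambda>z. hermite k (g z))" if "continuous_on UNIV g" for k and g :: "_ \<Rightarrow> complex"
    using continuous_on_compose2[OF h that] by auto
  have "continuous_on UNIV (\<lambda>z. phase_point (fst z) (snd z) j)" for j :: 'd
    unfolding phase_point_def Complex_eq by (intro continuous_intros)
  then show ?thesis
    unfolding iter_partial_tf_shift tensor_wave_def hermite_wave_def
    by (intro continuous_intros hc) auto
qed

text \<open>The sign of \<open>snd z\<close> is reversed in the coefficient because both \<^const>\<open>tf_coeff\<close> and the atoms use
  \<open>exp (- \<i> y \<bullet> \<xi>)\<close>.\<close>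

lemma tf_inversion:
  fixes f :: "real^'d::finite \<Rightarrow> complex"
  assumes s: "1/2 \<le> s" and h: "0 < h" and M: "0 \<le> M" and f: "gs_bound s h M f"
  shows "(\<integral>z. tf_coeff f (fst z) (- snd z) * tf_atom z y \<partial>lborel) = complex_of_real ((2 * pi) ^ CARD('d)) * f y"
proof -
  have q: "0 < 1/s" using s by simp
  define c where "c = pi powr (- real CARD('d) / 4)"
  have c: "0 < c" by (simp add: c_def)
  have gw: "0 \<le> gauss_window t" "gauss_window t \<le> c" for t :: "real^'d"
    by (auto simp: gauss_window_def c_def mult_le_cancel_left1)
  have fc: "continuous_on UNIV f" using gs_bound_continuous[OF f, of "[]"] by simp
  have fb: "norm (f t) \<le> M" for t using gs_bound_replicate[OF f, of 0 undefined t] by simp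
  obtain r C where r: "0 < r" "0 < C" and dec: "\<And>M (f :: real^'d \<Rightarrow> complex) x \<xi>. 0 \<le> M \<Longrightarrow> gs_bound s h M f \<Longrightarrow>
    norm (tf_coeff f x \<xi>) \<le> C * M * exp (- r * (norm x powr (1/s) + norm \<xi> powr (1/s)))"
    using tf_coeff_decay[OF s h, where 'd='d] by blast
  let ?N = "2 * real DIM((real^'d) \<times> (real^'d))"
  obtain K where K: "0 < K" "\<And>z :: (real^'d) \<times> (real^'d). exp (- r * (norm (fst z) powr (1/s) + norm (snd z) powr (1/s))) \<le> K * (1 + norm z) powr - ?N"
    using exp_phase_decay[OF r(1) q, of ?N] by blast
  \<comment> \<open>For fixed \<open>x\<close> the coefficient is the Fourier transform in \<xi> of
    \<open>f\<close> times a shifted window. Inversion gives \<open>f y\<close> times a squared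
    window, which the later integration over \<open>x\<close> removes.\<close>
  have inner: "(\<integral>\<xi>. tf_coeff f x (- \<xi>) * tf_shift x \<xi> y \<partial>lborel) =
      complex_of_real ((2 * pi) ^ CARD('d)) * f y * (complex_of_real (gauss_window (x - y)) * complex_of_real (gauss_window (x - y)))" for x
  proof -
    define k where "k t = f t * complex_of_real (gauss_window (t - x))" for t
    have kc: "continuous_on UNIV k" unfolding k_def gauss_window_def by (intro continuous_intros fc) auto
    have F: "tf_coeff f x \<xi> = (\<integral>t. k t * iexp (- (t \<bullet> \<xi>)) \<partial>lborel)" for \<xi>
      by (simp add: tf_coeff_def k_def tf_shift_def mult.assoc)
    have "integrable lborel (\<lambda>t. complex_of_real (gauss_window (t - x)))"
    proof -
      have "integrable (distr lborel borel ((+) (- x))) (\<lambda>t. complex_of_real (gauss_window t))"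
        using integral_gauss_window_square(1) by (simp add: lborel_distr_plus)
      then show ?thesis by (subst (asm) integrable_distr_eq) (auto simp: gauss_window_def)
    qed
    then have "integrable lborel (\<lambda>t. complex_of_real M * complex_of_real (gauss_window (t - x)))"
      by (intro integrable_mult_right)
    then have ki: "integrable lborel k"
      by (rule Bochner_Integration.integrable_bound)
         (use fb gw M kc in \<open>auto simp: borel_measurable_continuous_onI k_def norm_mult intro!: mult_right_mono\<close>)
    have "(\<lambda>\<xi>. tf_coeff f x \<xi>) = (\<lambda>\<xi>. tf_coeff f (fst (x, \<xi>)) (snd (x, \<xi>)))" by simp
    also have "\<dots> \<in> borel_measurable borel"
      by (rule measurable_compose[OF _ tf_coeff_borel(1)[OF fc], of "\<lambda>\<xi>. (x, \<xi>)"]) simp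
    finally have Fm: "(\<lambda>\<xi>. tf_coeff f x \<xi>) \<in> borel_measurable borel" .
    obtain K1 where K1: "0 < K1" "\<And>t. 0 \<le> t \<Longrightarrow> exp (- r * t powr (1/s)) \<le> K1 * (1 + t) powr - (2 * real DIM(real^'d))"
      using exp_powr_decay[OF r(1) q, of "2 * real DIM(real^'d)"] by blast
    have Fi: "integrable lborel (\<lambda>\<xi>. tf_coeff f x \<xi>)"
    proof (rule integrable_lborel_decay[OF Fm _ order_refl])
      fix \<xi>
      have "norm (tf_coeff f x \<xi>) \<le> C * M * exp (- r * (norm x powr (1/s) + norm \<xi> powr (1/s)))" by (rule dec[OF M f])
      also have "\<dots> \<le> C * M * exp (- r * norm \<xi> powr (1/s))" using r M by (intro mult_left_mono) auto
      also have "\<dots> \<le> C * M * (K1 * (1 + norm \<xi>) powr - (2 * real DIM(real^'d)))" using r M by (intro mult_left_mono K1) auto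
      finally show "norm (tf_coeff f x \<xi>) \<le> (C * M * K1) * (1 + norm \<xi>) powr - (2 * real DIM(real^'d))" by (simp only: mult.assoc)
    qed
    have "(\<integral>\<xi>. tf_coeff f x \<xi> * iexp (y \<bullet> \<xi>) \<partial>lborel) = complex_of_real ((2 * pi) ^ DIM(real^'d)) * k y"
      unfolding F
    proof (rule fourier_inversion[OF kc _ ki])
      show "norm (k t) \<le> M * c" for t
        using mult_mono[OF fb gw(2) M gw(1), of t "t - x"] gw(1) by (simp add: k_def norm_mult)
      show "integrable lborel (\<lambda>\<xi>. \<integral>t. k t * iexp (- (t \<bullet> \<xi>)) \<partial>lborel)" using Fi by (simp only: F)
    qed
    then have inv: "(\<integral>\<xi>. tf_coeff f x \<xi> * iexp (y \<bullet> \<xi>) \<partial>lborel) = complex_of_real ((2 * pi) ^ CARD('d)) * k y" by simp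
    have "(\<integral>\<xi>. tf_coeff f x (- \<xi>) * tf_shift x \<xi> y \<partial>lborel) =
        (\<integral>\<xi>. complex_of_real (gauss_window (y - x)) * (tf_coeff f x (- \<xi>) * iexp (- (y \<bullet> \<xi>))) \<partial>lborel)"
      by (simp add: tf_shift_def mult_ac)
    also have "\<dots> = complex_of_real (gauss_window (y - x)) * (\<integral>\<xi>. tf_coeff f x (- \<xi>) * iexp (- (y \<bullet> \<xi>)) \<partial>lborel)"
      by (rule Bochner_Integration.integral_mult_right_zero)
    also have "(\<integral>\<xi>. tf_coeff f x (- \<xi>) * iexp (- (y \<bullet> \<xi>)) \<partial>lborel) = (\<integral>\<xi>. tf_coeff f x \<xi> * iexp (y \<bullet> \<xi>) \<partial>lborel)"
      using lborel_integral_affine[of "\<lambda>\<xi>. tf_coeff f x \<xi> * iexp (y \<bullet> \<xi>)" "-1" 0] Fm by simp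
    also note inv
    also have "gauss_window (y - x) = gauss_window (x - y)" by (simp add: gauss_window_def norm_minus_commute)
    also have "k y = f y * complex_of_real (gauss_window (x - y))" by (simp add: k_def gauss_window_def norm_minus_commute)
    finally show ?thesis by (simp add: mult_ac)
  qed
  have int: "integrable lborel (\<lambda>z. tf_coeff f (fst z) (- snd z) * tf_atom z y)"
  proof (rule integrable_lborel_decay[OF _ _ order_refl])
    show "(\<lambda>z. tf_coeff f (fst z) (- snd z) * tf_atom z y) \<in> borel_measurable borel"
      using tf_coeff_borel(2)[OF fc] borel_measurable_continuous_onI[OF continuous_iter_partial_tf_atom[of "[]" y]] by simp
    fix z :: "(real^'d) \<times> (real^'d)"
    have "norm (tf_coeff f (fst z) (- snd z) * tf_atom z y) \<le> (C * M * exp (- r * (norm (fst z) powr (1/s) + norm (snd z) powr (1/s)))) * c"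
      unfolding norm_mult norm_tf_shift using dec[OF M f, of "fst z" "- snd z"] gw r M by (intro mult_mono) auto
    also have "\<dots> \<le> (C * M * (K * (1 + norm z) powr - ?N)) * c"
      using r M c by (intro mult_right_mono mult_left_mono K) auto
    finally show "norm (tf_coeff f (fst z) (- snd z) * tf_atom z y) \<le> (C * M * K * c) * (1 + norm z) powr - ?N" by (simp only: mult_ac)
  qed
  have "(\<integral>z. tf_coeff f (fst z) (- snd z) * tf_atom z y \<partial>lborel) = (\<integral>x. (\<integral>\<xi>. tf_coeff f x (- \<xi>) * tf_shift x \<xi> y \<partial>lborel) \<partial>lborel)"
    using lborel_pair.integral_fst'[of "\<lambda>z. tf_coeff f (fst z) (- snd z) * tf_atom z y"] int by (simp add: lborel_prod)
  also have "\<dots> = complex_of_real ((2 * pi) ^ CARD('d)) * f y"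
    unfolding inner by (subst Bochner_Integration.integral_mult_right_zero, subst integral_gauss_window_square(2)) simp
  finally show ?thesis .
qed

lemma gs_bound_iter_partial_tf_shift:
  assumes "gs_bound s H W (tf_shift x \<xi>)"
  shows "norm (iter_partial L (tf_shift x \<xi>) y) \<le> W * gs_weight s H (count_list L) (\<lambda>_. 0)"
  using gs_boundD[OF assms, of y "\<lambda>_. 0" "count_list L"] by (simp add: multi_deriv_count_list_tf_shift)

text \<open>The mean value inequality bounds all remainder quotients by a multiple of
  \<open>M z\<close>, uniformly in the increment, so dominated convergence along sequences of
  increments gives the full derivative and not only the partial ones.\<close>

lemma has_derivative_parametric_integral:
  fixes f :: "'z::euclidean_space \<Rightarrow> real^'d::finite \<Rightarrow> complex" and f' :: "'d \<Rightarrow> 'z \<Rightarrow> real^'d \<Rightarrow> complex" and a :: "'z \<Rightarrow> complex"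
  assumes der: "\<And>z y. (f z has_derivative (\<lambda>v. \<Sum>i\<in>UNIV. v $ i *\<^sub>R f' i z y)) (at y)"
    and bd: "\<And>i z y. norm (f' i z y) \<le> M z"
    and intf: "\<And>y. integrable lborel (\<lambda>z. a z * f z y)"
    and intf': "\<And>i y. integrable lborel (\<lambda>z. a z * f' i z y)"
    and intM: "integrable lborel (\<lambda>z. norm (a z) * M z)"
  shows "((\<lambda>y. \<integral>z. a z * f z y \<partial>lborel) has_derivative (\<lambda>v. \<Sum>i\<in>UNIV. v $ i *\<^sub>R (\<integral>z. a z * f' i z y \<partial>lborel))) (at y)"
proof -
  let ?D = "\<lambda>z v. \<Sum>i\<in>UNIV. v $ i *\<^sub>R f' i z y"
  let ?n = "real CARD('d)"
  have Dn: "norm (\<Sum>i\<in>UNIV. v $ i *\<^sub>R f' i z x) \<le> ?n * M z * norm v" for z x and v :: "real^'d"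
  proof -
    have "norm (\<Sum>i\<in>UNIV. v $ i *\<^sub>R f' i z x) \<le> (\<Sum>i\<in>(UNIV::'d set). norm v * M z)"
      using bd component_le_norm_cart[of v] by (intro order.trans[OF norm_sum] sum_mono) (auto intro!: mult_mono)
    then show ?thesis by (simp add: mult_ac)
  qed
  have fl: "norm (f z (y + v) - f z y) \<le> ?n * M z * norm v" for z v
  proof -
    have "norm (f z (y + v) - f z y) \<le> (?n * M z) * norm (y + v - y)"
    proof (rule differentiable_bound[of UNIV "f z" "\<lambda>x v. \<Sum>i\<in>UNIV. v $ i *\<^sub>R f' i z x"])
      show "onorm (\<lambda>v. \<Sum>i\<in>UNIV. v $ i *\<^sub>R f' i z x) \<le> ?n * M z" for x
        by (rule onorm_le) (rule Dn)
    qed (auto intro: der)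
    then show ?thesis by simp
  qed
  show ?thesis
    unfolding has_derivative_at
  proof
    show "bounded_linear (\<lambda>v. \<Sum>i\<in>UNIV. v $ i *\<^sub>R (\<integral>z. a z * f' i z y \<partial>lborel))"
      by (intro bounded_linear_sum bounded_linear_scaleR_const bounded_linear_vec_nth)
    let ?R = "\<lambda>v z. a z * ((f z (y + v) - f z y - ?D z v) /\<^sub>R norm v)"
    have eq: "norm ((\<integral>z. a z * f z (y + v) \<partial>lborel) - (\<integral>z. a z * f z y \<partial>lborel) -
        (\<Sum>i\<in>UNIV. v $ i *\<^sub>R (\<integral>z. a z * f' i z y \<partial>lborel))) / norm v = norm (\<integral>z. ?R v z \<partial>lborel)" for v
    proof -
      have iD: "integrable lborel (\<lambda>z. \<Sum>i\<in>UNIV. v $ i *\<^sub>R (a z * f' i z y))"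
        by (intro Bochner_Integration.integrable_sum integrable_scaleR_right intf')
      have "(\<integral>z. ?R v z \<partial>lborel) = (\<integral>z. (a z * f z (y + v) - a z * f z y - (\<Sum>i\<in>UNIV. v $ i *\<^sub>R (a z * f' i z y))) /\<^sub>R norm v \<partial>lborel)"
        by (intro Bochner_Integration.integral_cong refl) (simp add: right_diff_distrib sum_distrib_left mult_scaleR_right)
      also have "\<dots> = ((\<integral>z. a z * f z (y + v) \<partial>lborel) - (\<integral>z. a z * f z y \<partial>lborel) -
        (\<Sum>i\<in>UNIV. v $ i *\<^sub>R (\<integral>z. a z * f' i z y \<partial>lborel))) /\<^sub>R norm v"
        by (simp add: intf intf' iD Bochner_Integration.integral_diff Bochner_Integration.integrable_diff Bochner_Integration.integral_sum)
      finally show ?thesis by (simp only: norm_scaleR) (simp add: divide_inverse mult.commute)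
    qed
    have Rb: "norm (?R v z) \<le> 2 * ?n * (norm (a z) * M z)" for v z
    proof (cases "v = 0")
      case True
      have "0 \<le> M z" using order.trans[OF norm_ge_zero bd] .
      then show ?thesis using True by simp
    next
      case False
      have "norm (f z (y + v) - f z y - ?D z v) \<le> ?n * M z * norm v + ?n * M z * norm v"
        by (intro order.trans[OF norm_triangle_ineq4] add_mono fl Dn)
      then have "norm ((f z (y + v) - f z y - ?D z v) /\<^sub>R norm v) \<le> 2 * ?n * M z"
        unfolding norm_scaleR using False by (simp add: field_simps)
      then have "norm (a z) * norm ((f z (y + v) - f z y - ?D z v) /\<^sub>R norm v) \<le> norm (a z) * (2 * ?n * M z)"
        by (intro mult_left_mono) auto
      then show ?thesis by (simp only: norm_mult mult_ac)
    qed
    have "((\<lambda>v. \<integral>z. ?R v z \<partial>lborel) \<longlongrightarrow> 0) (at 0)"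
      unfolding tendsto_at_iff_sequentially comp_def
    proof (intro allI impI)
      fix X :: "nat \<Rightarrow> real^'d" assume X0: "\<forall>i. X i \<in> UNIV - {0}" and X: "X \<longlonglongrightarrow> 0"
      have "(\<lambda>n. \<integral>z. ?R (X n) z \<partial>lborel) \<longlonglongrightarrow> (\<integral>z. 0 \<partial>(lborel :: 'z measure))"
      proof (rule integral_dominated_convergence)
        show "integrable lborel (\<lambda>z. 2 * ?n * (norm (a z) * M z))" by (intro integrable_mult_right intM)
        show "AE z in lborel. norm (?R (X n) z) \<le> 2 * ?n * (norm (a z) * M z)" for n by (intro AE_I2 Rb)
        show "AE z in lborel. (\<lambda>n. ?R (X n) z) \<longlonglongrightarrow> 0"
        proof (rule AE_I2)
          fix z
          have "((\<lambda>v. norm (f z (y + v) - f z y - ?D z v) / norm v) \<longlongrightarrow> 0) (at 0)"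
            using der[of z y] unfolding has_derivative_at by simp
          moreover have "filterlim X (at 0) sequentially" unfolding filterlim_at using X X0 by simp
          ultimately have "(\<lambda>n. norm (f z (y + X n) - f z y - ?D z (X n)) / norm (X n)) \<longlonglongrightarrow> 0" by (rule filterlim_compose)
          then have "(\<lambda>n. norm ((f z (y + X n) - f z y - ?D z (X n)) /\<^sub>R norm (X n))) \<longlonglongrightarrow> 0"
            by (simp add: divide_inverse mult.commute)
          then have "(\<lambda>n. (f z (y + X n) - f z y - ?D z (X n)) /\<^sub>R norm (X n)) \<longlonglongrightarrow> 0" by (rule tendsto_norm_zero_cancel)
          then show "(\<lambda>n. ?R (X n) z) \<longlonglongrightarrow> 0" by (rule tendsto_mult_right_zero)
        qed
        show "(\<lambda>z. ?R (X n) z) \<in> borel_measurable lborel" for n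
        proof -
          have "(\<lambda>z. ?R (X n) z) = (\<lambda>z. (a z * f z (y + X n) - a z * f z y - (\<Sum>i\<in>UNIV. X n $ i *\<^sub>R (a z * f' i z y))) /\<^sub>R norm (X n))"
            by (rule ext) (simp add: right_diff_distrib sum_distrib_left mult_scaleR_right)
          then show ?thesis using borel_measurable_integrable[OF intf] borel_measurable_integrable[OF intf']
            by (simp only:) (intro borel_measurable_scaleR borel_measurable_diff borel_measurable_sum borel_measurable_const)
        qed
      qed auto
      then show "(\<lambda>n. \<integral>z. ?R (X n) z \<partial>lborel) \<longlonglongrightarrow> 0" by simp
    qed
    then have "((\<lambda>v. norm (\<integral>z. ?R v z \<partial>lborel)) \<longlongrightarrow> 0) (at 0)" by (rule tendsto_norm_zero)
    then show "(\<lambda>v. norm ((\<integral>z. a z * f z (y + v) \<partial>lborel) - (\<integral>z. a z * f z y \<partial>lborel) -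
        (\<Sum>i\<in>UNIV. v $ i *\<^sub>R (\<integral>z. a z * f' i z y \<partial>lborel))) / norm v) \<midarrow>0\<rightarrow> 0"
      by (simp only: eq)
  qed
qed

text \<open>The seminorm of a superposition is at most the integral of the seminorms. As
  \<open>W\<close> does not depend on the multi-indices, one integrability condition covers all
  derivatives.\<close>

lemma tf_synthesis:
  fixes a :: "(real^'d::finite) \<times> (real^'d) \<Rightarrow> complex"
  assumes H: "0 < H" and a: "a \<in> borel_measurable borel"
    and W: "\<And>z. gs_bound s H (W z) (tf_atom z)" and int: "integrable lborel (\<lambda>z. norm (a z) * W z)"
  defines "g \<equiv> \<lambda>y. \<integral>z. a z * tf_atom z y \<partial>lborel"
  shows "iter_partial L g = (\<lambda>y. \<integral>z. a z * iter_partial L (tf_atom z) y \<partial>lborel)"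
    "integrable lborel (\<lambda>z. a z * iter_partial L (tf_atom z) y)"
    "gs_bound s H (\<integral>z. norm (a z) * W z \<partial>lborel) g"
proof -
  have m: "(\<lambda>z. a z * iter_partial L (tf_atom z) y) \<in> borel_measurable lborel" for L y
    using a borel_measurable_continuous_onI[OF continuous_iter_partial_tf_atom[of L y]] by simp
  have b: "norm (iter_partial L (tf_atom z) y) \<le> W z * gs_weight s H (count_list L) (\<lambda>_. 0)" for L z y
    by (rule gs_bound_iter_partial_tf_shift[OF W])
  show i: "integrable lborel (\<lambda>z. a z * iter_partial L (tf_atom z) y)" for L y
  proof (rule Bochner_Integration.integrable_bound[OF _ m])
    show "integrable lborel (\<lambda>z. norm (a z) * W z * gs_weight s H (count_list L) (\<lambda>_. 0))" by (intro integrable_mult_left int)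
    show "AE z in lborel. norm (a z * iter_partial L (tf_atom z) y) \<le> norm (norm (a z) * W z * gs_weight s H (count_list L) (\<lambda>_. 0))"
      unfolding norm_mult[of "a _"] real_norm_def mult.assoc
      by (intro AE_I2 order.trans[OF mult_left_mono[OF b] abs_ge_self]) auto
  qed
  have D: "((\<lambda>y. \<integral>z. a z * iter_partial L (tf_atom z) y \<partial>lborel) has_derivative
      (\<lambda>v. \<Sum>i\<in>UNIV. v $ i *\<^sub>R (\<integral>z. a z * iter_partial (i # L) (tf_atom z) y \<partial>lborel))) (at y)" for L y
  proof (rule has_derivative_parametric_integral)
    show "(iter_partial L (tf_atom z) has_derivative (\<lambda>v. \<Sum>i\<in>UNIV. v $ i *\<^sub>R iter_partial (i # L) (tf_atom z) y)) (at y)" for z y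
      using has_derivative_partial_deriv[OF C_infinity_differentiable[OF tf_shift_C_infinity]] by simp
    show "norm (iter_partial (i # L) (tf_atom z) y) \<le> W z * (\<Sum>i\<in>UNIV. gs_weight s H (count_list (i # L)) (\<lambda>_. 0))" for i z y
    proof -
      have "0 \<le> W z" using order.trans[OF norm_ge_zero b[of "[]" z undefined]] gs_weight_pos[OF H, of s "count_list ([] :: 'd list)" "\<lambda>_. 0"]
        by (auto simp: zero_le_mult_iff)
      have "gs_weight s H (count_list (i # L)) (\<lambda>_. 0) \<le> (\<Sum>i\<in>UNIV. gs_weight s H (count_list (i # L)) (\<lambda>_. 0))"
        using gs_weight_pos[OF H, THEN less_imp_le] by (intro member_le_sum) auto
      then show ?thesis by (rule order.trans[OF b mult_left_mono]) fact
    qed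
    show "integrable lborel (\<lambda>z. norm (a z) * (W z * (\<Sum>i\<in>UNIV. gs_weight s H (count_list (i # L)) (\<lambda>_. 0))))"
      unfolding mult.assoc[symmetric] by (intro integrable_mult_left int)
  qed (rule i)+
  have it: "iter_partial L g = (\<lambda>y. \<integral>z. a z * iter_partial L (tf_atom z) y \<partial>lborel)" for L
  proof (induction L)
    case Nil
    then show ?case by (simp add: g_def)
  next
    case (Cons j L)
    show ?case unfolding iter_partial_simps(2)[of j L g] Cons.IH
      by (rule ext) (rule partial_deriv_eqI[OF D])
  qed
  then show "iter_partial L g = (\<lambda>y. \<integral>z. a z * iter_partial L (tf_atom z) y \<partial>lborel)" .
  show "gs_bound s H (\<integral>z. norm (a z) * W z \<partial>lborel) g"
    unfolding gs_bound_def
  proof (intro conjI allI)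
    have "iter_partial L g differentiable (at y)" for L y
      unfolding it by (rule differentiableI[OF D])
    then show "g \<in> C_infinity" by (simp add: C_infinity_def differentiable_on_def)
    fix \<alpha> \<beta> :: "'d \<Rightarrow> nat" and y :: "real^'d"
    let ?p = "complex_of_real (multi_power y \<beta>)"
    have md: "multi_deriv \<alpha> g y = (\<integral>z. a z * multi_deriv \<alpha> (tf_atom z) y \<partial>lborel)"
      unfolding multi_deriv_def it ..
    have "\<bar>multi_power y \<beta>\<bar> * norm (multi_deriv \<alpha> g y) = norm (\<integral>z. ?p * (a z * multi_deriv \<alpha> (tf_atom z) y) \<partial>lborel)"
      unfolding md by (simp add: norm_mult)
    also have "\<dots> \<le> (\<integral>z. norm (a z) * W z * gs_weight s H \<alpha> \<beta> \<partial>lborel)"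
    proof (rule Bochner_Integration.integral_norm_bound_integral)
      show "integrable lborel (\<lambda>z. ?p * (a z * multi_deriv \<alpha> (tf_atom z) y))"
        unfolding multi_deriv_def by (intro integrable_mult_right i)
      show "integrable lborel (\<lambda>z. norm (a z) * W z * gs_weight s H \<alpha> \<beta>)" by (intro integrable_mult_left int)
      show "norm (?p * (a z * multi_deriv \<alpha> (tf_atom z) y)) \<le> norm (a z) * W z * gs_weight s H \<alpha> \<beta>" for z
        using mult_left_mono[OF gs_boundD[OF W[of z], of y \<beta> \<alpha>] norm_ge_zero[of "a z"]] by (simp add: norm_mult mult_ac)
    qed
    also have "\<dots> = (\<integral>z. norm (a z) * W z \<partial>lborel) * gs_weight s H \<alpha> \<beta>" by simp
    finally show "\<bar>multi_power y \<beta>\<bar> * norm (multi_deriv \<alpha> g y) \<le> (\<integral>z. norm (a z) * W z \<partial>lborel) * gs_weight s H \<alpha> \<beta>" .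
  qed
qed

lemma multi_deriv_sum:
  assumes "finite I" "I \<noteq> {}" "\<And>i. i \<in> I \<Longrightarrow> f i \<in> C_infinity"
  shows "(\<lambda>x. \<Sum>i\<in>I. a i * f i x) \<in> C_infinity \<and> multi_deriv \<alpha> (\<lambda>x. \<Sum>i\<in>I. a i * f i x) x = (\<Sum>i\<in>I. a i * multi_deriv \<alpha> (f i) x)"
  using assms
proof (induction I rule: finite_ne_induct)
  case (singleton i)
  then show ?case
    using C_infinity_lincomb[of "f i" "f i" "a i" 0] multi_deriv_lincomb[of "f i" "f i" \<alpha> "a i" 0] by simp
next
  case (insert i I)
  then show ?case
    using C_infinity_lincomb[of "f i" "\<lambda>x. \<Sum>i\<in>I. a i * f i x" "a i" 1]
      multi_deriv_lincomb[of "f i" "\<lambda>x. \<Sum>i\<in>I. a i * f i x" \<alpha> "a i" 1] by simp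
qed

lemma integrable_gauss_bound:
  fixes f :: "'a::euclidean_space \<Rightarrow> 'b::{banach, second_countable_topology}"
  assumes "f \<in> borel_measurable borel" "0 < r" "\<And>z. norm (f z) \<le> C * exp (- r * (norm z)\<^sup>2)"
  shows "integrable lborel f"
proof -
  have C: "0 \<le> C" using order.trans[OF norm_ge_zero assms(3)[of 0]] by simp
  obtain K where K: "0 < K" "\<And>t. 0 \<le> t \<Longrightarrow> exp (- r * t powr 2) \<le> K * (1 + t) powr - (2 * real DIM('a))"
    using exp_powr_decay[OF assms(2), of 2 "2 * real DIM('a)"] by auto
  show ?thesis
  proof (rule integrable_lborel_decay[OF assms(1) _ order_refl])
    fix z
    have "norm (f z) \<le> C * exp (- r * norm z powr 2)" using assms(3)[of z] by simp
    also have "\<dots> \<le> C * (K * (1 + norm z) powr - (2 * real DIM('a)))" using C by (intro mult_left_mono K) auto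
    finally show "norm (f z) \<le> (C * K) * (1 + norm z) powr - (2 * real DIM('a))" by (simp only: mult.assoc)
  qed
qed

text \<open>Replacing \<open>tf_atom z\<close> by \<open>tf_atom (S n z)\<close> for simple functions \<open>S n z \<longlonglongrightarrow> z\<close> makes the integral a
  finite sum, and the Lipschitz bound of \<open>tf_shift_lipschitz\<close> gives convergence in a single seminorm.\<close>

lemma GS_dual_exchange:
  fixes u :: "(real^'d::finite \<Rightarrow> complex) \<Rightarrow> complex" and a :: "(real^'d) \<times> (real^'d) \<Rightarrow> complex"
  assumes u: "u \<in> GS_dual (1/2)" and a: "a \<in> borel_measurable borel" and r: "0 < r"
    and ab: "\<And>z. norm (a z) \<le> Ca * exp (- r * (norm z)\<^sup>2)"
  shows "u (\<lambda>y. \<integral>z. a z * tf_atom z y \<partial>lborel) = (\<integral>z. a z * u (tf_atom z) \<partial>lborel)"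
proof -
  have Ca: "0 \<le> Ca" using order.trans[OF norm_ge_zero ab[of 0]] by simp
  \<comment> \<open>Rates are counted in units of \<delta>. The Lipschitz bound spends 5 of the 10,
    since \<open>norm (S n z) \<le> 2 * norm z\<close>, and the distance from \<open>S n z\<close>
    to \<open>z\<close> spends one more.\<close>
  define \<delta> where "\<delta> = r / 10"
  have \<delta>: "0 < \<delta>" "r = 10 * \<delta>" using r by (auto simp: \<delta>_def)
  obtain H0 C0 where H0: "1 \<le> H0" "0 < C0" "\<And>(x::real^'d) \<xi>. gs_bound (1/2) H0
    (C0 * exp (\<delta> * (norm x powr (1/(1/2)) + norm \<xi> powr (1/(1/2))))) (tf_shift x \<xi>)"
    using tf_shift_gs_bound[OF order_refl \<delta>(1), where 'd='d] by blast
  define W where "W z = C0 * exp (\<delta> * (norm z)\<^sup>2)" for z :: "(real^'d) \<times> (real^'d)"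
  have W: "gs_bound (1/2) H0 (W z) (tf_atom z)" for z
    using H0(3)[of "fst z" "snd z"] by (simp add: W_def norm_pair_power2)
  have Wc: "continuous_on UNIV W" unfolding W_def by (intro continuous_intros)
  define \<psi> where "\<psi> y = (\<integral>z. a z * tf_atom z y \<partial>lborel)" for y
  have iW: "integrable lborel (\<lambda>z. norm (a z) * W z)"
  proof (rule integrable_gauss_bound[where r = "9 * \<delta>" and C = "Ca * C0"])
    show "(\<lambda>z. norm (a z) * W z) \<in> borel_measurable borel"
      using a borel_measurable_continuous_onI[OF Wc] by simp
    fix z
    have "norm (norm (a z) * W z) \<le> Ca * exp (- r * (norm z)\<^sup>2) * (C0 * exp (\<delta> * (norm z)\<^sup>2))"
    proof -
      have "norm (norm (a z) * W z) = norm (a z) * (C0 * exp (\<delta> * (norm z)\<^sup>2))" using H0(2) by (simp add: W_def abs_mult)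
      then show ?thesis using H0(2) Ca by (simp only:) (intro mult_mono ab, auto)
    qed
    also have "\<dots> = Ca * C0 * (exp (- r * (norm z)\<^sup>2) * exp (\<delta> * (norm z)\<^sup>2))" by (simp add: mult_ac)
    also have "exp (- r * (norm z)\<^sup>2) * exp (\<delta> * (norm z)\<^sup>2) = exp (- (9 * \<delta>) * (norm z)\<^sup>2)"
      unfolding \<delta>(2) mult_exp_exp by (rule arg_cong[where f=exp]) (simp add: algebra_simps)
    finally show "norm (norm (a z) * W z) \<le> Ca * C0 * exp (- (9 * \<delta>) * (norm z)\<^sup>2)" .
  qed (use \<delta> in simp)
  have H0pos: "0 < H0" using H0(1) by simp
  note syn = tf_synthesis[OF H0pos a W iW, folded \<psi>_def]
  have \<psi>C: "\<psi> \<in> C_infinity" using syn(3) by (rule gs_bound_C_infinity)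
  have "0 \<le> (\<integral>z. norm (a z) * W z \<partial>lborel)" using H0 by (intro integral_nonneg_AE AE_I2) (simp add: W_def)
  then have \<psi>GS: "\<psi> \<in> GS (1/2)" using H0pos syn(3) by (intro gs_bound_in_GS)
  have \<psi>md: "multi_deriv \<alpha> \<psi> y = (\<integral>z. a z * multi_deriv \<alpha> (tf_atom z) y \<partial>lborel)"
    and \<psi>int: "integrable lborel (\<lambda>z. a z * multi_deriv \<alpha> (tf_atom z) y)" for \<alpha> y
    unfolding multi_deriv_def using syn(1) syn(2) by auto
  obtain H C1 where H: "1 \<le> H" "0 < C1" "\<And>(x::real^'d) \<xi> x' \<xi>'. gs_bound (1/2) H
    (C1 * exp (\<delta> * ((norm x)\<^sup>2 + (norm \<xi>)\<^sup>2 + (norm x')\<^sup>2 + (norm \<xi>')\<^sup>2)) * (norm (x' - x) + norm (\<xi>' - \<xi>)))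
    (\<lambda>y. tf_shift x' \<xi>' y - tf_shift x \<xi> y)"
    using tf_shift_lipschitz[OF \<delta>(1), where 'd='d] by blast
  have Hpos: "0 < H" using H(1) by simp
  obtain K where K: "0 < K" "\<And>M f. 0 \<le> M \<Longrightarrow> gs_bound (1/2) H M f \<Longrightarrow> norm (u f) \<le> K * M"
    using GS_dual_bounded[OF u Hpos] by blast
  obtain C2 where C2: "0 < C2" "\<And>x \<xi>. norm (u (tf_shift x \<xi>)) \<le> C2 * exp (\<delta> * (norm x powr (1/(1/2)) + norm \<xi> powr (1/(1/2))))"
    using GS_dual_tf_shift_bound[OF u order_refl \<delta>(1)] by blast
  have ub: "norm (u (tf_atom z)) \<le> C2 * exp (\<delta> * (norm z)\<^sup>2)" for z
    using C2(2)[of "fst z" "snd z"] by (simp add: norm_pair_power2)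
  have TGS: "tf_atom z \<in> GS (1/2)" for z :: "(real^'d) \<times> (real^'d)" by (rule GS_tf_shift) simp
  \<comment> \<open>The identity is approximated by simple functions that at most double the norm,
    which keeps the Gaussian domination uniform in \<open>n\<close>.\<close>
  have "(\<lambda>z. z) \<in> borel_measurable (lborel :: ((real^'d) \<times> (real^'d)) measure)" by simp
  from borel_measurable_implies_sequence_metric[OF this, of 0] obtain S where
    S: "\<And>n. simple_function (lborel :: ((real^'d) \<times> (real^'d)) measure) (S n)" and Slim: "\<And>z. (\<lambda>n. S n z) \<longlonglongrightarrow> z"
    and Sd: "\<And>n z. dist (S n z) 0 \<le> 2 * dist z 0" by auto
  have Sn: "norm (S n z) \<le> 2 * norm z" for n z using Sd[of n z] by simp
  have Sm: "S n \<in> borel_measurable borel" for n using borel_measurable_simple_function[OF S[of n]] by simp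
  have Sfin: "finite (range (S n))" for n using simple_functionD(1)[OF S[of n]] by simp
  have Sset: "{z. S n z = v} \<in> sets borel" for n v
    using simple_functionD(2)[OF S[of n], of "{v}"] by (simp add: vimage_def)
  have ai: "integrable lborel a" by (rule integrable_gauss_bound[OF a r ab])
  \<comment> \<open>Integrals of \<open>a\<close> over the level sets of \<open>S n\<close>, the
    coefficients of the finite sum.\<close>
  define c where "c n v = (\<integral>z. a z * indicator {z. S n z = v} z \<partial>lborel)" for n v
  have aind: "integrable lborel (\<lambda>z. a z * indicator {z. S n z = v} z)" for n v
    using integrable_mult_indicator[of "{z. S n z = v}" lborel a] Sset ai
    by (simp add: scaleR_conv_of_real of_real_indicator mult.commute)
  have csum: "integrable lborel (\<lambda>z. a z * G (S n z))" "(\<Sum>v\<in>range (S n). c n v * G v) = (\<integral>z. a z * G (S n z) \<partial>lborel)" for G :: "_ \<Rightarrow> complex" and n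
  proof -
    have eq: "a z * G (S n z) = (\<Sum>v\<in>range (S n). G v * (a z * indicator {z. S n z = v} z))" for z
    proof -
      have "(\<Sum>v\<in>range (S n). G v * (a z * indicator {z. S n z = v} z)) = (\<Sum>v\<in>range (S n). if v = S n z then G v * a z else 0)"
        by (intro sum.cong) (auto simp: indicator_def)
      then show ?thesis using Sfin[of n] by (simp add: mult.commute)
    qed
    show "integrable lborel (\<lambda>z. a z * G (S n z))"
      unfolding eq by (intro Bochner_Integration.integrable_sum integrable_mult_right aind)
    have "(\<integral>z. a z * G (S n z) \<partial>lborel) = (\<Sum>v\<in>range (S n). G v * c n v)"
      unfolding eq c_def by (subst Bochner_Integration.integral_sum) (auto intro: integrable_mult_right aind)
    then show "(\<Sum>v\<in>range (S n). c n v * G v) = (\<integral>z. a z * G (S n z) \<partial>lborel)" by (simp add: mult.commute)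
  qed
  define \<psi>n where "\<psi>n n y = (\<Sum>v\<in>range (S n). c n v * tf_atom v y)" for n y
  have ne: "range (S n) \<noteq> {}" for n by auto
  have \<psi>n: "\<psi>n n \<in> GS (1/2)" "u (\<psi>n n) = (\<integral>z. a z * u (tf_atom (S n z)) \<partial>lborel)" for n
    using GS_dual_sum[OF u Sfin[of n] ne, of tf_atom "c n"] TGS csum(2)[of n "\<lambda>v. u (tf_atom v)"]
    unfolding \<psi>n_def[abs_def] by auto
  have \<psi>nC: "\<psi>n n \<in> C_infinity" and \<psi>nmd: "multi_deriv \<alpha> (\<psi>n n) y = (\<integral>z. a z * multi_deriv \<alpha> (tf_atom (S n z)) y \<partial>lborel)" for n \<alpha> y
    using multi_deriv_sum[OF Sfin[of n] ne, of tf_atom "c n" \<alpha> y] tf_shift_C_infinity csum(2)[of n "\<lambda>v. multi_deriv \<alpha> (tf_atom v) y"]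
    unfolding \<psi>n_def[abs_def] by auto
  define D where "D = 2 * Ca * C1"
  have D: "0 \<le> D" using Ca H by (simp add: D_def)
  \<comment> \<open>The error density in the seminorm of step \<open>H\<close>: it tends to 0
    pointwise with \<open>S n z\<close>, under the integrable bound \<open>w\<close>.\<close>
  define e where "e n z = D * exp (- (5 * \<delta>) * (norm z)\<^sup>2) * norm (S n z - z)" for n z
  have e0: "0 \<le> e n z" for n z using D by (simp add: e_def)
  have em: "e n \<in> borel_measurable borel" for n
    unfolding e_def using Sm[of n] by measurable
  define w where "w z = 3 * D * exp (1 / (4 * \<delta>)) * exp (- (4 * \<delta>) * (norm z)\<^sup>2)" for z :: "(real^'d) \<times> (real^'d)"
  have ew: "e n z \<le> w z" for n z
  proof -
    have "norm (S n z - z) \<le> norm (S n z) + norm z" by (rule norm_triangle_ineq4)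
    also have "\<dots> \<le> 3 * norm z" using Sn[of n z] by simp
    also have "\<dots> \<le> 3 * exp (norm z)" using exp_ge_add_one_self[of "norm z"] by linarith
    also have "\<dots> \<le> 3 * exp (1\<^sup>2 / (4 * \<delta>) + \<delta> * (norm z)\<^sup>2)" using linear_le_quadratic[OF \<delta>(1), of 1 "norm z"] by simp
    finally have 1: "norm (S n z - z) \<le> 3 * exp (1\<^sup>2 / (4 * \<delta>) + \<delta> * (norm z)\<^sup>2)" .
    have "e n z \<le> D * exp (- (5 * \<delta>) * (norm z)\<^sup>2) * (3 * exp (1\<^sup>2 / (4 * \<delta>) + \<delta> * (norm z)\<^sup>2))"
      unfolding e_def using D by (intro mult_left_mono 1) auto
    also have "\<dots> = 3 * D * (exp (- (5 * \<delta>) * (norm z)\<^sup>2) * exp (1\<^sup>2 / (4 * \<delta>) + \<delta> * (norm z)\<^sup>2))" by (simp add: mult_ac)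
    also have "exp (- (5 * \<delta>) * (norm z)\<^sup>2) * exp (1\<^sup>2 / (4 * \<delta>) + \<delta> * (norm z)\<^sup>2) = exp (1 / (4 * \<delta>)) * exp (- (4 * \<delta>) * (norm z)\<^sup>2)"
      unfolding mult_exp_exp by (rule arg_cong[where f=exp]) (simp add: algebra_simps)
    finally show ?thesis by (simp add: w_def mult.assoc)
  qed
  have iw: "integrable lborel w"
    by (rule integrable_gauss_bound[where r = "4 * \<delta>" and C = "3 * D * exp (1 / (4 * \<delta>))"])
       (use \<delta> D in \<open>auto simp: w_def[abs_def] abs_mult\<close>)
  have ie: "integrable lborel (e n)" for n
  proof (rule Bochner_Integration.integrable_bound[OF iw])
    show "e n \<in> borel_measurable lborel" using em by simp
    show "AE z in lborel. norm (e n z) \<le> norm (w z)"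
      using e0 ew[of n] by (intro AE_I2) (simp only: real_norm_def abs_of_nonneg, rule order.trans[OF _ abs_ge_self])
  qed
  have E0: "(\<lambda>n. \<integral>z. e n z \<partial>lborel) \<longlonglongrightarrow> 0"
  proof -
    have "(\<lambda>n. \<integral>z. e n z \<partial>lborel) \<longlonglongrightarrow> (\<integral>z. 0 \<partial>(lborel :: ((real^'d) \<times> (real^'d)) measure))"
    proof (rule integral_dominated_convergence[OF _ _ iw])
      show "AE z in lborel. (\<lambda>n. e n z) \<longlonglongrightarrow> 0"
      proof (rule AE_I2)
        fix z
        have "(\<lambda>n. D * exp (- (5 * \<delta>) * (norm z)\<^sup>2) * norm (S n z - z)) \<longlonglongrightarrow> D * exp (- (5 * \<delta>) * (norm z)\<^sup>2) * norm (z - z)"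
          by (intro tendsto_intros Slim)
        then show "(\<lambda>n. e n z) \<longlonglongrightarrow> 0" by (simp add: e_def)
      qed
      show "AE z in lborel. norm (e n z) \<le> w z" for n using e0 ew by (intro AE_I2) auto
    qed (use em in auto)
    then show ?thesis by simp
  qed
  have close: "norm (u \<psi> - u (\<psi>n n)) \<le> K * (\<integral>z. e n z \<partial>lborel)" for n
  proof -
    have "gs_bound (1/2) H (\<integral>z. e n z \<partial>lborel) (\<lambda>y. 1 * \<psi> y + (-1) * \<psi>n n y)"
      unfolding gs_bound_def multi_deriv_lincomb[OF \<psi>C \<psi>nC]
    proof (intro conjI allI C_infinity_lincomb \<psi>C \<psi>nC)
      fix \<alpha> \<beta> :: "'d \<Rightarrow> nat" and y :: "real^'d"
      let ?p = "complex_of_real (multi_power y \<beta>)"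
      let ?g = "gs_weight (1/2) H \<alpha> \<beta>"
      let ?d = "\<lambda>z. a z * multi_deriv \<alpha> (tf_atom z) y - a z * multi_deriv \<alpha> (tf_atom (S n z)) y"
      have id: "integrable lborel ?d" by (intro Bochner_Integration.integrable_diff \<psi>int csum(1))
      have "1 * multi_deriv \<alpha> \<psi> y + (-1) * multi_deriv \<alpha> (\<psi>n n) y = (\<integral>z. ?d z \<partial>lborel)"
        unfolding \<psi>md \<psi>nmd using Bochner_Integration.integral_diff[OF \<psi>int[of \<alpha> y] csum(1)[of "\<lambda>v. multi_deriv \<alpha> (tf_atom v) y" n]] by simp
      then have "\<bar>multi_power y \<beta>\<bar> * norm (1 * multi_deriv \<alpha> \<psi> y + (-1) * multi_deriv \<alpha> (\<psi>n n) y) = norm (\<integral>z. ?p * ?d z \<partial>lborel)"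
        by (simp add: norm_mult)
      also have "\<dots> \<le> (\<integral>z. e n z * ?g \<partial>lborel)"
      proof (rule Bochner_Integration.integral_norm_bound_integral)
        show "integrable lborel (\<lambda>z. ?p * ?d z)" by (intro integrable_mult_right id)
        show "integrable lborel (\<lambda>z. e n z * ?g)" by (intro integrable_mult_left ie)
        fix z
        have g0: "0 \<le> ?g" using gs_weight_pos[OF Hpos, of "1/2" \<alpha> \<beta>] by simp
        let ?X = "exp (\<delta> * ((norm (fst (S n z)))\<^sup>2 + (norm (snd (S n z)))\<^sup>2 + (norm (fst z))\<^sup>2 + (norm (snd z))\<^sup>2))"
        let ?Y = "norm (fst z - fst (S n z)) + norm (snd z - snd (S n z))"
        have "\<bar>multi_power y \<beta>\<bar> * norm (multi_deriv \<alpha> (\<lambda>y. 1 * tf_atom z y + (-1) * tf_atom (S n z) y) y) \<le> (C1 * ?X * ?Y) * ?g"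
          using gs_boundD[OF H(3)[of "fst (S n z)" "snd (S n z)" "fst z" "snd z"], of y \<beta> \<alpha>] by simp
        then have 1: "\<bar>multi_power y \<beta>\<bar> * norm (multi_deriv \<alpha> (tf_atom z) y - multi_deriv \<alpha> (tf_atom (S n z)) y) \<le> (C1 * ?X * ?Y) * ?g"
          unfolding multi_deriv_lincomb[OF tf_shift_C_infinity tf_shift_C_infinity] by simp
        have X: "?X \<le> exp (5 * \<delta> * (norm z)\<^sup>2)"
        proof -
          have "(norm (S n z))\<^sup>2 \<le> (2 * norm z)\<^sup>2" by (intro power_mono Sn) auto
          then have "(norm (S n z))\<^sup>2 + (norm z)\<^sup>2 \<le> 5 * (norm z)\<^sup>2" by (simp add: power_mult_distrib)
          then have "\<delta> * ((norm (S n z))\<^sup>2 + (norm z)\<^sup>2) \<le> \<delta> * (5 * (norm z)\<^sup>2)" using \<delta> by (intro mult_left_mono) auto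
          then show ?thesis by (simp add: norm_pair_power2[of z] norm_pair_power2[of "S n z"] algebra_simps)
        qed
        have Y: "?Y \<le> 2 * norm (S n z - z)"
          using norm_fst_le[of "fst z - fst (S n z)" "snd z - snd (S n z)"] norm_snd_le[of "snd z - snd (S n z)" "fst z - fst (S n z)"]
          unfolding norm_minus_commute[of "S n z" z] by (simp add: minus_prod_def)
        have "norm (?p * ?d z) = norm (a z) * (\<bar>multi_power y \<beta>\<bar> * norm (multi_deriv \<alpha> (tf_atom z) y - multi_deriv \<alpha> (tf_atom (S n z)) y))"
          by (simp add: norm_mult flip: right_diff_distrib)
        also have "\<dots> \<le> (Ca * exp (- r * (norm z)\<^sup>2)) * ((C1 * ?X * ?Y) * ?g)"
          using Ca by (intro mult_mono ab 1) auto
        also have "\<dots> \<le> (Ca * exp (- r * (norm z)\<^sup>2)) * ((C1 * exp (5 * \<delta> * (norm z)\<^sup>2) * (2 * norm (S n z - z))) * ?g)"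
          using Ca H g0 by (intro mult_left_mono mult_right_mono mult_mono X Y) (auto intro: add_nonneg_nonneg)
        also have "\<dots> = D * (exp (- r * (norm z)\<^sup>2) * exp (5 * \<delta> * (norm z)\<^sup>2)) * norm (S n z - z) * ?g"
          by (simp add: D_def mult_ac)
        also have "exp (- r * (norm z)\<^sup>2) * exp (5 * \<delta> * (norm z)\<^sup>2) = exp (- (5 * \<delta>) * (norm z)\<^sup>2)"
          unfolding mult_exp_exp \<delta>(2) by (rule arg_cong[where f=exp]) (simp add: algebra_simps)
        finally show "norm (?p * ?d z) \<le> e n z * ?g" by (simp add: e_def)
      qed
      also have "\<dots> = (\<integral>z. e n z \<partial>lborel) * ?g" by simp
      finally show "\<bar>multi_power y \<beta>\<bar> * norm (1 * multi_deriv \<alpha> \<psi> y + (-1) * multi_deriv \<alpha> (\<psi>n n) y) \<le> (\<integral>z. e n z \<partial>lborel) * ?g" .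
    qed
    moreover have "u (\<lambda>y. 1 * \<psi> y + (-1) * \<psi>n n y) = u \<psi> - u (\<psi>n n)"
      by (subst GS_dual_linear[OF u \<psi>GS \<psi>n(1)]) simp
    moreover have "0 \<le> (\<integral>z. e n z \<partial>lborel)" using e0 by (intro integral_nonneg_AE AE_I2)
    ultimately show ?thesis using K(2) by metis
  qed
  have lim1: "(\<lambda>n. u (\<psi>n n)) \<longlonglongrightarrow> u \<psi>"
  proof -
    have "(\<lambda>n. K * (\<integral>z. e n z \<partial>lborel)) \<longlonglongrightarrow> K * 0" by (intro tendsto_intros E0)
    then have *: "(\<lambda>n. K * (\<integral>z. e n z \<partial>lborel)) \<longlonglongrightarrow> 0" by simp
    have "(\<lambda>n. u (\<psi>n n) - u \<psi>) \<longlonglongrightarrow> 0"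
    proof (rule Lim_null_comparison[OF _ *])
      show "\<forall>\<^sub>F n in sequentially. norm (u (\<psi>n n) - u \<psi>) \<le> K * (\<integral>z. e n z \<partial>lborel)"
        using close by (intro always_eventually allI) (simp only: norm_minus_commute)
    qed
    then show ?thesis by (rule LIM_zero_cancel)
  qed
  have uc: "continuous_on UNIV (\<lambda>z. u (tf_atom z))" by (rule continuous_on_GS_dual_tf_shift[OF u])
  have um: "(\<lambda>z. u (tf_atom z)) \<in> borel_measurable borel" using uc by (rule borel_measurable_continuous_onI)
  have lim2: "(\<lambda>n. \<integral>z. a z * u (tf_atom (S n z)) \<partial>lborel) \<longlonglongrightarrow> (\<integral>z. a z * u (tf_atom z) \<partial>lborel)"
  proof (rule integral_dominated_convergence)
    let ?w = "\<lambda>z :: (real^'d) \<times> (real^'d). Ca * C2 * exp (- (6 * \<delta>) * (norm z)\<^sup>2)"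
    show "integrable lborel ?w"
      by (rule integrable_gauss_bound[where r = "6 * \<delta>" and C = "Ca * C2"]) (use \<delta> Ca C2 in \<open>auto simp: abs_mult\<close>)
    show "(\<lambda>z. a z * u (tf_atom z)) \<in> borel_measurable lborel" using a um by simp
    show "(\<lambda>z. a z * u (tf_atom (S n z))) \<in> borel_measurable lborel" for n
      using borel_measurable_integrable[OF csum(1)[of "\<lambda>v. u (tf_atom v)" n]] .
    show "AE z in lborel. (\<lambda>n. a z * u (tf_atom (S n z))) \<longlonglongrightarrow> a z * u (tf_atom z)"
      by (intro AE_I2 tendsto_mult_left continuous_on_tendsto_compose[OF uc Slim]) auto
    show "AE z in lborel. norm (a z * u (tf_atom (S n z))) \<le> ?w z" for n
    proof (rule AE_I2)
      fix z
      have "(norm (S n z))\<^sup>2 \<le> (2 * norm z)\<^sup>2" by (intro power_mono Sn) auto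
      then have "\<delta> * (norm (S n z))\<^sup>2 \<le> \<delta> * (4 * (norm z)\<^sup>2)" using \<delta> by (intro mult_left_mono) (auto simp: power_mult_distrib)
      then have "C2 * exp (\<delta> * (norm (S n z))\<^sup>2) \<le> C2 * exp (4 * \<delta> * (norm z)\<^sup>2)" using C2 by (simp add: mult_ac)
      then have "norm (u (tf_atom (S n z))) \<le> C2 * exp (4 * \<delta> * (norm z)\<^sup>2)" using ub order.trans by blast
      then have "norm (a z * u (tf_atom (S n z))) \<le> (Ca * exp (- r * (norm z)\<^sup>2)) * (C2 * exp (4 * \<delta> * (norm z)\<^sup>2))"
        unfolding norm_mult using Ca by (intro mult_mono ab) auto
      also have "\<dots> = Ca * C2 * (exp (- r * (norm z)\<^sup>2) * exp (4 * \<delta> * (norm z)\<^sup>2))" by (simp add: mult_ac)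
      also have "exp (- r * (norm z)\<^sup>2) * exp (4 * \<delta> * (norm z)\<^sup>2) = exp (- (6 * \<delta>) * (norm z)\<^sup>2)"
        unfolding mult_exp_exp \<delta>(2) by (rule arg_cong[where f=exp]) (simp add: algebra_simps)
      finally show "norm (a z * u (tf_atom (S n z))) \<le> ?w z" .
    qed
  qed
  have "u \<psi> = (\<integral>z. a z * u (tf_atom z) \<partial>lborel)"
    using LIMSEQ_unique[OF lim1[unfolded \<psi>n(2)] lim2] .
  then show ?thesis unfolding \<psi>_def[abs_def] .
qed

text \<open>For the index 1/2 the coefficients of \<open>f\<close> have Gaussian decay, which is
  what \<open>GS_dual_exchange\<close> requires to move \<open>u\<close> inside the inversion
  integral.\<close>

lemma GS_dual_expansion:
  fixes u :: "(real^'d::finite \<Rightarrow> complex) \<Rightarrow> complex"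
  assumes u: "u \<in> GS_dual (1/2)" and f: "f \<in> GS (1/2)"
  shows "u f = inverse (complex_of_real ((2 * pi) ^ CARD('d))) * (\<integral>z. tf_coeff f (fst z) (- snd z) * u (tf_atom z) \<partial>lborel)"
proof -
  let ?k = "inverse (complex_of_real ((2 * pi) ^ CARD('d)))"
  obtain h M where h: "0 < h" "0 \<le> M" "gs_bound (1/2) h M f" using f by (rule GS_E)
  have fc: "continuous_on UNIV f" using gs_bound_continuous[OF h(3), of "[]"] by simp
  obtain r C where r: "0 < r" "0 < C" and dec: "\<And>M (f :: real^'d \<Rightarrow> complex) x \<xi>. 0 \<le> M \<Longrightarrow> gs_bound (1/2) h M f \<Longrightarrow>
    norm (tf_coeff f x \<xi>) \<le> C * M * exp (- r * (norm x powr (1/(1/2)) + norm \<xi> powr (1/(1/2))))"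
    using tf_coeff_decay[OF order_refl h(1), where 'd='d] by blast
  define a where "a z = ?k * tf_coeff f (fst z) (- snd z)" for z
  have am: "a \<in> borel_measurable borel" unfolding a_def using tf_coeff_borel(2)[OF fc] by simp
  have "norm (a z) \<le> (norm ?k * (C * M)) * exp (- r * (norm z)\<^sup>2)" for z
    using mult_left_mono[OF dec[OF h(2,3), of "fst z" "- snd z"], of "norm ?k"]
    by (simp add: a_def norm_mult norm_pair_power2 mult.assoc)
  from GS_dual_exchange[OF u am r(1) this]
  have "u (\<lambda>y. \<integral>z. a z * tf_atom z y \<partial>lborel) = (\<integral>z. a z * u (tf_atom z) \<partial>lborel)" .
  moreover have "(\<integral>z. a z * tf_atom z y \<partial>lborel) = f y" for y
  proof -
    have "?k * complex_of_real ((2 * pi) ^ CARD('d)) = 1" by (rule left_inverse) simp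
    then show ?thesis
      unfolding a_def mult.assoc Bochner_Integration.integral_mult_right_zero tf_inversion[OF order_refl h]
      by (simp only: mult.assoc[symmetric] mult_1)
  qed
  moreover have "(\<integral>z. a z * u (tf_atom z) \<partial>lborel) = ?k * (\<integral>z. tf_coeff f (fst z) (- snd z) * u (tf_atom z) \<partial>lborel)"
    unfolding a_def mult.assoc by (rule Bochner_Integration.integral_mult_right_zero)
  ultimately show ?thesis by simp
qed

section \<open>Exponential weights\<close>

text \<open>Here the gap \<epsilon> between the exponents is used: any multiple of the smaller power
  is absorbed by an arbitrarily small multiple of the larger one, up to a constant.\<close>

lemma powr_absorb:
  fixes a b c r :: real
  assumes "0 < a" "a < b" "0 < r"
  obtains D where "\<And>t. 0 \<le> t \<Longrightarrow> c * t powr a \<le> D + r * t powr b"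
proof
  define c' where "c' = max c 0"
  \<comment> \<open>The point where \<open>c' * t powr a\<close> and \<open>r * t powr b\<close>
    meet.\<close>
  define T where "T = (c' / r) powr (1 / (b - a))"
  fix t :: real assume t: "0 \<le> t"
  have "c * t powr a \<le> c' * t powr a" by (intro mult_right_mono) (auto simp: c'_def)
  also have "\<dots> \<le> c' * T powr a + r * t powr b"
  proof (cases "T \<le> t")
    case True
    have "c' / r = T powr (b - a)" using assms by (simp add: T_def powr_powr c'_def)
    also have "\<dots> \<le> t powr (b - a)" using True assms by (intro powr_mono2) (auto simp: T_def)
    finally have "c' \<le> r * t powr (b - a)" using assms by (simp add: field_simps)
    then have "c' * t powr a \<le> r * t powr (b - a) * t powr a" by (intro mult_right_mono) auto
    also have "\<dots> = r * t powr b" by (simp add: powr_add[symmetric] mult.assoc)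
    finally show ?thesis by (simp add: c'_def add_increasing)
  next
    case False
    then have "t powr a \<le> T powr a" using t assms by (intro powr_mono2) auto
    then have "c' * t powr a \<le> c' * T powr a" by (intro mult_left_mono) (auto simp: c'_def)
    then show ?thesis using assms by (simp add: add_increasing2)
  qed
  finally show "c * t powr a \<le> c' * T powr a + r * t powr b" .
qed

lemma exp_phase_absorb:
  fixes a b c r :: real
  assumes "0 < a" "a < b" "0 < r"
  obtains D where "0 < D" "\<And>s t. 0 \<le> s \<Longrightarrow> 0 \<le> t \<Longrightarrow>
    exp (c * (s powr a + t powr a)) * exp (- r * (s powr b + t powr b)) \<le> D * exp (- (r / 2) * (s powr b + t powr b))"
proof -
  obtain D where D: "\<And>t. 0 \<le> t \<Longrightarrow> c * t powr a \<le> D + r / 2 * t powr b"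
    using powr_absorb[of a b "r / 2" c] assms by auto
  show ?thesis
  proof (rule that)
    show "0 < exp (2 * D)" by simp
    fix s t :: real assume "0 \<le> s" "0 \<le> t"
    then have "c * (s powr a + t powr a) + - r * (s powr b + t powr b) \<le> 2 * D + - (r / 2) * (s powr b + t powr b)"
      using D[of s] D[of t] by (simp add: algebra_simps)
    then show "exp (c * (s powr a + t powr a)) * exp (- r * (s powr b + t powr b)) \<le> exp (2 * D) * exp (- (r / 2) * (s powr b + t powr b))"
      by (simp only: mult_exp_exp exp_le_cancel_iff)
  qed
qed

lemma gs_bound_bounded: "gs_bound s h M f \<Longrightarrow> norm (f t) \<le> M"
  using gs_bound_replicate[of s h M f 0 undefined t] by simp

lemma gs_bound_borel: "gs_bound s h M f \<Longrightarrow> f \<in> borel_measurable borel"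
  using gs_bound_continuous[of s h M f "[]"] borel_measurable_continuous_onI by simp

text \<open>\<open>C\<close> is uniform over the step, the form in which \<open>GS_dualI\<close>
  asks for boundedness.\<close>

lemma gs_bound_integrable:
  assumes s: "0 < s" and h: "0 < h"
  obtains C where "\<And>M (f :: real^'d::finite \<Rightarrow> complex). 0 \<le> M \<Longrightarrow> gs_bound s h M f \<Longrightarrow> integrable lborel f \<and> (\<integral>t. norm (f t) \<partial>lborel) \<le> C * M"
proof -
  define r where "r = s / 2 / (real CARD('d) * h) powr (1/s)"
  have r: "0 < r" using s h by (simp add: r_def)
  let ?E = "\<lambda>t::real^'d. exp (- r * norm t powr (1/s))"
  obtain K where K: "0 < K" "\<And>t. 0 \<le> t \<Longrightarrow> exp (- r * t powr (1/s)) \<le> K * (1 + t) powr - (2 * real DIM(real^'d))"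
    using exp_powr_decay[of r "1/s" "2 * real DIM(real^'d)"] r s by auto
  have E: "integrable lborel ?E"
    by (rule integrable_lborel_decay[where K = K and N = "2 * real DIM(real^'d)"]) (use K in auto)
  show ?thesis
  proof (rule that)
    fix M and f :: "real^'d \<Rightarrow> complex" assume M: "0 \<le> M" and f: "gs_bound s h M f"
    have b: "norm (f t) \<le> 2 powr s * M * ?E t" for t
      unfolding r_def by (rule gs_bound_decay[OF f h s M])
    have iE: "integrable lborel (\<lambda>t. 2 powr s * M * ?E t)" by (intro integrable_mult_right E)
    have f_int: "integrable lborel f"
    proof (rule Bochner_Integration.integrable_bound[OF iE])
      show "f \<in> borel_measurable lborel" using gs_bound_borel[OF f] by simp
      show "AE t in lborel. norm (f t) \<le> norm (2 powr s * M * ?E t)"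
        unfolding real_norm_def by (intro AE_I2 order.trans[OF b abs_ge_self])
    qed
    have "(\<integral>t. norm (f t) \<partial>lborel) \<le> (\<integral>t. 2 powr s * M * ?E t \<partial>lborel)"
      by (intro integral_mono integrable_norm f_int iE b)
    also have "\<dots> = (2 powr s * (\<integral>t. ?E t \<partial>lborel)) * M" by simp
    finally show "integrable lborel f \<and> (\<integral>t. norm (f t) \<partial>lborel) \<le> (2 powr s * (\<integral>t. ?E t \<partial>lborel)) * M"
      using f_int by simp
  qed
qed

lemma GS_integrable:
  assumes "f \<in> GS s" "0 < s" shows "integrable lborel (f :: real^'d::finite \<Rightarrow> complex)"
proof -
  obtain h M where "0 < h" "0 \<le> M" "gs_bound s h M f" using assms(1) by (rule GS_E)
  then show ?thesis using gs_bound_integrable[OF assms(2)] by metis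
qed

lemma integrable_bounded_mult:
  fixes f g :: "'a::euclidean_space \<Rightarrow> complex"
  assumes "f \<in> borel_measurable borel" "\<And>t. norm (f t) \<le> M" "integrable lborel g"
  shows "integrable lborel (\<lambda>t. f t * g t)"
proof (rule Bochner_Integration.integrable_bound)
  show "integrable lborel (\<lambda>t. M * norm (g t))" by (intro integrable_mult_right integrable_norm assms)
  show "(\<lambda>t. f t * g t) \<in> borel_measurable lborel" using assms(1,3) by simp
  have "norm (f t * g t) \<le> M * norm (g t)" for t unfolding norm_mult by (intro mult_right_mono assms) simp
  then show "AE t in lborel. norm (f t * g t) \<le> norm (M * norm (g t))"
    unfolding real_norm_def[of "M * _"] by (intro AE_I2 order.trans[OF _ abs_ge_self])
qed

text \<open>\<open>f\<close> is bounded, and the integral of the modulus of a test function is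
  controlled linearly by its seminorm.\<close>

lemma GS_distr_GS_dual:
  fixes f :: "real^'d::finite \<Rightarrow> complex"
  assumes f: "f \<in> GS s"
  shows "GS_distr f \<in> GS_dual (1/2)"
    "GS_distr f (tf_shift x \<xi>) = tf_coeff f x \<xi>"
proof -
  obtain h M where M: "0 < h" "0 \<le> M" "gs_bound s h M f" using f by (rule GS_E)
  have int: "integrable lborel (\<lambda>t. f t * \<psi> t)" if "\<psi> \<in> GS (1/2)" for \<psi>
    by (rule integrable_bounded_mult[OF gs_bound_borel[OF M(3)] gs_bound_bounded[OF M(3)] GS_integrable[OF that]]) simp
  show "GS_distr f \<in> GS_dual (1/2)"
  proof (rule GS_dualI)
    show "GS_distr f \<in> extensional (GS (1/2))" by (simp add: GS_distr_def)
    fix \<psi> \<phi> :: "real^'d \<Rightarrow> complex" and a b :: complex assume \<psi>: "\<psi> \<in> GS (1/2)" and \<phi>: "\<phi> \<in> GS (1/2)"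
    have "(\<integral>t. f t * (a * \<psi> t + b * \<phi> t) \<partial>lborel) = (\<integral>t. a * (f t * \<psi> t) + b * (f t * \<phi> t) \<partial>lborel)"
      by (simp add: algebra_simps)
    also have "\<dots> = a * (\<integral>t. f t * \<psi> t \<partial>lborel) + b * (\<integral>t. f t * \<phi> t \<partial>lborel)"
      using int[OF \<psi>] int[OF \<phi>] by simp
    finally show "GS_distr f (\<lambda>x. a * \<psi> x + b * \<phi> x) = a * GS_distr f \<psi> + b * GS_distr f \<phi>"
      using \<psi> \<phi> GS_lincomb[OF \<psi> \<phi>] by (simp add: GS_distr_def)
  next
    fix k :: real assume k: "0 < k"
    obtain C where C: "\<And>N (\<psi> :: real^'d \<Rightarrow> complex). 0 \<le> N \<Longrightarrow> gs_bound (1/2) k N \<psi> \<Longrightarrow> integrable lborel \<psi> \<and> (\<integral>t. norm (\<psi> t) \<partial>lborel) \<le> C * N"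
      using gs_bound_integrable[of "1/2" k, where 'd='d] k by auto
    show "\<exists>K. \<forall>N \<psi>. 0 \<le> N \<longrightarrow> gs_bound (1/2) k N \<psi> \<longrightarrow> norm (GS_distr f \<psi>) \<le> K * N"
    proof (intro exI allI impI)
      fix N and \<psi> :: "real^'d \<Rightarrow> complex" assume N: "0 \<le> N" and \<psi>: "gs_bound (1/2) k N \<psi>"
      have GS: "\<psi> \<in> GS (1/2)" using k N \<psi> by (intro gs_bound_in_GS)
      have "norm (\<integral>t. f t * \<psi> t \<partial>lborel) \<le> (\<integral>t. M * norm (\<psi> t) \<partial>lborel)"
      proof (rule Bochner_Integration.integral_norm_bound_integral[OF int[OF GS]])
        show "integrable lborel (\<lambda>t. M * norm (\<psi> t))" using C[OF N \<psi>] by (intro integrable_mult_right integrable_norm) auto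
        show "norm (f t * \<psi> t) \<le> M * norm (\<psi> t)" for t
          unfolding norm_mult by (intro mult_right_mono gs_bound_bounded[OF M(3)]) simp
      qed
      also have "\<dots> = M * (\<integral>t. norm (\<psi> t) \<partial>lborel)" by simp
      also have "\<dots> \<le> M * (C * N)" using C[OF N \<psi>] M by (intro mult_left_mono) auto
      finally show "norm (GS_distr f \<psi>) \<le> M * C * N" using GS by (simp add: GS_distr_def mult.assoc)
    qed
  qed
  show "GS_distr f (tf_shift x \<xi>) = tf_coeff f x \<xi>"
    using GS_tf_shift[of "1/2" x \<xi>] by (simp add: GS_distr_def tf_coeff_def)
qed

text \<open>Lets the sign of the frequency in the reconstruction formula move from the coefficient
  to the atom.\<close>

lemma lborel_distr_reflect:
  "distr lborel borel (\<lambda>z :: 'a::euclidean_space \<times> 'b::euclidean_space. (fst z, - snd z)) = lborel"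
proof -
  have 1: "distr (lborel :: 'a measure) borel (\<lambda>x. x) = lborel" using distr_id2[of "borel :: 'a measure" lborel] by simp
  have 2: "distr (lborel :: 'b measure) borel uminus = lborel"
    using lborel_affine[of "-1" "0::'b"] by (simp add: density_1)
  have "lborel \<Otimes>\<^sub>M lborel = distr (lborel \<Otimes>\<^sub>M lborel) (borel \<Otimes>\<^sub>M borel) (\<lambda>(x::'a, y::'b). (x, - y))"
    using pair_measure_distr[of "\<lambda>x::'a. x" lborel borel "uminus :: 'b \<Rightarrow> 'b" lborel borel] unfolding 1 2
    by (simp add: sigma_finite_lborel)
  then have "lborel = distr lborel borel (\<lambda>(x::'a, y::'b). (x, - y))" unfolding lborel_prod borel_prod .
  then show ?thesis by (simp add: case_prod_unfold)
qed

lemma integral_reflect: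
  fixes F :: "'a::euclidean_space \<times> 'b::euclidean_space \<Rightarrow> complex"
  assumes "F \<in> borel_measurable borel"
  shows "(\<integral>z. F (fst z, - snd z) \<partial>lborel) = (\<integral>z. F z \<partial>lborel)"
proof -
  have "(\<lambda>z :: 'a \<times> 'b. (fst z, - snd z)) \<in> borel_measurable lborel"
    by (simp, intro borel_measurable_continuous_onI continuous_intros)
  from integral_distr[OF this assms] show ?thesis by (simp add: lborel_distr_reflect)
qed

text \<open>Within a unit ball \<open>norm x powr \<gamma> + norm \<xi> powr \<gamma>\<close>
  changes at most by the factor \<open>2 powr \<gamma>\<close> and an additive constant. The
  pointwise bound thus keeps the exponent \<gamma>, while the rate shrinks for \<open>0 < c\<close>
  and grows in modulus for \<open>c < 0\<close>.\<close>

lemma modulation_space_decay: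
  fixes B :: "((real^'d::finite) \<times> (real^'d)) mixed_space"
  assumes B: "mixed_quasi_norm_space B" and u: "u \<in> modulation_space \<omega> B" and \<gamma>: "0 < \<gamma>" and C: "0 < C"
    and \<omega>: "\<And>x \<xi>. \<omega> (x, \<xi>) = C * exp (c * (norm x powr \<gamma> + norm \<xi> powr \<gamma>))"
  obtains K where "0 < K" "\<And>z. norm (u (tf_atom z)) \<le>
    K * exp (- (if 0 < c then c / 2 powr \<gamma> else c * 2 powr \<gamma>) * (norm (fst z) powr \<gamma> + norm (snd z) powr \<gamma>))"
proof -
  define e where "e = (if 0 < c then c / 2 powr \<gamma> else c * 2 powr \<gamma>)"
  \<comment> \<open>The additive loss of the unit shift, in the same two cases as the rate
    \<open>e\<close>.\<close>
  define D where "D = (if 0 < c then - 2 * c else 2 * c * 2 powr \<gamma>)"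
  define q where "q z = norm (fst z) powr \<gamma> + norm (snd z) powr \<gamma>" for z :: "(real^'d) \<times> (real^'d)"
  have uG: "u \<in> GS_dual (1/2)" and fin: "mixed_qnorm B (\<lambda>z. ennreal (norm (STFT u z * complex_of_real (\<omega> z)))) < \<infinity>"
    using u by (auto simp: modulation_space_def)
  obtain k where k: "0 < k" "\<And>u \<omega> z m. u \<in> GS_dual (1/2) \<Longrightarrow> 0 \<le> m \<Longrightarrow> (\<And>p. dist p z \<le> 1 \<Longrightarrow> m \<le> \<omega> p) \<Longrightarrow>
    ennreal (k * m * norm (STFT u z)) \<le> mixed_qnorm B (\<lambda>p. ennreal (norm (STFT u p * complex_of_real (\<omega> p))))"
    using STFT_le_mixed_qnorm[OF B] by blast
  obtain Q where Q: "0 \<le> Q" "mixed_qnorm B (\<lambda>z. ennreal (norm (STFT u z * complex_of_real (\<omega> z)))) = ennreal Q"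
    using fin by (cases "mixed_qnorm B (\<lambda>z. ennreal (norm (STFT u z * complex_of_real (\<omega> z))))") auto
  have near: "v' powr \<gamma> \<le> 2 powr \<gamma> * (v powr \<gamma> + 1)" if "0 \<le> v" "0 \<le> v'" "v' \<le> v + 1" for v v' :: real
  proof -
    have "v' powr \<gamma> \<le> (v + 1) powr \<gamma>" using that \<gamma> by (intro powr_mono2) auto
    also have "\<dots> \<le> 2 powr \<gamma> * (v powr \<gamma> + 1 powr \<gamma>)" using that \<gamma> by (intro powr_add_le) auto
    finally show ?thesis by simp
  qed
  have qq: "q p \<le> 2 powr \<gamma> * (q z + 2)" if "dist p z \<le> 1" for p z
  proof -
    have "norm (fst p) \<le> norm (fst z) + 1" "norm (snd p) \<le> norm (snd z) + 1"
      using that dist_fst_le[of p z] dist_snd_le[of p z] norm_triangle_sub[of "fst p" "fst z"] norm_triangle_sub[of "snd p" "snd z"]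
      by (auto simp: dist_norm)
    then show ?thesis using near[of "norm (fst z)" "norm (fst p)"] near[of "norm (snd z)" "norm (snd p)"]
      by (simp add: q_def algebra_simps)
  qed
  have \<omega>q: "\<omega> z = C * exp (c * q z)" for z using \<omega>[of "fst z" "snd z"] by (simp add: q_def)
  have low: "C * exp (D + e * q z) \<le> \<omega> p" if d: "dist p z \<le> 1" for p z
  proof -
    have "D + e * q z \<le> c * q p"
    proof (cases "0 < c")
      case True
      have "q z \<le> 2 powr \<gamma> * (q p + 2)" using qq[of z p] d by (simp add: dist_commute)
      then have "c / 2 powr \<gamma> * q z \<le> c / 2 powr \<gamma> * (2 powr \<gamma> * (q p + 2))" using True by (intro mult_left_mono) auto
      then show ?thesis using True by (simp add: e_def D_def algebra_simps)
    next
      case False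
      have "c * (2 powr \<gamma> * (q z + 2)) \<le> c * q p" using False qq[OF d] by (intro mult_left_mono_neg) auto
      then show ?thesis using False by (simp add: e_def D_def algebra_simps)
    qed
    then show ?thesis unfolding \<omega>q using C by (intro mult_left_mono) auto
  qed
  define b where "b = (2 * pi) powr (- real CARD('d) / 2)"
  have b: "0 < b" by (simp add: b_def)
  show ?thesis
  proof (rule that)
    show "0 < (Q + 1) / (k * C * exp D * b)" using Q k C b by (intro divide_pos_pos) auto
    fix z :: "(real^'d) \<times> (real^'d)"
    have "ennreal (k * (C * exp (D + e * q z)) * norm (STFT u z)) \<le> ennreal Q"
      unfolding Q(2)[symmetric] by (rule k(2)[OF uG _ low]) (use C in auto)
    then have 1: "k * (C * exp (D + e * q z)) * norm (STFT u z) \<le> Q" using Q by (simp add: ennreal_le_iff)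
    have "norm (STFT u z) = b * norm (u (tf_atom z))"
      using STFT_eq[of u "fst z" "snd z"] by (simp add: norm_mult b_def)
    with 1 have "norm (u (tf_atom z)) * (k * C * exp D * b) * exp (e * q z) \<le> Q + 1"
      by (simp add: exp_add mult_ac)
    then have "norm (u (tf_atom z)) * (k * C * exp D * b) \<le> (Q + 1) * exp (- (e * q z))"
      by (simp add: exp_minus field_simps)
    then have "norm (u (tf_atom z)) \<le> (Q + 1) / (k * C * exp D * b) * exp (- (e * q z))"
      using k C b by (simp add: field_simps)
    then show "norm (u (tf_atom z)) \<le> (Q + 1) / (k * C * exp D * b) *
        exp (- (if 0 < c then c / 2 powr \<gamma> else c * 2 powr \<gamma>) * (norm (fst z) powr \<gamma> + norm (snd z) powr \<gamma>))"
      by (simp add: e_def q_def)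
  qed
qed

section \<open>Inclusions into the modulation space\<close>

lemma continuous_exp_weight:
  fixes \<omega> :: "(real^'d::finite) \<times> (real^'d) \<Rightarrow> real"
  assumes "0 < \<gamma>" "\<And>x \<xi>. \<omega> (x, \<xi>) = C * exp (c * (norm x powr \<gamma> + norm \<xi> powr \<gamma>))"
  shows "continuous_on UNIV \<omega>"
proof -
  have "\<omega> = (\<lambda>z. C * exp (c * (norm (fst z) powr \<gamma> + norm (snd z) powr \<gamma>)))"
    using assms(2) by (metis prod.collapse)
  then show ?thesis
    by (simp only:) (intro continuous_intros continuous_on_powr', use assms(1) in auto)
qed

lemma modulation_spaceI_exp:
  fixes B :: "((real^'d::finite) \<times> (real^'d)) mixed_space"
  assumes B: "mixed_quasi_norm_space B" and u: "u \<in> GS_dual (1/2)" and \<gamma>: "0 < \<gamma>" "0 < b" and r: "0 < r"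
    and \<omega>: "\<And>x \<xi>. \<omega> (x, \<xi>) = C * exp (c * (norm x powr \<gamma> + norm \<xi> powr \<gamma>))"
    and bd: "\<And>x \<xi>. norm (u (tf_shift x \<xi>)) * \<bar>\<omega> (x, \<xi>)\<bar> \<le> K * exp (- r * (norm x powr b + norm \<xi> powr b))"
  shows "u \<in> modulation_space \<omega> B"
proof (rule modulation_spaceI[OF B u continuous_exp_weight[OF \<gamma>(1) \<omega>]])
  fix N
  obtain D where D: "0 < D" "\<And>z :: (real^'d) \<times> (real^'d). exp (- r * (norm (fst z) powr b + norm (snd z) powr b)) \<le> D * (1 + norm z) powr - N"
    using exp_phase_decay[OF r \<gamma>(2), of N] by blast
  have K: "0 \<le> K"
  proof -
    have "0 \<le> norm (u (tf_shift 0 0)) * \<bar>\<omega> (0, 0)\<bar>" by simp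
    also have "\<dots> \<le> K * exp (- r * (norm (0::real^'d) powr b + norm (0::real^'d) powr b))" by (rule bd)
    finally show ?thesis by (simp add: zero_le_mult_iff)
  qed
  let ?b = "(2 * pi) powr (- real CARD('d) / 2)"
  have "norm (STFT u z) * \<bar>\<omega> z\<bar> \<le> (?b * K * D) * (1 + norm z) powr - N" for z
  proof -
    have "norm (STFT u z) * \<bar>\<omega> z\<bar> = ?b * (norm (u (tf_atom z)) * \<bar>\<omega> (fst z, snd z)\<bar>)"
      using STFT_eq[of u "fst z" "snd z"] by (simp add: norm_mult)
    also have "\<dots> \<le> ?b * (K * exp (- r * (norm (fst z) powr b + norm (snd z) powr b)))"
      by (intro mult_left_mono bd) simp
    also have "\<dots> \<le> ?b * (K * (D * (1 + norm z) powr - N))" using K by (intro mult_left_mono D) auto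
    finally show ?thesis by (simp only: mult.assoc)
  qed
  then show "\<exists>K. \<forall>z. norm (STFT u z) * \<bar>\<omega> z\<bar> \<le> K * (1 + norm z) powr - N" by blast
qed

text \<open>The decay rate \<open>r\<close> of the coefficients is dictated by \<open>f\<close>.
  However small it is, half of it absorbs the weight, because the exponent \<open>b\<close> exceeds
  \<gamma>.\<close>

lemma GS_sub_subset_modulation_space:
  fixes B :: "((real^'d::finite) \<times> (real^'d)) mixed_space"
  assumes B: "mixed_quasi_norm_space B" and \<gamma>: "0 < \<gamma>" "\<gamma> < b" "b \<le> 2"
    and \<omega>: "\<And>x \<xi>. \<omega> (x, \<xi>) = C * exp (c * (norm x powr \<gamma> + norm \<xi> powr \<gamma>))"
  shows "GS_sub (1 / b) \<subseteq> modulation_space \<omega> B"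
proof
  fix u :: "(real^'d \<Rightarrow> complex) \<Rightarrow> complex" assume "u \<in> GS_sub (1 / b)"
  then obtain f where f: "f \<in> GS (1 / b)" "u = GS_distr f" by (auto simp: GS_sub_def)
  obtain h M where h: "0 < h" "0 \<le> M" "gs_bound (1 / b) h M f" using f(1) by (rule GS_E)
  have s: "1/2 \<le> 1 / b" using \<gamma> by (simp add: field_simps)
  obtain r A where r: "0 < r" "0 < A" and dec: "\<And>M (f :: real^'d \<Rightarrow> complex) x \<xi>. 0 \<le> M \<Longrightarrow> gs_bound (1/b) h M f \<Longrightarrow>
    norm (tf_coeff f x \<xi>) \<le> A * M * exp (- r * (norm x powr (1/(1/b)) + norm \<xi> powr (1/(1/b))))"
    using tf_coeff_decay[OF s h(1), where 'd='d] by blast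
  obtain D where D: "0 < D" "\<And>s t. 0 \<le> s \<Longrightarrow> 0 \<le> t \<Longrightarrow>
    exp (c * (s powr \<gamma> + t powr \<gamma>)) * exp (- r * (s powr b + t powr b)) \<le> D * exp (- (r / 2) * (s powr b + t powr b))"
    using exp_phase_absorb[OF \<gamma>(1,2) r(1), of c] by blast
  have b: "0 < b" using \<gamma> by simp
  show "u \<in> modulation_space \<omega> B"
  proof (rule modulation_spaceI_exp[OF B _ \<gamma>(1) b _ \<omega>, of u "r / 2" "A * M * \<bar>C\<bar> * D"])
    show "u \<in> GS_dual (1/2)" using f by (simp add: GS_distr_GS_dual(1))
    show "0 < r / 2" using r by simp
    fix x \<xi> :: "real^'d"
    have "norm (u (tf_shift x \<xi>)) \<le> A * M * exp (- r * (norm x powr b + norm \<xi> powr b))"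
      using dec[OF h(2,3), of x \<xi>] f GS_distr_GS_dual(2)[OF f(1)] by simp
    then have "norm (u (tf_shift x \<xi>)) * \<bar>\<omega> (x, \<xi>)\<bar> \<le> (A * M * exp (- r * (norm x powr b + norm \<xi> powr b))) * \<bar>\<omega> (x, \<xi>)\<bar>"
      by (rule mult_right_mono) simp
    also have "\<dots> = A * M * \<bar>C\<bar> * (exp (c * (norm x powr \<gamma> + norm \<xi> powr \<gamma>)) * exp (- r * (norm x powr b + norm \<xi> powr b)))"
      by (simp add: \<omega> abs_mult mult_ac)
    also have "\<dots> \<le> A * M * \<bar>C\<bar> * (D * exp (- (r / 2) * (norm x powr b + norm \<xi> powr b)))"
      using r h by (intro mult_left_mono D) auto
    finally show "norm (u (tf_shift x \<xi>)) * \<bar>\<omega> (x, \<xi>)\<bar> \<le> A * M * \<bar>C\<bar> * D * exp (- (r / 2) * (norm x powr b + norm \<xi> powr b))"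
      by (simp only: mult.assoc)
  qed
qed

text \<open>The coefficients grow with the smaller exponent \<open>b\<close>, here at rate 1, and
  half of the decay of the weight absorbs this growth.\<close>

lemma GS_dual_sub_subset_modulation_space:
  fixes B :: "((real^'d::finite) \<times> (real^'d)) mixed_space"
  assumes B: "mixed_quasi_norm_space B" and \<gamma>: "0 < b" "b < \<gamma>" "b \<le> 2" and c: "c < 0"
    and \<omega>: "\<And>x \<xi>. \<omega> (x, \<xi>) = C * exp (c * (norm x powr \<gamma> + norm \<xi> powr \<gamma>))"
  shows "GS_dual_sub (1 / b) \<subseteq> modulation_space \<omega> B"
proof
  fix u :: "(real^'d \<Rightarrow> complex) \<Rightarrow> complex" assume "u \<in> GS_dual_sub (1 / b)"
  then obtain v where v: "v \<in> GS_dual (1 / b)" "u = restrict v (GS (1/2))" by (auto simp: GS_dual_sub_def)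
  have s: "1/2 \<le> 1 / b" using \<gamma> by (simp add: field_simps)
  obtain K where K: "0 < K" "\<And>x \<xi>. norm (v (tf_shift x \<xi>)) \<le> K * exp (1 * (norm x powr (1/(1/b)) + norm \<xi> powr (1/(1/b))))"
    using GS_dual_tf_shift_bound[OF v(1) s zero_less_one] by blast
  have nc: "0 < - c" using c by simp
  obtain D where D: "0 < D" "\<And>s t. 0 \<le> s \<Longrightarrow> 0 \<le> t \<Longrightarrow>
    exp (1 * (s powr b + t powr b)) * exp (- (- c) * (s powr \<gamma> + t powr \<gamma>)) \<le> D * exp (- (- c / 2) * (s powr \<gamma> + t powr \<gamma>))"
    using exp_phase_absorb[OF \<gamma>(1,2) nc, of 1] by blast
  have g: "0 < \<gamma>" using \<gamma> by simp
  show "u \<in> modulation_space \<omega> B"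
  proof (rule modulation_spaceI_exp[OF B _ g g _ \<omega>, of u "- c / 2" "K * \<bar>C\<bar> * D"])
    show "u \<in> GS_dual (1/2)" unfolding v(2) by (rule GS_dual_sub_mono[OF v(1) s])
    show "0 < - c / 2" using c by simp
    fix x \<xi> :: "real^'d"
    have "norm (u (tf_shift x \<xi>)) \<le> K * exp (1 * (norm x powr b + norm \<xi> powr b))"
      using K(2)[of x \<xi>] GS_tf_shift[of "1/2" x \<xi>] by (simp add: v(2))
    then have "norm (u (tf_shift x \<xi>)) * \<bar>\<omega> (x, \<xi>)\<bar> \<le> (K * exp (1 * (norm x powr b + norm \<xi> powr b))) * \<bar>\<omega> (x, \<xi>)\<bar>"
      by (rule mult_right_mono) simp
    also have "\<dots> = K * \<bar>C\<bar> * (exp (1 * (norm x powr b + norm \<xi> powr b)) * exp (- (- c) * (norm x powr \<gamma> + norm \<xi> powr \<gamma>)))"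
      by (simp add: \<omega> abs_mult mult_ac)
    also have "\<dots> \<le> K * \<bar>C\<bar> * (D * exp (- (- c / 2) * (norm x powr \<gamma> + norm \<xi> powr \<gamma>)))"
      using K by (intro mult_left_mono D) auto
    finally show "norm (u (tf_shift x \<xi>)) * \<bar>\<omega> (x, \<xi>)\<bar> \<le> K * \<bar>C\<bar> * D * exp (- (- c / 2) * (norm x powr \<gamma> + norm \<xi> powr \<gamma>))"
      by (simp only: mult.assoc)
  qed
qed

section \<open>From coefficient bounds back to functions and functionals\<close>

lemma integrable_phase_bound:
  fixes f :: "(real^'d::finite) \<times> (real^'d) \<Rightarrow> 'b::{banach, second_countable_topology}"
  assumes "f \<in> borel_measurable borel" "0 < r" "0 < b" "\<And>z. norm (f z) \<le> C * exp (- r * (norm (fst z) powr b + norm (snd z) powr b))"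
  shows "integrable lborel f"
proof -
  have "0 \<le> C * exp (- r * (norm (fst 0 :: real^'d) powr b + norm (snd 0 :: real^'d) powr b))" using order.trans[OF norm_ge_zero assms(4)[of 0]] by simp
  then have C: "0 \<le> C" by (simp add: zero_le_mult_iff)
  let ?N = "2 * real DIM((real^'d) \<times> (real^'d))"
  obtain K where K: "0 < K" "\<And>z :: (real^'d) \<times> (real^'d). exp (- r * (norm (fst z) powr b + norm (snd z) powr b)) \<le> K * (1 + norm z) powr - ?N"
    using exp_phase_decay[OF assms(2,3), of ?N] by blast
  show ?thesis
  proof (rule integrable_lborel_decay[OF assms(1) _ order_refl])
    fix z
    have "norm (f z) \<le> C * exp (- r * (norm (fst z) powr b + norm (snd z) powr b))" by (rule assms(4))
    also have "\<dots> \<le> C * (K * (1 + norm z) powr - ?N)" using C by (intro mult_left_mono K) auto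
    finally show "norm (f z) \<le> (C * K) * (1 + norm z) powr - ?N" by (simp only: mult.assoc)
  qed
qed

lemma borel_GS_dual_tf_atom:
  "u \<in> GS_dual (1/2) \<Longrightarrow> (\<lambda>z. u (tf_atom z)) \<in> borel_measurable borel"
  "u \<in> GS_dual (1/2) \<Longrightarrow> (\<lambda>z. u (tf_shift (fst z) (- snd z))) \<in> borel_measurable borel"
proof -
  assume u: "u \<in> GS_dual (1/2)"
  show 1: "(\<lambda>z. u (tf_atom z)) \<in> borel_measurable borel"
    by (rule borel_measurable_continuous_onI[OF continuous_on_GS_dual_tf_shift[OF u]])
  have "(\<lambda>z :: (real^'a) \<times> (real^'a). (fst z, - snd z)) \<in> borel_measurable borel"
    by (intro borel_measurable_continuous_onI continuous_intros)
  from measurable_compose[OF this 1] show "(\<lambda>z. u (tf_shift (fst z) (- snd z))) \<in> borel_measurable borel" by simp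
qed

text \<open>The representing function superposes atoms with the coefficients
  \<open>u (tf_shift x (- \<xi>))\<close>. Its seminorm is finite because the seminorms of the atoms
  grow with the smaller exponent \<open>b\<close>. Pairing it with a test function and applying
  Fubini leads back to \<open>GS_dual_expansion\<close>.\<close>

lemma GS_dual_decay_imp_GS_sub:
  fixes u :: "(real^'d::finite \<Rightarrow> complex) \<Rightarrow> complex"
  assumes u: "u \<in> GS_dual (1/2)" and e: "0 < e" and b: "0 < b" "b < \<gamma>" "b \<le> 2"
    and bd: "\<And>z. norm (u (tf_atom z)) \<le> K * exp (- e * (norm (fst z) powr \<gamma> + norm (snd z) powr \<gamma>))"
  shows "u \<in> GS_sub (1 / b)"
proof -
  have \<gamma>: "0 < \<gamma>" using b by simp
  have s: "1/2 \<le> 1 / b" using b by (simp add: field_simps)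
  have "0 \<le> K * exp (- e * (norm (fst 0 :: real^'d) powr \<gamma> + norm (snd 0 :: real^'d) powr \<gamma>))" using order.trans[OF norm_ge_zero bd[of 0]] by simp
  then have K: "0 \<le> K" by (simp add: zero_le_mult_iff)
  let ?k = "inverse (complex_of_real ((2 * pi) ^ CARD('d)))"
  define a where "a z = ?k * u (tf_shift (fst z) (- snd z))" for z
  have am: "a \<in> borel_measurable borel" unfolding a_def using borel_GS_dual_tf_atom(2)[OF u] by simp
  have ab: "norm (a z) \<le> (norm ?k * K) * exp (- e * (norm (fst z) powr \<gamma> + norm (snd z) powr \<gamma>))" for z
    using mult_left_mono[OF bd[of "(fst z, - snd z)"], of "norm ?k"] by (simp add: a_def norm_mult mult.assoc)
  have ai: "integrable lborel a" by (rule integrable_phase_bound[OF am e \<gamma> ab])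
  obtain H A where H: "1 \<le> H" "0 < A" "\<And>(x::real^'d) \<xi>. gs_bound (1/b) H
    (A * exp (1 * (norm x powr (1/(1/b)) + norm \<xi> powr (1/(1/b))))) (tf_shift x \<xi>)"
    using tf_shift_gs_bound[OF s zero_less_one, where 'd='d] by blast
  have Hpos: "0 < H" using H(1) by simp
  define W where "W z = A * exp (1 * (norm (fst z) powr b + norm (snd z) powr b))" for z :: "(real^'d) \<times> (real^'d)"
  have W: "gs_bound (1/b) H (W z) (tf_atom z)" for z using H(3)[of "fst z" "snd z"] by (simp add: W_def)
  have Wm: "W \<in> borel_measurable borel"
    unfolding W_def by (intro borel_measurable_continuous_onI continuous_intros continuous_on_powr') (use b in auto)
  obtain D where D: "0 < D" "\<And>s t. 0 \<le> s \<Longrightarrow> 0 \<le> t \<Longrightarrow>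
    exp (1 * (s powr b + t powr b)) * exp (- e * (s powr \<gamma> + t powr \<gamma>)) \<le> D * exp (- (e / 2) * (s powr \<gamma> + t powr \<gamma>))"
    using exp_phase_absorb[OF b(1,2) e, of 1] by blast
  have iW: "integrable lborel (\<lambda>z. norm (a z) * W z)"
  proof (rule integrable_phase_bound[where r = "e / 2" and b = \<gamma>])
    show "(\<lambda>z. norm (a z) * W z) \<in> borel_measurable borel" using am Wm by simp
    fix z
    have "norm (norm (a z) * W z) = norm (a z) * W z" using H(2) by (simp add: W_def abs_mult)
    also have "\<dots> \<le> ((norm ?k * K) * exp (- e * (norm (fst z) powr \<gamma> + norm (snd z) powr \<gamma>))) * W z"
      using H(2) by (intro mult_right_mono ab) (simp add: W_def)
    also have "\<dots> = (norm ?k * K * A) * (exp (1 * (norm (fst z) powr b + norm (snd z) powr b)) * exp (- e * (norm (fst z) powr \<gamma> + norm (snd z) powr \<gamma>)))"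
      by (simp add: W_def mult_ac)
    also have "\<dots> \<le> (norm ?k * K * A) * (D * exp (- (e / 2) * (norm (fst z) powr \<gamma> + norm (snd z) powr \<gamma>)))"
      using K H(2) by (intro mult_left_mono D) auto
    finally show "norm (norm (a z) * W z) \<le> (norm ?k * K * A * D) * exp (- (e / 2) * (norm (fst z) powr \<gamma> + norm (snd z) powr \<gamma>))"
      by (simp only: mult.assoc)
  qed (use e \<gamma> in auto)
  define g where "g y = (\<integral>z. a z * tf_atom z y \<partial>lborel)" for y
  have gb: "gs_bound (1/b) H (\<integral>z. norm (a z) * W z \<partial>lborel) g"
    using tf_synthesis(3)[OF Hpos am W iW] unfolding g_def[abs_def] .
  have "0 \<le> (\<integral>z. norm (a z) * W z \<partial>lborel)" using H by (intro integral_nonneg_AE AE_I2) (simp add: W_def)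
  then have gGS: "g \<in> GS (1/b)" using gb Hpos by (intro gs_bound_in_GS)
  \<comment> \<open>Equality as extensional functions: outside \<open>GS (1/2)\<close> both sides
    have the default value.\<close>
  have "GS_distr g f = u f" for f
  proof (cases "f \<in> GS (1/2)")
    case False
    then show ?thesis using u by (auto simp: GS_distr_def GS_dual_def extensional_def)
  next
    case True
    obtain h M where f: "0 < h" "0 \<le> M" "gs_bound (1/2) h M f" using True by (rule GS_E)
    have fi: "integrable lborel f" by (rule GS_integrable[OF True]) simp
    have fm: "f \<in> borel_measurable borel" by (rule gs_bound_borel[OF f(3)])
    have fc: "continuous_on UNIV f" using gs_bound_continuous[OF f(3), of "[]"] by simp
    have "GS_distr g f = (\<integral>y. (\<integral>z. a z * tf_atom z y * f y \<partial>lborel) \<partial>lborel)"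
      using True by (simp add: GS_distr_def g_def)
    also have "\<dots> = (\<integral>z. (\<integral>y. a z * tf_atom z y * f y \<partial>lborel) \<partial>lborel)"
    proof (rule lborel_pair.Fubini_integral)
      let ?c = "pi powr (- real CARD('d) / 4)"
      show "integrable (lborel \<Otimes>\<^sub>M lborel) (\<lambda>(z, y). a z * tf_atom z y * f y)"
      proof (rule Bochner_Integration.integrable_bound)
        show "integrable (lborel \<Otimes>\<^sub>M lborel) (\<lambda>p. complex_of_real ?c * (case p of (z, y) \<Rightarrow> a z * f y))"
          by (intro integrable_mult_right integrable_pair_mult ai fi)
        have "continuous_on UNIV (\<lambda>p :: ((real^'d) \<times> (real^'d)) \<times> (real^'d). tf_atom (fst p) (snd p))"
          unfolding tf_shift_def gauss_window_def by (intro continuous_intros) auto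
        then have T: "(\<lambda>p :: ((real^'d) \<times> (real^'d)) \<times> (real^'d). tf_atom (fst p) (snd p)) \<in> borel_measurable (lborel \<Otimes>\<^sub>M lborel)"
          unfolding lborel_prod by (simp add: borel_measurable_continuous_onI)
        have A: "(\<lambda>p. a (fst p)) \<in> borel_measurable (lborel \<Otimes>\<^sub>M (lborel :: (real^'d) measure))"
          by (rule measurable_compose[OF measurable_fst]) (use am in simp)
        have F: "(\<lambda>p. f (snd p)) \<in> borel_measurable ((lborel :: ((real^'d) \<times> (real^'d)) measure) \<Otimes>\<^sub>M lborel)"
          by (rule measurable_compose[OF measurable_snd]) (use fm in simp)
        show "(\<lambda>(z, y). a z * tf_atom z y * f y) \<in> borel_measurable (lborel \<Otimes>\<^sub>M lborel)"
          unfolding case_prod_unfold by (intro borel_measurable_times T A F)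
        have gw: "gauss_window t \<le> ?c" for t :: "real^'d" by (auto simp: gauss_window_def mult_le_cancel_left1)
        have "norm (a z * tf_atom z y * f y) \<le> norm (complex_of_real ?c * (a z * f y))" for z y
          using mult_mono[OF order_refl gw[of "y - fst z"], of "norm (a z) * norm (f y)"]
          by (simp add: norm_mult norm_tf_shift gauss_window_def mult_ac)
        then show "AE p in lborel \<Otimes>\<^sub>M lborel. norm (case p of (z, y) \<Rightarrow> a z * tf_atom z y * f y) \<le>
           norm (complex_of_real ?c * (case p of (z, y) \<Rightarrow> a z * f y))" by (intro AE_I2) (auto split: prod.splits)
      qed
    qed
    also have "\<dots> = (\<integral>z. ?k * (tf_coeff f (fst z) (snd z) * u (tf_shift (fst z) (- snd z))) \<partial>lborel)"
    proof (intro Bochner_Integration.integral_cong refl)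
      fix z :: "(real^'d) \<times> (real^'d)"
      have "(\<integral>y. a z * tf_atom z y * f y \<partial>lborel) = (\<integral>y. a z * (f y * tf_atom z y) \<partial>lborel)"
        by (simp only: mult_ac)
      also have "\<dots> = a z * (\<integral>y. f y * tf_atom z y \<partial>lborel)"
        by (rule Bochner_Integration.integral_mult_right_zero)
      finally show "(\<integral>y. a z * tf_atom z y * f y \<partial>lborel) = ?k * (tf_coeff f (fst z) (snd z) * u (tf_shift (fst z) (- snd z)))"
        by (simp add: tf_coeff_def a_def mult_ac)
    qed
    also have "\<dots> = ?k * (\<integral>z. tf_coeff f (fst z) (snd z) * u (tf_shift (fst z) (- snd z)) \<partial>lborel)"
      by (rule Bochner_Integration.integral_mult_right_zero)
    also have "(\<integral>z. tf_coeff f (fst z) (snd z) * u (tf_shift (fst z) (- snd z)) \<partial>lborel) =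
        (\<integral>z. tf_coeff f (fst z) (- snd z) * u (tf_atom z) \<partial>lborel)"
      using integral_reflect[of "\<lambda>z. tf_coeff f (fst z) (- snd z) * u (tf_atom z)"] tf_coeff_borel(2)[OF fc] borel_GS_dual_tf_atom(1)[OF u]
      by simp
    finally show ?thesis using GS_dual_expansion[OF u True] by simp
  qed
  then have "u = GS_distr g" by (intro ext) simp
  with gGS show ?thesis by (auto simp: GS_sub_def)
qed

lemma tf_coeff_lincomb:
  assumes f: "f \<in> GS s" and g: "g \<in> GS s" and s: "0 < s"
  shows "tf_coeff (\<lambda>t. a * f t + b * g t) x \<xi> = a * tf_coeff f x \<xi> + b * tf_coeff g x \<xi>"
proof -
  have m: "tf_shift x \<xi> \<in> borel_measurable borel" by (rule borel_measurable_continuous_onI[OF continuous_tf_shift])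
  have gw: "norm (tf_shift x \<xi> t) \<le> pi powr (- real CARD('a) / 4)" for t
    by (auto simp: norm_tf_shift gauss_window_def mult_le_cancel_left1)
  have i: "integrable lborel (\<lambda>t. k t * tf_shift x \<xi> t)" if "k \<in> GS s" for k
    using integrable_bounded_mult[OF m gw GS_integrable[OF that s]] by (simp add: mult.commute)
  have "tf_coeff (\<lambda>t. a * f t + b * g t) x \<xi> = (\<integral>t. a * (f t * tf_shift x \<xi> t) + b * (g t * tf_shift x \<xi> t) \<partial>lborel)"
    by (simp add: tf_coeff_def algebra_simps)
  also have "\<dots> = a * tf_coeff f x \<xi> + b * tf_coeff g x \<xi>"
    using i[OF f] i[OF g] by (simp add: tf_coeff_def)
  finally show ?thesis .
qed

text \<open>The right-hand side of \<open>GS_dual_expansion\<close> still converges for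
  \<open>f\<close> in the larger space, since coefficients there decay with the exponent
  \<open>b > \<gamma>\<close>; it defines the extension.\<close>

lemma GS_dual_growth_imp_GS_dual_sub:
  fixes u :: "(real^'d::finite \<Rightarrow> complex) \<Rightarrow> complex"
  assumes u: "u \<in> GS_dual (1/2)" and \<gamma>: "0 < \<gamma>" "\<gamma> < b" "b \<le> 2" and K: "0 \<le> K"
    and bd: "\<And>z. norm (u (tf_atom z)) \<le> K * exp (e * (norm (fst z) powr \<gamma> + norm (snd z) powr \<gamma>))"
  shows "u \<in> GS_dual_sub (1 / b)"
proof -
  have b: "0 < b" using \<gamma> by simp
  have s: "1/2 \<le> 1 / b" using \<gamma> b by (simp add: field_simps)
  have s0: "0 < 1 / b" using b by simp
  let ?k = "inverse (complex_of_real ((2 * pi) ^ CARD('d)))"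
  let ?F = "\<lambda>f z. tf_coeff f (fst z) (- snd z) * u (tf_atom z)"
  define U where "U = (\<lambda>f\<in>GS (1/b). ?k * (\<integral>z. ?F f z \<partial>lborel))"
  \<comment> \<open>\<open>L\<close> depends only on the step \<open>h\<close>, which gives the
    continuity of the extension.\<close>
  have main: "\<exists>L. \<forall>M (f :: real^'d \<Rightarrow> complex). 0 \<le> M \<longrightarrow> gs_bound (1/b) h M f \<longrightarrow>
     integrable lborel (?F f) \<and> norm (\<integral>z. ?F f z \<partial>lborel) \<le> L * M" if h: "0 < h" for h
  proof -
    obtain r C where r: "0 < r" "0 < C" and dec: "\<And>M (f :: real^'d \<Rightarrow> complex) x \<xi>. 0 \<le> M \<Longrightarrow> gs_bound (1/b) h M f \<Longrightarrow>
      norm (tf_coeff f x \<xi>) \<le> C * M * exp (- r * (norm x powr (1/(1/b)) + norm \<xi> powr (1/(1/b))))"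
      using tf_coeff_decay[OF s h, where 'd='d] by blast
    obtain D where D: "0 < D" "\<And>s t. 0 \<le> s \<Longrightarrow> 0 \<le> t \<Longrightarrow>
      exp (e * (s powr \<gamma> + t powr \<gamma>)) * exp (- r * (s powr b + t powr b)) \<le> D * exp (- (r / 2) * (s powr b + t powr b))"
      using exp_phase_absorb[OF \<gamma>(1,2) r(1), of e] by blast
    let ?E = "\<lambda>z :: (real^'d) \<times> (real^'d). exp (- (r / 2) * (norm (fst z) powr b + norm (snd z) powr b))"
    have Em: "?E \<in> borel_measurable borel"
      by (intro borel_measurable_continuous_onI continuous_intros continuous_on_powr') (use b in auto)
    have Ei: "integrable lborel ?E"
      by (rule integrable_phase_bound[OF Em, of "r / 2" b 1]) (use r b in auto)
    show ?thesis
    proof (intro exI allI impI)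
      fix M and f :: "real^'d \<Rightarrow> complex" assume M: "0 \<le> M" and f: "gs_bound (1/b) h M f"
      have fc: "continuous_on UNIV f" using gs_bound_continuous[OF f, of "[]"] by simp
      have Fb: "norm (?F f z) \<le> C * M * K * D * ?E z" for z
      proof -
        have "norm (?F f z) \<le> (C * M * exp (- r * (norm (fst z) powr b + norm (snd z) powr b))) * (K * exp (e * (norm (fst z) powr \<gamma> + norm (snd z) powr \<gamma>)))"
          unfolding norm_mult using dec[OF M f, of "fst z" "- snd z"] bd[of z] r M by (intro mult_mono) auto
        also have "\<dots> = C * M * K * (exp (e * (norm (fst z) powr \<gamma> + norm (snd z) powr \<gamma>)) * exp (- r * (norm (fst z) powr b + norm (snd z) powr b)))"
          by (simp add: mult_ac)
        also have "\<dots> \<le> C * M * K * (D * ?E z)" using r M K by (intro mult_left_mono D) auto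
        finally show ?thesis by (simp only: mult.assoc)
      qed
      have Fm: "?F f \<in> borel_measurable borel" using tf_coeff_borel(2)[OF fc] borel_GS_dual_tf_atom(1)[OF u] by simp
      have Fi: "integrable lborel (?F f)" by (rule integrable_phase_bound[OF Fm _ b Fb]) (use r in simp)
      have "norm (\<integral>z. ?F f z \<partial>lborel) \<le> (\<integral>z. C * M * K * D * ?E z \<partial>lborel)"
        by (rule Bochner_Integration.integral_norm_bound_integral[OF Fi _ Fb]) (intro integrable_mult_right Ei)
      also have "\<dots> = (C * K * D * (\<integral>z. ?E z \<partial>lborel)) * M" by simp
      finally show "integrable lborel (?F f) \<and> norm (\<integral>z. ?F f z \<partial>lborel) \<le> (C * K * D * (\<integral>z. ?E z \<partial>lborel)) * M"
        using Fi by simp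
    qed
  qed
  have Fi: "integrable lborel (?F f)" if fG: "f \<in> GS (1/b)" for f
  proof -
    obtain h M where "0 < h" "0 \<le> M" "gs_bound (1/b) h M f" using fG by (rule GS_E)
    with main show ?thesis by blast
  qed
  have "U \<in> GS_dual (1/b)"
  proof (rule GS_dualI)
    show "U \<in> extensional (GS (1/b))" by (simp add: U_def)
    fix f g :: "real^'d \<Rightarrow> complex" and \<alpha> \<beta> :: complex assume f: "f \<in> GS (1/b)" and g: "g \<in> GS (1/b)"
    have "(\<integral>z. ?F (\<lambda>x. \<alpha> * f x + \<beta> * g x) z \<partial>lborel) = (\<integral>z. \<alpha> * ?F f z + \<beta> * ?F g z \<partial>lborel)"
      unfolding tf_coeff_lincomb[OF f g s0] by (simp add: algebra_simps)
    also have "\<dots> = \<alpha> * (\<integral>z. ?F f z \<partial>lborel) + \<beta> * (\<integral>z. ?F g z \<partial>lborel)"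
      using Fi[OF f] Fi[OF g] by simp
    finally show "U (\<lambda>x. \<alpha> * f x + \<beta> * g x) = \<alpha> * U f + \<beta> * U g"
      using f g GS_lincomb[OF f g] by (simp add: U_def algebra_simps)
  next
    fix h :: real assume h: "0 < h"
    obtain L where L: "\<And>M (f :: real^'d \<Rightarrow> complex). 0 \<le> M \<Longrightarrow> gs_bound (1/b) h M f \<Longrightarrow>
       integrable lborel (?F f) \<and> norm (\<integral>z. ?F f z \<partial>lborel) \<le> L * M"
      using main[OF h] by blast
    show "\<exists>K. \<forall>M f. 0 \<le> M \<longrightarrow> gs_bound (1/b) h M f \<longrightarrow> norm (U f) \<le> K * M"
    proof (intro exI allI impI)
      fix M and f :: "real^'d \<Rightarrow> complex" assume M: "0 \<le> M" and f: "gs_bound (1/b) h M f"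
      have "f \<in> GS (1/b)" using h M f by (rule gs_bound_in_GS)
      then show "norm (U f) \<le> norm ?k * L * M"
        using mult_left_mono[OF conjunct2[OF L[OF M f]] norm_ge_zero[of ?k]] by (simp add: U_def norm_mult mult.assoc)
    qed
  qed
  moreover have "restrict U (GS (1/2)) f = u f" for f
  proof (cases "f \<in> GS (1/2)")
    case True
    then have "f \<in> GS (1/b)" using GS_mono[OF s] by blast
    with True show ?thesis using GS_dual_expansion[OF u True] by (simp add: U_def)
  next
    case False
    then show ?thesis using u by (auto simp: GS_dual_def extensional_def)
  qed
  then have "u = restrict U (GS (1/2))" by (intro ext) simp
  ultimately show ?thesis by (auto simp: GS_dual_sub_def)
qed

theorem proposition4p9:
  fixes B :: "((real^'d::finite) \<times> (real^'d)) mixed_space"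
  assumes "mixed_quasi_norm_space B"
  shows "(\<Union>\<omega>\<in>{\<omega> \<in> PQ0. rotation_invariant \<omega>}. modulation_space \<omega> B) = Upsilon \<and>
    (\<forall>(\<gamma>::real) (\<epsilon>::real) (C::real) (c::real) \<omega>.
       0 < \<gamma> \<and> \<gamma> < 2 \<and> 0 < \<epsilon> \<and> \<epsilon> < min \<gamma> (2 - \<gamma>) \<and> 0 < C \<and>
       (\<forall>x \<xi>. \<omega> (x, \<xi>) = C * exp (c * (norm x powr \<gamma> + norm \<xi> powr \<gamma>))) \<longrightarrow>
       (0 < c \<longrightarrow>
          GS_sub (1 / (\<gamma> + \<epsilon>)) \<subseteq> modulation_space \<omega> B \<and>
          modulation_space \<omega> B \<subseteq> GS_sub (1 / (\<gamma> - \<epsilon>))) \<and>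
       (c < 0 \<longrightarrow>
          GS_dual_sub (1 / (\<gamma> - \<epsilon>)) \<subseteq> modulation_space \<omega> B \<and>
          modulation_space \<omega> B \<subseteq> GS_dual_sub (1 / (\<gamma> + \<epsilon>))))"
proof (intro conjI allI impI union_modulation_spaces[OF assms])
  fix \<gamma> \<epsilon> C c :: real and \<omega> :: "(real^'d) \<times> (real^'d) \<Rightarrow> real"
  assume H: "0 < \<gamma> \<and> \<gamma> < 2 \<and> 0 < \<epsilon> \<and> \<epsilon> < min \<gamma> (2 - \<gamma>) \<and> 0 < C \<and>
       (\<forall>x \<xi>. \<omega> (x, \<xi>) = C * exp (c * (norm x powr \<gamma> + norm \<xi> powr \<gamma>)))"
  \<comment> \<open>The condition on \<epsilon> keeps both shifted exponents between 0 and 2, so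
    that the indices of the spaces are at least 1/2.\<close>
  then have \<gamma>: "0 < \<gamma>" "0 < C" and up: "\<gamma> < \<gamma> + \<epsilon>" "\<gamma> + \<epsilon> \<le> 2" and down: "0 < \<gamma> - \<epsilon>" "\<gamma> - \<epsilon> < \<gamma>" "\<gamma> - \<epsilon> \<le> 2"
    and \<omega>: "\<And>x \<xi>. \<omega> (x, \<xi>) = C * exp (c * (norm x powr \<gamma> + norm \<xi> powr \<gamma>))"
    by auto
  {
    assume c: "0 < c"
    show "GS_sub (1 / (\<gamma> + \<epsilon>)) \<subseteq> modulation_space \<omega> B"
      by (rule GS_sub_subset_modulation_space[OF assms \<gamma>(1) up \<omega>])
    show "modulation_space \<omega> B \<subseteq> GS_sub (1 / (\<gamma> - \<epsilon>))"
    proof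
      fix u assume u: "u \<in> modulation_space \<omega> B"
      obtain K where K: "0 < K" "\<And>z. norm (u (tf_atom z)) \<le>
        K * exp (- (if 0 < c then c / 2 powr \<gamma> else c * 2 powr \<gamma>) * (norm (fst z) powr \<gamma> + norm (snd z) powr \<gamma>))"
        using modulation_space_decay[OF assms u \<gamma> \<omega>] by blast
      show "u \<in> GS_sub (1 / (\<gamma> - \<epsilon>))"
        by (rule GS_dual_decay_imp_GS_sub[OF _ _ down, of u "c / 2 powr \<gamma>" K])
           (use u c K(2) in \<open>auto simp: modulation_space_def\<close>)
    qed
  }
  {
    assume c: "c < 0"
    show "GS_dual_sub (1 / (\<gamma> - \<epsilon>)) \<subseteq> modulation_space \<omega> B"
      by (rule GS_dual_sub_subset_modulation_space[OF assms down c \<omega>])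
    show "modulation_space \<omega> B \<subseteq> GS_dual_sub (1 / (\<gamma> + \<epsilon>))"
    proof
      fix u assume u: "u \<in> modulation_space \<omega> B"
      obtain K where K: "0 < K" "\<And>z. norm (u (tf_atom z)) \<le>
        K * exp (- (if 0 < c then c / 2 powr \<gamma> else c * 2 powr \<gamma>) * (norm (fst z) powr \<gamma> + norm (snd z) powr \<gamma>))"
        using modulation_space_decay[OF assms u \<gamma> \<omega>] by blast
      \<comment> \<open>For \<open>c < 0\<close> the number \<open>- (c * 2 powr \<gamma>)\<close>
        is positive: the bound \<open>K\<close> is a growth bound with this rate.\<close>
      show "u \<in> GS_dual_sub (1 / (\<gamma> + \<epsilon>))"
        by (rule GS_dual_growth_imp_GS_dual_sub[OF _ \<gamma>(1) up, of u K "- (c * 2 powr \<gamma>)"])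
           (use u c K in \<open>auto simp: modulation_space_def\<close>)
    qed
  }
qed

end
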